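(* Let $\epsilon$ be a primitive $\ell$-th root of unity, $\ell\ge3$ odd. There is a Hopf Poisson algebra isomorphism $Fr:Z_1\to Z_\epsilon$ defined by $$Fr((q-q^{-1})h_m)=\ell(q-q^{-1})h_{m\ell}\ (m\in\mathbb Z\setminus\{0\}),\quad Fr(\Gamma)=\Gamma^\ell,\quad Fr(\Lambda)=\Lambda^\ell,\quad Fr(k)=k.$$
   Context: $[l]_q=\frac{q^l-q^{-l}}{q-q^{-1}}$. $U_q(\hat{\mathfrak{gl}}_1)$ is the $\mathbb C(q)$-algebra with generators $h_m$ ($m\in\mathbb Z\setminus\{0\}$), $\Lambda^{\pm1}$ and central elements $\Gamma^{\pm1},k^{\pm1}$, with relations $$[h_m,h_{-m'}]=\delta_{m,m'}\frac1m[m]_q\frac{\Gamma^{2m}-\Gamma^{-2m}}{q-q^{-1}},\qquad h_m\Lambda=q^{2m}\Lambda h_m.$$ Hopf structure: $\Delta(h_m)=h_m\otimes\Gamma^{-|m|}+\Gamma^{|m|}\otimes h_m$; $\Delta(x)=x\otimes x$, $S(x)=x^{-1}$, $\varepsilon(x)=1$ for $x=\Gamma,\Lambda,k$; $S(h_m)=-h_m$, $\varepsilon(h_m)=0$. Let $\mathcal A$ be the $\mathbb C[q^{\pm1}]$-subalgebra generated by the $(q-q^{-1})h_m$, $\Lambda^{\pm1}$, $\Gamma^{\pm1}$, $k^{\pm1}$. For $\epsilon$ a primitive $\ell$-th root of unity, $\ell\ge3$ odd, $U_\epsilon(\hat{\mathfrak{gl}}_1)=\mathcal A/(q-\epsilon)\mathcal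 A$, and $Z_\epsilon\subset U_\epsilon(\hat{\mathfrak{gl}}_1)$ is the Hopf subalgebra (contained in the center) generated by (the images of) the $(q-q^{-1})h_{r\ell}$ ($r\in\mathbb Z\setminus\{0\}$), $k^{\pm1}$, $\Gamma^{\pm\ell}$, $\Lambda^{\pm\ell}$. Its Poisson bracket is $\{x,y\}=\frac{[\tilde x,\tilde y]}{\ell(q^\ell-q^{-\ell})}\bmod(q-\epsilon)$, where $\tilde x,\tilde y\in\mathcal A$ are lifts of $x,y$ (the commutator is divisible by $q-\epsilon$, and $q^\ell-q^{-\ell}$ has a simple zero at $q=\epsilon$). $Z_1=\mathcal A/(q-1)\mathcal A$ is a commutative Hopf algebra, with Poisson bracket given by the same formula with $\epsilon=1,\ell=1$. *)

theory Defs
  imports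
    Complex_Main
    "HOL-Library.Poly_Mapping"
    "HOL-Computational_Algebra.Fraction_Field"
    "HOL-Computational_Algebra.Polynomial"
    "HOL-Algebra.Algebraic_Closure_Type"
    "HOL-Algebra.Algebra"
begin

section \<open>The base rings\<close>

type_synonym ratfun = "complex poly fract"

definition qq :: ratfun where
  "qq = Fract [:0, 1:] 1"

definition const :: "complex \<Rightarrow> ratfun" where
  "const c = Fract [:c:] 1"

definition qint :: "int \<Rightarrow> ratfun" where
  "qint n = (qq powi n - qq powi (- n)) / (qq - inverse qq)"

abbreviation ring_C :: "complex ring" where
  "ring_C \<equiv> ring_of_type_algebra"

abbreviation ring_Cq :: "ratfun ring" where
  "ring_Cq \<equiv> ring_of_type_algebra"

text \<open>The ring of Laurent polynomials in \<open>q\<close>, as a subring of the rational functions.\<close>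

definition laurent :: "ratfun set" where
  "laurent = {Fract p (monom 1 n) | p n. True}"

abbreviation ring_L :: "ratfun ring" where
  "ring_L \<equiv> ring_Cq\<lparr>carrier := laurent\<rparr>"

text \<open>Evaluation of a Laurent polynomial at \<open>q = \<epsilon>\<close>, for \<open>\<epsilon> \<noteq> 0\<close>; the set below is a singleton
  for \<open>f\<close> in \<^const>\<open>laurent\<close>.\<close>

definition laurent_eval :: "complex \<Rightarrow> ratfun \<Rightarrow> complex" where
  "laurent_eval \<epsilon> f = the_elem {poly p \<epsilon> / \<epsilon> ^ n | p n. f = Fract p (monom 1 n)}"


section \<open>Algebras, tensor products and Hopf algebras\<close>

text \<open>The records below carry no axioms, and the algebras need not be commutative (unlike in the
  locale \<^locale>\<open>algebra\<close>). Scalars of a subring act through the same operation.\<close>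

definition monoid_ring :: "('g, 'm) monoid_scheme \<Rightarrow> ('g \<Rightarrow>\<^sub>0 'k::comm_ring_1) ring" where
  "monoid_ring G =
    \<lparr>carrier = {f. Poly_Mapping.keys f \<subseteq> carrier G},
     monoid.mult = (\<lambda>f g. \<Sum>a\<in>Poly_Mapping.keys f. \<Sum>b\<in>Poly_Mapping.keys g.
       Poly_Mapping.single (a \<otimes>\<^bsub>G\<^esub> b) (Poly_Mapping.lookup f a * Poly_Mapping.lookup g b)),
     one = Poly_Mapping.single \<one>\<^bsub>G\<^esub> 1,
     ring.zero = 0,
     add = (+)\<rparr>"

definition gen_subalgebra ::
  "('a, 'r) ring_scheme \<Rightarrow> ('a, 'b, 'm) module_scheme \<Rightarrow> 'b set \<Rightarrow> 'b set" where
  "gen_subalgebra R M H = generate_ring M (H \<union> {r \<odot>\<^bsub>M\<^esub> \<one>\<^bsub>M\<^esub> | r. r \<in> carrier R})"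

text \<open>The tensor product of two algebras over \<open>R\<close>: the free abelian group on
  \<open>carrier M \<times> carrier N\<close> modulo bilinearity and balancedness over \<open>R\<close>. With componentwise
  multiplication of basis elements the free abelian group is a monoid ring, in which the additive
  subgroup spanned by the relators is already an ideal, so that dividing by the ideal they generate
  gives the usual tensor product together with its ring structure.\<close>

definition tensor_relators ::
  "('a, 'r) ring_scheme \<Rightarrow> ('a, 'b, 'm) module_scheme \<Rightarrow> ('a, 'c, 'n) module_scheme
    \<Rightarrow> (('b \<times> 'c) \<Rightarrow>\<^sub>0 int) set" where
  "tensor_relators R M N =
    {frag_of (x \<oplus>\<^bsub>M\<^esub> x', y) - frag_of (x, y) - frag_of (x', y) | x x' y.
       x \<in> carrier M \<and> x' \<in> carrier M \<and> y \<in> carrier N} \<union>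
    {frag_of (x, y \<oplus>\<^bsub>N\<^esub> y') - frag_of (x, y) - frag_of (x, y') | x y y'.
       x \<in> carrier M \<and> y \<in> carrier N \<and> y' \<in> carrier N} \<union>
    {frag_of (r \<odot>\<^bsub>M\<^esub> x, y) - frag_of (x, r \<odot>\<^bsub>N\<^esub> y) | r x y.
       r \<in> carrier R \<and> x \<in> carrier M \<and> y \<in> carrier N}"

definition tensor_class ::
  "('a, 'r) ring_scheme \<Rightarrow> ('a, 'b, 'm) module_scheme \<Rightarrow> ('a, 'c, 'n) module_scheme
    \<Rightarrow> (('b \<times> 'c) \<Rightarrow>\<^sub>0 int) \<Rightarrow> (('b \<times> 'c) \<Rightarrow>\<^sub>0 int) set" where
  "tensor_class R M N w =
    (Idl\<^bsub>monoid_ring (M \<times>\<times> N)\<^esub> (tensor_relators R M N)) +>\<^bsub>monoid_ring (M \<times>\<times> N)\<^esub> w"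

definition pure_tensor ::
  "('a, 'r) ring_scheme \<Rightarrow> ('a, 'b, 'm) module_scheme \<Rightarrow> ('a, 'c, 'n) module_scheme
    \<Rightarrow> 'b \<Rightarrow> 'c \<Rightarrow> (('b \<times> 'c) \<Rightarrow>\<^sub>0 int) set" where
  "pure_tensor R M N x y = tensor_class R M N (frag_of (x, y))"

definition tensor ::
  "('a, 'r) ring_scheme \<Rightarrow> ('a, 'b, 'm) module_scheme \<Rightarrow> ('a, 'c, 'n) module_scheme
    \<Rightarrow> ('a, (('b \<times> 'c) \<Rightarrow>\<^sub>0 int) set) module" where
  "tensor R M N =
    (let T = monoid_ring (M \<times>\<times> N) Quot (Idl\<^bsub>monoid_ring (M \<times>\<times> N)\<^esub> (tensor_relators R M N)) in
     \<lparr>carrier = carrier T, monoid.mult = monoid.mult T, one = one T, ring.zero = ring.zero T, add = add T,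
      module.smult = (\<lambda>r U. pure_tensor R M N (r \<odot>\<^bsub>M\<^esub> \<one>\<^bsub>M\<^esub>) \<one>\<^bsub>N\<^esub> \<otimes>\<^bsub>T\<^esub> U)\<rparr>)"

text \<open>The map \<open>f \<otimes> g\<close> on an element \<open>U\<close> of some tensor product, with values in
  \<open>M' \<otimes> N'\<close> over \<open>R'\<close>.\<close>

definition tensor_map ::
  "('a, 'r) ring_scheme \<Rightarrow> ('a, 'd, 'm) module_scheme \<Rightarrow> ('a, 'e, 'n) module_scheme
    \<Rightarrow> ('b \<Rightarrow> 'd) \<Rightarrow> ('c \<Rightarrow> 'e) \<Rightarrow> (('b \<times> 'c) \<Rightarrow>\<^sub>0 int) set \<Rightarrow> (('d \<times> 'e) \<Rightarrow>\<^sub>0 int) set" where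
  "tensor_map R' M' N' f g U =
    the_elem ((\<lambda>w. tensor_class R' M' N' (frag_extend (\<lambda>(x, y). frag_of (f x, g y)) w)) ` U)"

record ('a, 'b) hopf_algebra = "('a, 'b) module" +
  comult :: "'b \<Rightarrow> (('b \<times> 'b) \<Rightarrow>\<^sub>0 int) set"
  counit :: "'b \<Rightarrow> 'a"
  antipode :: "'b \<Rightarrow> 'b"

record ('a, 'b) hopf_poisson_algebra = "('a, 'b) hopf_algebra" +
  pbracket :: "'b \<Rightarrow> 'b \<Rightarrow> 'b"

text \<open>Restriction of the Hopf structure of \<open>H\<close>, an algebra over \<open>K\<close>, to a subset \<open>S\<close> viewed as an
  algebra over a subring \<open>R\<close> of \<open>K\<close>: the coproduct of \<open>x\<close> is the element of \<open>S \<otimes>\<^sub>R S\<close> whose image in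
  \<open>H \<otimes>\<^sub>K H\<close> is the coproduct of \<open>x\<close> in \<open>H\<close>.\<close>

definition restrict_hopf ::
  "('a, 'r) ring_scheme \<Rightarrow> ('a, 'k) ring_scheme \<Rightarrow> ('a, 'b) hopf_algebra \<Rightarrow> 'b set
    \<Rightarrow> ('a, 'b) hopf_algebra" where
  "restrict_hopf R K H S =
    H\<lparr>carrier := S,
      comult := (\<lambda>x. THE t. t \<in> carrier (tensor R (H\<lparr>carrier := S\<rparr>) (H\<lparr>carrier := S\<rparr>)) \<and>
                   tensor_map K H H (\<lambda>y. y) (\<lambda>y. y) t = comult H x)\<rparr>"

definition add_hopf ::
  "('a, 'b) module \<Rightarrow> ('b \<Rightarrow> (('b \<times> 'b) \<Rightarrow>\<^sub>0 int) set) \<Rightarrow> ('b \<Rightarrow> 'a) \<Rightarrow> ('b \<Rightarrow> 'b)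
    \<Rightarrow> ('a, 'b) hopf_algebra" where
  "add_hopf M \<Delta> \<eta> S =
    \<lparr>carrier = carrier M, monoid.mult = monoid.mult M, one = one M, ring.zero = ring.zero M, add = add M,
     module.smult = module.smult M, comult = \<Delta>, counit = \<eta>, antipode = S\<rparr>"

definition add_poisson ::
  "('a, 'b) hopf_algebra \<Rightarrow> ('b \<Rightarrow> 'b \<Rightarrow> 'b) \<Rightarrow> ('a, 'b) hopf_poisson_algebra" where
  "add_poisson H br =
    \<lparr>carrier = carrier H, monoid.mult = monoid.mult H, one = one H, ring.zero = ring.zero H, add = add H,
     module.smult = module.smult H, comult = comult H, counit = counit H, antipode = antipode H,
     pbracket = br\<rparr>"

definition hopf_poisson_iso ::
  "('a, 'r) ring_scheme \<Rightarrow> ('a, 'b) hopf_poisson_algebra \<Rightarrow> ('a, 'c) hopf_poisson_algebra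
    \<Rightarrow> ('b \<Rightarrow> 'c) set" where
  "hopf_poisson_iso R A B =
    {f \<in> ring_iso A B.
      (\<forall>r\<in>carrier R. \<forall>x\<in>carrier A. f (r \<odot>\<^bsub>A\<^esub> x) = r \<odot>\<^bsub>B\<^esub> f x) \<and>
      (\<forall>x\<in>carrier A. comult B (f x) = tensor_map R B B f f (comult A x)) \<and>
      (\<forall>x\<in>carrier A. counit B (f x) = counit A x) \<and>
      (\<forall>x\<in>carrier A. antipode B (f x) = f (antipode A x)) \<and>
      (\<forall>x\<in>carrier A. \<forall>y\<in>carrier A. f (pbracket A x y) = pbracket B (f x) (f y))}"


section \<open>The quantum affine algebra of gl(1)\<close>

text \<open>Primed constructors are the inverses of the unprimed ones. The letter \<open>GenH 0\<close> is excluded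
  below.\<close>

datatype gen = GenH int | GenLam | GenLam' | GenGam | GenGam' | GenK | GenK'

definition gens :: "gen set" where
  "gens = UNIV - {GenH 0}"

definition free_alg :: "(gen list \<Rightarrow>\<^sub>0 ratfun) ring" where
  "free_alg = monoid_ring \<lparr>carrier = lists gens, monoid.mult = (@), one = []\<rparr>"

abbreviation word :: "gen list \<Rightarrow> gen list \<Rightarrow>\<^sub>0 ratfun" where
  "word w \<equiv> Poly_Mapping.single w 1"

definition gam_pow :: "int \<Rightarrow> gen list" where
  "gam_pow n = (if n \<ge> 0 then replicate (nat n) GenGam else replicate (nat (- n)) GenGam')"

definition gl1_relators :: "(gen list \<Rightarrow>\<^sub>0 ratfun) set" where
  "gl1_relators =
    {word [GenH m, GenH (- m')] - word [GenH (- m'), GenH m] -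
      (if m = m'
       then let c = 1 / of_int m * qint m / (qq - inverse qq)
            in Poly_Mapping.single (gam_pow (2 * m)) c - Poly_Mapping.single (gam_pow (- 2 * m)) c
       else 0) | m m'. m \<noteq> 0 \<and> m' \<noteq> 0} \<union>
    {word [GenH m, GenLam] - Poly_Mapping.single [GenLam, GenH m] (qq powi (2 * m)) | m. m \<noteq> 0} \<union>
    {word [x, y] - word [] | x y.
      (x, y) \<in> {(GenLam, GenLam'), (GenLam', GenLam), (GenGam, GenGam'), (GenGam', GenGam),
                (GenK, GenK'), (GenK', GenK)}} \<union>
    {word [x, y] - word [y, x] | x y. x \<in> {GenGam, GenGam', GenK, GenK'} \<and> y \<in> gens}"

type_synonym uq = "(gen list \<Rightarrow>\<^sub>0 ratfun) set"

definition uq_class :: "(gen list \<Rightarrow>\<^sub>0 ratfun) \<Rightarrow> uq" where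
  "uq_class w = (Idl\<^bsub>free_alg\<^esub> gl1_relators) +>\<^bsub>free_alg\<^esub> w"

definition Uq_alg :: "(ratfun, uq) module" where
  "Uq_alg =
    (let Q = free_alg Quot (Idl\<^bsub>free_alg\<^esub> gl1_relators) in
     \<lparr>carrier = carrier Q, monoid.mult = monoid.mult Q, one = one Q, ring.zero = ring.zero Q, add = add Q,
      module.smult = (\<lambda>r U. uq_class (Poly_Mapping.single [] r) \<otimes>\<^bsub>Q\<^esub> U)\<rparr>)"

definition ugen :: "gen \<Rightarrow> uq" where
  "ugen x = uq_class (word [x])"

text \<open>The algebra homomorphism from \<^const>\<open>free_alg\<close> with prescribed values \<open>\<phi>\<close> on letters, and
  the map it induces on \<^const>\<open>Uq_alg\<close>.\<close>

definition free_alg_ext ::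
  "(ratfun, 'b, 'm) module_scheme \<Rightarrow> (gen \<Rightarrow> 'b) \<Rightarrow> (gen list \<Rightarrow>\<^sub>0 ratfun) \<Rightarrow> 'b" where
  "free_alg_ext B \<phi> f =
    (\<Oplus>\<^bsub>B\<^esub>w\<in>Poly_Mapping.keys f. Poly_Mapping.lookup f w \<odot>\<^bsub>B\<^esub> foldr (\<lambda>x y. \<phi> x \<otimes>\<^bsub>B\<^esub> y) w \<one>\<^bsub>B\<^esub>)"

definition uq_ext ::
  "(ratfun, 'b, 'm) module_scheme \<Rightarrow> (gen \<Rightarrow> 'b) \<Rightarrow> uq \<Rightarrow> 'b" where
  "uq_ext B \<phi> U = the_elem (free_alg_ext B \<phi> ` U)"

abbreviation Uq_tensor :: "(ratfun, ((uq \<times> uq) \<Rightarrow>\<^sub>0 int) set) module" where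
  "Uq_tensor \<equiv> tensor ring_Cq Uq_alg Uq_alg"

abbreviation uq_pure :: "uq \<Rightarrow> uq \<Rightarrow> ((uq \<times> uq) \<Rightarrow>\<^sub>0 int) set" where
  "uq_pure \<equiv> pure_tensor ring_Cq Uq_alg Uq_alg"

fun comult_gen :: "gen \<Rightarrow> ((uq \<times> uq) \<Rightarrow>\<^sub>0 int) set" where
  "comult_gen (GenH m) =
     uq_pure (ugen (GenH m)) (uq_class (word (gam_pow (- \<bar>m\<bar>)))) \<oplus>\<^bsub>Uq_tensor\<^esub>
     uq_pure (uq_class (word (gam_pow \<bar>m\<bar>))) (ugen (GenH m))"
| "comult_gen x = uq_pure (ugen x) (ugen x)"

fun counit_gen :: "gen \<Rightarrow> ratfun" where
  "counit_gen (GenH m) = 0"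
| "counit_gen x = 1"

fun antipode_gen :: "gen \<Rightarrow> uq" where
  "antipode_gen (GenH m) = \<ominus>\<^bsub>Uq_alg\<^esub> ugen (GenH m)"
| "antipode_gen GenLam = ugen GenLam'"
| "antipode_gen GenLam' = ugen GenLam"
| "antipode_gen GenGam = ugen GenGam'"
| "antipode_gen GenGam' = ugen GenGam"
| "antipode_gen GenK = ugen GenK'"
| "antipode_gen GenK' = ugen GenK"

definition Cq_alg :: "(ratfun, ratfun) module" where
  "Cq_alg = \<lparr>carrier = UNIV, monoid.mult = (*), one = 1, ring.zero = 0, add = (+), module.smult = (*)\<rparr>"

text \<open>The antipode is an anti-homomorphism, that is, a homomorphism to the opposite algebra.\<close>

definition Uq :: "(ratfun, uq) hopf_algebra" where
  "Uq = add_hopf Uq_alg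
    (uq_ext Uq_tensor comult_gen)
    (uq_ext Cq_alg counit_gen)
    (uq_ext (Uq_alg\<lparr>monoid.mult := (\<lambda>x y. y \<otimes>\<^bsub>Uq_alg\<^esub> x)\<rparr>) antipode_gen)"


section \<open>The integral form and its specializations\<close>

definition hh :: "int \<Rightarrow> uq" where
  "hh m = (qq - inverse qq) \<odot>\<^bsub>Uq\<^esub> ugen (GenH m)"

definition int_form :: "(ratfun, uq) hopf_algebra" where
  "int_form = restrict_hopf ring_L ring_Cq Uq
    (gen_subalgebra ring_L Uq
      ({hh m | m. m \<noteq> 0} \<union>
       ugen ` {GenLam, GenLam', GenGam, GenGam', GenK, GenK'}))"

definition spec_ideal :: "complex \<Rightarrow> uq set" where
  "spec_ideal \<epsilon> = {(qq - const \<epsilon>) \<odot>\<^bsub>int_form\<^esub> a | a. a \<in> carrier int_form}"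

definition spec_class :: "complex \<Rightarrow> uq \<Rightarrow> uq set" where
  "spec_class \<epsilon> a = spec_ideal \<epsilon> +>\<^bsub>int_form\<^esub> a"

definition U_spec_alg :: "complex \<Rightarrow> (complex, uq set) module" where
  "U_spec_alg \<epsilon> =
    (let Q = int_form Quot spec_ideal \<epsilon> in
     \<lparr>carrier = carrier Q, monoid.mult = monoid.mult Q, one = one Q, ring.zero = ring.zero Q, add = add Q,
      module.smult = (\<lambda>c U. spec_class \<epsilon> (const c \<odot>\<^bsub>int_form\<^esub> \<one>\<^bsub>int_form\<^esub>) \<otimes>\<^bsub>Q\<^esub> U)\<rparr>)"

definition U_spec :: "complex \<Rightarrow> (complex, uq set) hopf_algebra" where
  "U_spec \<epsilon> = add_hopf (U_spec_alg \<epsilon>)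
    (\<lambda>U. the_elem ((\<lambda>a. tensor_map ring_C (U_spec_alg \<epsilon>) (U_spec_alg \<epsilon>)
            (spec_class \<epsilon>) (spec_class \<epsilon>) (comult int_form a)) ` U))
    (\<lambda>U. the_elem ((\<lambda>a. laurent_eval \<epsilon> (counit int_form a)) ` U))
    (\<lambda>U. the_elem ((\<lambda>a. spec_class \<epsilon> (antipode int_form a)) ` U))"

text \<open>\<open>W\<close> is the value modulo \<open>q - \<epsilon>\<close> of an element \<open>b\<close> of the localization of the integral form
  at \<open>q - \<epsilon>\<close>: for a polynomial \<open>p\<close> with \<open>p(\<epsilon>) \<noteq> 0\<close> such that \<open>p b\<close> lies in the integral form,
  \<open>W\<close> is the class of \<open>p b\<close> divided by \<open>p(\<epsilon>)\<close>. The localization is needed since in the Poisson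
  bracket \<open>q\<^sup>l - q\<^sup>-\<^sup>l\<close> is \<open>q - \<epsilon>\<close> times a factor which does not vanish at \<open>\<epsilon>\<close> but which is not
  invertible in the Laurent polynomials.\<close>

definition reduces_to :: "complex \<Rightarrow> uq \<Rightarrow> uq set \<Rightarrow> bool" where
  "reduces_to \<epsilon> b W \<longleftrightarrow>
    (\<exists>p. poly p \<epsilon> \<noteq> 0 \<and> Fract p 1 \<odot>\<^bsub>Uq\<^esub> b \<in> carrier int_form \<and>
         W = inverse (poly p \<epsilon>) \<odot>\<^bsub>U_spec \<epsilon>\<^esub> spec_class \<epsilon> (Fract p 1 \<odot>\<^bsub>Uq\<^esub> b))"

text \<open>The lifts of a class to the integral form are its elements as a coset.\<close>

definition spec_bracket :: "complex \<Rightarrow> nat \<Rightarrow> uq set \<Rightarrow> uq set \<Rightarrow> uq set" where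
  "spec_bracket \<epsilon> l U V =
    (THE W. \<exists>x\<in>U. \<exists>y\<in>V. reduces_to \<epsilon>
      (inverse (of_nat l * (qq powi int l - qq powi (- int l))) \<odot>\<^bsub>Uq\<^esub>
        ((x \<otimes>\<^bsub>Uq\<^esub> y) \<ominus>\<^bsub>Uq\<^esub> (y \<otimes>\<^bsub>Uq\<^esub> x))) W)"

definition Z_one :: "(complex, uq set) hopf_poisson_algebra" where
  "Z_one = add_poisson (U_spec 1) (spec_bracket 1 1)"

definition Z_root :: "complex \<Rightarrow> nat \<Rightarrow> (complex, uq set) hopf_poisson_algebra" where
  "Z_root \<epsilon> l = add_poisson
    (restrict_hopf ring_C ring_C (U_spec \<epsilon>)
      (gen_subalgebra ring_C (U_spec \<epsilon>)
        ({spec_class \<epsilon> (hh (r * int l)) | r. r \<noteq> 0} \<union>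
         {spec_class \<epsilon> (ugen x) | x. x \<in> {GenK, GenK'}} \<union>
         {spec_class \<epsilon> (ugen x) [^]\<^bsub>U_spec \<epsilon>\<^esub> l | x. x \<in> {GenGam, GenGam', GenLam, GenLam'}})))
    (spec_bracket \<epsilon> l)"

definition primitive_root_of_unity :: "nat \<Rightarrow> complex \<Rightarrow> bool" where
  "primitive_root_of_unity l \<epsilon> \<longleftrightarrow> l > 0 \<and> \<epsilon> ^ l = 1 \<and> (\<forall>k. 0 < k \<and> k < l \<longrightarrow> \<epsilon> ^ k \<noteq> 1)"

end

theory Submission
  imports Defs
begin

text \<open>Ordered monomials in \<open>\<Lambda>\<close>, \<open>\<Gamma>\<close>, \<open>k\<close> and the \<open>h\<^sub>m\<close> span the quantum algebra, and their images under a
  Fock representation are linearly independent. The rescaled ones form a basis of the integral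
  form over the Laurent polynomials, hence a basis of every specialization. Therefore
  inclusions of subalgebras spanned by part of the basis remain injective on tensor squares, which
  makes the restricted coproducts well defined, and a commutator of lifts which vanishes modulo
  \<open>q - \<epsilon>\<close> can be divided by \<open>q\<^sup>l - q\<^sup>-\<^sup>l\<close> in the localization at \<open>q - \<epsilon>\<close>.

  The map is defined on the basis of the specialization at \<open>1\<close>: it multiplies the exponents of
  \<open>\<Lambda>\<close> and \<open>\<Gamma>\<close> and the indices of the letters \<open>h\<^sub>m\<close> by \<open>l\<close>. It is thus injective and respects the
  structure because it does so on generators. At \<open>\<epsilon>\<close> the bracket of \<open>h\<^bsub>ml\<^esub>\<close> and \<open>h\<^bsub>-ml\<^esub>\<close> is
  \<open>l\<^sup>-\<^sup>2\<close> times that expected from the value at \<open>1\<close>; the factor \<open>l\<close> in the image of \<open>h\<^sub>m\<close>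
  compensates for this.\<close>

section \<open>Algebras over subrings of the scalars\<close>

text \<open>The structure maps are given by \<open>the_elem\<close> or \<open>THE\<close>, so
  nothing is known about them until they are shown to be well defined; this obstacle shapes the
  proof. Maps out of the quantum algebra are controlled by checking that the relators are killed, so
  that the coproduct, the counit, the antipode and the Fock action are instances of one universal
  property. A restricted coproduct needs more: elements of a tensor square over a smaller ring could
  become equal over the larger one, and only coordinate functionals on the larger tensor square
  exclude this. The constant l^-2 arises as follows. For the rescaled letters, [h_m, h_-m] is (q^m -
  q^-m)/m times \<Gamma>^2m - \<Gamma>^-2m. With ml in place of m, dividing this coefficient by
  l(q^l - q^-l) leaves the quantum integer [m] in the variable q^l, divided by m l^2, and this
  integer becomes m at \<epsilon>. In the bracket with \<Lambda>^l the exponent 2 m l^2 yields, to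
  first order, ml times q^l - q^-l; the denominator removes the l, and no constant remains.\<close>

lemma poly_mapping_induct_on [consumes 1, case_names zero single add]:
  fixes f :: "'a \<Rightarrow>\<^sub>0 'k::comm_monoid_add"
  assumes "Poly_Mapping.keys f \<subseteq> C" "P 0"
    and single: "\<And>a c. a \<in> C \<Longrightarrow> P (Poly_Mapping.single a c)"
    and add: "\<And>f g. Poly_Mapping.keys f \<subseteq> C \<Longrightarrow> Poly_Mapping.keys g \<subseteq> C \<Longrightarrow> P f \<Longrightarrow> P g \<Longrightarrow> P (f + g)"
  shows "P f"
proof -
  have "Poly_Mapping.keys (\<Sum>a\<in>F. Poly_Mapping.single a (c a)) \<subseteq> C \<and>
      P (\<Sum>a\<in>F. Poly_Mapping.single a (c a))" if "finite F" "F \<subseteq> C" for F and c :: "'a \<Rightarrow> 'k"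
    using that
  proof (induction F rule: finite_induct)
    case (insert x F)
    moreover have "Poly_Mapping.keys (Poly_Mapping.single x (c x)) \<subseteq> C"
      using insert by simp
    ultimately show ?case
      using add[of "Poly_Mapping.single x (c x)"] single[of x "c x"]
        keys_add[of "Poly_Mapping.single x (c x)" "\<Sum>a\<in>F. Poly_Mapping.single a (c a)"]
      by (simp; blast)
  qed (simp add: assms)
  moreover have "f = (\<Sum>a\<in>Poly_Mapping.keys f. Poly_Mapping.single a (Poly_Mapping.lookup f a))"
    by (rule poly_mapping_eqI)
      (simp add: lookup_sum lookup_single when_def in_keys_iff)
  ultimately show ?thesis
    using assms(1) finite_keys by metis
qed

section \<open>Monoid rings\<close>

lemma monoid_ring_simps [simp]:
  "carrier (monoid_ring G) = {f. Poly_Mapping.keys f \<subseteq> carrier G}"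
  "one (monoid_ring G) = Poly_Mapping.single \<one>\<^bsub>G\<^esub> 1"
  "ring.zero (monoid_ring G) = 0"
  "add (monoid_ring G) = (+)"
  by (simp_all add: monoid_ring_def)

lemma monoid_ring_mult:
  "monoid.mult (monoid_ring G) f g = (\<Sum>a\<in>Poly_Mapping.keys f. \<Sum>b\<in>Poly_Mapping.keys g.
       Poly_Mapping.single (a \<otimes>\<^bsub>G\<^esub> b) (Poly_Mapping.lookup f a * Poly_Mapping.lookup g b))"
  by (simp add: monoid_ring_def)

lemma monoid_ring_mult_single [simp]:
  "Poly_Mapping.single a c \<otimes>\<^bsub>monoid_ring G\<^esub> Poly_Mapping.single b d = Poly_Mapping.single (a \<otimes>\<^bsub>G\<^esub> b) (c * d)"
  by (simp add: monoid_ring_mult)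

text \<open>Cancellation may make the support of \<open>f + f'\<close> smaller than the union of the
  two supports. The double sum is additive all the same, because a summand with coefficient zero
  vanishes.\<close>

lemma monoid_ring_mult_add_left:
  "(f + f') \<otimes>\<^bsub>monoid_ring G\<^esub> g = f \<otimes>\<^bsub>monoid_ring G\<^esub> g + f' \<otimes>\<^bsub>monoid_ring G\<^esub> g"
  unfolding monoid_ring_mult
  by (rule setsum_keys_plus_distrib) (simp_all add: single_add sum.distrib ring_distribs)

lemma monoid_ring_mult_add_right:
  "f \<otimes>\<^bsub>monoid_ring G\<^esub> (g + g') = f \<otimes>\<^bsub>monoid_ring G\<^esub> g + f \<otimes>\<^bsub>monoid_ring G\<^esub> g'"
proof -
  have "(\<Sum>b\<in>Poly_Mapping.keys (g + g').
       Poly_Mapping.single (a \<otimes>\<^bsub>G\<^esub> b) (x * Poly_Mapping.lookup (g + g') b)) =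
    (\<Sum>b\<in>Poly_Mapping.keys g. Poly_Mapping.single (a \<otimes>\<^bsub>G\<^esub> b) (x * Poly_Mapping.lookup g b)) +
    (\<Sum>b\<in>Poly_Mapping.keys g'. Poly_Mapping.single (a \<otimes>\<^bsub>G\<^esub> b) (x * Poly_Mapping.lookup g' b))" for a x
    by (rule setsum_keys_plus_distrib) (simp_all add: single_add ring_distribs)
  then show ?thesis
    unfolding monoid_ring_mult by (simp add: sum.distrib)
qed

lemma monoid_ring_mult_zero [simp]:
  "0 \<otimes>\<^bsub>monoid_ring G\<^esub> g = 0" "f \<otimes>\<^bsub>monoid_ring G\<^esub> 0 = 0"
  by (simp_all add: monoid_ring_mult)

lemma keys_add_subset: "Poly_Mapping.keys f \<subseteq> C \<Longrightarrow> Poly_Mapping.keys g \<subseteq> C \<Longrightarrow> Poly_Mapping.keys (f + g) \<subseteq> C"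
  by (rule order_trans[OF keys_add Un_least])

lemma (in monoid) monoid_ring_mult_closed:
  assumes "Poly_Mapping.keys f \<subseteq> carrier G" "Poly_Mapping.keys g \<subseteq> carrier G"
  shows "Poly_Mapping.keys (f \<otimes>\<^bsub>monoid_ring G\<^esub> g) \<subseteq> carrier G"
  using assms
proof (induction f rule: poly_mapping_induct_on)
  case (single a c)
  show ?case using single(2)
    by (induction g rule: poly_mapping_induct_on)
      (use single(1) in \<open>simp_all add: monoid_ring_mult_add_right keys_add_subset\<close>)
qed (simp_all add: monoid_ring_mult_add_left keys_add_subset)

lemma (in monoid) monoid_ring_mult_assoc:
  assumes "Poly_Mapping.keys f \<subseteq> carrier G" "Poly_Mapping.keys g \<subseteq> carrier G"
    "Poly_Mapping.keys h \<subseteq> carrier G"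
  shows "f \<otimes>\<^bsub>monoid_ring G\<^esub> g \<otimes>\<^bsub>monoid_ring G\<^esub> h = f \<otimes>\<^bsub>monoid_ring G\<^esub> (g \<otimes>\<^bsub>monoid_ring G\<^esub> h)"
  using assms
proof (induction f rule: poly_mapping_induct_on)
  case (single a c)
  from single(2,3) show ?case
  proof (induction g rule: poly_mapping_induct_on)
    case (single b d)
    from single(2) show ?case
      by (induction h rule: poly_mapping_induct_on)
        (use single(1) \<open>a \<in> carrier G\<close> in \<open>auto simp: monoid_ring_mult_add_right m_assoc mult.assoc\<close>)
  qed (auto simp: monoid_ring_mult_add_left monoid_ring_mult_add_right)
qed (auto simp: monoid_ring_mult_add_left monoid_ring_mult_add_right)

lemma (in monoid) monoid_ring_one:
  assumes "Poly_Mapping.keys f \<subseteq> carrier G"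
  shows "Poly_Mapping.single \<one> 1 \<otimes>\<^bsub>monoid_ring G\<^esub> f = f" "f \<otimes>\<^bsub>monoid_ring G\<^esub> Poly_Mapping.single \<one> 1 = f"
  using assms
  by (induction f rule: poly_mapping_induct_on)
    (auto simp: monoid_ring_mult_add_left monoid_ring_mult_add_right)

lemma (in monoid) monoid_ring_is_ring: "ring (monoid_ring G :: ('a \<Rightarrow>\<^sub>0 'k::comm_ring_1) ring)"
proof (rule ringI)
  show "abelian_group (monoid_ring G :: ('a \<Rightarrow>\<^sub>0 'k) ring)"
  proof (rule abelian_groupI)
    fix x :: "'a \<Rightarrow>\<^sub>0 'k" assume "x \<in> carrier (monoid_ring G)"
    then show "\<exists>y\<in>carrier (monoid_ring G). y \<oplus>\<^bsub>monoid_ring G\<^esub> x = \<zero>\<^bsub>monoid_ring G\<^esub>"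
      by (intro bexI[of _ "- x"]) (auto simp: in_keys_iff)
  qed (simp_all add: keys_add_subset add.assoc add.commute)
  show "monoid (monoid_ring G :: ('a \<Rightarrow>\<^sub>0 'k) ring)"
  proof (rule monoidI)
    fix x y z :: "'a \<Rightarrow>\<^sub>0 'k"
    assume "x \<in> carrier (monoid_ring G)" "y \<in> carrier (monoid_ring G)" "z \<in> carrier (monoid_ring G)"
    then show "x \<otimes>\<^bsub>monoid_ring G\<^esub> y \<in> carrier (monoid_ring G)"
      "x \<otimes>\<^bsub>monoid_ring G\<^esub> y \<otimes>\<^bsub>monoid_ring G\<^esub> z = x \<otimes>\<^bsub>monoid_ring G\<^esub> (y \<otimes>\<^bsub>monoid_ring G\<^esub> z)"
      "\<one>\<^bsub>monoid_ring G\<^esub> \<otimes>\<^bsub>monoid_ring G\<^esub> x = x" "x \<otimes>\<^bsub>monoid_ring G\<^esub> \<one>\<^bsub>monoid_ring G\<^esub> = x"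
      using monoid_ring_mult_closed monoid_ring_mult_assoc monoid_ring_one by simp_all
  qed simp
qed (simp_all only: monoid_ring_simps monoid_ring_mult_add_left monoid_ring_mult_add_right)

lemma (in monoid) monoid_ring_a_inv:
  fixes f :: "'a \<Rightarrow>\<^sub>0 'k::comm_ring_1"
  assumes "Poly_Mapping.keys f \<subseteq> carrier G"
  shows "\<ominus>\<^bsub>monoid_ring G\<^esub> f = - f"
proof -
  interpret R: ring "monoid_ring G :: ('a \<Rightarrow>\<^sub>0 'k) ring" by (rule monoid_ring_is_ring)
  have "Poly_Mapping.keys (- f) \<subseteq> carrier G" using assms by (auto simp: in_keys_iff)
  then show ?thesis
    using R.minus_equality[of "- f" f] assms by simp
qed

text \<open>The scalars are a subset \<open>A\<close> of the scalar type, so that one locale covers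
  the quantum algebra over the rational functions, its integral form over \<open>laurent\<close> and
  the complex specializations. Multiplication may be noncommutative, hence a compatibility law on
  each side.\<close>

locale scalar_algebra = ring M for M :: "('k::comm_ring_1, 'b, 'm) module_scheme" (structure) +
  fixes A :: "'k set"
  assumes one_scalar [simp]: "1 \<in> A"
    and add_scalar [simp]: "r \<in> A \<Longrightarrow> s \<in> A \<Longrightarrow> r + s \<in> A"
    and uminus_scalar [simp]: "r \<in> A \<Longrightarrow> - r \<in> A"
    and mult_scalar [simp]: "r \<in> A \<Longrightarrow> s \<in> A \<Longrightarrow> r * s \<in> A"
    and smult_closed [simp, intro]: "r \<in> A \<Longrightarrow> x \<in> carrier M \<Longrightarrow> r \<odot> x \<in> carrier M"
    and smult_l_distr: "r \<in> A \<Longrightarrow> s \<in> A \<Longrightarrow> x \<in> carrier M \<Longrightarrow> (r + s) \<odot> x = r \<odot> x \<oplus> s \<odot> x"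
    and smult_r_distr: "r \<in> A \<Longrightarrow> x \<in> carrier M \<Longrightarrow> y \<in> carrier M \<Longrightarrow> r \<odot> (x \<oplus> y) = r \<odot> x \<oplus> r \<odot> y"
    and smult_assoc1: "r \<in> A \<Longrightarrow> s \<in> A \<Longrightarrow> x \<in> carrier M \<Longrightarrow> (r * s) \<odot> x = r \<odot> (s \<odot> x)"
    and smult_one [simp]: "x \<in> carrier M \<Longrightarrow> 1 \<odot> x = x"
    and smult_mult_left: "r \<in> A \<Longrightarrow> x \<in> carrier M \<Longrightarrow> y \<in> carrier M \<Longrightarrow> (r \<odot> x) \<otimes> y = r \<odot> (x \<otimes> y)"
    and smult_mult_right: "r \<in> A \<Longrightarrow> x \<in> carrier M \<Longrightarrow> y \<in> carrier M \<Longrightarrow> x \<otimes> (r \<odot> y) = r \<odot> (x \<otimes> y)"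
begin

lemma zero_scalar [simp]: "0 \<in> A"
  using add_scalar[of 1 "- 1"] by simp

lemma diff_scalar [simp]: "r \<in> A \<Longrightarrow> s \<in> A \<Longrightarrow> r - s \<in> A"
  using add_scalar[of r "- s"] by simp

lemma smult_zero_left [simp]: "x \<in> carrier M \<Longrightarrow> 0 \<odot> x = \<zero>"
  using smult_l_distr[of 0 0 x] by (metis add.comm_inv_char add.r_cancel_one' add_0 smult_closed zero_scalar)

lemma smult_zero_right [simp]: "r \<in> A \<Longrightarrow> r \<odot> \<zero> = \<zero>"
  using smult_r_distr[of r \<zero> \<zero>] by (metis add.r_cancel_one' l_zero smult_closed zero_closed)

lemma smult_uminus_left: "r \<in> A \<Longrightarrow> x \<in> carrier M \<Longrightarrow> (- r) \<odot> x = \<ominus> (r \<odot> x)"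
  using smult_l_distr[of "- r" r x] by (simp add: minus_equality)

lemma smult_uminus_right: "r \<in> A \<Longrightarrow> x \<in> carrier M \<Longrightarrow> r \<odot> (\<ominus> x) = \<ominus> (r \<odot> x)"
  using smult_r_distr[of r "\<ominus> x" x] by (simp add: minus_equality l_neg)

lemma smult_minus_right: "r \<in> A \<Longrightarrow> x \<in> carrier M \<Longrightarrow> y \<in> carrier M \<Longrightarrow> r \<odot> (x \<ominus> y) = r \<odot> x \<ominus> r \<odot> y"
  by (simp add: a_minus_def smult_r_distr smult_uminus_right)

lemma smult_minus_left: "r \<in> A \<Longrightarrow> s \<in> A \<Longrightarrow> x \<in> carrier M \<Longrightarrow> (r - s) \<odot> x = r \<odot> x \<ominus> s \<odot> x"
  using smult_l_distr[of r "- s" x] by (simp add: a_minus_def smult_uminus_left)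

lemma smult_commute: "r \<in> A \<Longrightarrow> s \<in> A \<Longrightarrow> x \<in> carrier M \<Longrightarrow> r \<odot> (s \<odot> x) = s \<odot> (r \<odot> x)"
  by (metis mult.commute smult_assoc1)

lemma smult_eq_mult: "r \<in> A \<Longrightarrow> x \<in> carrier M \<Longrightarrow> r \<odot> x = (r \<odot> \<one>) \<otimes> x"
  by (simp add: smult_mult_left)

definition lin :: "('a \<Rightarrow> 'b) \<Rightarrow> ('a \<Rightarrow>\<^sub>0 'k) \<Rightarrow> 'b" where
  "lin e f = (\<Oplus>w\<in>Poly_Mapping.keys f. Poly_Mapping.lookup f w \<odot> e w)"

text \<open>Besides the support, the coefficients have to be restricted, since \<open>lookup\<close>
  takes its values in the whole scalar type.\<close>

definition scalars_in :: "'a set \<Rightarrow> ('a \<Rightarrow>\<^sub>0 'k) set" where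
  "scalars_in C = {f. Poly_Mapping.keys f \<subseteq> C \<and> (\<forall>w. Poly_Mapping.lookup f w \<in> A)}"

lemma scalars_in_add: "f \<in> scalars_in C \<Longrightarrow> g \<in> scalars_in C \<Longrightarrow> f + g \<in> scalars_in C"
  by (auto simp: scalars_in_def lookup_add dest!: subsetD[OF keys_add])

lemma scalars_in_single: "a \<in> C \<Longrightarrow> c \<in> A \<Longrightarrow> Poly_Mapping.single a c \<in> scalars_in C"
  by (auto simp: scalars_in_def lookup_single when_def)

lemma scalars_in_zero: "0 \<in> scalars_in C"
  by (simp add: scalars_in_def)

lemma lin_closed [simp]: "f \<in> scalars_in C \<Longrightarrow> e ` C \<subseteq> carrier M \<Longrightarrow> lin e f \<in> carrier M"
  unfolding lin_def by (rule finsum_closed) (auto simp: scalars_in_def)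

text \<open>Functions with different supports become comparable on a common finite index set; the
  additivity of \<open>lin\<close> is obtained in this way.\<close>

lemma lin_superset:
  assumes "f \<in> scalars_in C" "e ` C \<subseteq> carrier M" "finite F" "Poly_Mapping.keys f \<subseteq> F" "F \<subseteq> C"
  shows "lin e f = (\<Oplus>w\<in>F. Poly_Mapping.lookup f w \<odot> e w)"
  unfolding lin_def
  by (rule add.finprod_mono_neutral_cong_left)
    (use assms in \<open>auto simp: scalars_in_def in_keys_iff subset_iff\<close>)

lemma lin_add:
  assumes "f \<in> scalars_in C" "g \<in> scalars_in C" "e ` C \<subseteq> carrier M"
  shows "lin e (f + g) = lin e f \<oplus> lin e g"
proof -
  let ?F = "Poly_Mapping.keys f \<union> Poly_Mapping.keys g"
  have C: "?F \<subseteq> C" using assms by (auto simp: scalars_in_def)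
  have "lin e (f + g) = (\<Oplus>w\<in>?F. (Poly_Mapping.lookup f w + Poly_Mapping.lookup g w) \<odot> e w)"
    using lin_superset[OF scalars_in_add[OF assms(1,2)] assms(3), of ?F] C keys_add[of f g]
    by (simp add: lookup_add)
  also have "\<dots> = (\<Oplus>w\<in>?F. Poly_Mapping.lookup f w \<odot> e w \<oplus> Poly_Mapping.lookup g w \<odot> e w)"
    using C assms by (intro finsum_cong') (auto simp: scalars_in_def smult_l_distr subset_iff)
  also have "\<dots> = lin e f \<oplus> lin e g"
    using C assms
    by (subst finsum_addf) (auto simp: scalars_in_def subset_iff image_subset_iff lin_superset[OF assms(1,3), of ?F] lin_superset[OF assms(2,3), of ?F])
  finally show ?thesis .
qed

lemma lin_single: "c \<in> A \<Longrightarrow> e a \<in> carrier M \<Longrightarrow> lin e (Poly_Mapping.single a c) = c \<odot> e a"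
  by (simp add: lin_def)

lemma lin_zero: "lin e 0 = \<zero>"
  by (simp add: lin_def)

text \<open>Removing one key at a time leaves the other coefficients untouched, so all intermediate
  functions keep their coefficients in \<open>A\<close>. An arbitrary decomposition into a sum would
  not ensure this.\<close>

lemma scalars_in_induct [consumes 1, case_names zero single add]:
  assumes "f \<in> scalars_in C" "P 0"
    and "\<And>a c. a \<in> C \<Longrightarrow> c \<in> A \<Longrightarrow> P (Poly_Mapping.single a c)"
    and add: "\<And>f g. f \<in> scalars_in C \<Longrightarrow> g \<in> scalars_in C \<Longrightarrow> P f \<Longrightarrow> P g \<Longrightarrow> P (f + g)"
  shows "P f"
  using assms(1)
proof (induction "card (Poly_Mapping.keys f)" arbitrary: f)
  case 0
  then show ?case using assms(2) by simp
next
  case (Suc n)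
  then obtain a where a: "a \<in> Poly_Mapping.keys f" by (metis card.empty equals0I nat.distinct(1))
  define g where "g = f - Poly_Mapping.single a (Poly_Mapping.lookup f a)"
  have keys: "Poly_Mapping.keys g = Poly_Mapping.keys f - {a}"
    by (auto simp: g_def in_keys_iff lookup_minus lookup_single when_def split: if_splits)
  have g: "g \<in> scalars_in C"
    using Suc.prems keys by (auto simp: scalars_in_def g_def lookup_minus lookup_single when_def split: if_splits)
  have "P g"
    using Suc.hyps(1)[of g] Suc.hyps(2) g keys a by (simp add: card_Diff_singleton)
  moreover have s: "Poly_Mapping.single a (Poly_Mapping.lookup f a) \<in> scalars_in C"
    using Suc.prems a by (auto simp: scalars_in_def lookup_single when_def)
  moreover have "P (Poly_Mapping.single a (Poly_Mapping.lookup f a))"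
    using Suc.prems a assms(3) by (auto simp: scalars_in_def)
  ultimately have "P (g + Poly_Mapping.single a (Poly_Mapping.lookup f a))" using g add by blast
  then show ?case by (simp add: g_def)
qed

end

section \<open>Tensor products of algebras\<close>

text \<open>An inductive set provides inductions over spans without choosing coefficients and
  without mentioning finite supports; \<open>span_of_lin\<close> recovers coefficients where they
  are needed.\<close>

inductive_set span_of :: "('k, 'b, 'm) module_scheme \<Rightarrow> 'k set \<Rightarrow> ('i \<Rightarrow> 'b) \<Rightarrow> 'i set \<Rightarrow> 'b set"
  for M (structure) and A e E where
    zero: "\<zero> \<in> span_of M A e E"
  | step: "r \<in> A \<Longrightarrow> i \<in> E \<Longrightarrow> x \<in> span_of M A e E \<Longrightarrow> r \<odot> e i \<oplus> x \<in> span_of M A e E"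

context scalar_algebra
begin

lemma span_of_closed: "x \<in> span_of M A e E \<Longrightarrow> e ` E \<subseteq> carrier M \<Longrightarrow> x \<in> carrier M"
  by (induction rule: span_of.induct) auto

lemma span_of_add:
  "x \<in> span_of M A e E \<Longrightarrow> y \<in> span_of M A e E \<Longrightarrow> e ` E \<subseteq> carrier M \<Longrightarrow> x \<oplus> y \<in> span_of M A e E"
proof (induction rule: span_of.induct)
  case (step r i x)
  then show ?case
    by (metis a_assoc image_subset_iff smult_closed span_of.step span_of_closed)
qed (simp add: span_of_closed)

lemma span_of_smult:
  "x \<in> span_of M A e E \<Longrightarrow> r \<in> A \<Longrightarrow> e ` E \<subseteq> carrier M \<Longrightarrow> r \<odot> x \<in> span_of M A e E"
proof (induction rule: span_of.induct)
  case (step s i x)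
  then have "r \<odot> (s \<odot> e i \<oplus> x) = (r * s) \<odot> e i \<oplus> r \<odot> x"
    by (subst smult_r_distr) (auto simp: smult_assoc1 span_of_closed)
  then show ?case using step by (simp add: span_of.step)
qed (simp add: span_of.zero)

lemma span_of_base: "i \<in> E \<Longrightarrow> e ` E \<subseteq> carrier M \<Longrightarrow> e i \<in> span_of M A e E"
  using span_of.step[OF one_scalar _ span_of.zero, of i E M e] by (simp add: image_subset_iff)

lemma span_of_lin:
  assumes "x \<in> span_of M A e E" "e ` E \<subseteq> carrier M"
  obtains f where "f \<in> scalars_in E" "x = lin e f"
proof -
  have "\<exists>f \<in> scalars_in E. x = lin e f"
    using assms
  proof (induction rule: span_of.induct)
    case zero
    then show ?case using scalars_in_zero lin_zero by metis
  next
    case (step r i x)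
    then obtain f where f: "f \<in> scalars_in E" "x = lin e f" by blast
    have s: "Poly_Mapping.single i r \<in> scalars_in E" using step by (simp add: scalars_in_single)
    have "r \<odot> e i \<oplus> x = lin e (Poly_Mapping.single i r + f)"
      using step f by (subst lin_add[OF s f(1)]) (auto simp: lin_single)
    then show ?case using scalars_in_add[OF s f(1)] by blast
  qed
  then show thesis using that by blast
qed

end

text \<open>This is the well-definedness principle behind every map defined by
  \<open>the_elem\<close> on a quotient: if \<open>h\<close> does not change under adding elements
  of the ideal, its image of a coset is a singleton, cosets being nonempty.\<close>

lemma (in ideal) the_elem_coset:
  fixes h :: "'a \<Rightarrow> 'c"
  assumes "\<And>i. i \<in> I \<Longrightarrow> h (i \<oplus>\<^bsub>R\<^esub> a) = h a"
  shows "the_elem (h ` (I +>\<^bsub>R\<^esub> a)) = h a"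
proof -
  have "h ` (I +>\<^bsub>R\<^esub> a) \<subseteq> {h a}"
    using assms by (auto simp: a_r_coset_def')
  moreover have "\<zero>\<^bsub>R\<^esub> \<oplus>\<^bsub>R\<^esub> a \<in> I +>\<^bsub>R\<^esub> a"
    unfolding a_r_coset_def' using additive_subgroup.zero_closed[OF is_additive_subgroup] by blast
  ultimately have "h ` (I +>\<^bsub>R\<^esub> a) = {h a}"
    by (metis empty_iff image_is_empty subset_singletonD)
  then show ?thesis by simp
qed

text \<open>The kernel is an ideal containing \<open>Y\<close>, hence it contains the ideal
  generated by \<open>Y\<close>. It thus suffices to check relators.\<close>

lemma ring_hom_zero_on_Idl:
  assumes "ring R" "ring S" "h \<in> ring_hom R S" "Y \<subseteq> carrier R" "\<And>x. x \<in> Y \<Longrightarrow> h x = \<zero>\<^bsub>S\<^esub>"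
    and "a \<in> Idl\<^bsub>R\<^esub> Y"
  shows "h a = \<zero>\<^bsub>S\<^esub>"
proof -
  interpret ring_hom_ring R S h using assms by (intro ring_hom_ringI2)
  have "Y \<subseteq> a_kernel R S h"
    unfolding a_kernel_def' using assms(4,5) by (intro subsetI CollectI conjI) (erule (1) subsetD)
  then have "a \<in> a_kernel R S h"
    by (rule subsetD[OF R.genideal_minimal[OF kernel_is_ideal] assms(6)])
  then show ?thesis by simp
qed

lemma frag_cmul_frag_of: "frag_cmul c (frag_of p) = Poly_Mapping.single p c"
  by (rule poly_mapping_eqI) (simp add: lookup_single when_def)

lemma frag_extend_single: "frag_extend b (Poly_Mapping.single p c) = frag_cmul c (b p)"
  by (metis frag_cmul_frag_of frag_extend_cmul frag_extend_of)

text \<open>Quotients, modules and Hopf algebras are built as new records by copying fields, so the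
  ring axioms have to be carried from one record to the next.\<close>

lemma ring_transfer:
  assumes "ring R" "carrier S = carrier R" "monoid.mult S = monoid.mult R" "one S = one R"
    "ring.zero S = ring.zero R" "add S = add R"
  shows "ring S"
proof -
  interpret R: ring R by fact
  show ?thesis
  proof (rule ringI)
    show "abelian_group S"
    proof (rule abelian_groupI)
      fix x assume "x \<in> carrier S"
      then show "\<exists>y\<in>carrier S. y \<oplus>\<^bsub>S\<^esub> x = \<zero>\<^bsub>S\<^esub>"
        using R.l_neg R.a_inv_closed assms by metis
    qed (simp_all add: assms R.a_ac)
    show "Group.monoid S"
      by (rule monoidI) (simp_all add: assms R.m_assoc)
  qed (simp_all add: assms R.l_distr R.r_distr)
qed

text \<open>Negation is no field of the record: it is a description depending on the carrier, zero
  and addition, and therefore has to be transferred separately.\<close>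

lemma a_inv_transfer:
  assumes "carrier S = carrier R" "ring.zero S = ring.zero R" "add S = add R"
  shows "a_inv S = a_inv R" "a_minus S = a_minus R"
proof -
  show "a_inv S = a_inv R"
    using assms by (simp add: a_inv_def m_inv_def fun_eq_iff)
  then show "a_minus S = a_minus R"
    using assms by (simp add: a_minus_def fun_eq_iff)
qed

section \<open>The tensor product of two algebras as a quotient of a monoid ring\<close>

locale algebra_pair = M: scalar_algebra M A + N: scalar_algebra N A
  for M :: "('k::comm_ring_1, 'b, 'm) module_scheme" and N :: "('k, 'c, 'n) module_scheme"
    and A :: "'k set" +
  fixes R :: "('k, 'r) ring_scheme"
  assumes carrier_R: "carrier R = A"
begin

abbreviation "MN \<equiv> monoid_ring (M \<times>\<times> N) :: (('b \<times> 'c) \<Rightarrow>\<^sub>0 int) ring"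
abbreviation "rel_ideal \<equiv> Idl\<^bsub>MN\<^esub> (tensor_relators R M N)"
abbreviation "T \<equiv> tensor R M N"
abbreviation "tc \<equiv> tensor_class R M N"
abbreviation "pure \<equiv> pure_tensor R M N"

sublocale MxN: monoid "M \<times>\<times> N"
  by (rule DirProd_monoid) (rule M.is_monoid, rule N.is_monoid)

sublocale MN: ring MN
  by (rule MxN.monoid_ring_is_ring)

lemma keys_diff_subset: "Poly_Mapping.keys f \<subseteq> C \<Longrightarrow> Poly_Mapping.keys g \<subseteq> C \<Longrightarrow> Poly_Mapping.keys (f - g) \<subseteq> C"
  for f g :: "'a \<Rightarrow>\<^sub>0 int"
  by (rule order_trans[OF keys_diff Un_least])

lemma relators_closed: "tensor_relators R M N \<subseteq> carrier MN"
  unfolding tensor_relators_def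
  by (intro subsetI; elim UnE CollectE exE conjE; simp add: keys_diff_subset carrier_R)

lemma rel_ideal: "ideal rel_ideal MN"
  by (rule MN.genideal_ideal[OF relators_closed])

lemma MN_minus: "f \<in> carrier MN \<Longrightarrow> g \<in> carrier MN \<Longrightarrow> f \<ominus>\<^bsub>MN\<^esub> g = f - g"
  by (simp add: a_minus_def MxN.monoid_ring_a_inv)

lemma tc_eqI: "f \<in> carrier MN \<Longrightarrow> g \<in> carrier MN \<Longrightarrow> f - g \<in> rel_ideal \<Longrightarrow> tc f = tc g"
  using MN.quotient_eq_iff_same_a_r_cos[OF rel_ideal, of f g] by (simp add: MN_minus tensor_class_def)

lemma carrier_T: "carrier T = tc ` carrier MN"
  by (auto simp: tensor_def Let_def FactRing_def A_RCOSETS_def' tensor_class_def)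

lemma tc_closed [simp]: "w \<in> carrier MN \<Longrightarrow> tc w \<in> carrier T"
  unfolding carrier_T by blast

lemma T_add: "f \<in> carrier MN \<Longrightarrow> g \<in> carrier MN \<Longrightarrow> tc f \<oplus>\<^bsub>T\<^esub> tc g = tc (f + g)"
  using ideal.a_rcos_sum[OF rel_ideal, of f g] by (simp add: tensor_def Let_def FactRing_def tensor_class_def)

lemma T_mult: "f \<in> carrier MN \<Longrightarrow> g \<in> carrier MN \<Longrightarrow> tc f \<otimes>\<^bsub>T\<^esub> tc g = tc (f \<otimes>\<^bsub>MN\<^esub> g)"
  using ideal.rcoset_mult_add[OF rel_ideal, of f g] by (simp add: tensor_def Let_def FactRing_def tensor_class_def)

lemma T_zero: "\<zero>\<^bsub>T\<^esub> = tc 0"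
  using MN.a_rcos_zero[OF rel_ideal additive_subgroup.zero_closed[OF ideal.axioms(1)[OF rel_ideal]]]
  by (simp add: tensor_def Let_def FactRing_def tensor_class_def)

lemma T_one: "\<one>\<^bsub>T\<^esub> = pure \<one>\<^bsub>M\<^esub> \<one>\<^bsub>N\<^esub>"
  by (simp add: tensor_def Let_def FactRing_def tensor_class_def pure_tensor_def)

lemma T_smult: "r \<odot>\<^bsub>T\<^esub> U = pure (r \<odot>\<^bsub>M\<^esub> \<one>\<^bsub>M\<^esub>) \<one>\<^bsub>N\<^esub> \<otimes>\<^bsub>T\<^esub> U"
  by (simp add: tensor_def Let_def)

sublocale T: ring T
  by (rule ring_transfer[OF ideal.quotient_is_ring[OF rel_ideal]]) (simp_all add: tensor_def Let_def)

lemma pure_closed [simp, intro]: "x \<in> carrier M \<Longrightarrow> y \<in> carrier N \<Longrightarrow> pure x y \<in> carrier T"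
  unfolding pure_tensor_def by (rule tc_closed) simp

lemma pure_add_left:
  assumes "x \<in> carrier M" "x' \<in> carrier M" "y \<in> carrier N"
  shows "pure (x \<oplus>\<^bsub>M\<^esub> x') y = pure x y \<oplus>\<^bsub>T\<^esub> pure x' y"
proof -
  have "frag_of (x \<oplus>\<^bsub>M\<^esub> x', y) - frag_of (x, y) - frag_of (x', y) \<in> rel_ideal"
    by (rule subsetD[OF MN.genideal_self[OF relators_closed]])
      (use assms in \<open>auto simp: tensor_relators_def\<close>)
  then show ?thesis
    using assms unfolding pure_tensor_def
    by (subst T_add, simp, simp, intro tc_eqI) (simp_all add: diff_diff_eq keys_add_subset)
qed

lemma pure_add_right:
  assumes "x \<in> carrier M" "y \<in> carrier N" "y' \<in> carrier N"
  shows "pure x (y \<oplus>\<^bsub>N\<^esub> y') = pure x y \<oplus>\<^bsub>T\<^esub> pure x y'"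
proof -
  have "frag_of (x, y \<oplus>\<^bsub>N\<^esub> y') - frag_of (x, y) - frag_of (x, y') \<in> rel_ideal"
    by (rule subsetD[OF MN.genideal_self[OF relators_closed]])
      (use assms in \<open>auto simp: tensor_relators_def\<close>)
  then show ?thesis
    using assms unfolding pure_tensor_def
    by (subst T_add, simp, simp, intro tc_eqI) (simp_all add: diff_diff_eq keys_add_subset)
qed

lemma pure_balanced:
  assumes "r \<in> A" "x \<in> carrier M" "y \<in> carrier N"
  shows "pure (r \<odot>\<^bsub>M\<^esub> x) y = pure x (r \<odot>\<^bsub>N\<^esub> y)"
proof -
  have "frag_of (r \<odot>\<^bsub>M\<^esub> x, y) - frag_of (x, r \<odot>\<^bsub>N\<^esub> y) \<in> rel_ideal"
    by (rule subsetD[OF MN.genideal_self[OF relators_closed]])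
      (use assms carrier_R in \<open>auto simp: tensor_relators_def\<close>)
  then show ?thesis
    using assms unfolding pure_tensor_def by (intro tc_eqI) simp_all
qed

lemma pure_mult:
  assumes "x \<in> carrier M" "x' \<in> carrier M" "y \<in> carrier N" "y' \<in> carrier N"
  shows "pure x y \<otimes>\<^bsub>T\<^esub> pure x' y' = pure (x \<otimes>\<^bsub>M\<^esub> x') (y \<otimes>\<^bsub>N\<^esub> y')"
  using assms unfolding pure_tensor_def by (subst T_mult) simp_all

lemma pure_smult:
  assumes "r \<in> A" "x \<in> carrier M" "y \<in> carrier N"
  shows "r \<odot>\<^bsub>T\<^esub> pure x y = pure (r \<odot>\<^bsub>M\<^esub> x) y"
  using assms by (simp add: T_smult pure_mult M.smult_mult_left)

lemma pure_zero_left: "y \<in> carrier N \<Longrightarrow> pure \<zero>\<^bsub>M\<^esub> y = \<zero>\<^bsub>T\<^esub>"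
  using pure_add_left[of "\<zero>\<^bsub>M\<^esub>" "\<zero>\<^bsub>M\<^esub>" y] by (metis M.l_zero M.zero_closed T.add.r_cancel_one' pure_closed)

lemma pure_zero_right: "x \<in> carrier M \<Longrightarrow> pure x \<zero>\<^bsub>N\<^esub> = \<zero>\<^bsub>T\<^esub>"
  using pure_add_right[of x "\<zero>\<^bsub>N\<^esub>" "\<zero>\<^bsub>N\<^esub>"] by (metis N.l_zero N.zero_closed T.add.r_cancel_one' pure_closed)

lemma pure_uminus_left: "x \<in> carrier M \<Longrightarrow> y \<in> carrier N \<Longrightarrow> pure (\<ominus>\<^bsub>M\<^esub> x) y = \<ominus>\<^bsub>T\<^esub> pure x y"
  using pure_add_left[of "\<ominus>\<^bsub>M\<^esub> x" x y] by (simp add: M.l_neg pure_zero_left T.minus_equality)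

text \<open>Elements of the tensor product are classes of integer combinations of pairs. A positive
  multiple of a pair is a repeated sum, and a negative one is turned into a positive one by negating
  the left entry, so that sums of pure tensors exhaust everything and the induction needs no case
  for negation.\<close>

lemma tensor_induct [consumes 1, case_names pure add]:
  assumes U: "U \<in> carrier T"
    and pure: "\<And>x y. x \<in> carrier M \<Longrightarrow> y \<in> carrier N \<Longrightarrow> P (pure x y)"
    and add: "\<And>U V. U \<in> carrier T \<Longrightarrow> V \<in> carrier T \<Longrightarrow> P U \<Longrightarrow> P V \<Longrightarrow> P (U \<oplus>\<^bsub>T\<^esub> V)"
  shows "P U"
proof -
  have zero: "P (tc 0)"
    using pure[of "\<zero>\<^bsub>M\<^esub>" "\<zero>\<^bsub>N\<^esub>"] by (simp add: pure_zero_left T_zero)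
  have nat: "P (tc (Poly_Mapping.single (x, y) (int n)))" if xy: "x \<in> carrier M" "y \<in> carrier N" for x y n
  proof (induction n)
    case (Suc n)
    have "tc (Poly_Mapping.single (x, y) (int (Suc n))) =
        tc (frag_of (x, y)) \<oplus>\<^bsub>T\<^esub> tc (Poly_Mapping.single (x, y) (int n))"
      using xy by (subst T_add) (simp_all flip: single_add)
    then show ?case
      using add[OF _ _ pure[OF xy] Suc] xy by (simp add: pure_tensor_def flip: pure_tensor_def)
  qed (simp add: zero)
  have neg: "tc (Poly_Mapping.single (x, y) (- c)) = tc (Poly_Mapping.single (\<ominus>\<^bsub>M\<^esub> x, y) c)"
    if xy: "x \<in> carrier M" "y \<in> carrier N" and c: "c = int n" for x y c n
    unfolding c
  proof (induction n)
    case (Suc n)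
    have "tc (frag_of (\<ominus>\<^bsub>M\<^esub> x, y)) = tc (- frag_of (x, y))"
    proof -
      have "tc (- frag_of (x, y)) \<oplus>\<^bsub>T\<^esub> tc (frag_of (x, y)) = \<zero>\<^bsub>T\<^esub>"
        using xy by (subst T_add) (simp_all add: T_zero)
      then show ?thesis
        using pure_uminus_left[OF xy] xy T.minus_equality[of "tc (- frag_of (x, y))" "tc (frag_of (x, y))"]
        by (simp add: pure_tensor_def)
    qed
    moreover have "tc (Poly_Mapping.single (x, y) (- int (Suc n))) =
        tc (- frag_of (x, y)) \<oplus>\<^bsub>T\<^esub> tc (Poly_Mapping.single (x, y) (- int n))"
      using xy by (subst T_add) (simp_all flip: single_add single_uminus)
    moreover have "tc (Poly_Mapping.single (\<ominus>\<^bsub>M\<^esub> x, y) (int (Suc n))) =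
        tc (frag_of (\<ominus>\<^bsub>M\<^esub> x, y)) \<oplus>\<^bsub>T\<^esub> tc (Poly_Mapping.single (\<ominus>\<^bsub>M\<^esub> x, y) (int n))"
      using xy by (subst T_add) (simp_all flip: single_add)
    ultimately show ?case using Suc by simp
  qed simp
  obtain w where w: "w \<in> carrier MN" "U = tc w" using U unfolding carrier_T by blast
  from w(1) have "Poly_Mapping.keys w \<subseteq> carrier M \<times> carrier N" by simp
  then have "P (tc w)"
  proof (induction w rule: poly_mapping_induct_on)
    case (single a c)
    then obtain x y where xy: "a = (x, y)" "x \<in> carrier M" "y \<in> carrier N" by auto
    show ?case
    proof (cases "c \<ge> 0")
      case True
      then show ?thesis using nat[OF xy(2,3), of "nat c"] xy by simp
    next
      case False
      then show ?thesis
        using nat[of "\<ominus>\<^bsub>M\<^esub> x" y "nat (- c)"] neg[OF xy(2,3), of "- c" "nat (- c)"] xy by simp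
    qed
  next
    case (add f g)
    then show ?case using assms(3)[of "tc f" "tc g"] by (simp add: T_add)
  qed (rule zero)
  then show ?thesis using w by simp
qed

lemma scalar_algebra_T: "scalar_algebra T A"
proof unfold_locales
  fix r s x assume r: "r \<in> A" "s \<in> A" and x: "x \<in> carrier T"
  note c = M.smult_closed[OF r(1) M.one_closed] M.smult_closed[OF r(2) M.one_closed]
  show "(r + s) \<odot>\<^bsub>T\<^esub> x = r \<odot>\<^bsub>T\<^esub> x \<oplus>\<^bsub>T\<^esub> s \<odot>\<^bsub>T\<^esub> x"
    unfolding T_smult using r x by (simp add: M.smult_l_distr pure_add_left T.l_distr)
  show "(r * s) \<odot>\<^bsub>T\<^esub> x = r \<odot>\<^bsub>T\<^esub> (s \<odot>\<^bsub>T\<^esub> x)"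
    unfolding T_smult using r x
    by (simp add: M.smult_assoc1 pure_mult M.smult_mult_left flip: T.m_assoc)
next
  fix r x y assume r: "r \<in> A" and x: "x \<in> carrier T" and y: "y \<in> carrier T"
  show "r \<odot>\<^bsub>T\<^esub> x \<in> carrier T" "r \<odot>\<^bsub>T\<^esub> (x \<oplus>\<^bsub>T\<^esub> y) = r \<odot>\<^bsub>T\<^esub> x \<oplus>\<^bsub>T\<^esub> r \<odot>\<^bsub>T\<^esub> y"
    "r \<odot>\<^bsub>T\<^esub> x \<otimes>\<^bsub>T\<^esub> y = r \<odot>\<^bsub>T\<^esub> (x \<otimes>\<^bsub>T\<^esub> y)"
    unfolding T_smult using r x y by (simp_all add: T.r_distr T.m_assoc)
  \<comment> \<open>Scalars act as left multiplication by a particular pure tensor. Its centrality,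
    checked on pure tensors, yields the compatibility law for the right factor.\<close>
  have "x \<otimes>\<^bsub>T\<^esub> pure (r \<odot>\<^bsub>M\<^esub> \<one>\<^bsub>M\<^esub>) \<one>\<^bsub>N\<^esub> = pure (r \<odot>\<^bsub>M\<^esub> \<one>\<^bsub>M\<^esub>) \<one>\<^bsub>N\<^esub> \<otimes>\<^bsub>T\<^esub> x"
    using x
    by (induction rule: tensor_induct)
      (use r in \<open>simp_all add: pure_mult M.smult_mult_left M.smult_mult_right T.l_distr T.r_distr\<close>)
  then show "x \<otimes>\<^bsub>T\<^esub> (r \<odot>\<^bsub>T\<^esub> y) = r \<odot>\<^bsub>T\<^esub> (x \<otimes>\<^bsub>T\<^esub> y)"
    unfolding T_smult using r x y by (simp flip: T.m_assoc)
next
  fix x assume "x \<in> carrier T"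
  then show "1 \<odot>\<^bsub>T\<^esub> x = x" unfolding T_smult by (simp flip: T_one)
qed simp_all

end

section \<open>Additive functionals on a tensor product\<close>

lemma monoid_ring_mult_diff_left:
  "(f - f') \<otimes>\<^bsub>monoid_ring G\<^esub> g = f \<otimes>\<^bsub>monoid_ring G\<^esub> g - f' \<otimes>\<^bsub>monoid_ring G\<^esub> g"
  using monoid_ring_mult_add_left[where f="f - f'" and f'=f' and g=g and G=G] by (simp add: algebra_simps)

lemma monoid_ring_mult_diff_right:
  "f \<otimes>\<^bsub>monoid_ring G\<^esub> (g - g') = f \<otimes>\<^bsub>monoid_ring G\<^esub> g - f \<otimes>\<^bsub>monoid_ring G\<^esub> g'"
  using monoid_ring_mult_add_right[where f=f and g="g - g'" and g'=g' and G=G] by (simp add: algebra_simps)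

definition frag_functional :: "('b \<Rightarrow> 'c \<Rightarrow> 'p) \<Rightarrow> ('b \<times> 'c \<Rightarrow>\<^sub>0 int) \<Rightarrow> 'p::comm_ring_1" where
  "frag_functional \<phi> w = (\<Sum>p\<in>Poly_Mapping.keys w. of_int (Poly_Mapping.lookup w p) * \<phi> (fst p) (snd p))"

lemma frag_functional_add: "frag_functional \<phi> (v + w) = frag_functional \<phi> v + frag_functional \<phi> w"
  unfolding frag_functional_def by (rule setsum_keys_plus_distrib) (simp_all add: ring_distribs)

lemma frag_functional_single: "frag_functional \<phi> (Poly_Mapping.single (x, y) n) = of_int n * \<phi> x y"
  by (simp add: frag_functional_def)

lemma frag_functional_zero: "frag_functional \<phi> 0 = 0"
  by (simp add: frag_functional_def)

lemma frag_functional_diff: "frag_functional \<phi> (v - w) = frag_functional \<phi> v - frag_functional \<phi> w"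
  using frag_functional_add[of \<phi> "v - w" w] by simp

context algebra_pair
begin

context
  fixes \<phi> :: "'b \<Rightarrow> 'c \<Rightarrow> 'p::comm_ring_1"
  assumes add_left: "\<And>x x' y. x \<in> carrier M \<Longrightarrow> x' \<in> carrier M \<Longrightarrow> y \<in> carrier N \<Longrightarrow>
      \<phi> (x \<oplus>\<^bsub>M\<^esub> x') y = \<phi> x y + \<phi> x' y"
    and add_right: "\<And>x y y'. x \<in> carrier M \<Longrightarrow> y \<in> carrier N \<Longrightarrow> y' \<in> carrier N \<Longrightarrow>
      \<phi> x (y \<oplus>\<^bsub>N\<^esub> y') = \<phi> x y + \<phi> x y'"
    and balanced: "\<And>r x y. r \<in> A \<Longrightarrow> x \<in> carrier M \<Longrightarrow> y \<in> carrier N \<Longrightarrow>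
      \<phi> (r \<odot>\<^bsub>M\<^esub> x) y = \<phi> x (r \<odot>\<^bsub>N\<^esub> y)"
begin

text \<open>The relators are stable under multiplication by basis elements, so the elements whose
  multiples are all killed by the functional form an ideal containing the relators.\<close>

lemma frag_functional_rel_ideal:
  assumes "w \<in> rel_ideal"
  shows "frag_functional \<phi> w = 0"
proof -
  define J where "J = {w \<in> carrier MN. \<forall>u\<in>carrier MN. \<forall>v\<in>carrier MN.
      frag_functional \<phi> (u \<otimes>\<^bsub>MN\<^esub> w \<otimes>\<^bsub>MN\<^esub> v) = 0}"
  have J: "w \<in> J \<Longrightarrow> w \<in> carrier MN"
    "w \<in> J \<Longrightarrow> u \<in> carrier MN \<Longrightarrow> v \<in> carrier MN \<Longrightarrow> frag_functional \<phi> (u \<otimes>\<^bsub>MN\<^esub> w \<otimes>\<^bsub>MN\<^esub> v) = 0"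
    for u v w by (simp_all add: J_def)
  have "ideal J MN"
  proof (rule idealI)
    show "subgroup J (add_monoid MN)"
    proof (rule MN.add.subgroupI)
      show "J \<subseteq> carrier MN" using J(1) by (rule subsetI)
      show "J \<noteq> {}"
      proof -
        have "0 \<in> J" by (simp add: J_def frag_functional_zero)
        then show ?thesis by blast
      qed
      fix a b assume a: "a \<in> J"
      have "\<ominus>\<^bsub>MN\<^esub> a = 0 - a" using J(1)[OF a] by (simp add: MxN.monoid_ring_a_inv)
      moreover have "0 - a \<in> carrier MN" using J(1)[OF a] by simp
      ultimately show "\<ominus>\<^bsub>MN\<^esub> a \<in> J"
        using J(2)[OF a]
        by (simp only: J_def mem_Collect_eq monoid_ring_mult_diff_left monoid_ring_mult_diff_right
            frag_functional_diff frag_functional_zero monoid_ring_mult_zero) simp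
      assume b: "b \<in> J"
      show "a \<oplus>\<^bsub>MN\<^esub> b \<in> J"
        using J(1)[OF a] J(1)[OF b] J(2)[OF a] J(2)[OF b]
        by (simp add: J_def monoid_ring_mult_add_left monoid_ring_mult_add_right frag_functional_add keys_add_subset)
    qed
    fix a x assume a: "a \<in> J" and x: "x \<in> carrier MN"
    show "x \<otimes>\<^bsub>MN\<^esub> a \<in> J"
      unfolding J_def using J(1)[OF a] x J(2)[OF a]
      by (auto simp del: monoid_ring_simps simp flip: MN.m_assoc)
    show "a \<otimes>\<^bsub>MN\<^esub> x \<in> J"
      unfolding J_def using J(1)[OF a] x J(2)[OF a]
      by (auto simp del: monoid_ring_simps simp: MN.m_assoc)
  qed (rule MN.ring_axioms)
  moreover have "tensor_relators R M N \<subseteq> J"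
  proof
    fix w assume w: "w \<in> tensor_relators R M N"
    have "frag_functional \<phi> (u \<otimes>\<^bsub>MN\<^esub> w \<otimes>\<^bsub>MN\<^esub> v) = 0"
      if "Poly_Mapping.keys u \<subseteq> carrier M \<times> carrier N" "Poly_Mapping.keys v \<subseteq> carrier M \<times> carrier N" for u v
      using that
    proof (induction u rule: poly_mapping_induct_on)
      case (single p m)
      from single(2) show ?case
      proof (induction v rule: poly_mapping_induct_on)
        case (single q n)
        obtain a b a' b' where "p = (a, b)" "q = (a', b')" "a \<in> carrier M" "b \<in> carrier N"
          "a' \<in> carrier M" "b' \<in> carrier N" using single \<open>p \<in> _\<close> by auto
        then show ?case
          using w unfolding tensor_relators_def
          by (elim UnE CollectE exE conjE)
            (simp_all add: monoid_ring_mult_diff_left monoid_ring_mult_diff_right frag_functional_diff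
              frag_functional_single M.l_distr M.r_distr N.l_distr N.r_distr add_left add_right
              M.smult_mult_left M.smult_mult_right N.smult_mult_left N.smult_mult_right balanced carrier_R
              ring_distribs)
      qed (simp_all add: monoid_ring_mult_add_right frag_functional_add frag_functional_zero)
    qed (simp_all add: monoid_ring_mult_add_left frag_functional_add frag_functional_zero)
    then show "w \<in> J"
      unfolding J_def using relators_closed w by auto
  qed
  ultimately have "rel_ideal \<subseteq> J" by (rule MN.genideal_minimal)
  then have "w \<in> J" using assms by (rule subsetD)
  from J(2)[OF this MN.one_closed MN.one_closed] show ?thesis
    using MN.l_one[OF J(1)[OF \<open>w \<in> J\<close>]] MN.r_one[OF J(1)[OF \<open>w \<in> J\<close>]]
    by (simp del: monoid_ring_simps)
qed

definition "tensor_functional U = the_elem (frag_functional \<phi> ` U)"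

lemma tensor_functional_tc: "w \<in> carrier MN \<Longrightarrow> tensor_functional (tc w) = frag_functional \<phi> w"
  unfolding tensor_functional_def tensor_class_def
  by (rule ideal.the_elem_coset[OF rel_ideal]) (simp add: frag_functional_add frag_functional_rel_ideal)

lemma tensor_functional_pure:
  "x \<in> carrier M \<Longrightarrow> y \<in> carrier N \<Longrightarrow> tensor_functional (pure x y) = \<phi> x y"
  unfolding pure_tensor_def by (subst tensor_functional_tc) (simp_all add: frag_functional_single)

lemma tensor_functional_add:
  "U \<in> carrier T \<Longrightarrow> V \<in> carrier T \<Longrightarrow> tensor_functional (U \<oplus>\<^bsub>T\<^esub> V) = tensor_functional U + tensor_functional V"
  unfolding carrier_T
  by (auto simp del: monoid_ring_simps simp: T_add tensor_functional_tc)
    (simp add: tensor_functional_tc keys_add_subset frag_functional_add)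

lemma tensor_functional_zero: "tensor_functional \<zero>\<^bsub>T\<^esub> = 0"
  unfolding T_zero by (subst tensor_functional_tc) (simp_all add: frag_functional_zero)

end

end

text \<open>Functoriality of the tensor product, with a change of scalars \<open>\<theta>\<close>.
  This covers the inclusion of Laurent polynomials into rational functions, their evaluation at a
  complex number, and maps which are linear over the complex numbers.\<close>

locale algebra_pair_hom = P: algebra_pair M N A R + P': algebra_pair M' N' A' R'
  for M :: "('k::comm_ring_1, 'b, 'm) module_scheme" and N :: "('k, 'c, 'n) module_scheme" and A and R :: "('k, 'r) ring_scheme"
    and M' :: "('l::comm_ring_1, 'd, 'm1) module_scheme" and N' :: "('l, 'e, 'n1) module_scheme" and A' and R' :: "('l, 'r1) ring_scheme" +
  fixes f :: "'b \<Rightarrow> 'd" and g :: "'c \<Rightarrow> 'e" and \<theta> :: "'k \<Rightarrow> 'l"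
  assumes f: "f \<in> ring_hom M M'" and g: "g \<in> ring_hom N N'"
    and theta: "\<And>r. r \<in> A \<Longrightarrow> \<theta> r \<in> A'"
    and f_smult: "\<And>r x. r \<in> A \<Longrightarrow> x \<in> carrier M \<Longrightarrow> f (r \<odot>\<^bsub>M\<^esub> x) = \<theta> r \<odot>\<^bsub>M'\<^esub> f x"
    and g_smult: "\<And>r y. r \<in> A \<Longrightarrow> y \<in> carrier N \<Longrightarrow> g (r \<odot>\<^bsub>N\<^esub> y) = \<theta> r \<odot>\<^bsub>N'\<^esub> g y"
begin

abbreviation "tmap \<equiv> tensor_map R' M' N' f g"

definition "frag_map = frag_extend (\<lambda>(x, y). frag_of (f x, g y))"

lemma frag_map_single: "frag_map (Poly_Mapping.single (x, y) c) = Poly_Mapping.single (f x, g y) c"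
  by (simp add: frag_map_def frag_extend_single frag_cmul_frag_of)

lemma frag_map_single': "frag_map (Poly_Mapping.single p c) = Poly_Mapping.single (f (fst p), g (snd p)) c"
  by (cases p) (simp add: frag_map_single)

lemma frag_map_zero: "frag_map 0 = 0"
  by (simp add: frag_map_def)

lemma frag_map_add: "frag_map (v + w) = frag_map v + frag_map w"
  by (simp add: frag_map_def frag_extend_add)

lemma frag_map_diff: "frag_map (v - w) = frag_map v - frag_map w"
  by (simp add: frag_map_def frag_extend_diff)

lemma frag_map_closed: "w \<in> carrier P.MN \<Longrightarrow> frag_map w \<in> carrier P'.MN"
proof -
  assume "w \<in> carrier P.MN"
  then have "Poly_Mapping.keys w \<subseteq> carrier M \<times> carrier N" by simp
  then show ?thesis
    by (induction w rule: poly_mapping_induct_on)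
      (simp_all add: frag_map_zero frag_map_single' frag_map_add keys_add_subset
        mem_Times_iff ring_hom_closed[OF f] ring_hom_closed[OF g] split: prod.splits)
qed

lemma frag_map_mult:
  assumes "v \<in> carrier P.MN" "w \<in> carrier P.MN"
  shows "frag_map (v \<otimes>\<^bsub>P.MN\<^esub> w) = frag_map v \<otimes>\<^bsub>P'.MN\<^esub> frag_map w"
proof -
  have "Poly_Mapping.keys v \<subseteq> carrier M \<times> carrier N" "Poly_Mapping.keys w \<subseteq> carrier M \<times> carrier N"
    using assms by simp_all
  then show ?thesis
  proof (induction v rule: poly_mapping_induct_on)
    case (single p m)
    from single(2) show ?case
    proof (induction w rule: poly_mapping_induct_on)
      case (single q n)
      then show ?case using \<open>p \<in> _\<close>
        by (auto simp: frag_map_single ring_hom_mult[OF f] ring_hom_mult[OF g])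
    qed (simp_all add: frag_map_zero frag_map_add monoid_ring_mult_add_right)
  qed (simp_all add: frag_map_zero frag_map_add monoid_ring_mult_add_left)
qed

lemma tc_frag_map_hom: "(\<lambda>w. P'.tc (frag_map w)) \<in> ring_hom P.MN P'.T"
proof (rule ring_hom_memI)
  fix v w assume vw: "v \<in> carrier P.MN" "w \<in> carrier P.MN"
  note c = frag_map_closed[OF vw(1)] frag_map_closed[OF vw(2)]
  show "P'.tc (frag_map v) \<in> carrier P'.T" by (rule P'.tc_closed[OF c(1)])
  show "P'.tc (frag_map (v \<otimes>\<^bsub>P.MN\<^esub> w)) = P'.tc (frag_map v) \<otimes>\<^bsub>P'.T\<^esub> P'.tc (frag_map w)"
    using vw c by (simp only: frag_map_mult P'.T_mult)
  show "P'.tc (frag_map (v \<oplus>\<^bsub>P.MN\<^esub> w)) = P'.tc (frag_map v) \<oplus>\<^bsub>P'.T\<^esub> P'.tc (frag_map w)"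
    using vw c by (simp only: P'.T_add) (simp add: frag_map_add)
next
  show "P'.tc (frag_map \<one>\<^bsub>P.MN\<^esub>) = \<one>\<^bsub>P'.T\<^esub>"
    by (simp add: frag_map_single ring_hom_one[OF f] ring_hom_one[OF g] P'.T_one pure_tensor_def)
qed

text \<open>Applying \<open>f\<close> and \<open>g\<close> to the entries and then taking classes is
  a ring homomorphism on the monoid ring. For independence of the representative it is therefore
  enough that the three kinds of relators are killed.\<close>

lemma tmap_tc:
  assumes w: "w \<in> carrier P.MN"
  shows "tmap (P.tc w) = P'.tc (frag_map w)"
proof -
  have zero: "P'.tc (frag_map i) = \<zero>\<^bsub>P'.T\<^esub>" if i: "i \<in> P.rel_ideal" for i
  proof (rule ring_hom_zero_on_Idl[OF P.MN.ring_axioms P'.T.ring_axioms tc_frag_map_hom P.relators_closed _ i])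
    fix y assume y: "y \<in> tensor_relators R M N"
    \<comment> \<open>A mapped relator is a difference of two elements whose classes agree by
      bilinearity or balancedness of \<open>pure\<close>; such a difference has class zero.\<close>
    have d: "P'.tc (a - b) = \<zero>\<^bsub>P'.T\<^esub>" if "a \<in> carrier P'.MN" "b \<in> carrier P'.MN" "P'.tc a = P'.tc b" for a b
    proof -
      have "P'.tc (a - b) \<oplus>\<^bsub>P'.T\<^esub> P'.tc b = P'.tc a"
        using that by (subst P'.T_add) (simp_all add: P'.keys_diff_subset)
      then show ?thesis using that
        by (metis P'.T.add.r_cancel_one' P'.T.add.m_comm P'.tc_closed P'.MN_minus P'.MN.minus_closed)
    qed
    note hom = ring_hom_closed[OF f] ring_hom_closed[OF g] ring_hom_add[OF f] ring_hom_add[OF g]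
    show "P'.tc (frag_map y) = \<zero>\<^bsub>P'.T\<^esub>"
      using y unfolding tensor_relators_def
    proof (elim UnE CollectE exE conjE)
      fix x x' z
      assume y: "y = frag_of (x \<oplus>\<^bsub>M\<^esub> x', z) - frag_of (x, z) - frag_of (x', z)"
        and c: "x \<in> carrier M" "x' \<in> carrier M" "z \<in> carrier N"
      have "P'.tc (frag_of (f x \<oplus>\<^bsub>M'\<^esub> f x', g z)) = P'.tc (frag_of (f x, g z) + frag_of (f x', g z))"
        using P'.pure_add_left[of "f x" "f x'" "g z"] c hom
        by (simp add: pure_tensor_def P'.T_add)
      then show ?thesis unfolding y
        using c by (simp add: frag_map_diff frag_map_add frag_map_single diff_diff_eq hom, intro d) (simp_all add: hom keys_add_subset)
    next
      fix x z z'
      assume y: "y = frag_of (x, z \<oplus>\<^bsub>N\<^esub> z') - frag_of (x, z) - frag_of (x, z')"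
        and c: "x \<in> carrier M" "z \<in> carrier N" "z' \<in> carrier N"
      have "P'.tc (frag_of (f x, g z \<oplus>\<^bsub>N'\<^esub> g z')) = P'.tc (frag_of (f x, g z) + frag_of (f x, g z'))"
        using P'.pure_add_right[of "f x" "g z" "g z'"] c hom
        by (simp add: pure_tensor_def P'.T_add)
      then show ?thesis unfolding y
        using c by (simp add: frag_map_diff frag_map_add frag_map_single diff_diff_eq hom, intro d) (simp_all add: hom keys_add_subset)
    next
      fix r x z
      assume y: "y = frag_of (r \<odot>\<^bsub>M\<^esub> x, z) - frag_of (x, r \<odot>\<^bsub>N\<^esub> z)"
        and c: "r \<in> carrier R" "x \<in> carrier M" "z \<in> carrier N"
      have r: "r \<in> A" using c P.carrier_R by simp
      have "P'.tc (frag_of (\<theta> r \<odot>\<^bsub>M'\<^esub> f x, g z)) = P'.tc (frag_of (f x, \<theta> r \<odot>\<^bsub>N'\<^esub> g z))"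
        using P'.pure_balanced[of "\<theta> r" "f x" "g z"] c hom theta[OF r]
        by (simp add: pure_tensor_def)
      then show ?thesis unfolding y
        using c r theta[OF r] by (simp add: frag_map_diff frag_map_single f_smult g_smult, intro d) (simp_all add: hom)
    qed
  qed
  have "tmap (P.tc w) = the_elem ((\<lambda>w. P'.tc (frag_map w)) ` P.tc w)"
    by (simp add: tensor_map_def frag_map_def)
  also have "\<dots> = P'.tc (frag_map w)"
    unfolding tensor_class_def[of R M N]
  proof (rule ideal.the_elem_coset[OF P.rel_ideal])
    fix i assume i: "i \<in> P.rel_ideal"
    have "P'.tc (frag_map (i \<oplus>\<^bsub>P.MN\<^esub> w)) = P'.tc (frag_map i) \<oplus>\<^bsub>P'.T\<^esub> P'.tc (frag_map w)"
      using ring_hom_add[OF tc_frag_map_hom ideal.Icarr[OF P.rel_ideal i] w] .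
    then show "P'.tc (frag_map (i \<oplus>\<^bsub>P.MN\<^esub> w)) = P'.tc (frag_map w)"
      using zero[OF i] frag_map_closed[OF w] by (simp del: monoid_ring_simps)
  qed
  finally show ?thesis .
qed

lemma tmap_pure: "x \<in> carrier M \<Longrightarrow> y \<in> carrier N \<Longrightarrow> tmap (P.pure x y) = P'.pure (f x) (g y)"
  unfolding pure_tensor_def by (subst tmap_tc) (simp_all add: frag_map_single)

lemma tmap_hom: "tmap \<in> ring_hom P.T P'.T"
proof (rule ring_hom_memI)
  fix U V assume "U \<in> carrier P.T" "V \<in> carrier P.T"
  then obtain v w where vw: "U = P.tc v" "V = P.tc w" "v \<in> carrier P.MN" "w \<in> carrier P.MN"
    unfolding P.carrier_T by blast
  show "tmap U \<in> carrier P'.T"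
    unfolding vw(1) tmap_tc[OF vw(3)] by (rule P'.tc_closed[OF frag_map_closed[OF vw(3)]])
  have "v \<otimes>\<^bsub>P.MN\<^esub> w \<in> carrier P.MN" "v + w \<in> carrier P.MN"
    using vw P.MN.m_closed P.MN.a_closed[of v w] by (simp_all del: monoid_ring_simps(1))
  then show "tmap (U \<otimes>\<^bsub>P.T\<^esub> V) = tmap U \<otimes>\<^bsub>P'.T\<^esub> tmap V"
    "tmap (U \<oplus>\<^bsub>P.T\<^esub> V) = tmap U \<oplus>\<^bsub>P'.T\<^esub> tmap V"
    using vw by (simp_all only: P.T_mult P.T_add tmap_tc frag_map_mult frag_map_add P'.T_mult P'.T_add frag_map_closed)
next
  show "tmap \<one>\<^bsub>P.T\<^esub> = \<one>\<^bsub>P'.T\<^esub>"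
    by (simp add: P.T_one P'.T_one tmap_pure ring_hom_one[OF f] ring_hom_one[OF g])
qed

lemma tmap_smult:
  assumes "r \<in> A" "U \<in> carrier P.T"
  shows "tmap (r \<odot>\<^bsub>P.T\<^esub> U) = \<theta> r \<odot>\<^bsub>P'.T\<^esub> tmap U"
  using assms
  by (simp add: P.T_smult P'.T_smult ring_hom_mult[OF tmap_hom] tmap_pure f_smult g_smult
      ring_hom_one[OF f] ring_hom_one[OF g])

end

text \<open>In general a tensor square of a subalgebra, taken over a smaller scalar ring, need not
  embed into the tensor square of the whole algebra. It does if the subalgebra is spanned by
  elements \<open>e i\<close> with dual coordinate functions \<open>c\<close> on the whole algebra:
  \<open>t\<close> is a combination of the \<open>e i \<otimes> e j\<close>, and the functional
  formed from two coordinate functions recovers each of its coefficients from the image of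
  \<open>t\<close>.\<close>

theorem tensor_inclusion_kernel_trivial:
  fixes H :: "('k::comm_ring_1, 'b, 'm) module_scheme" and R :: "('k, 'r) ring_scheme"
    and K :: "('k, 'r1) ring_scheme" and c :: "'b \<Rightarrow> 'i \<Rightarrow> 'k" and S :: "'b set"
  defines "HS \<equiv> H\<lparr>carrier := S\<rparr>"
  assumes H: "scalar_algebra H UNIV" and HS: "scalar_algebra HS A"
    and R: "carrier R = A" and K: "carrier K = UNIV" and S: "S \<subseteq> carrier H"
    and c_add: "\<And>x y i. x \<in> carrier H \<Longrightarrow> y \<in> carrier H \<Longrightarrow> c (x \<oplus>\<^bsub>H\<^esub> y) i = c x i + c y i"
    and c_smult: "\<And>r x i. x \<in> carrier H \<Longrightarrow> c (r \<odot>\<^bsub>H\<^esub> x) i = r * c x i"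
    and c_base: "\<And>i j. i \<in> E \<Longrightarrow> c (e i) j = (if i = j then 1 else 0)"
    and e: "e ` E \<subseteq> S" and span: "\<And>x. x \<in> S \<Longrightarrow> x \<in> span_of HS A e E"
    and t: "t \<in> carrier (tensor R HS HS)"
    and eq: "tensor_map K H H (\<lambda>y. y) (\<lambda>y. y) t = \<zero>\<^bsub>tensor K H H\<^esub>"
  shows "t = \<zero>\<^bsub>tensor R HS HS\<^esub>"
proof -
  interpret H: scalar_algebra H UNIV by fact
  interpret HS: scalar_algebra HS A by fact
  have HS_simps: "carrier HS = S" "add HS = add H" "monoid.mult HS = monoid.mult H" "one HS = one H"
    "ring.zero HS = ring.zero H" "module.smult HS = module.smult H"
    by (simp_all add: HS_def)
  interpret h: algebra_pair_hom HS HS A R H H UNIV K "\<lambda>y. y" "\<lambda>y. y" "\<lambda>r. r"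
    by unfold_locales (use S in \<open>auto simp: HS_simps R K ring_hom_def\<close>)
  interpret T: scalar_algebra h.P.T A by (rule h.P.scalar_algebra_T)
  define e2 where "e2 p = h.P.pure (e (fst p)) (e (snd p))" for p
  have e2: "e2 ` (E \<times> E) \<subseteq> carrier h.P.T"
    using e by (auto simp: e2_def HS_simps intro!: h.P.pure_closed)
  have eS: "e i \<in> carrier HS" if "i \<in> E" for i using e that by (auto simp: HS_simps)
  have eE: "e ` E \<subseteq> carrier HS" using eS by auto
  have span1: "h.P.pure (e i) y \<in> span_of h.P.T A e2 (E \<times> E)"
    if "i \<in> E" "y \<in> span_of HS A e E" for i y
    using that(2)
  proof (induction rule: span_of.induct)
    case zero
    then show ?case using eS that by (simp add: h.P.pure_zero_right span_of.zero)
  next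
    case (step s j y)
    then have y: "y \<in> carrier HS" using HS.span_of_closed eE by blast
    have "h.P.pure (e i) (s \<odot>\<^bsub>HS\<^esub> e j \<oplus>\<^bsub>HS\<^esub> y) = s \<odot>\<^bsub>h.P.T\<^esub> e2 (i, j) \<oplus>\<^bsub>h.P.T\<^esub> h.P.pure (e i) y"
      using step y eS that
      by (simp add: h.P.pure_add_right e2_def h.P.pure_smult flip: h.P.pure_balanced)
    then show ?case using step that by (simp add: span_of.step)
  qed
  have span2: "h.P.pure x y \<in> span_of h.P.T A e2 (E \<times> E)"
    if "x \<in> span_of HS A e E" "y \<in> span_of HS A e E" for x y
    using that(1)
  proof (induction rule: span_of.induct)
    case zero
    then show ?case using HS.span_of_closed[OF that(2) eE] by (simp add: h.P.pure_zero_left span_of.zero)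
  next
    case (step r i x)
    then have x: "x \<in> carrier HS" using HS.span_of_closed eE by blast
    have y: "y \<in> carrier HS" using HS.span_of_closed[OF that(2) eE] .
    have "h.P.pure (r \<odot>\<^bsub>HS\<^esub> e i \<oplus>\<^bsub>HS\<^esub> x) y = r \<odot>\<^bsub>h.P.T\<^esub> h.P.pure (e i) y \<oplus>\<^bsub>h.P.T\<^esub> h.P.pure x y"
      using step x y eS by (simp add: h.P.pure_add_left h.P.pure_smult)
    then show ?case
      using T.span_of_add[OF T.span_of_smult[OF span1[OF step(2) that(2)] step(1) e2] step.IH e2] by simp
  qed
  from t have "t \<in> span_of h.P.T A e2 (E \<times> E)"
  proof (induction rule: h.P.tensor_induct)
    case (pure x y)
    then show ?case using span span2 by (simp add: HS_simps)
  next
    case (add U V)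
    then show ?case using T.span_of_add e2 by blast
  qed
  then obtain v where v: "v \<in> T.scalars_in (E \<times> E)" "t = T.lin e2 v"
    using T.span_of_lin e2 by blast
  have "Poly_Mapping.lookup v (k, l) = 0" if kl: "k \<in> E" "l \<in> E" for k l
  proof -
    \<comment> \<open>The product of two coordinate functions is biadditive and, the coordinates
      being linear over all scalars, balanced; it descends to the larger tensor product. There it
      picks out the coefficient of \<open>e k \<otimes> e l\<close>.\<close>
    define \<phi> where "\<phi> x y = c x k * c y l" for x y
    define F where "F = h.P'.tensor_functional \<phi>"
    have F_add: "F (U \<oplus>\<^bsub>h.P'.T\<^esub> V) = F U + F V" if "U \<in> carrier h.P'.T" "V \<in> carrier h.P'.T" for U V
      unfolding F_def
      by (rule h.P'.tensor_functional_add) (use that in \<open>auto simp: \<phi>_def c_add c_smult algebra_simps\<close>)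
    have F_zero: "F \<zero>\<^bsub>h.P'.T\<^esub> = 0"
      unfolding F_def
      by (rule h.P'.tensor_functional_zero) (auto simp: \<phi>_def c_add c_smult algebra_simps)
    have F_pure: "F (h.P'.pure x y) = c x k * c y l" if "x \<in> carrier H" "y \<in> carrier H" for x y
      unfolding F_def
      by (subst h.P'.tensor_functional_pure) (use that in \<open>auto simp: \<phi>_def c_add c_smult algebra_simps\<close>)
    have "T.lin e2 v \<in> carrier h.P.T \<and> F (h.tmap (T.lin e2 v)) = Poly_Mapping.lookup v (k, l)"
      using v(1)
    proof (induction v rule: T.scalars_in_induct)
      case zero
      have "h.tmap \<zero>\<^bsub>h.P.T\<^esub> = \<zero>\<^bsub>h.P'.T\<^esub>"
        using ring_hom_zero[OF h.tmap_hom h.P.T.ring_axioms h.P'.T.ring_axioms] .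
      then show ?case by (simp add: T.lin_zero F_zero)
    next
      case (single p a)
      then obtain i j where p: "p = (i, j)" "i \<in> E" "j \<in> E" by auto
      have ij: "e i \<in> carrier HS" "e j \<in> carrier HS" "e i \<in> carrier H" "e j \<in> carrier H"
        using p eS S by (auto simp: HS_simps)
      have "T.lin e2 (Poly_Mapping.single p a) = h.P.pure (a \<odot>\<^bsub>H\<^esub> e i) (e j)"
        using single ij by (subst T.lin_single) (auto simp: p e2_def h.P.pure_smult HS_simps intro!: h.P.pure_closed)
      moreover have "a \<odot>\<^bsub>H\<^esub> e i \<in> carrier HS"
        using HS.smult_closed[OF single(2) ij(1)] by (simp add: HS_simps)
      ultimately show ?case
        using p ij
        by (simp add: h.tmap_pure F_pure c_smult c_base lookup_single when_def h.P.pure_closed)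
    next
      case (add f g)
      then show ?case
        by (simp add: T.lin_add[OF add(1,2) e2] ring_hom_add[OF h.tmap_hom] F_add
            ring_hom_closed[OF h.tmap_hom] lookup_add)
    qed
    then show ?thesis using eq F_zero v(2) by simp
  qed
  moreover have "Poly_Mapping.lookup v p = 0" if "p \<notin> E \<times> E" for p
    using v(1) that by (auto simp: T.scalars_in_def in_keys_iff)
  ultimately have "v = 0"
    by (intro poly_mapping_eqI) (metis lookup_zero mem_Sigma_iff surj_pair)
  then show ?thesis using v(2) T.lin_zero by simp
qed

section \<open>The quantum algebra and its Hopf structure\<close>

lemma scalar_algebra_transfer:
  assumes "scalar_algebra M A" "carrier M' = carrier M" "monoid.mult M' = monoid.mult M" "one M' = one M"
    "ring.zero M' = ring.zero M" "add M' = add M" "module.smult M' = module.smult M"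
  shows "scalar_algebra M' A"
proof -
  interpret M: scalar_algebra M A by fact
  interpret M': ring M' by (rule ring_transfer[OF M.ring_axioms]) (simp_all add: assms)
  show ?thesis
    by unfold_locales
      (simp_all add: assms M.smult_l_distr M.smult_r_distr M.smult_assoc1 M.smult_mult_left M.smult_mult_right)
qed

text \<open>The definitions form tensor products of records with Hopf structure, while the proofs
  use the underlying modules. The tensor product sees only the algebra fields, so both
  agree.\<close>

lemma tensor_transfer:
  assumes "carrier M' = carrier M" "monoid.mult M' = monoid.mult M" "one M' = one M"
    "add M' = add M" "module.smult M' = module.smult M"
    and "carrier N' = carrier N" "monoid.mult N' = monoid.mult N" "one N' = one N"
    "add N' = add N" "module.smult N' = module.smult N" and "carrier R' = carrier R"
  shows "tensor_class R' M' N' = tensor_class R M N" "pure_tensor R' M' N' = pure_tensor R M N"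
    "tensor R' M' N' = tensor R M N" "tensor_map R' M' N' = tensor_map R M N"
proof -
  have "M' \<times>\<times> N' = M \<times>\<times> N" by (simp add: DirProd_def assms)
  moreover have "tensor_relators R' M' N' = tensor_relators R M N"
    by (simp add: tensor_relators_def assms)
  ultimately show tc: "tensor_class R' M' N' = tensor_class R M N"
    by (simp add: tensor_class_def fun_eq_iff)
  then show p: "pure_tensor R' M' N' = pure_tensor R M N"
    by (simp add: pure_tensor_def fun_eq_iff)
  show "tensor R' M' N' = tensor R M N"
    using \<open>M' \<times>\<times> N' = M \<times>\<times> N\<close> \<open>tensor_relators R' M' N' = tensor_relators R M N\<close>
    by (simp add: tensor_def p assms)
  show "tensor_map R' M' N' = tensor_map R M N"
    by (simp add: tensor_map_def fun_eq_iff tc)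
qed

lemma ring_Cq_simps [simp]: "carrier (ring_of_type_algebra :: 'a::comm_ring_1 ring) = UNIV"
  by (simp add: ring_of_type_algebra_def)

text \<open>The structure constant of the Heisenberg commutator of the unscaled letters, with the
  factor \<Gamma>^2m - \<Gamma>^-2m split off.\<close>

definition heis_const :: "int \<Rightarrow> ratfun" where
  "heis_const m = 1 / of_int m * qint m / (qq - inverse qq)"

abbreviation free_mon :: "gen list monoid" where
  "free_mon \<equiv> \<lparr>carrier = lists gens, monoid.mult = (@), one = []\<rparr>"

lemma monoid_free_mon: "Group.monoid free_mon"
  by (rule monoidI) auto

lemma ring_free_alg: "ring free_alg"
  unfolding free_alg_def by (rule monoid.monoid_ring_is_ring[OF monoid_free_mon])

lemma carrier_free_alg: "carrier free_alg = {f. Poly_Mapping.keys f \<subseteq> lists gens}"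
  by (simp add: free_alg_def)

lemma gens_simps [simp]: "GenH m \<in> gens \<longleftrightarrow> m \<noteq> 0" "GenLam \<in> gens" "GenLam' \<in> gens"
  "GenGam \<in> gens" "GenGam' \<in> gens" "GenK \<in> gens" "GenK' \<in> gens"
  by (auto simp: gens_def)

lemma gam_pow_in_lists [simp]: "gam_pow n \<in> lists gens"
  by (auto simp: gam_pow_def in_lists_conv_set)

lemma keys_diff_subset': "Poly_Mapping.keys f \<subseteq> C \<Longrightarrow> Poly_Mapping.keys g \<subseteq> C \<Longrightarrow> Poly_Mapping.keys (f - g) \<subseteq> C"
  for f g :: "'a \<Rightarrow>\<^sub>0 'b::ab_group_add"
  by (auto simp: in_keys_iff lookup_minus subset_iff) (metis diff_zero)

lemma free_alg_diff_closed:
  "f \<in> carrier free_alg \<Longrightarrow> g \<in> carrier free_alg \<Longrightarrow> f - g \<in> carrier free_alg"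
  by (simp add: carrier_free_alg keys_diff_subset')

lemma free_alg_single_closed: "w \<in> lists gens \<Longrightarrow> Poly_Mapping.single w c \<in> carrier free_alg"
  by (simp add: carrier_free_alg)

lemma free_alg_zero_closed: "0 \<in> carrier free_alg"
  by (simp add: carrier_free_alg)

lemma free_alg_mult_word: "Poly_Mapping.single u c \<otimes>\<^bsub>free_alg\<^esub> Poly_Mapping.single v d = Poly_Mapping.single (u @ v) (c * d)"
  by (simp add: free_alg_def)

lemma gl1_relators_closed: "gl1_relators \<subseteq> carrier free_alg"
  unfolding gl1_relators_def Let_def
  by (intro subsetI; elim UnE CollectE exE conjE;
      auto intro!: free_alg_diff_closed free_alg_single_closed free_alg_zero_closed gam_pow_in_lists)

text \<open>The hypothesis of the universal property: values for the letters, in any algebra over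
  the rational functions, which satisfy the defining relations. The instances are the algebra
  itself, its tensor square, the ground field, the opposite algebra and the endomorphisms of the
  Fock space. Relations are written as exchange rules, ready for reordering products.\<close>

locale quantum_gl1_rep = scalar_algebra B UNIV for B :: "(ratfun, 'b, 'm) module_scheme" (structure) +
  fixes \<phi> :: "gen \<Rightarrow> 'b"
  assumes phi_closed: "x \<in> gens \<Longrightarrow> \<phi> x \<in> carrier B"
    and phi_inverse: "(x, y) \<in> {(GenLam, GenLam'), (GenLam', GenLam), (GenGam, GenGam'), (GenGam', GenGam),
                (GenK, GenK'), (GenK', GenK)} \<Longrightarrow> \<phi> x \<otimes> \<phi> y = \<one>"
    and phi_central: "x \<in> {GenGam, GenGam', GenK, GenK'} \<Longrightarrow> y \<in> gens \<Longrightarrow> \<phi> x \<otimes> \<phi> y = \<phi> y \<otimes> \<phi> x"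
    and phi_lam: "m \<noteq> 0 \<Longrightarrow> \<phi> (GenH m) \<otimes> \<phi> GenLam = (qq powi (2 * m)) \<odot> (\<phi> GenLam \<otimes> \<phi> (GenH m))"
    and phi_heis: "m \<noteq> 0 \<Longrightarrow> m' \<noteq> 0 \<Longrightarrow> \<phi> (GenH m) \<otimes> \<phi> (GenH (- m')) =
        \<phi> (GenH (- m')) \<otimes> \<phi> (GenH m) \<oplus> (if m = m' then heis_const m \<odot>
          (foldr (\<lambda>x y. \<phi> x \<otimes> y) (gam_pow (2 * m)) \<one> \<ominus> foldr (\<lambda>x y. \<phi> x \<otimes> y) (gam_pow (- (2 * m))) \<one>) else \<zero>)"
begin

abbreviation "wd w \<equiv> foldr (\<lambda>x y. \<phi> x \<otimes> y) w \<one>"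
abbreviation "gp n \<equiv> wd (gam_pow n)"

lemma wd_closed [simp]: "w \<in> lists gens \<Longrightarrow> wd w \<in> carrier B"
  by (induction w) (auto simp: phi_closed)

lemma wd_append: "v \<in> lists gens \<Longrightarrow> w \<in> lists gens \<Longrightarrow> wd (v @ w) = wd v \<otimes> wd w"
  by (induction v) (auto simp: phi_closed m_assoc)

lemma gam_pow_Suc: "gp (n + 1) = \<phi> GenGam \<otimes> gp n"
proof (cases "n \<ge> 0")
  case True
  then have "gam_pow (n + 1) = GenGam # gam_pow n"
    by (simp add: gam_pow_def nat_add_distrib)
  then show ?thesis by simp
next
  case False
  then have "nat (- n) = Suc (nat (- (n + 1)))" by simp
  then have "gam_pow n = GenGam' # gam_pow (n + 1)"
    using False by (auto simp: gam_pow_def)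
  then show ?thesis
    using phi_inverse[of GenGam GenGam'] by (simp add: phi_closed flip: m_assoc)
qed

lemma gam_pow_pred: "gp (n - 1) = \<phi> GenGam' \<otimes> gp n"
  using gam_pow_Suc[of "n - 1"] phi_inverse[of GenGam' GenGam] by (simp add: phi_closed flip: m_assoc)

lemma gp_0 [simp]: "gp 0 = \<one>"
  by (simp add: gam_pow_def)

lemma gp_add: "gp (m + n) = gp m \<otimes> gp n"
proof (induction m rule: int_induct[where k = 0])
  case (step1 i)
  then show ?case using gam_pow_Suc[of "i + n"] gam_pow_Suc[of i]
    by (simp add: phi_closed m_assoc add.commute add.left_commute)
next
  case (step2 i)
  then show ?case using gam_pow_pred[of "i + n"] gam_pow_pred[of i]
    by (simp add: phi_closed m_assoc algebra_simps)
qed simp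

lemma gp_commute: "y \<in> gens \<Longrightarrow> gp n \<otimes> \<phi> y = \<phi> y \<otimes> gp n"
proof (induction n rule: int_induct[where k = 0])
  case (step1 i)
  then show ?case using phi_central[of GenGam y]
    by (simp add: gam_pow_Suc phi_closed m_assoc) (simp add: phi_closed flip: m_assoc)
next
  case (step2 i)
  then show ?case using phi_central[of GenGam' y]
    by (simp add: gam_pow_pred phi_closed m_assoc) (simp add: phi_closed flip: m_assoc)
qed (simp add: phi_closed)

lemma scalars_in_UNIV: "f \<in> carrier free_alg \<longleftrightarrow> f \<in> scalars_in (lists gens)"
  by (simp add: carrier_free_alg scalars_in_def)

lemma free_alg_ext_lin: "free_alg_ext B \<phi> f = lin wd f"
  by (simp add: free_alg_ext_def lin_def)

lemma wd_image: "wd ` lists gens \<subseteq> carrier B"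
  by (rule image_subsetI) (rule wd_closed)

lemma free_alg_ext_word: "w \<in> lists gens \<Longrightarrow> free_alg_ext B \<phi> (Poly_Mapping.single w c) = c \<odot> wd w"
  unfolding free_alg_ext_lin by (subst lin_single) auto

lemma free_alg_ext_add: "f \<in> carrier free_alg \<Longrightarrow> g \<in> carrier free_alg \<Longrightarrow>
    free_alg_ext B \<phi> (f + g) = free_alg_ext B \<phi> f \<oplus> free_alg_ext B \<phi> g"
  unfolding free_alg_ext_lin scalars_in_UNIV by (rule lin_add[OF _ _ wd_image])

lemma free_alg_ext_closed: "f \<in> carrier free_alg \<Longrightarrow> free_alg_ext B \<phi> f \<in> carrier B"
  unfolding free_alg_ext_lin scalars_in_UNIV by (rule lin_closed[OF _ wd_image])

lemma free_alg_ext_diff: "f \<in> carrier free_alg \<Longrightarrow> g \<in> carrier free_alg \<Longrightarrow>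
    free_alg_ext B \<phi> (f - g) = free_alg_ext B \<phi> f \<ominus> free_alg_ext B \<phi> g"
  using free_alg_ext_add[of "f - g" g] free_alg_ext_closed[of "f - g"] free_alg_ext_closed[of g]
  by (simp add: carrier_free_alg keys_diff_subset' a_minus_def a_assoc r_neg)

lemma free_alg_ext_hom: "free_alg_ext B \<phi> \<in> ring_hom free_alg B"
proof (rule ring_hom_memI)
  fix f g assume f: "f \<in> carrier free_alg" and g: "g \<in> carrier free_alg"
  show "free_alg_ext B \<phi> (f \<oplus>\<^bsub>free_alg\<^esub> g) = free_alg_ext B \<phi> f \<oplus> free_alg_ext B \<phi> g"
    using free_alg_ext_add[OF f g] by (simp add: free_alg_def)
  have z: "free_alg_ext B \<phi> 0 = \<zero>" by (simp add: free_alg_ext_lin lin_zero)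
  interpret F: ring free_alg by (rule ring_free_alg)
  have F: "add free_alg = (+)" "ring.zero free_alg = 0" by (simp_all add: free_alg_def)
  have keys: "Poly_Mapping.keys f \<subseteq> lists gens" "Poly_Mapping.keys g \<subseteq> lists gens"
    using f g by (simp_all add: carrier_free_alg)
  show "free_alg_ext B \<phi> (f \<otimes>\<^bsub>free_alg\<^esub> g) = free_alg_ext B \<phi> f \<otimes> free_alg_ext B \<phi> g"
    using keys
  proof (induction f rule: poly_mapping_induct_on)
    case zero
    then show ?case using g F.l_null[OF g] by (simp add: F z free_alg_ext_closed)
  next
    case (single u c)
    have u: "Poly_Mapping.single u c \<in> carrier free_alg" using single by (simp add: carrier_free_alg)
    from single(2) show ?case
    proof (induction g rule: poly_mapping_induct_on)
      case zero
      then show ?case using F.r_null[OF u] by (simp add: F z free_alg_ext_closed[OF u])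
    next
      case (single v d)
      have "wd u \<in> carrier B" "wd v \<in> carrier B" using single \<open>u \<in> lists gens\<close> by auto
      moreover have "u @ v \<in> lists gens" using single \<open>u \<in> lists gens\<close> by simp
      ultimately show ?case using single \<open>u \<in> lists gens\<close>
        by (simp only: free_alg_mult_word free_alg_ext_word wd_append)
          (simp add: smult_mult_left smult_mult_right smult_assoc1, intro smult_commute, simp_all)
    next
      case (add g h)
      then have c: "g \<in> carrier free_alg" "h \<in> carrier free_alg" by (simp_all add: carrier_free_alg)
      have "Poly_Mapping.single u c \<otimes>\<^bsub>free_alg\<^esub> (g + h) =
          Poly_Mapping.single u c \<otimes>\<^bsub>free_alg\<^esub> g + Poly_Mapping.single u c \<otimes>\<^bsub>free_alg\<^esub> h"
        using F.r_distr[OF c u] by (simp add: F)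
      then show ?case using add c u
        by (simp add: free_alg_ext_add free_alg_ext_closed r_distr)
    qed
  next
    case (add f h)
    then have c: "f \<in> carrier free_alg" "h \<in> carrier free_alg" by (simp_all add: carrier_free_alg)
    have "(f + h) \<otimes>\<^bsub>free_alg\<^esub> g = f \<otimes>\<^bsub>free_alg\<^esub> g + h \<otimes>\<^bsub>free_alg\<^esub> g"
      using F.l_distr[OF c g] by (simp add: F)
    then show ?case using add c g
      by (simp add: free_alg_ext_add free_alg_ext_closed l_distr)
  qed
next
  show "free_alg_ext B \<phi> \<one>\<^bsub>free_alg\<^esub> = \<one>"
    by (simp add: free_alg_def free_alg_ext_word)
qed (rule free_alg_ext_closed)

lemma free_alg_ext_relators:
  assumes "y \<in> gl1_relators"
  shows "free_alg_ext B \<phi> y = \<zero>"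
proof -
  have cl: "Poly_Mapping.single w c \<in> carrier free_alg" if "w \<in> lists gens" for w c
    using that by (simp add: carrier_free_alg)
  have cld: "f - g \<in> carrier free_alg" if "f \<in> carrier free_alg" "g \<in> carrier free_alg" for f g
    using that by (simp add: carrier_free_alg keys_diff_subset')
  show ?thesis
    using assms unfolding gl1_relators_def
  proof (elim UnE CollectE exE conjE)
    fix m m' :: int assume m: "m \<noteq> 0" "m' \<noteq> 0"
    assume y: "y = word [GenH m, GenH (- m')] - word [GenH (- m'), GenH m] -
      (if m = m' then let c = 1 / of_int m * qint m / (qq - inverse qq)
            in Poly_Mapping.single (gam_pow (2 * m)) c - Poly_Mapping.single (gam_pow (- 2 * m)) c
       else 0)"
    have z: "free_alg_ext B \<phi> 0 = \<zero>" "0 \<in> carrier free_alg"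
      by (simp_all add: free_alg_ext_lin lin_zero carrier_free_alg)
    show ?thesis
    proof (cases "m = m'")
      case True
      have "y = word [GenH m, GenH (- m')] - word [GenH (- m'), GenH m] -
        (Poly_Mapping.single (gam_pow (2 * m)) (heis_const m) - Poly_Mapping.single (gam_pow (- (2 * m))) (heis_const m))"
        unfolding y using True by (simp add: heis_const_def Let_def)
      then show ?thesis
        using m phi_heis[OF m] True
        by (simp add: free_alg_ext_diff cl cld free_alg_ext_word phi_closed smult_minus_right)
          (simp add: phi_closed a_minus_def minus_add r_neg a_ac r_neg1 r_neg2)
    next
      case False
      then show ?thesis
        using m phi_heis[OF m] unfolding y
        by (simp add: free_alg_ext_diff cl cld free_alg_ext_word phi_closed z a_minus_def r_neg)
    qed
  next
    fix m :: int assume m: "m \<noteq> 0"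
    assume y: "y = word [GenH m, GenLam] - Poly_Mapping.single [GenLam, GenH m] (qq powi (2 * m))"
    then show ?thesis
      using m phi_lam[OF m] by (simp add: free_alg_ext_diff cl free_alg_ext_word phi_closed a_minus_def r_neg)
  next
    fix x x' assume y: "y = word [x, x'] - word []" and
      x: "(x, x') \<in> {(GenLam, GenLam'), (GenLam', GenLam), (GenGam, GenGam'), (GenGam', GenGam),
                (GenK, GenK'), (GenK', GenK)}"
    then have "x \<in> gens" "x' \<in> gens" by auto
    then show ?thesis
      using phi_inverse[OF x] y by (simp add: free_alg_ext_diff cl free_alg_ext_word phi_closed a_minus_def r_neg)
  next
    fix x x' assume y: "y = word [x, x'] - word [x', x]" and
      x: "x \<in> {GenGam, GenGam', GenK, GenK'}" and x': "x' \<in> gens"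
    then have "x \<in> gens" by auto
    then show ?thesis
      using phi_central[OF x x'] y x' by (simp add: free_alg_ext_diff cl free_alg_ext_word phi_closed a_minus_def r_neg)
  qed
qed

text \<open>The extension to the free algebra is a ring homomorphism that kills the relators, hence
  it is constant on cosets of the ideal they generate.\<close>

lemma uq_ext_class:
  assumes f: "f \<in> carrier free_alg"
  shows "uq_ext B \<phi> (uq_class f) = free_alg_ext B \<phi> f"
  unfolding uq_ext_def uq_class_def
proof (rule ideal.the_elem_coset)
  interpret F: ring free_alg by (rule ring_free_alg)
  show id: "ideal (Idl\<^bsub>free_alg\<^esub> gl1_relators) free_alg" by (rule F.genideal_ideal[OF gl1_relators_closed])
  fix i assume i: "i \<in> Idl\<^bsub>free_alg\<^esub> gl1_relators"
  then have "i \<in> carrier free_alg" by (rule ideal.Icarr[OF id])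
  moreover have "free_alg_ext B \<phi> i = \<zero>"
    by (rule ring_hom_zero_on_Idl[OF F.ring_axioms ring_axioms free_alg_ext_hom gl1_relators_closed
          free_alg_ext_relators i])
  ultimately show "free_alg_ext B \<phi> (i \<oplus>\<^bsub>free_alg\<^esub> f) = free_alg_ext B \<phi> f"
    using f ring_hom_add[OF free_alg_ext_hom] by (simp add: free_alg_ext_closed)
qed

end

lemma Uq_alg_carrier: "carrier Uq_alg = uq_class ` carrier free_alg"
  by (auto simp: Uq_alg_def Let_def FactRing_def A_RCOSETS_def' uq_class_def)

lemma ideal_gl1: "ideal (Idl\<^bsub>free_alg\<^esub> gl1_relators) free_alg"
  by (rule ring.genideal_ideal[OF ring_free_alg gl1_relators_closed])

lemma Uq_alg_add: "f \<in> carrier free_alg \<Longrightarrow> g \<in> carrier free_alg \<Longrightarrow>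
    uq_class f \<oplus>\<^bsub>Uq_alg\<^esub> uq_class g = uq_class (f + g)"
  using ideal.a_rcos_sum[OF ideal_gl1, of f g]
  by (simp add: Uq_alg_def Let_def FactRing_def uq_class_def) (simp add: free_alg_def)

lemma Uq_alg_mult: "f \<in> carrier free_alg \<Longrightarrow> g \<in> carrier free_alg \<Longrightarrow>
    uq_class f \<otimes>\<^bsub>Uq_alg\<^esub> uq_class g = uq_class (f \<otimes>\<^bsub>free_alg\<^esub> g)"
  using ideal.rcoset_mult_add[OF ideal_gl1, of f g]
  by (simp add: Uq_alg_def Let_def FactRing_def uq_class_def)

lemma Uq_alg_one: "\<one>\<^bsub>Uq_alg\<^esub> = uq_class (word [])"
  by (simp add: Uq_alg_def Let_def FactRing_def uq_class_def) (simp add: free_alg_def)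

lemma Uq_alg_zero: "\<zero>\<^bsub>Uq_alg\<^esub> = uq_class 0"
proof -
  interpret F: ring free_alg by (rule ring_free_alg)
  have "Idl\<^bsub>free_alg\<^esub> gl1_relators +>\<^bsub>free_alg\<^esub> \<zero>\<^bsub>free_alg\<^esub> = Idl\<^bsub>free_alg\<^esub> gl1_relators"
    by (rule F.a_rcos_zero[OF ideal_gl1 additive_subgroup.zero_closed[OF ideal.axioms(1)[OF ideal_gl1]]])
  then show ?thesis
    by (simp add: Uq_alg_def Let_def FactRing_def uq_class_def) (simp add: free_alg_def)
qed

lemma Uq_alg_smult: "r \<odot>\<^bsub>Uq_alg\<^esub> U = uq_class (Poly_Mapping.single [] r) \<otimes>\<^bsub>Uq_alg\<^esub> U"
  by (simp add: Uq_alg_def Let_def)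

lemma ring_Uq_alg: "ring Uq_alg"
  by (rule ring_transfer[OF ideal.quotient_is_ring[OF ideal_gl1]]) (simp_all add: Uq_alg_def Let_def)

lemma uq_class_closed: "f \<in> carrier free_alg \<Longrightarrow> uq_class f \<in> carrier Uq_alg"
  by (simp add: Uq_alg_carrier)

lemma Uq_alg_smult_word:
  "w \<in> lists gens \<Longrightarrow> r \<odot>\<^bsub>Uq_alg\<^esub> uq_class (Poly_Mapping.single w c) = uq_class (Poly_Mapping.single w (r * c))"
  unfolding Uq_alg_smult
  by (subst Uq_alg_mult) (simp_all add: free_alg_single_closed free_alg_def)

lemma Uq_alg_induct_word [consumes 1, case_names word add]:
  assumes U: "U \<in> carrier Uq_alg"
    and word: "\<And>w c. w \<in> lists gens \<Longrightarrow> P (uq_class (Poly_Mapping.single w c))"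
    and add: "\<And>U V. U \<in> carrier Uq_alg \<Longrightarrow> V \<in> carrier Uq_alg \<Longrightarrow> P U \<Longrightarrow> P V \<Longrightarrow> P (U \<oplus>\<^bsub>Uq_alg\<^esub> V)"
  shows "P U"
proof -
  obtain f where f: "f \<in> carrier free_alg" "U = uq_class f" using U unfolding Uq_alg_carrier by blast
  have "Poly_Mapping.keys f \<subseteq> lists gens" using f by (simp add: carrier_free_alg)
  then have "P (uq_class f)"
  proof (induction f rule: poly_mapping_induct_on)
    case zero
    then show ?case using word[of "[]" 0] by simp
  next
    case (add f g)
    then have c: "f \<in> carrier free_alg" "g \<in> carrier free_alg" by (simp_all add: carrier_free_alg)
    then show ?case
      using assms(3)[OF uq_class_closed[OF c(1)] uq_class_closed[OF c(2)]] add by (simp add: Uq_alg_add)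
  qed (rule word)
  then show ?thesis using f by simp
qed

lemma scalar_algebra_Uq_alg: "scalar_algebra Uq_alg UNIV"
proof -
  interpret U: ring Uq_alg by (rule ring_Uq_alg)
  define s where "s r = uq_class (Poly_Mapping.single [] r)" for r
  have s: "s r \<in> carrier Uq_alg" for r
    unfolding s_def by (rule uq_class_closed[OF free_alg_single_closed]) simp
  have s_add: "s (r + t) = s r \<oplus>\<^bsub>Uq_alg\<^esub> s t" for r t
    unfolding s_def by (subst Uq_alg_add) (simp_all add: free_alg_single_closed single_add)
  have s_mult: "s (r * t) = s r \<otimes>\<^bsub>Uq_alg\<^esub> s t" for r t
    unfolding s_def by (subst Uq_alg_mult) (simp_all add: free_alg_single_closed free_alg_mult_word)
  have s_one: "s 1 = \<one>\<^bsub>Uq_alg\<^esub>" by (simp add: s_def Uq_alg_one)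
  \<comment> \<open>Scalars are represented by multiples of the empty word, which is neutral for
    concatenation; their classes are therefore central.\<close>
  have comm: "x \<otimes>\<^bsub>Uq_alg\<^esub> s r = s r \<otimes>\<^bsub>Uq_alg\<^esub> x" if "x \<in> carrier Uq_alg" for x r
    using that
  proof (induction rule: Uq_alg_induct_word)
    case (word w c)
    then show ?case unfolding s_def
      by (simp add: Uq_alg_mult free_alg_single_closed free_alg_mult_word mult.commute)
  qed (simp add: U.l_distr U.r_distr s)
  have sm: "module.smult Uq_alg = (\<lambda>r U. s r \<otimes>\<^bsub>Uq_alg\<^esub> U)"
    by (simp add: fun_eq_iff Uq_alg_smult s_def)
  show ?thesis
  proof unfold_locales
    fix r x y assume "x \<in> carrier Uq_alg" "y \<in> carrier Uq_alg"
    then show "x \<otimes>\<^bsub>Uq_alg\<^esub> (r \<odot>\<^bsub>Uq_alg\<^esub> y) = r \<odot>\<^bsub>Uq_alg\<^esub> (x \<otimes>\<^bsub>Uq_alg\<^esub> y)"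
      using comm[of x r] by (simp add: sm s flip: U.m_assoc)
  qed (simp_all add: sm s U.l_distr U.r_distr U.m_assoc s_add s_mult s_one)
qed

text \<open>The universal property in usable form. The coproduct, the counit, the antipode and the
  Fock action get all their algebraic laws from instances of it.\<close>

lemma uq_ext_hom_aux:
  assumes "quantum_gl1_rep B \<phi>"
  shows "uq_ext B \<phi> \<in> ring_hom Uq_alg B"
    and "U \<in> carrier Uq_alg \<Longrightarrow> uq_ext B \<phi> (r \<odot>\<^bsub>Uq_alg\<^esub> U) = r \<odot>\<^bsub>B\<^esub> uq_ext B \<phi> U"
    and "x \<in> gens \<Longrightarrow> uq_ext B \<phi> (ugen x) = \<phi> x"
    and "w \<in> lists gens \<Longrightarrow> uq_ext B \<phi> (uq_class (word w)) = foldr (\<lambda>x y. \<phi> x \<otimes>\<^bsub>B\<^esub> y) w \<one>\<^bsub>B\<^esub>"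
proof -
  interpret B: quantum_gl1_rep B \<phi> by fact
  interpret F: ring free_alg by (rule ring_free_alg)
  have plus: "f + g = f \<oplus>\<^bsub>free_alg\<^esub> g" for f g by (simp add: free_alg_def)
  show hom: "uq_ext B \<phi> \<in> ring_hom Uq_alg B"
  proof (rule ring_hom_memI)
    fix U V assume "U \<in> carrier Uq_alg" "V \<in> carrier Uq_alg"
    then obtain f g where fg: "U = uq_class f" "V = uq_class g" "f \<in> carrier free_alg" "g \<in> carrier free_alg"
      unfolding Uq_alg_carrier by blast
    show "uq_ext B \<phi> U \<in> carrier B"
      using fg by (simp add: B.uq_ext_class B.free_alg_ext_closed)
    show "uq_ext B \<phi> (U \<otimes>\<^bsub>Uq_alg\<^esub> V) = uq_ext B \<phi> U \<otimes>\<^bsub>B\<^esub> uq_ext B \<phi> V"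
      using fg by (simp add: B.uq_ext_class Uq_alg_mult ring_hom_mult[OF B.free_alg_ext_hom])
    show "uq_ext B \<phi> (U \<oplus>\<^bsub>Uq_alg\<^esub> V) = uq_ext B \<phi> U \<oplus>\<^bsub>B\<^esub> uq_ext B \<phi> V"
      using fg by (simp add: B.uq_ext_class Uq_alg_add plus ring_hom_add[OF B.free_alg_ext_hom])
  next
    show "uq_ext B \<phi> \<one>\<^bsub>Uq_alg\<^esub> = \<one>\<^bsub>B\<^esub>"
      by (simp add: Uq_alg_one B.uq_ext_class free_alg_single_closed B.free_alg_ext_word)
  qed
  show "uq_ext B \<phi> (r \<odot>\<^bsub>Uq_alg\<^esub> U) = r \<odot>\<^bsub>B\<^esub> uq_ext B \<phi> U" if "U \<in> carrier Uq_alg"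
    using that ring_hom_closed[OF hom that]
    by (simp add: Uq_alg_smult ring_hom_mult[OF hom] uq_class_closed free_alg_single_closed
        B.uq_ext_class B.free_alg_ext_word B.smult_mult_left)
  show "uq_ext B \<phi> (ugen x) = \<phi> x" if "x \<in> gens"
    using that by (simp add: ugen_def B.uq_ext_class free_alg_single_closed B.free_alg_ext_word B.phi_closed)
  show "uq_ext B \<phi> (uq_class (word w)) = foldr (\<lambda>x y. \<phi> x \<otimes>\<^bsub>B\<^esub> y) w \<one>\<^bsub>B\<^esub>" if "w \<in> lists gens"
    using that by (simp add: B.uq_ext_class free_alg_single_closed B.free_alg_ext_word)
qed

lemma Uq_alg_wd: "w \<in> lists gens \<Longrightarrow> uq_class (word w) = foldr (\<lambda>x y. ugen x \<otimes>\<^bsub>Uq_alg\<^esub> y) w \<one>\<^bsub>Uq_alg\<^esub>"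
proof (induction w)
  case (Cons x w)
  then have "ugen x \<otimes>\<^bsub>Uq_alg\<^esub> uq_class (word w) = uq_class (word (x # w))"
    unfolding ugen_def by (subst Uq_alg_mult) (simp_all add: free_alg_single_closed free_alg_mult_word)
  then show ?case using Cons by simp
qed (simp add: Uq_alg_one)

lemma uq_class_eqI:
  assumes "f - g \<in> gl1_relators" "f \<in> carrier free_alg" "g \<in> carrier free_alg"
  shows "uq_class f = uq_class g"
proof -
  interpret F: ring free_alg by (rule ring_free_alg)
  have "f \<ominus>\<^bsub>free_alg\<^esub> g = f - g"
    using assms(2,3) by (simp add: a_minus_def free_alg_def monoid.monoid_ring_a_inv[OF monoid_free_mon])
  then show ?thesis
    unfolding uq_class_def
    using F.quotient_eq_iff_same_a_r_cos[OF ideal_gl1 assms(2,3)] assms(1)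
      F.genideal_self[OF gl1_relators_closed] by auto
qed

text \<open>Taking the generators themselves as values turns the relators, which are elements of an
  ideal, into equations for computing in the algebra.\<close>

lemma quantum_gl1_rep_Uq_alg: "quantum_gl1_rep Uq_alg ugen"
proof -
  interpret U: scalar_algebra Uq_alg UNIV by (rule scalar_algebra_Uq_alg)
  note cl = free_alg_single_closed free_alg_diff_closed
  have w2: "ugen x \<otimes>\<^bsub>Uq_alg\<^esub> ugen y = uq_class (word [x, y])" if "x \<in> gens" "y \<in> gens" for x y
    unfolding ugen_def using that by (subst Uq_alg_mult) (simp_all add: cl free_alg_mult_word)
  show ?thesis
  proof unfold_locales
    show "ugen x \<in> carrier Uq_alg" if "x \<in> gens" for x
      unfolding ugen_def using that by (simp add: uq_class_closed cl)
    show "ugen x \<otimes>\<^bsub>Uq_alg\<^esub> ugen y = \<one>\<^bsub>Uq_alg\<^esub>"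
      if "(x, y) \<in> {(GenLam, GenLam'), (GenLam', GenLam), (GenGam, GenGam'), (GenGam', GenGam),
                (GenK, GenK'), (GenK', GenK)}" for x y
    proof -
      have g: "x \<in> gens" "y \<in> gens" using that by auto
      have "uq_class (word [x, y]) = uq_class (word [])"
        by (rule uq_class_eqI) (use that g in \<open>auto simp: gl1_relators_def cl\<close>)
      then show ?thesis using g by (simp add: w2 Uq_alg_one)
    qed
    show "ugen x \<otimes>\<^bsub>Uq_alg\<^esub> ugen y = ugen y \<otimes>\<^bsub>Uq_alg\<^esub> ugen x"
      if x: "x \<in> {GenGam, GenGam', GenK, GenK'}" and y: "y \<in> gens" for x y
    proof -
      have g: "x \<in> gens" using that by auto
      have "word [x, y] - word [y, x] \<in> gl1_relators"
        unfolding gl1_relators_def using x y by blast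
      then have "uq_class (word [x, y]) = uq_class (word [y, x])"
        by (rule uq_class_eqI) (use that g in \<open>auto simp: cl\<close>)
      then show ?thesis using g y by (simp add: w2)
    qed
    show "ugen (GenH m) \<otimes>\<^bsub>Uq_alg\<^esub> ugen GenLam = (qq powi (2 * m)) \<odot>\<^bsub>Uq_alg\<^esub> (ugen GenLam \<otimes>\<^bsub>Uq_alg\<^esub> ugen (GenH m))"
      if m: "m \<noteq> 0" for m
    proof -
      have "word [GenH m, GenLam] - Poly_Mapping.single [GenLam, GenH m] (qq powi (2 * m)) \<in> gl1_relators"
        unfolding gl1_relators_def using m by blast
      then have "uq_class (word [GenH m, GenLam]) = uq_class (Poly_Mapping.single [GenLam, GenH m] (qq powi (2 * m)))"
        by (rule uq_class_eqI) (use m in \<open>auto simp: cl\<close>)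
      then show ?thesis using m by (simp add: w2 Uq_alg_smult_word)
    qed
    show "ugen (GenH m) \<otimes>\<^bsub>Uq_alg\<^esub> ugen (GenH (- m')) = ugen (GenH (- m')) \<otimes>\<^bsub>Uq_alg\<^esub> ugen (GenH m) \<oplus>\<^bsub>Uq_alg\<^esub>
        (if m = m' then heis_const m \<odot>\<^bsub>Uq_alg\<^esub>
          (foldr (\<lambda>x y. ugen x \<otimes>\<^bsub>Uq_alg\<^esub> y) (gam_pow (2 * m)) \<one>\<^bsub>Uq_alg\<^esub> \<ominus>\<^bsub>Uq_alg\<^esub>
           foldr (\<lambda>x y. ugen x \<otimes>\<^bsub>Uq_alg\<^esub> y) (gam_pow (- (2 * m))) \<one>\<^bsub>Uq_alg\<^esub>) else \<zero>\<^bsub>Uq_alg\<^esub>)"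
      if m: "m \<noteq> 0" "m' \<noteq> 0" for m m'
    proof -
      \<comment> \<open>Collecting the central term in \<open>D\<close> brings the relator into the
        form of one word minus a sum, as required for equating two classes.\<close>
      define D where "D = (if m = m' then Poly_Mapping.single (gam_pow (2 * m)) (heis_const m) -
          Poly_Mapping.single (gam_pow (- (2 * m))) (heis_const m) else 0)"
      have D: "D \<in> carrier free_alg" unfolding D_def by (simp add: cl free_alg_zero_closed)
      have "word [GenH m, GenH (- m')] - word [GenH (- m'), GenH m] - D =
          word [GenH m, GenH (- m')] - word [GenH (- m'), GenH m] -
      (if m = m' then let c = 1 / of_int m * qint m / (qq - inverse qq)
            in Poly_Mapping.single (gam_pow (2 * m)) c - Poly_Mapping.single (gam_pow (- 2 * m)) c
       else 0)" by (simp add: D_def heis_const_def Let_def)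
      then have "word [GenH m, GenH (- m')] - word [GenH (- m'), GenH m] - D \<in> gl1_relators"
        unfolding gl1_relators_def using m by blast
      then have "word [GenH m, GenH (- m')] - (word [GenH (- m'), GenH m] + D) \<in> gl1_relators"
        by (simp add: diff_diff_eq)
      then have "uq_class (word [GenH m, GenH (- m')]) = uq_class (word [GenH (- m'), GenH m] + D)"
        by (rule uq_class_eqI) (use m D in \<open>simp_all add: carrier_free_alg keys_add_subset\<close>)
      also have "\<dots> = uq_class (word [GenH (- m'), GenH m]) \<oplus>\<^bsub>Uq_alg\<^esub> uq_class D"
        using m D by (subst Uq_alg_add) (simp_all add: cl)
      also have "uq_class D = (if m = m' then heis_const m \<odot>\<^bsub>Uq_alg\<^esub>
          (uq_class (word (gam_pow (2 * m))) \<ominus>\<^bsub>Uq_alg\<^esub> uq_class (word (gam_pow (- (2 * m))))) else \<zero>\<^bsub>Uq_alg\<^esub>)"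
      proof (cases "m = m'")
        case True
        have "uq_class D \<oplus>\<^bsub>Uq_alg\<^esub> uq_class (Poly_Mapping.single (gam_pow (- (2 * m))) (heis_const m)) =
            uq_class (Poly_Mapping.single (gam_pow (2 * m)) (heis_const m))"
          using D by (subst Uq_alg_add) (simp_all add: cl D_def True)
        then have "uq_class D = uq_class (Poly_Mapping.single (gam_pow (2 * m)) (heis_const m)) \<ominus>\<^bsub>Uq_alg\<^esub>
            uq_class (Poly_Mapping.single (gam_pow (- (2 * m))) (heis_const m))"
          using D uq_class_closed[OF D] uq_class_closed[OF cl(1)[OF gam_pow_in_lists]]
          by (metis U.add.inv_solve_right a_minus_def)
        then show ?thesis using True
          by (simp add: U.smult_minus_right uq_class_closed cl Uq_alg_smult_word)
      next
        case False
        then show ?thesis by (simp add: D_def Uq_alg_zero)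
      qed
      finally show ?thesis using m by (simp add: w2 flip: Uq_alg_wd)
    qed
  qed
qed

lemma Uq_simps [simp]:
  "carrier Uq = carrier Uq_alg" "monoid.mult Uq = monoid.mult Uq_alg" "one Uq = one Uq_alg"
  "ring.zero Uq = ring.zero Uq_alg" "add Uq = add Uq_alg" "module.smult Uq = module.smult Uq_alg"
  "comult Uq = uq_ext Uq_tensor comult_gen" "counit Uq = uq_ext Cq_alg counit_gen"
  "antipode Uq = uq_ext (Uq_alg\<lparr>monoid.mult := (\<lambda>x y. y \<otimes>\<^bsub>Uq_alg\<^esub> x)\<rparr>) antipode_gen"
  by (simp_all add: Uq_def add_hopf_def)

lemma Uq_inv_simps [simp]: "a_inv Uq = a_inv Uq_alg" "a_minus Uq = a_minus Uq_alg"
  using a_inv_transfer[of Uq Uq_alg] by simp_all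

lemma Uq_tensor_simps [simp]:
  "tensor_class ring_Cq Uq Uq = tensor_class ring_Cq Uq_alg Uq_alg" "pure_tensor ring_Cq Uq Uq = uq_pure"
  "tensor ring_Cq Uq Uq = Uq_tensor" "tensor_map ring_Cq Uq Uq = tensor_map ring_Cq Uq_alg Uq_alg"
  by (rule tensor_transfer; simp)+

interpretation UU: quantum_gl1_rep Uq_alg ugen
  by (rule quantum_gl1_rep_Uq_alg)

abbreviation gam :: "int \<Rightarrow> uq" where
  "gam n \<equiv> uq_class (word (gam_pow n))"

lemma gam_eq: "UU.gp n = gam n"
  by (simp add: Uq_alg_wd)

lemma gam_closed [simp]: "gam n \<in> carrier Uq_alg"
  by (simp flip: gam_eq)

lemma gam_add: "gam (m + n) = gam m \<otimes>\<^bsub>Uq_alg\<^esub> gam n"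
  using UU.gp_add[of m n] by (simp only: gam_eq)

lemma gam_commute: "y \<in> gens \<Longrightarrow> gam n \<otimes>\<^bsub>Uq_alg\<^esub> ugen y = ugen y \<otimes>\<^bsub>Uq_alg\<^esub> gam n"
  using UU.gp_commute[of y n] by (simp only: gam_eq)

lemma gam_gam_commute: "gam m \<otimes>\<^bsub>Uq_alg\<^esub> gam n = gam n \<otimes>\<^bsub>Uq_alg\<^esub> gam m"
  by (metis gam_add add.commute)

lemma ugen_heis:
  assumes "m \<noteq> 0" "m' \<noteq> 0"
  shows "ugen (GenH m) \<otimes>\<^bsub>Uq_alg\<^esub> ugen (GenH (- m')) = ugen (GenH (- m')) \<otimes>\<^bsub>Uq_alg\<^esub> ugen (GenH m) \<oplus>\<^bsub>Uq_alg\<^esub>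
    (if m = m' then heis_const m \<odot>\<^bsub>Uq_alg\<^esub> (gam (2 * m) \<ominus>\<^bsub>Uq_alg\<^esub> gam (- (2 * m))) else \<zero>\<^bsub>Uq_alg\<^esub>)"
  using UU.phi_heis[OF assms] by (simp only: gam_eq)

section \<open>The Hopf structure on the generators\<close>

interpretation TT: algebra_pair Uq_alg Uq_alg UNIV ring_Cq
  by unfold_locales simp

interpretation TTS: scalar_algebra Uq_tensor UNIV
  by (rule TT.scalar_algebra_T)

lemma (in algebra_pair) pure_minus_left:
  "x \<in> carrier M \<Longrightarrow> x' \<in> carrier M \<Longrightarrow> y \<in> carrier N \<Longrightarrow> pure (x \<ominus>\<^bsub>M\<^esub> x') y = pure x y \<ominus>\<^bsub>T\<^esub> pure x' y"
  by (simp add: a_minus_def pure_add_left pure_uminus_left)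

lemma (in algebra_pair) pure_uminus_right: "x \<in> carrier M \<Longrightarrow> y \<in> carrier N \<Longrightarrow> pure x (\<ominus>\<^bsub>N\<^esub> y) = \<ominus>\<^bsub>T\<^esub> pure x y"
  using pure_add_right[of x "\<ominus>\<^bsub>N\<^esub> y" y] by (simp add: N.l_neg pure_zero_right T.minus_equality)

lemma (in algebra_pair) pure_minus_right:
  "x \<in> carrier M \<Longrightarrow> y \<in> carrier N \<Longrightarrow> y' \<in> carrier N \<Longrightarrow> pure x (y \<ominus>\<^bsub>N\<^esub> y') = pure x y \<ominus>\<^bsub>T\<^esub> pure x y'"
  by (simp add: a_minus_def pure_add_right pure_uminus_right)

lemma (in algebra_pair) pure_smult_right:
  "r \<in> A \<Longrightarrow> x \<in> carrier M \<Longrightarrow> y \<in> carrier N \<Longrightarrow> pure x (r \<odot>\<^bsub>N\<^esub> y) = r \<odot>\<^bsub>T\<^esub> pure x y"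
  by (simp add: pure_smult pure_balanced)

text \<open>The two telescoping patterns needed for the coproduct of the Heisenberg relation: the
  first occurs for positive, the second for negative index.\<close>

lemma (in abelian_group) minus_minus_swap:
  "x \<in> carrier G \<Longrightarrow> y \<in> carrier G \<Longrightarrow> z \<in> carrier G \<Longrightarrow> (x \<ominus> y) \<oplus> (z \<ominus> x) = z \<ominus> y"
  "x \<in> carrier G \<Longrightarrow> y \<in> carrier G \<Longrightarrow> z \<in> carrier G \<Longrightarrow> (x \<ominus> y) \<oplus> (y \<ominus> z) = x \<ominus> z"
  by (simp_all add: a_minus_def a_ac r_neg1 r_neg2)

lemma set_gam_pow: "set (gam_pow n) \<subseteq> {GenGam, GenGam'}"
  by (auto simp: gam_pow_def)

lemma comult_gam:
  "foldr (\<lambda>x y. comult_gen x \<otimes>\<^bsub>Uq_tensor\<^esub> y) (gam_pow n) \<one>\<^bsub>Uq_tensor\<^esub> = uq_pure (gam n) (gam n)"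
proof -
  have "foldr (\<lambda>x y. comult_gen x \<otimes>\<^bsub>Uq_tensor\<^esub> y) w \<one>\<^bsub>Uq_tensor\<^esub> = uq_pure (UU.wd w) (UU.wd w) \<and> UU.wd w \<in> carrier Uq_alg"
    if "set w \<subseteq> {GenGam, GenGam'}" for w
    using that by (induction w) (auto simp: TT.T_one TT.pure_mult UU.phi_closed)
  from this[OF set_gam_pow] show ?thesis by (simp add: gam_eq)
qed

text \<open>In the commutator of the two coproducts the mixed terms cancel, since powers of \<Gamma>
  are central. What remains is d \<otimes> \<Gamma>^(-2|m|) + \<Gamma>^(2|m|) \<otimes> d, where d
  is a multiple of \<Gamma>^2m - \<Gamma>^-2m. One pure tensor occurs with both signs, and the rest
  is the required difference of squares of group-like elements.\<close>

lemma comult_heis: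
  assumes m: "m \<noteq> 0" "m' \<noteq> 0"
  shows "comult_gen (GenH m) \<otimes>\<^bsub>Uq_tensor\<^esub> comult_gen (GenH (- m')) =
    comult_gen (GenH (- m')) \<otimes>\<^bsub>Uq_tensor\<^esub> comult_gen (GenH m) \<oplus>\<^bsub>Uq_tensor\<^esub>
    (if m = m' then heis_const m \<odot>\<^bsub>Uq_tensor\<^esub> (uq_pure (gam (2 * m)) (gam (2 * m)) \<ominus>\<^bsub>Uq_tensor\<^esub>
       uq_pure (gam (- (2 * m))) (gam (- (2 * m)))) else \<zero>\<^bsub>Uq_tensor\<^esub>)"
proof -
  define a b g g' k k' where "a = ugen (GenH m)" and "b = ugen (GenH (- m'))"
    and "g = gam \<bar>m\<bar>" and "g' = gam (- \<bar>m\<bar>)" and "k = gam \<bar>m'\<bar>" and "k' = gam (- \<bar>m'\<bar>)"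
  define d where "d = (if m = m' then heis_const m \<odot>\<^bsub>Uq_alg\<^esub> (gam (2 * m) \<ominus>\<^bsub>Uq_alg\<^esub> gam (- (2 * m))) else \<zero>\<^bsub>Uq_alg\<^esub>)"
  note defs = a_def b_def g_def g'_def k_def k'_def
  have c: "a \<in> carrier Uq_alg" "b \<in> carrier Uq_alg" "g \<in> carrier Uq_alg" "g' \<in> carrier Uq_alg"
    "k \<in> carrier Uq_alg" "k' \<in> carrier Uq_alg" "d \<in> carrier Uq_alg"
    using m by (simp_all add: defs d_def UU.phi_closed)
  have ab: "a \<otimes>\<^bsub>Uq_alg\<^esub> b = b \<otimes>\<^bsub>Uq_alg\<^esub> a \<oplus>\<^bsub>Uq_alg\<^esub> d"
    unfolding a_def b_def d_def by (rule ugen_heis[OF m])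
  have comm: "g \<otimes>\<^bsub>Uq_alg\<^esub> b = b \<otimes>\<^bsub>Uq_alg\<^esub> g" "g' \<otimes>\<^bsub>Uq_alg\<^esub> b = b \<otimes>\<^bsub>Uq_alg\<^esub> g'"
    "k \<otimes>\<^bsub>Uq_alg\<^esub> a = a \<otimes>\<^bsub>Uq_alg\<^esub> k" "k' \<otimes>\<^bsub>Uq_alg\<^esub> a = a \<otimes>\<^bsub>Uq_alg\<^esub> k'"
    "k' \<otimes>\<^bsub>Uq_alg\<^esub> g' = g' \<otimes>\<^bsub>Uq_alg\<^esub> k'" "k \<otimes>\<^bsub>Uq_alg\<^esub> g = g \<otimes>\<^bsub>Uq_alg\<^esub> k"
    using m by (simp_all add: defs gam_commute gam_gam_commute)
  have X: "comult_gen (GenH m) = uq_pure a g' \<oplus>\<^bsub>Uq_tensor\<^esub> uq_pure g a"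
    "comult_gen (GenH (- m')) = uq_pure b k' \<oplus>\<^bsub>Uq_tensor\<^esub> uq_pure k b"
    by (simp_all add: defs)
  have D: "uq_pure d (g' \<otimes>\<^bsub>Uq_alg\<^esub> k') \<oplus>\<^bsub>Uq_tensor\<^esub> uq_pure (g \<otimes>\<^bsub>Uq_alg\<^esub> k) d =
    (if m = m' then heis_const m \<odot>\<^bsub>Uq_tensor\<^esub> (uq_pure (gam (2 * m)) (gam (2 * m)) \<ominus>\<^bsub>Uq_tensor\<^esub>
       uq_pure (gam (- (2 * m))) (gam (- (2 * m)))) else \<zero>\<^bsub>Uq_tensor\<^esub>)"
  proof (cases "m = m'")
    case True
    have gg: "g \<otimes>\<^bsub>Uq_alg\<^esub> k = gam (2 * \<bar>m\<bar>)" "g' \<otimes>\<^bsub>Uq_alg\<^esub> k' = gam (- (2 * \<bar>m\<bar>))"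
      by (simp_all add: defs True flip: gam_add)
    have "uq_pure d (g' \<otimes>\<^bsub>Uq_alg\<^esub> k') \<oplus>\<^bsub>Uq_tensor\<^esub> uq_pure (g \<otimes>\<^bsub>Uq_alg\<^esub> k) d =
      heis_const m \<odot>\<^bsub>Uq_tensor\<^esub> ((uq_pure (gam (2 * m)) (gam (- (2 * \<bar>m\<bar>))) \<ominus>\<^bsub>Uq_tensor\<^esub>
        uq_pure (gam (- (2 * m))) (gam (- (2 * \<bar>m\<bar>)))) \<oplus>\<^bsub>Uq_tensor\<^esub>
       (uq_pure (gam (2 * \<bar>m\<bar>)) (gam (2 * m)) \<ominus>\<^bsub>Uq_tensor\<^esub> uq_pure (gam (2 * \<bar>m\<bar>)) (gam (- (2 * m)))))"
      unfolding gg d_def if_P[OF True]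
      by (simp add: TT.pure_minus_left TT.pure_minus_right TT.pure_smult_right TTS.smult_r_distr
          flip: TT.pure_smult)
    also have "\<dots> = heis_const m \<odot>\<^bsub>Uq_tensor\<^esub> (uq_pure (gam (2 * m)) (gam (2 * m)) \<ominus>\<^bsub>Uq_tensor\<^esub>
       uq_pure (gam (- (2 * m))) (gam (- (2 * m))))"
      by (cases "m > 0") (simp_all add: TT.T.minus_minus_swap)
    finally show ?thesis using True by simp
  next
    case False
    then show ?thesis using c by (simp add: d_def TT.pure_zero_left TT.pure_zero_right)
  qed
  have "comult_gen (GenH m) \<otimes>\<^bsub>Uq_tensor\<^esub> comult_gen (GenH (- m')) =
    comult_gen (GenH (- m')) \<otimes>\<^bsub>Uq_tensor\<^esub> comult_gen (GenH m) \<oplus>\<^bsub>Uq_tensor\<^esub>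
    (uq_pure d (g' \<otimes>\<^bsub>Uq_alg\<^esub> k') \<oplus>\<^bsub>Uq_tensor\<^esub> uq_pure (g \<otimes>\<^bsub>Uq_alg\<^esub> k) d)"
    unfolding X using c
    by (simp add: TT.T.l_distr TT.T.r_distr TT.pure_mult ab comm TT.pure_add_left TT.pure_add_right TT.T.a_ac)
  then show ?thesis unfolding D .
qed

lemma quantum_gl1_rep_comult: "quantum_gl1_rep Uq_tensor comult_gen"
proof unfold_locales
  have cg: "comult_gen x = uq_pure (ugen x) (ugen x)" if "x \<notin> range GenH" for x
    using that by (cases x) auto
  show "comult_gen x \<in> carrier Uq_tensor" if "x \<in> gens" for x
    using that by (cases x) (auto simp: UU.phi_closed)
  show "comult_gen x \<otimes>\<^bsub>Uq_tensor\<^esub> comult_gen y = \<one>\<^bsub>Uq_tensor\<^esub>"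
    if "(x, y) \<in> {(GenLam, GenLam'), (GenLam', GenLam), (GenGam, GenGam'), (GenGam', GenGam),
                (GenK, GenK'), (GenK', GenK)}" for x y
  proof -
    have "x \<in> gens" "y \<in> gens" "x \<notin> range GenH" "y \<notin> range GenH" using that by auto
    then show ?thesis
      using UU.phi_inverse[OF that] by (simp add: cg TT.pure_mult UU.phi_closed TT.T_one)
  qed
  show "comult_gen x \<otimes>\<^bsub>Uq_tensor\<^esub> comult_gen y = comult_gen y \<otimes>\<^bsub>Uq_tensor\<^esub> comult_gen x"
    if x: "x \<in> {GenGam, GenGam', GenK, GenK'}" and y: "y \<in> gens" for x y
  proof -
    have x': "x \<in> gens" "x \<notin> range GenH" using x by auto
    note comm = UU.phi_central[OF x y]
    have gc: "gam n \<otimes>\<^bsub>Uq_alg\<^esub> ugen x = ugen x \<otimes>\<^bsub>Uq_alg\<^esub> gam n" for n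
      by (rule gam_commute[OF x'(1)])
    show ?thesis
    proof (cases "y \<in> range GenH")
      case True
      then obtain m where "y = GenH m" by blast
      then show ?thesis
        using x' y comm by (simp add: cg TT.pure_mult UU.phi_closed TT.T.l_distr TT.T.r_distr gc)
    next
      case False
      then show ?thesis using x' y comm by (simp add: cg TT.pure_mult UU.phi_closed)
    qed
  qed
  show "comult_gen (GenH m) \<otimes>\<^bsub>Uq_tensor\<^esub> comult_gen GenLam =
      (qq powi (2 * m)) \<odot>\<^bsub>Uq_tensor\<^esub> (comult_gen GenLam \<otimes>\<^bsub>Uq_tensor\<^esub> comult_gen (GenH m))" if m: "m \<noteq> 0" for m
  proof -
    have "GenH m \<in> gens" using m by simp
    then show ?thesis
      using UU.phi_lam[OF m] gam_commute[of GenLam]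
      by (simp add: TT.pure_mult UU.phi_closed TT.T.l_distr TT.T.r_distr TTS.smult_r_distr
          TT.pure_smult_right flip: TT.pure_smult)
  qed
  show "comult_gen (GenH m) \<otimes>\<^bsub>Uq_tensor\<^esub> comult_gen (GenH (- m')) =
    comult_gen (GenH (- m')) \<otimes>\<^bsub>Uq_tensor\<^esub> comult_gen (GenH m) \<oplus>\<^bsub>Uq_tensor\<^esub>
    (if m = m' then heis_const m \<odot>\<^bsub>Uq_tensor\<^esub>
       (foldr (\<lambda>x y. comult_gen x \<otimes>\<^bsub>Uq_tensor\<^esub> y) (gam_pow (2 * m)) \<one>\<^bsub>Uq_tensor\<^esub> \<ominus>\<^bsub>Uq_tensor\<^esub>
        foldr (\<lambda>x y. comult_gen x \<otimes>\<^bsub>Uq_tensor\<^esub> y) (gam_pow (- (2 * m))) \<one>\<^bsub>Uq_tensor\<^esub>) else \<zero>\<^bsub>Uq_tensor\<^esub>)"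
    if "m \<noteq> 0" "m' \<noteq> 0" for m m'
    unfolding comult_gam by (rule comult_heis[OF that])
qed

lemma scalar_algebra_Cq_alg: "scalar_algebra Cq_alg UNIV"
proof -
  have "ring Cq_alg"
    by (rule ring_transfer[OF comm_ring_1_class.ring_from_type_algebra])
      (simp_all add: Cq_alg_def ring_of_type_algebra_def)
  then show ?thesis
    by (intro scalar_algebra.intro scalar_algebra_axioms.intro) (simp_all add: Cq_alg_def algebra_simps)
qed

lemma Cq_alg_simps [simp]: "carrier Cq_alg = UNIV" "monoid.mult Cq_alg = (*)" "one Cq_alg = 1"
  "ring.zero Cq_alg = 0" "add Cq_alg = (+)" "module.smult Cq_alg = (*)"
  by (simp_all add: Cq_alg_def)

text \<open>Powers of \<Gamma> have counit 1, so the central term of the Heisenberg relation goes to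
  zero, while all letters \<open>GenH m\<close> go to zero themselves.\<close>

lemma quantum_gl1_rep_counit: "quantum_gl1_rep Cq_alg counit_gen"
proof -
  interpret C: scalar_algebra Cq_alg UNIV by (rule scalar_algebra_Cq_alg)
  have gp: "foldr (\<lambda>x y. counit_gen x * y) (gam_pow n) 1 = 1" for n
  proof -
    have "foldr (\<lambda>x y. counit_gen x * y) w 1 = 1" if "set w \<subseteq> {GenGam, GenGam'}" for w
      using that by (induction w) auto
    from this[OF set_gam_pow] show ?thesis .
  qed
  show ?thesis
  proof unfold_locales
    show "counit_gen x \<otimes>\<^bsub>Cq_alg\<^esub> counit_gen y = \<one>\<^bsub>Cq_alg\<^esub>"
      if "(x, y) \<in> {(GenLam, GenLam'), (GenLam', GenLam), (GenGam, GenGam'), (GenGam', GenGam),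
                (GenK, GenK'), (GenK', GenK)}" for x y
      using that by auto
    show "counit_gen (GenH m) \<otimes>\<^bsub>Cq_alg\<^esub> counit_gen (GenH (- m')) =
      counit_gen (GenH (- m')) \<otimes>\<^bsub>Cq_alg\<^esub> counit_gen (GenH m) \<oplus>\<^bsub>Cq_alg\<^esub>
      (if m = m' then heis_const m \<odot>\<^bsub>Cq_alg\<^esub> (foldr (\<lambda>x y. counit_gen x \<otimes>\<^bsub>Cq_alg\<^esub> y) (gam_pow (2 * m)) \<one>\<^bsub>Cq_alg\<^esub>
       \<ominus>\<^bsub>Cq_alg\<^esub> foldr (\<lambda>x y. counit_gen x \<otimes>\<^bsub>Cq_alg\<^esub> y) (gam_pow (- (2 * m))) \<one>\<^bsub>Cq_alg\<^esub>) else \<zero>\<^bsub>Cq_alg\<^esub>)" for m m'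
      using C.r_neg[of 1] by (simp add: gp a_minus_def)
  qed (simp_all add: mult.commute)
qed

abbreviation Uq_op :: "(ratfun, uq) module" where
  "Uq_op \<equiv> Uq_alg\<lparr>monoid.mult := (\<lambda>x y. y \<otimes>\<^bsub>Uq_alg\<^esub> x)\<rparr>"

lemma scalar_algebra_Uq_op: "scalar_algebra Uq_op UNIV"
proof -
  have "ring Uq_op"
  proof (rule ringI)
    show "abelian_group Uq_op"
      by (rule abelian_groupI) (auto simp: UU.a_ac intro: bexI[of _ "a_inv Uq_alg _"] UU.l_neg)
    show "Group.monoid Uq_op" by (rule monoidI) (simp_all add: UU.m_assoc)
  qed (simp_all add: UU.l_distr UU.r_distr)
  then show ?thesis
    by (intro scalar_algebra.intro scalar_algebra_axioms.intro)
      (simp_all add: UU.smult_l_distr UU.smult_r_distr UU.smult_assoc1 UU.smult_mult_left UU.smult_mult_right)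
qed

lemma antipode_gam: "foldr (\<lambda>x y. antipode_gen x \<otimes>\<^bsub>Uq_op\<^esub> y) (gam_pow n) \<one>\<^bsub>Uq_op\<^esub> = gam (- n)"
proof -
  have 1: "foldr (\<lambda>x y. antipode_gen x \<otimes>\<^bsub>Uq_op\<^esub> y) (replicate k GenGam) \<one>\<^bsub>Uq_op\<^esub> = gam (- int k)" for k
  proof (induction k)
    case (Suc k)
    have "gam (- int (Suc k)) = ugen GenGam' \<otimes>\<^bsub>Uq_alg\<^esub> gam (- int k)"
    proof -
      have "- int (Suc k) = - int k - 1" by simp
      then show ?thesis using UU.gam_pow_pred[of "- int k"] by (simp only: gam_eq)
    qed
    then show ?case using Suc gam_commute[of GenGam'] by simp
  qed (simp flip: gam_eq)
  have 2: "foldr (\<lambda>x y. antipode_gen x \<otimes>\<^bsub>Uq_op\<^esub> y) (replicate k GenGam') \<one>\<^bsub>Uq_op\<^esub> = gam (int k)" for k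
  proof (induction k)
    case (Suc k)
    have "gam (int (Suc k)) = ugen GenGam \<otimes>\<^bsub>Uq_alg\<^esub> gam (int k)"
    proof -
      have "int (Suc k) = int k + 1" by simp
      then show ?thesis using UU.gam_pow_Suc[of "int k"] by (simp only: gam_eq)
    qed
    then show ?case using Suc gam_commute[of GenGam] by simp
  qed (simp flip: gam_eq)
  show ?thesis
    using 1[of "nat n"] 2[of "nat (- n)"] by (simp add: gam_pow_def)
qed

text \<open>Passing to the opposite product reverses the sign of a commutator, and replacing
  \<Gamma> by its inverse reverses the sign of the central term; the two signs that the letters h
  receive cancel each other in the product.\<close>

lemma quantum_gl1_rep_antipode: "quantum_gl1_rep Uq_op antipode_gen"
proof -
  interpret C: scalar_algebra Uq_op UNIV by (rule scalar_algebra_Uq_op)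
  have m: "a_inv Uq_op = a_inv Uq_alg" "a_minus Uq_op = a_minus Uq_alg"
    using a_inv_transfer[of Uq_op Uq_alg] by simp_all
  show ?thesis
  proof unfold_locales
    show "antipode_gen x \<in> carrier Uq_op" if "x \<in> gens" for x
      using that by (cases x) (auto simp: UU.phi_closed)
    show "antipode_gen x \<otimes>\<^bsub>Uq_op\<^esub> antipode_gen y = \<one>\<^bsub>Uq_op\<^esub>"
      if "(x, y) \<in> {(GenLam, GenLam'), (GenLam', GenLam), (GenGam, GenGam'), (GenGam', GenGam),
                (GenK, GenK'), (GenK', GenK)}" for x y
      using that by (auto simp: UU.phi_inverse)
    show "antipode_gen x \<otimes>\<^bsub>Uq_op\<^esub> antipode_gen y = antipode_gen y \<otimes>\<^bsub>Uq_op\<^esub> antipode_gen x"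
      if x: "x \<in> {GenGam, GenGam', GenK, GenK'}" and y: "y \<in> gens" for x y
    proof -
      obtain x' where x': "antipode_gen x = ugen x'" "x' \<in> {GenGam, GenGam', GenK, GenK'}" "x' \<in> gens"
        using x by auto
      show ?thesis
        using x'(1,3) y UU.phi_central[OF x'(2)]
        by (cases y) (auto simp: UU.phi_closed UU.l_minus UU.r_minus)
    qed
    show "antipode_gen (GenH m) \<otimes>\<^bsub>Uq_op\<^esub> antipode_gen GenLam =
      (qq powi (2 * m)) \<odot>\<^bsub>Uq_op\<^esub> (antipode_gen GenLam \<otimes>\<^bsub>Uq_op\<^esub> antipode_gen (GenH m))" if "m \<noteq> 0" for m
    proof -
      let ?h = "ugen (GenH m)" and ?x = "ugen GenLam" and ?y = "ugen GenLam'"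
      have c: "?h \<in> carrier Uq_alg" "?x \<in> carrier Uq_alg" "?y \<in> carrier Uq_alg"
        using that by (simp_all add: UU.phi_closed)
      have i: "?x \<otimes>\<^bsub>Uq_alg\<^esub> ?y = \<one>\<^bsub>Uq_alg\<^esub>" "?y \<otimes>\<^bsub>Uq_alg\<^esub> ?x = \<one>\<^bsub>Uq_alg\<^esub>"
        by (simp_all add: UU.phi_inverse)
      \<comment> \<open>Multiplying the exchange rule for h and \<Lambda> by the inverse of
        \<Lambda> on both sides gives the rule for the inverse letter.\<close>
      have "?y \<otimes>\<^bsub>Uq_alg\<^esub> ?h = ?y \<otimes>\<^bsub>Uq_alg\<^esub> (?h \<otimes>\<^bsub>Uq_alg\<^esub> ?x) \<otimes>\<^bsub>Uq_alg\<^esub> ?y"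
        using c i(1) by (simp add: UU.m_assoc)
      also have "\<dots> = (qq powi (2 * m)) \<odot>\<^bsub>Uq_alg\<^esub> (?y \<otimes>\<^bsub>Uq_alg\<^esub> (?x \<otimes>\<^bsub>Uq_alg\<^esub> ?h) \<otimes>\<^bsub>Uq_alg\<^esub> ?y)"
        using c UU.phi_lam[OF that] by (simp add: UU.smult_mult_left UU.smult_mult_right)
      also have "?y \<otimes>\<^bsub>Uq_alg\<^esub> (?x \<otimes>\<^bsub>Uq_alg\<^esub> ?h) = ?h"
        using c i by (simp flip: UU.m_assoc)
      finally show ?thesis
        using c by (simp add: UU.l_minus UU.r_minus UU.smult_uminus_right)
    qed
    show "antipode_gen (GenH m) \<otimes>\<^bsub>Uq_op\<^esub> antipode_gen (GenH (- m')) =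
      antipode_gen (GenH (- m')) \<otimes>\<^bsub>Uq_op\<^esub> antipode_gen (GenH m) \<oplus>\<^bsub>Uq_op\<^esub>
      (if m = m' then heis_const m \<odot>\<^bsub>Uq_op\<^esub> (foldr (\<lambda>x y. antipode_gen x \<otimes>\<^bsub>Uq_op\<^esub> y) (gam_pow (2 * m)) \<one>\<^bsub>Uq_op\<^esub>
       \<ominus>\<^bsub>Uq_op\<^esub> foldr (\<lambda>x y. antipode_gen x \<otimes>\<^bsub>Uq_op\<^esub> y) (gam_pow (- (2 * m))) \<one>\<^bsub>Uq_op\<^esub>) else \<zero>\<^bsub>Uq_op\<^esub>)"
      if mm: "m \<noteq> 0" "m' \<noteq> 0" for m m'
    proof -
      let ?a = "ugen (GenH m)" and ?b = "ugen (GenH (- m'))"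
      define D where "D x y = (if m = m' then heis_const m \<odot>\<^bsub>Uq_alg\<^esub> (gam x \<ominus>\<^bsub>Uq_alg\<^esub> gam y) else \<zero>\<^bsub>Uq_alg\<^esub>)" for x y
      have c: "?a \<in> carrier Uq_alg" "?b \<in> carrier Uq_alg" "D x y \<in> carrier Uq_alg" for x y
        using mm by (simp_all add: UU.phi_closed D_def)
      have "D (2 * m) (- (2 * m)) \<oplus>\<^bsub>Uq_alg\<^esub> D (- (2 * m)) (2 * m) = \<zero>\<^bsub>Uq_alg\<^esub>"
        by (simp add: D_def UU.minus_minus_swap flip: UU.smult_r_distr) (simp add: a_minus_def UU.r_neg)
      then have "?b \<otimes>\<^bsub>Uq_alg\<^esub> ?a = ?a \<otimes>\<^bsub>Uq_alg\<^esub> ?b \<oplus>\<^bsub>Uq_alg\<^esub> D (- (2 * m)) (2 * m)"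
        using ugen_heis[OF mm] c by (simp add: UU.a_assoc flip: D_def)
      then show ?thesis
        unfolding antipode_gam using mm c
        by (simp add: UU.l_minus UU.r_minus m D_def)
    qed
  qed
qed

lemmas comult_hom = uq_ext_hom_aux[OF quantum_gl1_rep_comult]
lemmas counit_hom = uq_ext_hom_aux[OF quantum_gl1_rep_counit]
lemmas antipode_hom = uq_ext_hom_aux[OF quantum_gl1_rep_antipode]

section \<open>Faithfulness: the Fock representation and ordered monomials\<close>

type_synonym fock = "int \<Rightarrow> int \<Rightarrow> int \<Rightarrow> int multiset \<Rightarrow> ratfun"

definition fock_end :: "(ratfun, fock \<Rightarrow> fock) module" where
  "fock_end = \<lparr>carrier = {T. (\<forall>u v. T (\<lambda>a b c N. u a b c N + v a b c N) = (\<lambda>a b c N. T u a b c N + T v a b c N)) \<and>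
       (\<forall>r u. T (\<lambda>a b c N. r * u a b c N) = (\<lambda>a b c N. r * T u a b c N))},
     monoid.mult = (\<circ>), one = id, ring.zero = (\<lambda>u a b c N. 0),
     add = (\<lambda>S T u a b c N. S u a b c N + T u a b c N), module.smult = (\<lambda>r T u a b c N. r * T u a b c N)\<rparr>"

lemma fock_end_simps [simp]:
  "monoid.mult fock_end = (\<circ>)" "one fock_end = id" "ring.zero fock_end = (\<lambda>u a b c N. 0)"
  "add fock_end = (\<lambda>S T u a b c N. S u a b c N + T u a b c N)"
  "module.smult fock_end = (\<lambda>r T u a b c N. r * T u a b c N)"
  by (simp_all add: fock_end_def)

lemma fock_end_carrier:
  "T \<in> carrier fock_end \<longleftrightarrow> (\<forall>u v. T (\<lambda>a b c N. u a b c N + v a b c N) = (\<lambda>a b c N. T u a b c N + T v a b c N)) \<and>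
       (\<forall>r u. T (\<lambda>a b c N. r * u a b c N) = (\<lambda>a b c N. r * T u a b c N))"
  by (simp add: fock_end_def)

lemma scalar_algebra_fock_end: "scalar_algebra fock_end UNIV"
proof -
  have "ring fock_end"
  proof (rule ringI)
    show "abelian_group fock_end"
    proof (rule abelian_groupI)
      fix T assume "T \<in> carrier fock_end"
      then show "\<exists>S\<in>carrier fock_end. S \<oplus>\<^bsub>fock_end\<^esub> T = \<zero>\<^bsub>fock_end\<^esub>"
        by (intro bexI[of _ "\<lambda>u a b c N. - T u a b c N"]) (simp_all add: fock_end_carrier fun_eq_iff)
    qed (simp_all add: fock_end_carrier fun_eq_iff algebra_simps)
    show "Group.monoid fock_end"
      by (rule monoidI) (simp_all add: fock_end_carrier o_assoc)
  qed (simp_all add: fock_end_carrier fun_eq_iff)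
  then show ?thesis
    by (intro scalar_algebra.intro scalar_algebra_axioms.intro)
      (simp_all add: fock_end_carrier fun_eq_iff algebra_simps)
qed

definition kap :: ratfun where "kap = qq - inverse qq"

lemma qq_nonzero [simp]: "qq \<noteq> 0"
  by (simp add: qq_def Zero_fract_def eq_fract)

lemma kap_nonzero [simp]: "kap \<noteq> 0"
proof
  assume "kap = 0"
  then have "qq * qq = 1" by (simp add: kap_def field_simps)
  then show False by (simp add: qq_def One_fract_def eq_fract one_pCons)
qed

text \<open>The structure constant of the rescaled letters. It is a Laurent polynomial, which is the
  purpose of rescaling by q - q^-1, and it vanishes at every nonzero \<epsilon> with \<epsilon>^(2m)
  = 1.\<close>

definition heis_coeff :: "int \<Rightarrow> ratfun" where
  "heis_coeff m = (qq powi m - qq powi (- m)) / of_int m"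

lemma heis_coeff_eq: "heis_coeff m = kap * kap * heis_const m"
  by (simp add: heis_coeff_def heis_const_def qint_def kap_def[symmetric])

lemma heis_coeff_uminus: "heis_coeff (- m) = heis_coeff m"
  unfolding heis_coeff_def of_int_minus minus_minus by (metis minus_diff_eq minus_divide_divide)

text \<open>The action of \<open>(q - q\<^sup>-\<^sup>1) h\<^sub>m\<close> on the coefficients, indexed by the exponent of \<open>\<Gamma>\<close> and the
  multiset of the indices of the \<open>h\<close>, of a combination of ordered monomials without \<open>\<Lambda>\<close>: the
  positive letters have to be commuted past the negative ones.\<close>

definition heis_op :: "int \<Rightarrow> (int \<Rightarrow> int multiset \<Rightarrow> ratfun) \<Rightarrow> int \<Rightarrow> int multiset \<Rightarrow> ratfun" where
  "heis_op m w b N = (if m \<in># N then w b (N - {#m#}) else 0) +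
    (if m > 0 then heis_coeff m * of_nat (count N (- m) + 1) *
      (w (b - 2 * m) (add_mset (- m) N) - w (b + 2 * m) (add_mset (- m) N)) else 0)"

text \<open>By symmetry of the claim one may assume that one index is positive; two operators with
  negative indices only add letters and commute. For opposite indices the claim is the usual
  relation between creation and annihilation operators.\<close>

lemma heis_op_commute:
  assumes m: "m \<noteq> 0" and n: "n \<noteq> 0"
  shows "heis_op m (heis_op n w) b N = heis_op n (heis_op m w) b N +
    (if m = - n then heis_coeff m * (w (b - 2 * m) N - w (b + 2 * m) N) else 0)"
proof -
  have main: "heis_op m (heis_op n w) b N = heis_op n (heis_op m w) b N +
    (if m = - n then heis_coeff m * (w (b - 2 * m) N - w (b + 2 * m) N) else 0)"
    if mn: "m > 0" "n \<noteq> 0" for m n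
  proof -
    consider "m = n" | "m = - n" | "m \<noteq> n" "m \<noteq> - n" by blast
    then show ?thesis
    proof cases
      case 1
      then show ?thesis using mn by simp
    next
      case 2
      have n: "n = - m" "\<not> n > 0" "m \<noteq> n" using 2 mn by simp_all
      have A: "m \<in># N - {#- m#} \<longleftrightarrow> m \<in># N" "- m \<in># N - {#m#} \<longleftrightarrow> - m \<in># N"
        using mn by (simp_all add: in_diff_count)
      have C: "N - {#- m#} - {#m#} = N - {#m#} - {#- m#}" by (rule diff_right_commute)
      have B: "add_mset (- m) (N - {#- m#}) = N" if "- m \<in># N" using that by simp
      have Z: "count N x = 0" if "x \<notin># N" for x using that by (simp add: not_in_iff)
      \<comment> \<open>The multiplicity of the letter \<open>- m\<close> seen by the annihilating
        part differs by one between the two orders of application; this difference produces the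
        central term.\<close>
      show ?thesis
        using mn unfolding n heis_op_def
        by (cases "- m \<in># N"; cases "m \<in># N") (simp_all add: A B C Z algebra_simps)
    next
      case 3
      have A: "m \<in># N - {#n#} \<longleftrightarrow> m \<in># N" "n \<in># N - {#m#} \<longleftrightarrow> n \<in># N"
        using 3 by (simp_all add: in_diff_count)
      have C: "N - {#n#} - {#m#} = N - {#m#} - {#n#}" by (rule diff_right_commute)
      have D: "add_mset (- m) N - {#n#} = add_mset (- m) (N - {#n#})"
        "add_mset (- n) N - {#m#} = add_mset (- n) (N - {#m#})"
        using 3 by (simp_all add: minus_equation_iff)
      have E: "n \<noteq> m" "n \<noteq> - m" "- m \<noteq> n" "- n \<noteq> m" "m \<noteq> - n" using 3 by auto
      show ?thesis
        using mn unfolding heis_op_def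
        by (cases "n \<in># N"; cases "m \<in># N"; cases "n > 0")
          (simp_all add: A C D E 3 algebra_simps add_mset_commute)
    qed
  qed
  show ?thesis
  proof (cases "m > 0")
    case True
    then show ?thesis using main n by blast
  next
    case m': False
    show ?thesis
    proof (cases "n > 0")
      case True
      from main[OF True m] show ?thesis
        by (auto simp: heis_coeff_uminus right_diff_distrib)
    next
      case False
      then have "\<not> m > 0" "\<not> n > 0" "m \<noteq> - n" using m m' n by auto
      moreover have "m \<in># N - {#n#} \<and> n \<in># N \<longleftrightarrow> n \<in># N - {#m#} \<and> m \<in># N"
        by (auto simp: in_diff_count not_in_iff split: if_splits)
      moreover have "N - {#n#} - {#m#} = N - {#m#} - {#n#}" by (rule diff_right_commute)
      ultimately show ?thesis by (auto simp: heis_op_def)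
    qed
  qed
qed

text \<open>The factor \<open>inverse kap\<close> undoes the rescaling built into
  \<open>heis_op\<close>. The power of q is the cost of moving h_m past \<Lambda>^a, as the
  monomials have \<Lambda> on the left. The remaining letters shift an exponent, and shifting
  coefficients goes in the opposite direction.\<close>

fun fock_op :: "gen \<Rightarrow> fock \<Rightarrow> fock" where
  "fock_op (GenH m) u = (\<lambda>a b c N. inverse kap * (qq powi (2 * m * a)) * heis_op m (\<lambda>b N. u a b c N) b N)"
| "fock_op GenLam u = (\<lambda>a. u (a - 1))"
| "fock_op GenLam' u = (\<lambda>a. u (a + 1))"
| "fock_op GenGam u = (\<lambda>a b. u a (b - 1))"
| "fock_op GenGam' u = (\<lambda>a b. u a (b + 1))"
| "fock_op GenK u = (\<lambda>a b c. u a b (c - 1))"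
| "fock_op GenK' u = (\<lambda>a b c. u a b (c + 1))"

lemma heis_op_linear:
  "heis_op m (\<lambda>b N. u b N + v b N) b N = heis_op m u b N + heis_op m v b N"
  "heis_op m (\<lambda>b N. r * u b N) b N = r * heis_op m u b N"
  by (simp_all add: heis_op_def algebra_simps)

lemma fock_op_closed: "fock_op x \<in> carrier fock_end"
  by (cases x) (simp_all add: fock_end_carrier heis_op_linear algebra_simps)

lemma fock_gam: "foldr (\<lambda>x y. fock_op x \<circ> y) (gam_pow n) id = (\<lambda>u a b. u a (b - n))"
proof -
  have 1: "foldr (\<lambda>x y. fock_op x \<circ> y) (replicate k GenGam) id = (\<lambda>u a b. u a (b - int k))" for k
    by (induction k) (simp_all del: foldr_replicate add: fun_eq_iff algebra_simps)
  have 2: "foldr (\<lambda>x y. fock_op x \<circ> y) (replicate k GenGam') id = (\<lambda>u a b. u a (b + int k))" for k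
    by (induction k) (simp_all del: foldr_replicate add: fun_eq_iff algebra_simps)
  show ?thesis using 1[of "nat n"] 2[of "nat (- n)"] by (auto simp: gam_pow_def simp del: foldr_replicate)
qed

lemma quantum_gl1_rep_fock: "quantum_gl1_rep fock_end fock_op"
proof -
  interpret C: scalar_algebra fock_end UNIV by (rule scalar_algebra_fock_end)
  have minus: "S \<ominus>\<^bsub>fock_end\<^esub> T = (\<lambda>u a b c N. S u a b c N - T u a b c N)"
    if "S \<in> carrier fock_end" "T \<in> carrier fock_end" for S T
  proof -
    have "\<ominus>\<^bsub>fock_end\<^esub> T = (\<lambda>u a b c N. - T u a b c N)"
      by (rule C.minus_equality) (use that in \<open>simp_all add: fock_end_carrier fun_eq_iff\<close>)
    then show ?thesis by (simp add: a_minus_def)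
  qed
  show ?thesis
  proof unfold_locales
    show "fock_op x \<in> carrier fock_end" for x by (rule fock_op_closed)
    show "fock_op x \<otimes>\<^bsub>fock_end\<^esub> fock_op y = \<one>\<^bsub>fock_end\<^esub>"
      if "(x, y) \<in> {(GenLam, GenLam'), (GenLam', GenLam), (GenGam, GenGam'), (GenGam', GenGam),
                (GenK, GenK'), (GenK', GenK)}" for x y
      using that by (auto simp: fun_eq_iff)
    show "fock_op x \<otimes>\<^bsub>fock_end\<^esub> fock_op y = fock_op y \<otimes>\<^bsub>fock_end\<^esub> fock_op x"
      if "x \<in> {GenGam, GenGam', GenK, GenK'}" for x y
      using that by (cases y) (auto simp: fun_eq_iff heis_op_def algebra_simps)
    show "fock_op (GenH m) \<otimes>\<^bsub>fock_end\<^esub> fock_op GenLam =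
        (qq powi (2 * m)) \<odot>\<^bsub>fock_end\<^esub> (fock_op GenLam \<otimes>\<^bsub>fock_end\<^esub> fock_op (GenH m))" for m
    proof -
      have pw: "qq powi (2 * m * a) = qq powi (2 * m) * qq powi (2 * m * (a - 1))" for a
      proof -
        have "2 * m * a = 2 * m + 2 * m * (a - 1)" by (simp add: algebra_simps)
        then show ?thesis using power_int_add[of qq "2 * m" "2 * m * (a - 1)"] by simp
      qed
      show ?thesis
      proof (intro ext)
        fix u :: fock and a b c N
        show "(fock_op (GenH m) \<otimes>\<^bsub>fock_end\<^esub> fock_op GenLam) u a b c N =
          ((qq powi (2 * m)) \<odot>\<^bsub>fock_end\<^esub> (fock_op GenLam \<otimes>\<^bsub>fock_end\<^esub> fock_op (GenH m))) u a b c N"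
          unfolding fock_end_simps comp_apply fock_op.simps pw[of a] by (simp only: mult_ac)
      qed
    qed
    show "fock_op (GenH m) \<otimes>\<^bsub>fock_end\<^esub> fock_op (GenH (- m')) =
      fock_op (GenH (- m')) \<otimes>\<^bsub>fock_end\<^esub> fock_op (GenH m) \<oplus>\<^bsub>fock_end\<^esub>
      (if m = m' then heis_const m \<odot>\<^bsub>fock_end\<^esub> (foldr (\<lambda>x y. fock_op x \<otimes>\<^bsub>fock_end\<^esub> y) (gam_pow (2 * m)) \<one>\<^bsub>fock_end\<^esub>
       \<ominus>\<^bsub>fock_end\<^esub> foldr (\<lambda>x y. fock_op x \<otimes>\<^bsub>fock_end\<^esub> y) (gam_pow (- (2 * m))) \<one>\<^bsub>fock_end\<^esub>) else \<zero>\<^bsub>fock_end\<^esub>)"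
      if mm: "m \<noteq> 0" "m' \<noteq> 0" for m m'
    proof -
      have sh: "(\<lambda>(u::fock) a b. u a (b - n)) \<in> carrier fock_end" for n by (simp add: fock_end_carrier)
      have "- m' \<noteq> 0" using mm by simp
      note comm = heis_op_commute[OF mm(1) this]
      \<comment> \<open>The costs of moving h_m and h_-m past \<Lambda>^a are inverse to each other,
        so the commutator on the Fock space does not depend on the exponent of \<Lambda>.\<close>
      have pw: "qq powi (2 * m * a) * qq powi (- (2 * m * a)) = 1" for a
        by (simp add: power_int_minus)
      show ?thesis
        unfolding fock_end_simps fock_gam minus[OF sh sh]
      proof (intro ext)
        fix u :: fock and a b c N
        have lin: "heis_op x (\<lambda>b N. inverse kap * qq powi y * w b N) b N = inverse kap * qq powi y * heis_op x w b N" for x y w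
          by (rule heis_op_linear)
        define w where "w = (\<lambda>b N. u a b c N)"
        define p where "p = inverse kap * qq powi (2 * m * a)"
        define p' where "p' = inverse kap * qq powi (2 * - m' * a)"
        have L: "(fock_op (GenH m) \<circ> fock_op (GenH (- m'))) u a b c N = p * (p' * heis_op m (heis_op (- m') w) b N)"
          "(fock_op (GenH (- m')) \<circ> fock_op (GenH m)) u a b c N = p' * (p * heis_op (- m') (heis_op m w) b N)"
          by (simp_all add: lin p_def p'_def w_def)
        have p: "p * p' * heis_coeff m = heis_const m" if "m = m'"
          using pw[of a] that heis_coeff_eq[of m] by (simp add: p_def p'_def field_simps)
        show "(fock_op (GenH m) \<circ> fock_op (GenH (- m'))) u a b c N =
          (fock_op (GenH (- m')) \<circ> fock_op (GenH m)) u a b c N +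
          (if m = m' then (\<lambda>u a b c N. heis_const m * (u a (b - 2 * m) c N - u a (b - - (2 * m)) c N)) else (\<lambda>u a b c N. 0)) u a b c N"
          unfolding L comm
        proof (cases "m = m'")
          case True
          then show "p * (p' * (heis_op (- m') (heis_op m w) b N +
              (if m = - (- m') then heis_coeff m * (w (b - 2 * m) N - w (b + 2 * m) N) else 0))) =
            p' * (p * heis_op (- m') (heis_op m w) b N) +
            (if m = m' then (\<lambda>u a b c N. heis_const m * (u a (b - 2 * m) c N - u a (b - - (2 * m)) c N)) else (\<lambda>u a b c N. 0)) u a b c N"
            unfolding p[OF True, symmetric] by (simp add: w_def ring_distribs mult_ac)
        next
          case False
          then show "p * (p' * (heis_op (- m') (heis_op m w) b N +
              (if m = - (- m') then heis_coeff m * (w (b - 2 * m) N - w (b + 2 * m) N) else 0))) =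
            p' * (p * heis_op (- m') (heis_op m w) b N) +
            (if m = m' then (\<lambda>u a b c N. heis_const m * (u a (b - 2 * m) c N - u a (b - - (2 * m)) c N)) else (\<lambda>u a b c N. 0)) u a b c N"
            by simp
        qed
      qed
    qed
  qed
qed

lemmas fock_hom = uq_ext_hom_aux[OF quantum_gl1_rep_fock]

text \<open>The inverse is passed as a second argument, because the inverses of \<Lambda>, \<Gamma>
  and k are generators of their own.\<close>

definition ipow :: "('a, 'm) monoid_scheme \<Rightarrow> 'a \<Rightarrow> 'a \<Rightarrow> int \<Rightarrow> 'a" where
  "ipow M x y n = (if n \<ge> 0 then x [^]\<^bsub>M\<^esub> nat n else y [^]\<^bsub>M\<^esub> nat (- n))"

context monoid
begin

context
  fixes x y
  assumes x: "x \<in> carrier G" and y: "y \<in> carrier G" and xy: "x \<otimes> y = \<one>" and yx: "y \<otimes> x = \<one>"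
begin

lemma ipow_closed: "ipow G x y n \<in> carrier G"
  using x y by (simp add: ipow_def del: pow_nat)

lemma ipow_0: "ipow G x y 0 = \<one>"
  by (simp add: ipow_def)

lemma ipow_Suc: "ipow G x y (n + 1) = x \<otimes> ipow G x y n"
proof (cases "n \<ge> 0")
  case True
  then have "nat (n + 1) = Suc (nat n)" by simp
  then show ?thesis using True x nat_pow_Suc2[of x "nat n"] by (simp add: ipow_def del: pow_nat)
next
  case False
  then have n: "nat (- n) = Suc (nat (- (n + 1)))" by simp
  have "x \<otimes> y [^] nat (- n) = y [^] nat (- (n + 1))"
    unfolding n using x y xy by (simp only: nat_pow_Suc2) (simp flip: m_assoc)
  moreover have "ipow G x y (n + 1) = y [^] nat (- (n + 1))"
    using False by (cases "n = - 1") (auto simp: ipow_def simp del: pow_nat)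
  ultimately show ?thesis using False by (simp add: ipow_def del: pow_nat)
qed

lemma ipow_pred: "ipow G x y (n - 1) = y \<otimes> ipow G x y n"
  using ipow_Suc[of "n - 1"] x y yx ipow_closed[of "n - 1"] by (simp flip: m_assoc)

lemma ipow_commute:
  assumes z: "z \<in> carrier G" and zx: "z \<otimes> x = x \<otimes> z" and zy: "z \<otimes> y = y \<otimes> z"
  shows "z \<otimes> ipow G x y n = ipow G x y n \<otimes> z"
proof (induction n rule: int_induct[where k = 0])
  case (step1 i)
  have "z \<otimes> (x \<otimes> ipow G x y i) = x \<otimes> (z \<otimes> ipow G x y i)"
    using z x zx ipow_closed by (simp flip: m_assoc)
  then show ?case using step1 x z ipow_closed by (simp add: ipow_Suc m_assoc)
next
  case (step2 i)
  have "z \<otimes> (y \<otimes> ipow G x y i) = y \<otimes> (z \<otimes> ipow G x y i)"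
    using z y zy ipow_closed by (simp flip: m_assoc)
  then show ?case using step2 y z ipow_closed by (simp add: ipow_pred m_assoc)
qed (simp add: ipow_0 z)

end

end

section \<open>Rescaled letters and ordered monomials\<close>

lemma hh_eq: "hh m = kap \<odot>\<^bsub>Uq_alg\<^esub> ugen (GenH m)"
  by (simp add: hh_def kap_def)

lemma hh_closed [simp]: "m \<noteq> 0 \<Longrightarrow> hh m \<in> carrier Uq_alg"
  by (simp add: hh_eq UU.phi_closed)

lemma ugen_closed [simp]: "x \<in> gens \<Longrightarrow> ugen x \<in> carrier Uq_alg"
  by (rule UU.phi_closed)

abbreviation lamp :: "int \<Rightarrow> uq" where "lamp \<equiv> ipow Uq_alg (ugen GenLam) (ugen GenLam')"
abbreviation kp :: "int \<Rightarrow> uq" where "kp \<equiv> ipow Uq_alg (ugen GenK) (ugen GenK')"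

lemma inverse_pairs [simp]:
  "ugen GenLam \<otimes>\<^bsub>Uq_alg\<^esub> ugen GenLam' = \<one>\<^bsub>Uq_alg\<^esub>" "ugen GenLam' \<otimes>\<^bsub>Uq_alg\<^esub> ugen GenLam = \<one>\<^bsub>Uq_alg\<^esub>"
  "ugen GenGam \<otimes>\<^bsub>Uq_alg\<^esub> ugen GenGam' = \<one>\<^bsub>Uq_alg\<^esub>" "ugen GenGam' \<otimes>\<^bsub>Uq_alg\<^esub> ugen GenGam = \<one>\<^bsub>Uq_alg\<^esub>"
  "ugen GenK \<otimes>\<^bsub>Uq_alg\<^esub> ugen GenK' = \<one>\<^bsub>Uq_alg\<^esub>" "ugen GenK' \<otimes>\<^bsub>Uq_alg\<^esub> ugen GenK = \<one>\<^bsub>Uq_alg\<^esub>"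
  by (simp_all add: UU.phi_inverse)

lemma lamp_closed [simp]: "lamp a \<in> carrier Uq_alg" and kp_closed [simp]: "kp c \<in> carrier Uq_alg"
  by (rule UU.ipow_closed; simp)+

lemma lamp_0 [simp]: "lamp 0 = \<one>\<^bsub>Uq_alg\<^esub>" and kp_0 [simp]: "kp 0 = \<one>\<^bsub>Uq_alg\<^esub>"
  and gam_0 [simp]: "gam 0 = \<one>\<^bsub>Uq_alg\<^esub>"
  by (simp_all add: ipow_def flip: gam_eq)

lemma lamp_Suc: "lamp (a + 1) = ugen GenLam \<otimes>\<^bsub>Uq_alg\<^esub> lamp a"
  and lamp_pred: "lamp (a - 1) = ugen GenLam' \<otimes>\<^bsub>Uq_alg\<^esub> lamp a"
  and kp_Suc: "kp (a + 1) = ugen GenK \<otimes>\<^bsub>Uq_alg\<^esub> kp a"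
  and kp_pred: "kp (a - 1) = ugen GenK' \<otimes>\<^bsub>Uq_alg\<^esub> kp a"
  by (simp_all add: UU.ipow_Suc UU.ipow_pred)

lemma gam_Suc: "gam (a + 1) = ugen GenGam \<otimes>\<^bsub>Uq_alg\<^esub> gam a"
  and gam_pred: "gam (a - 1) = ugen GenGam' \<otimes>\<^bsub>Uq_alg\<^esub> gam a"
  using UU.gam_pow_Suc[of a] UU.gam_pow_pred[of a] by (simp_all only: gam_eq)

lemma central_commute:
  "x \<in> {GenGam, GenGam', GenK, GenK'} \<Longrightarrow> y \<in> gens \<Longrightarrow> ugen y \<otimes>\<^bsub>Uq_alg\<^esub> ugen x = ugen x \<otimes>\<^bsub>Uq_alg\<^esub> ugen y"
  using UU.phi_central[of x y] by simp

lemma kp_commute: "y \<in> gens \<Longrightarrow> ugen y \<otimes>\<^bsub>Uq_alg\<^esub> kp c = kp c \<otimes>\<^bsub>Uq_alg\<^esub> ugen y"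
  by (rule UU.ipow_commute) (simp_all add: central_commute)

lemma central_lamp: "x \<in> {GenGam, GenGam', GenK, GenK'} \<Longrightarrow> ugen x \<otimes>\<^bsub>Uq_alg\<^esub> lamp a = lamp a \<otimes>\<^bsub>Uq_alg\<^esub> ugen x"
  by (rule UU.ipow_commute) (auto simp: central_commute)

lemma gam_kp: "gam n \<otimes>\<^bsub>Uq_alg\<^esub> kp a = kp a \<otimes>\<^bsub>Uq_alg\<^esub> gam n"
  by (rule UU.ipow_commute) (simp_all add: gam_commute)

lemma hh_gam: "m \<noteq> 0 \<Longrightarrow> hh m \<otimes>\<^bsub>Uq_alg\<^esub> gam n = gam n \<otimes>\<^bsub>Uq_alg\<^esub> hh m"
  using gam_commute[of "GenH m" n] by (simp add: hh_eq UU.smult_mult_left UU.smult_mult_right)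

lemma hh_kp: "m \<noteq> 0 \<Longrightarrow> hh m \<otimes>\<^bsub>Uq_alg\<^esub> kp n = kp n \<otimes>\<^bsub>Uq_alg\<^esub> hh m"
  using kp_commute[of "GenH m" n] by (simp add: hh_eq UU.smult_mult_left UU.smult_mult_right)

lemma hh_Lam: "m \<noteq> 0 \<Longrightarrow> hh m \<otimes>\<^bsub>Uq_alg\<^esub> ugen GenLam = (qq powi (2 * m)) \<odot>\<^bsub>Uq_alg\<^esub> (ugen GenLam \<otimes>\<^bsub>Uq_alg\<^esub> hh m)"
  by (simp add: hh_eq UU.smult_mult_left UU.smult_mult_right UU.phi_lam UU.smult_commute[of kap])

lemma hh_Lam': "m \<noteq> 0 \<Longrightarrow> hh m \<otimes>\<^bsub>Uq_alg\<^esub> ugen GenLam' = (qq powi (- (2 * m))) \<odot>\<^bsub>Uq_alg\<^esub> (ugen GenLam' \<otimes>\<^bsub>Uq_alg\<^esub> hh m)"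
proof -
  assume m: "m \<noteq> 0"
  let ?x = "ugen GenLam" and ?y = "ugen GenLam'"
  have "?y \<otimes>\<^bsub>Uq_alg\<^esub> hh m = ?y \<otimes>\<^bsub>Uq_alg\<^esub> (hh m \<otimes>\<^bsub>Uq_alg\<^esub> ?x) \<otimes>\<^bsub>Uq_alg\<^esub> ?y"
    using m by (simp add: UU.m_assoc)
  also have "\<dots> = (qq powi (2 * m)) \<odot>\<^bsub>Uq_alg\<^esub> (?y \<otimes>\<^bsub>Uq_alg\<^esub> (?x \<otimes>\<^bsub>Uq_alg\<^esub> hh m) \<otimes>\<^bsub>Uq_alg\<^esub> ?y)"
    using m by (simp add: hh_Lam UU.smult_mult_left UU.smult_mult_right)
  also have "?y \<otimes>\<^bsub>Uq_alg\<^esub> (?x \<otimes>\<^bsub>Uq_alg\<^esub> hh m) = hh m"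
    using m by (simp flip: UU.m_assoc)
  finally show ?thesis
    using m by (simp add: power_int_minus flip: UU.smult_assoc1)
qed

lemma hh_lamp:
  assumes m: "m \<noteq> 0"
  shows "hh m \<otimes>\<^bsub>Uq_alg\<^esub> lamp a = (qq powi (2 * m * a)) \<odot>\<^bsub>Uq_alg\<^esub> (lamp a \<otimes>\<^bsub>Uq_alg\<^esub> hh m)"
proof (induction a rule: int_induct[where k = 0])
  case base
  then show ?case using m by simp
next
  case (step1 i)
  have "hh m \<otimes>\<^bsub>Uq_alg\<^esub> lamp (i + 1) = (hh m \<otimes>\<^bsub>Uq_alg\<^esub> ugen GenLam) \<otimes>\<^bsub>Uq_alg\<^esub> lamp i"
    using m by (simp add: lamp_Suc UU.m_assoc)
  also have "\<dots> = (qq powi (2 * m)) \<odot>\<^bsub>Uq_alg\<^esub> (ugen GenLam \<otimes>\<^bsub>Uq_alg\<^esub> (hh m \<otimes>\<^bsub>Uq_alg\<^esub> lamp i))"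
    using m by (simp add: hh_Lam UU.smult_mult_left UU.m_assoc)
  also have "\<dots> = (qq powi (2 * m) * qq powi (2 * m * i)) \<odot>\<^bsub>Uq_alg\<^esub> (lamp (i + 1) \<otimes>\<^bsub>Uq_alg\<^esub> hh m)"
    using m by (simp add: step1 UU.smult_mult_right UU.smult_assoc1 lamp_Suc UU.m_assoc)
  also have "qq powi (2 * m) * qq powi (2 * m * i) = qq powi (2 * m * (i + 1))"
    using power_int_add[of qq "2 * m" "2 * m * i"] by (simp add: algebra_simps)
  finally show ?case .
next
  case (step2 i)
  have "hh m \<otimes>\<^bsub>Uq_alg\<^esub> lamp (i - 1) = (hh m \<otimes>\<^bsub>Uq_alg\<^esub> ugen GenLam') \<otimes>\<^bsub>Uq_alg\<^esub> lamp i"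
    using m by (simp add: lamp_pred UU.m_assoc)
  also have "\<dots> = (qq powi (- (2 * m))) \<odot>\<^bsub>Uq_alg\<^esub> (ugen GenLam' \<otimes>\<^bsub>Uq_alg\<^esub> (hh m \<otimes>\<^bsub>Uq_alg\<^esub> lamp i))"
    using m by (simp add: hh_Lam' UU.smult_mult_left UU.m_assoc)
  also have "\<dots> = (qq powi (- (2 * m)) * qq powi (2 * m * i)) \<odot>\<^bsub>Uq_alg\<^esub> (lamp (i - 1) \<otimes>\<^bsub>Uq_alg\<^esub> hh m)"
    using m by (simp add: step2 UU.smult_mult_right UU.smult_assoc1 lamp_pred UU.m_assoc)
  also have "qq powi (- (2 * m)) * qq powi (2 * m * i) = qq powi (2 * m * (i - 1))"
    using power_int_add[of qq "- (2 * m)" "2 * m * i"] by (simp add: algebra_simps)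
  finally show ?case .
qed

lemma hh_heis:
  assumes "m \<noteq> 0" "n \<noteq> 0"
  shows "hh m \<otimes>\<^bsub>Uq_alg\<^esub> hh n = hh n \<otimes>\<^bsub>Uq_alg\<^esub> hh m \<oplus>\<^bsub>Uq_alg\<^esub>
    (if n = - m then heis_coeff m \<odot>\<^bsub>Uq_alg\<^esub> (gam (2 * m) \<ominus>\<^bsub>Uq_alg\<^esub> gam (- (2 * m))) else \<zero>\<^bsub>Uq_alg\<^esub>)"
  using ugen_heis[of m "- n"] assms
  by (cases "n = - m")
    (simp_all add: hh_eq UU.smult_mult_left UU.smult_mult_right UU.smult_r_distr heis_coeff_eq UU.smult_assoc1 equation_minus_iff)

definition hprod :: "int list \<Rightarrow> uq" where
  "hprod xs = foldr (\<lambda>m y. hh m \<otimes>\<^bsub>Uq_alg\<^esub> y) xs \<one>\<^bsub>Uq_alg\<^esub>"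

lemma hprod_simps [simp]: "hprod [] = \<one>\<^bsub>Uq_alg\<^esub>" "hprod (m # xs) = hh m \<otimes>\<^bsub>Uq_alg\<^esub> hprod xs"
  by (simp_all add: hprod_def)

lemma hprod_closed [simp]: "0 \<notin> set xs \<Longrightarrow> hprod xs \<in> carrier Uq_alg"
  by (induction xs) auto

text \<open>Inserting h_m into a sorted product means passing the letters smaller than m. A
  correction arises only when a letter h_-m is passed, which requires -m < m and hence positive m.
  In that case all copies of h_-m are passed, and every one contributes the same central
  factor.\<close>

lemma hprod_straighten:
  assumes "sorted xs" "0 \<notin> set xs" and m: "m \<noteq> 0"
  shows "hh m \<otimes>\<^bsub>Uq_alg\<^esub> hprod xs = hprod (insort m xs) \<oplus>\<^bsub>Uq_alg\<^esub>
    (if m > 0 then (of_nat (count_list xs (- m)) * heis_coeff m) \<odot>\<^bsub>Uq_alg\<^esub>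
       ((gam (2 * m) \<ominus>\<^bsub>Uq_alg\<^esub> gam (- (2 * m))) \<otimes>\<^bsub>Uq_alg\<^esub> hprod (remove1 (- m) xs)) else \<zero>\<^bsub>Uq_alg\<^esub>)"
  using assms(1,2)
proof (induction xs)
  case Nil
  then show ?case using m by simp
next
  case (Cons x xs)
  define G where "G = gam (2 * m) \<ominus>\<^bsub>Uq_alg\<^esub> gam (- (2 * m))"
  have x: "x \<noteq> 0" "0 \<notin> set xs" "sorted xs" using Cons.prems by auto
  have c: "G \<in> carrier Uq_alg" "hprod xs \<in> carrier Uq_alg" "hprod (insort m xs) \<in> carrier Uq_alg"
    "hprod (remove1 (- m) xs) \<in> carrier Uq_alg" "hh x \<in> carrier Uq_alg" "hh m \<in> carrier Uq_alg"
    using x m by (auto simp: G_def set_insort_key dest: notin_set_remove1)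
  have Gx: "hh x \<otimes>\<^bsub>Uq_alg\<^esub> (G \<otimes>\<^bsub>Uq_alg\<^esub> y) = G \<otimes>\<^bsub>Uq_alg\<^esub> (hh x \<otimes>\<^bsub>Uq_alg\<^esub> y)" if "y \<in> carrier Uq_alg" for y
  proof -
    have "hh x \<otimes>\<^bsub>Uq_alg\<^esub> G = G \<otimes>\<^bsub>Uq_alg\<^esub> hh x"
      using x by (simp add: G_def UU.r_distr UU.l_distr UU.r_minus UU.l_minus a_minus_def hh_gam)
    then show ?thesis using that c by (simp flip: UU.m_assoc)
  qed
  show ?case
  proof (cases "m \<le> x")
    case True
    have "count_list (x # xs) (- m) = 0" if "m > 0"
      using True Cons.prems that by (auto simp: count_list_0_iff)
    moreover have "hprod (remove1 (- m) (x # xs)) \<in> carrier Uq_alg" using c by auto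
    ultimately show ?thesis using True c by (auto simp flip: G_def)
  next
    case False
    define T where "T = (if m > 0 then (of_nat (count_list xs (- m)) * heis_coeff m) \<odot>\<^bsub>Uq_alg\<^esub>
       (G \<otimes>\<^bsub>Uq_alg\<^esub> hprod (remove1 (- m) xs)) else \<zero>\<^bsub>Uq_alg\<^esub>)"
    define D where "D = (if x = - m then heis_coeff m \<odot>\<^bsub>Uq_alg\<^esub> G else \<zero>\<^bsub>Uq_alg\<^esub>)"
    have cT: "T \<in> carrier Uq_alg" "D \<in> carrier Uq_alg" using c by (auto simp: T_def D_def)
    have IH: "hh m \<otimes>\<^bsub>Uq_alg\<^esub> hprod xs = hprod (insort m xs) \<oplus>\<^bsub>Uq_alg\<^esub> T"
      unfolding T_def G_def by (rule Cons.IH[OF x(3,2)])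
    have "hh m \<otimes>\<^bsub>Uq_alg\<^esub> hprod (x # xs) = (hh m \<otimes>\<^bsub>Uq_alg\<^esub> hh x) \<otimes>\<^bsub>Uq_alg\<^esub> hprod xs"
      using c by (simp add: UU.m_assoc)
    also have "hh m \<otimes>\<^bsub>Uq_alg\<^esub> hh x = hh x \<otimes>\<^bsub>Uq_alg\<^esub> hh m \<oplus>\<^bsub>Uq_alg\<^esub> D"
      unfolding D_def G_def by (rule hh_heis[OF m x(1)])
    also have "(hh x \<otimes>\<^bsub>Uq_alg\<^esub> hh m \<oplus>\<^bsub>Uq_alg\<^esub> D) \<otimes>\<^bsub>Uq_alg\<^esub> hprod xs =
        hh x \<otimes>\<^bsub>Uq_alg\<^esub> (hh m \<otimes>\<^bsub>Uq_alg\<^esub> hprod xs) \<oplus>\<^bsub>Uq_alg\<^esub> D \<otimes>\<^bsub>Uq_alg\<^esub> hprod xs"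
      using c cT by (simp add: UU.l_distr UU.m_assoc)
    also have "\<dots> = hprod (insort m (x # xs)) \<oplus>\<^bsub>Uq_alg\<^esub> (hh x \<otimes>\<^bsub>Uq_alg\<^esub> T \<oplus>\<^bsub>Uq_alg\<^esub> D \<otimes>\<^bsub>Uq_alg\<^esub> hprod xs)"
      unfolding IH using c cT False by (simp add: UU.r_distr UU.a_assoc)
    also have "hh x \<otimes>\<^bsub>Uq_alg\<^esub> T \<oplus>\<^bsub>Uq_alg\<^esub> D \<otimes>\<^bsub>Uq_alg\<^esub> hprod xs =
      (if m > 0 then (of_nat (count_list (x # xs) (- m)) * heis_coeff m) \<odot>\<^bsub>Uq_alg\<^esub>
       (G \<otimes>\<^bsub>Uq_alg\<^esub> hprod (remove1 (- m) (x # xs))) else \<zero>\<^bsub>Uq_alg\<^esub>)"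
    proof (cases "x = - m")
      case True
      then have m0: "m > 0" using False m by simp
      note Gx' = Gx[unfolded True]
      \<comment> \<open>The head \<open>x\<close> is \<open>- m\<close>. By sortedness, a further
        copy of \<open>- m\<close> stands at the front of \<open>xs\<close>, so removing it and
        multiplying by \<open>hh x\<close> restores \<open>hprod xs\<close>. Without a further copy
        the coefficient is zero.\<close>
      have "(of_nat (count_list xs (- m)) * heis_coeff m) \<odot>\<^bsub>Uq_alg\<^esub> (G \<otimes>\<^bsub>Uq_alg\<^esub> (hh x \<otimes>\<^bsub>Uq_alg\<^esub> hprod (remove1 (- m) xs))) =
          (of_nat (count_list xs (- m)) * heis_coeff m) \<odot>\<^bsub>Uq_alg\<^esub> (G \<otimes>\<^bsub>Uq_alg\<^esub> hprod xs)"
      proof (cases "- m \<in> set xs")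
        case mem: True
        then obtain ys where "xs = - m # ys"
          using Cons.prems(1) True by (cases xs) force+
        then show ?thesis using True by simp
      next
        case False
        then have "count_list xs (- m) = 0" by (simp add: count_list_0_iff)
        then show ?thesis using c by simp
      qed
      then show ?thesis
        using True m0 c
        by (simp add: T_def D_def UU.smult_mult_right UU.smult_mult_left Gx' ring_distribs UU.smult_l_distr UU.a_comm)
    next
      case False
      then show ?thesis using c by (simp add: T_def D_def UU.smult_mult_right Gx)
    qed
    finally show ?thesis unfolding G_def .
  qed
qed

text \<open>The letters are the rescaled ones, in order that the same monomials serve as a basis
  over the rational functions and, for the integral form, over \<open>laurent\<close>.\<close>

fun pbw :: "int \<times> int \<times> int \<times> int multiset \<Rightarrow> uq" where
  "pbw (a, b, c, N) = lamp a \<otimes>\<^bsub>Uq_alg\<^esub> (gam b \<otimes>\<^bsub>Uq_alg\<^esub> (kp c \<otimes>\<^bsub>Uq_alg\<^esub> hprod (sorted_list_of_multiset N)))"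

definition pbw_index :: "(int \<times> int \<times> int \<times> int multiset) set" where
  "pbw_index = {(a, b, c, N). 0 \<notin># N}"

lemma pbw_closed: "0 \<notin># N \<Longrightarrow> pbw (a, b, c, N) \<in> carrier Uq_alg"
  by simp

lemma pbw_image: "pbw ` pbw_index \<subseteq> carrier Uq_alg"
  by (auto simp: pbw_index_def simp del: pbw.simps intro: pbw_closed)

lemma pbw_one: "pbw (0, 0, 0, {#}) = \<one>\<^bsub>Uq_alg\<^esub>"
  by simp

lemma ugen_pbw:
  assumes N: "0 \<notin># N"
  shows "ugen GenLam \<otimes>\<^bsub>Uq_alg\<^esub> pbw (a, b, c, N) = pbw (a + 1, b, c, N)"
    and "ugen GenLam' \<otimes>\<^bsub>Uq_alg\<^esub> pbw (a, b, c, N) = pbw (a - 1, b, c, N)"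
    and "ugen GenGam \<otimes>\<^bsub>Uq_alg\<^esub> pbw (a, b, c, N) = pbw (a, b + 1, c, N)"
    and "ugen GenGam' \<otimes>\<^bsub>Uq_alg\<^esub> pbw (a, b, c, N) = pbw (a, b - 1, c, N)"
    and "ugen GenK \<otimes>\<^bsub>Uq_alg\<^esub> pbw (a, b, c, N) = pbw (a, b, c + 1, N)"
    and "ugen GenK' \<otimes>\<^bsub>Uq_alg\<^esub> pbw (a, b, c, N) = pbw (a, b, c - 1, N)"
proof -
  have l: "ugen x \<otimes>\<^bsub>Uq_alg\<^esub> (lamp a \<otimes>\<^bsub>Uq_alg\<^esub> y) = lamp a \<otimes>\<^bsub>Uq_alg\<^esub> (ugen x \<otimes>\<^bsub>Uq_alg\<^esub> y)"
    if "x \<in> {GenGam, GenGam', GenK, GenK'}" "y \<in> carrier Uq_alg" for x y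
  proof -
    have "ugen x \<in> carrier Uq_alg" using that by auto
    then show ?thesis using that central_lamp[OF that(1), of a] by (simp flip: UU.m_assoc)
  qed
  have g: "ugen x \<otimes>\<^bsub>Uq_alg\<^esub> (gam b \<otimes>\<^bsub>Uq_alg\<^esub> y) = gam b \<otimes>\<^bsub>Uq_alg\<^esub> (ugen x \<otimes>\<^bsub>Uq_alg\<^esub> y)"
    if "x \<in> gens" "y \<in> carrier Uq_alg" for x y
    using that gam_commute[of x b] by (simp flip: UU.m_assoc)
  show "ugen GenLam \<otimes>\<^bsub>Uq_alg\<^esub> pbw (a, b, c, N) = pbw (a + 1, b, c, N)"
    "ugen GenLam' \<otimes>\<^bsub>Uq_alg\<^esub> pbw (a, b, c, N) = pbw (a - 1, b, c, N)"
    "ugen GenGam \<otimes>\<^bsub>Uq_alg\<^esub> pbw (a, b, c, N) = pbw (a, b + 1, c, N)"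
    "ugen GenGam' \<otimes>\<^bsub>Uq_alg\<^esub> pbw (a, b, c, N) = pbw (a, b - 1, c, N)"
    "ugen GenK \<otimes>\<^bsub>Uq_alg\<^esub> pbw (a, b, c, N) = pbw (a, b, c + 1, N)"
    "ugen GenK' \<otimes>\<^bsub>Uq_alg\<^esub> pbw (a, b, c, N) = pbw (a, b, c - 1, N)"
    using N by (simp_all add: lamp_Suc lamp_pred gam_Suc gam_pred kp_Suc kp_pred l g UU.m_assoc)
qed

lemma sorted_list_of_multiset_remove1:
  "sorted_list_of_multiset (N - {#x#}) = remove1 x (sorted_list_of_multiset N)"
proof -
  have "N - {#x#} = mset (remove1 x (sorted_list_of_multiset N))" by simp
  then show ?thesis
    by (simp only: sorted_list_of_multiset_mset) (simp add: sorted_sort_id sorted_remove1)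
qed

lemma count_list_sorted_list_of_multiset: "count_list (sorted_list_of_multiset N) x = count N x"
  by (metis count_mset mset_sorted_list_of_multiset)

text \<open>The straightening rule of sorted products carried through the factors \<Lambda>^a,
  \<Gamma>^b and k^c. All coefficients on the right are Laurent polynomials, which makes the
  \<open>laurent\<close>-span of the monomials stable under multiplication by h_m.\<close>

lemma hh_pbw:
  assumes N: "0 \<notin># N" and m: "m \<noteq> 0"
  shows "hh m \<otimes>\<^bsub>Uq_alg\<^esub> pbw (a, b, c, N) = (qq powi (2 * m * a)) \<odot>\<^bsub>Uq_alg\<^esub>
    (pbw (a, b, c, add_mset m N) \<oplus>\<^bsub>Uq_alg\<^esub>
     (if m > 0 then (of_nat (count N (- m)) * heis_coeff m) \<odot>\<^bsub>Uq_alg\<^esub>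
       (pbw (a, b + 2 * m, c, N - {#- m#}) \<ominus>\<^bsub>Uq_alg\<^esub> pbw (a, b - 2 * m, c, N - {#- m#})) else \<zero>\<^bsub>Uq_alg\<^esub>))"
proof -
  define P where "P = hprod (sorted_list_of_multiset N)"
  define Q where "Q = hprod (sorted_list_of_multiset (N - {#- m#}))"
  define R where "R = hprod (sorted_list_of_multiset (add_mset m N))"
  define t where "t = of_nat (count N (- m)) * heis_coeff m"
  have "0 \<notin># N - {#- m#}" using N by (meson in_diffD)
  then have c: "P \<in> carrier Uq_alg" "Q \<in> carrier Uq_alg" "R \<in> carrier Uq_alg"
    using N m by (auto simp: P_def Q_def R_def simp del: sorted_list_of_multiset_insert)
  define G where "G = gam (2 * m) \<ominus>\<^bsub>Uq_alg\<^esub> gam (- (2 * m))"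
  have cG: "G \<in> carrier Uq_alg" by (simp add: G_def)
  define Y where "Y = (if m > 0 then t \<odot>\<^bsub>Uq_alg\<^esub> (G \<otimes>\<^bsub>Uq_alg\<^esub> Q) else \<zero>\<^bsub>Uq_alg\<^esub>)"
  have cY: "Y \<in> carrier Uq_alg" using c cG by (simp add: Y_def)
  have "hh m \<otimes>\<^bsub>Uq_alg\<^esub> P = R \<oplus>\<^bsub>Uq_alg\<^esub> Y"
    using hprod_straighten[of "sorted_list_of_multiset N" m] N m
    by (simp add: P_def Q_def R_def t_def Y_def G_def sorted_list_of_multiset_remove1 count_list_sorted_list_of_multiset)
  have "hh m \<otimes>\<^bsub>Uq_alg\<^esub> pbw (a, b, c, N) = (hh m \<otimes>\<^bsub>Uq_alg\<^esub> lamp a) \<otimes>\<^bsub>Uq_alg\<^esub> (gam b \<otimes>\<^bsub>Uq_alg\<^esub> (kp c \<otimes>\<^bsub>Uq_alg\<^esub> P))"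
    using c m by (simp add: P_def UU.m_assoc)
  also have "\<dots> = (qq powi (2 * m * a)) \<odot>\<^bsub>Uq_alg\<^esub> (lamp a \<otimes>\<^bsub>Uq_alg\<^esub> ((hh m \<otimes>\<^bsub>Uq_alg\<^esub> gam b) \<otimes>\<^bsub>Uq_alg\<^esub> (kp c \<otimes>\<^bsub>Uq_alg\<^esub> P)))"
    using c m by (simp add: hh_lamp UU.smult_mult_left UU.m_assoc)
  also have "(hh m \<otimes>\<^bsub>Uq_alg\<^esub> gam b) \<otimes>\<^bsub>Uq_alg\<^esub> (kp c \<otimes>\<^bsub>Uq_alg\<^esub> P) = gam b \<otimes>\<^bsub>Uq_alg\<^esub> ((hh m \<otimes>\<^bsub>Uq_alg\<^esub> kp c) \<otimes>\<^bsub>Uq_alg\<^esub> P)"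
    using c m by (simp add: hh_gam UU.m_assoc)
  also have "\<dots> = gam b \<otimes>\<^bsub>Uq_alg\<^esub> (kp c \<otimes>\<^bsub>Uq_alg\<^esub> (hh m \<otimes>\<^bsub>Uq_alg\<^esub> P))"
    using c m by (simp add: hh_kp UU.m_assoc)
  also have "hh m \<otimes>\<^bsub>Uq_alg\<^esub> P = R \<oplus>\<^bsub>Uq_alg\<^esub> Y" by fact
  also have "lamp a \<otimes>\<^bsub>Uq_alg\<^esub> (gam b \<otimes>\<^bsub>Uq_alg\<^esub> (kp c \<otimes>\<^bsub>Uq_alg\<^esub> (R \<oplus>\<^bsub>Uq_alg\<^esub> Y))) =
    pbw (a, b, c, add_mset m N) \<oplus>\<^bsub>Uq_alg\<^esub> lamp a \<otimes>\<^bsub>Uq_alg\<^esub> (gam b \<otimes>\<^bsub>Uq_alg\<^esub> (kp c \<otimes>\<^bsub>Uq_alg\<^esub> Y))"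
    using c cY by (simp add: R_def UU.r_distr del: sorted_list_of_multiset_insert)
  also have "lamp a \<otimes>\<^bsub>Uq_alg\<^esub> (gam b \<otimes>\<^bsub>Uq_alg\<^esub> (kp c \<otimes>\<^bsub>Uq_alg\<^esub> Y)) = (if m > 0 then t \<odot>\<^bsub>Uq_alg\<^esub>
       (pbw (a, b + 2 * m, c, N - {#- m#}) \<ominus>\<^bsub>Uq_alg\<^esub> pbw (a, b - 2 * m, c, N - {#- m#})) else \<zero>\<^bsub>Uq_alg\<^esub>)"
  proof -
    have g: "kp c \<otimes>\<^bsub>Uq_alg\<^esub> (gam n \<otimes>\<^bsub>Uq_alg\<^esub> Q) = gam n \<otimes>\<^bsub>Uq_alg\<^esub> (kp c \<otimes>\<^bsub>Uq_alg\<^esub> Q)" for n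
      using c gam_kp[of n c] by (simp flip: UU.m_assoc)
    have "gam b \<otimes>\<^bsub>Uq_alg\<^esub> (gam n \<otimes>\<^bsub>Uq_alg\<^esub> (kp c \<otimes>\<^bsub>Uq_alg\<^esub> Q)) = gam (b + n) \<otimes>\<^bsub>Uq_alg\<^esub> (kp c \<otimes>\<^bsub>Uq_alg\<^esub> Q)" for n
      using c by (simp add: gam_add UU.m_assoc)
    from this[of "2 * m"] this[of "- (2 * m)"] show ?thesis
      using c
      by (simp add: Y_def G_def Q_def[symmetric] UU.smult_mult_right a_minus_def UU.r_distr UU.l_distr UU.r_minus UU.l_minus g)
  qed
  finally show ?thesis unfolding t_def .
qed

definition vacuum :: fock where
  "vacuum a b c N = (if a = 0 \<and> b = 0 \<and> c = 0 \<and> N = {#} then 1 else 0)"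

text \<open>An element is recovered from its action on the vacuum: an ordered monomial creates
  precisely the function concentrated at its own index. These functions are the coordinates for all
  later independence arguments.\<close>

definition pbw_coord :: "uq \<Rightarrow> int \<times> int \<times> int \<times> int multiset \<Rightarrow> ratfun" where
  "pbw_coord u = (\<lambda>(a, b, c, N). uq_ext fock_end fock_op u vacuum a b c N)"

lemma pbw_coord_add: "u \<in> carrier Uq_alg \<Longrightarrow> v \<in> carrier Uq_alg \<Longrightarrow>
    pbw_coord (u \<oplus>\<^bsub>Uq_alg\<^esub> v) i = pbw_coord u i + pbw_coord v i"
  by (simp add: pbw_coord_def ring_hom_add[OF fock_hom(1)] split: prod.splits)

lemma pbw_coord_smult: "u \<in> carrier Uq_alg \<Longrightarrow> pbw_coord (r \<odot>\<^bsub>Uq_alg\<^esub> u) i = r * pbw_coord u i"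
  by (simp add: pbw_coord_def fock_hom(2) split: prod.splits)

lemma pbw_coord_pbw:
  assumes "i \<in> pbw_index"
  shows "pbw_coord (pbw i) j = (if i = j then 1 else 0)"
proof -
  define \<rho> where "\<rho> = uq_ext fock_end fock_op"
  have \<rho>: "\<rho> (u \<otimes>\<^bsub>Uq_alg\<^esub> v) = \<rho> u \<circ> \<rho> v" if "u \<in> carrier Uq_alg" "v \<in> carrier Uq_alg" for u v
    using ring_hom_mult[OF fock_hom(1) that] by (simp add: \<rho>_def)
  have one: "\<rho> \<one>\<^bsub>Uq_alg\<^esub> = id" using ring_hom_one[OF fock_hom(1)] by (simp add: \<rho>_def)
  have gen: "\<rho> (ugen x) = fock_op x" if "x \<in> gens" for x using fock_hom(3)[OF that] by (simp add: \<rho>_def)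
  have lam: "\<rho> (lamp a) u = (\<lambda>a'. u (a' - a))" for a u
  proof (induction a rule: int_induct[where k = 0])
    case (step1 i)
    then show ?case unfolding lamp_Suc by (simp add: \<rho> gen algebra_simps)
  next
    case (step2 i)
    then show ?case unfolding lamp_pred by (simp add: \<rho> gen algebra_simps)
  qed (simp add: one)
  have kp: "\<rho> (kp c) u = (\<lambda>a b c'. u a b (c' - c))" for c u
  proof (induction c rule: int_induct[where k = 0])
    case (step1 i)
    then show ?case unfolding kp_Suc by (simp add: \<rho> gen algebra_simps)
  next
    case (step2 i)
    then show ?case unfolding kp_pred by (simp add: \<rho> gen algebra_simps)
  qed (simp add: one)
  have gam: "\<rho> (gam n) u = (\<lambda>a b. u a (b - n))" for n u
    using fock_hom(4)[OF gam_pow_in_lists, of n] by (simp add: \<rho>_def fock_gam)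
  have hp: "\<rho> (hprod xs) vacuum = (\<lambda>a b c N. if a = 0 \<and> b = 0 \<and> c = 0 \<and> N = mset xs then 1 else 0)"
    if "sorted xs" "0 \<notin> set xs" for xs
    using that
  proof (induction xs)
    case Nil
    then show ?case by (simp add: one vacuum_def fun_eq_iff)
  next
    case (Cons m xs)
    have m: "m \<noteq> 0" "0 \<notin> set xs" "sorted xs" using Cons.prems by auto
    have hm: "\<rho> (hh m) = (\<lambda>u a b c N. kap * fock_op (GenH m) u a b c N)"
      using fock_hom(2)[of "ugen (GenH m)" kap] gen[of "GenH m"] m(1) by (simp add: hh_eq \<rho>_def)
    have IH: "\<rho> (hprod xs) vacuum = (\<lambda>a b c N. if a = 0 \<and> b = 0 \<and> c = 0 \<and> N = mset xs then 1 else 0)"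
      by (rule Cons.IH[OF m(3,2)])
    have kk: "kap * (inverse kap * z) = z" for z by (simp flip: mult.assoc)
    have "\<rho> (hprod (m # xs)) vacuum = (\<lambda>a b c N. (qq powi (2 * m * a)) *
        heis_op m (\<lambda>b N. if a = 0 \<and> b = 0 \<and> c = 0 \<and> N = mset xs then 1 else 0) b N)"
      using m by (simp add: \<rho> hm IH mult.assoc kk)
    \<comment> \<open>In a sorted product the letters to the right of h_m have index at least m. For
      positive m none of them is h_-m, so nothing is annihilated and h_m acts by creation
      alone.\<close>
    moreover have "add_mset (- m) N \<noteq> mset xs" if "m > 0" for N
    proof
      assume "add_mset (- m) N = mset xs"
      then have "- m \<in> set xs" by (metis set_mset_mset union_single_eq_member)
      then show False using Cons.prems(1) that by auto
    qed
    moreover have "N - {#m#} = mset xs \<longleftrightarrow> N = mset (m # xs)" if "m \<in># N" for N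
      using that by (auto dest: insert_DiffM)
    ultimately show ?case by (auto simp: fun_eq_iff heis_op_def)
  qed
  obtain a b c N where i: "i = (a, b, c, N)" "0 \<notin># N" using assms by (auto simp: pbw_index_def)
  have "\<rho> (pbw i) vacuum = (\<lambda>a' b' c' N'. if a' = a \<and> b' = b \<and> c' = c \<and> N' = N then 1 else 0)"
    using i(2) hp[of "sorted_list_of_multiset N"]
    by (simp add: i(1) \<rho> lam gam kp fun_eq_iff)
  then show ?thesis
    unfolding pbw_coord_def i(1) by (cases j) (auto simp flip: \<rho>_def)
qed

section \<open>The integral form\<close>

definition poly_ratfun :: "complex poly \<Rightarrow> ratfun" where
  "poly_ratfun p = Fract p 1"

lemma poly_ratfun_simps:
  "poly_ratfun (p + q) = poly_ratfun p + poly_ratfun q" "poly_ratfun (p * q) = poly_ratfun p * poly_ratfun q"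
  "poly_ratfun (- p) = - poly_ratfun p" "poly_ratfun 1 = 1" "poly_ratfun 0 = 0"
  by (simp_all add: poly_ratfun_def One_fract_def Zero_fract_def)

lemma poly_ratfun_diff: "poly_ratfun (p - q) = poly_ratfun p - poly_ratfun q"
  by (simp add: poly_ratfun_def)

lemma poly_ratfun_eq_iff: "poly_ratfun p = poly_ratfun q \<longleftrightarrow> p = q"
  by (simp add: poly_ratfun_def eq_fract)

lemma poly_ratfun_const: "poly_ratfun [:c:] = const c"
  by (simp add: poly_ratfun_def const_def)

lemma poly_ratfun_monom: "poly_ratfun (monom 1 n) = qq ^ n"
proof (induction n)
  case (Suc n)
  have "monom 1 (Suc n) = [:0, 1:] * (monom 1 n :: complex poly)" by (simp add: monom_Suc)
  then show ?case using Suc by (simp only: poly_ratfun_simps) (simp add: poly_ratfun_def qq_def)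
qed (simp add: poly_ratfun_simps flip: one_pCons)

lemma poly_ratfun_linear: "poly_ratfun [:- \<epsilon>, 1:] = qq - const \<epsilon>"
  by (simp add: poly_ratfun_def qq_def const_def)

lemma laurent_iff: "f \<in> laurent \<longleftrightarrow> (\<exists>p n. f = poly_ratfun p / qq ^ n)"
proof -
  have "Fract p (monom 1 n) = poly_ratfun p / qq ^ n" for p n
    by (simp add: poly_ratfun_def flip: poly_ratfun_monom)
  then show ?thesis by (simp add: laurent_def)
qed

lemma laurentI: "poly_ratfun p / qq ^ n \<in> laurent"
  by (auto simp: laurent_iff)

lemma laurent_poly [simp]: "poly_ratfun p \<in> laurent"
  using laurentI[of p 0] by simp

lemma laurent_const [simp]: "const c \<in> laurent"
  by (simp flip: poly_ratfun_const)

lemma laurent_qq [simp]: "qq \<in> laurent"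
  using laurent_poly[of "monom 1 1"] unfolding poly_ratfun_monom by simp

lemma laurent_inverse_qq [simp]: "inverse qq \<in> laurent"
  using laurentI[of 1 1] by (simp add: poly_ratfun_simps inverse_eq_divide)

lemma laurent_add [simp]: "f \<in> laurent \<Longrightarrow> g \<in> laurent \<Longrightarrow> f + g \<in> laurent"
proof -
  assume "f \<in> laurent" "g \<in> laurent"
  then obtain p n p' n' where "f = poly_ratfun p / qq ^ n" "g = poly_ratfun p' / qq ^ n'"
    unfolding laurent_iff by blast
  then have "f + g = poly_ratfun (p * monom 1 n' + p' * monom 1 n) / qq ^ (n + n')"
    by (simp add: poly_ratfun_simps poly_ratfun_monom power_add add_frac_eq)
  then show ?thesis by (auto simp: laurent_iff)
qed

lemma laurent_mult [simp]: "f \<in> laurent \<Longrightarrow> g \<in> laurent \<Longrightarrow> f * g \<in> laurent"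
proof -
  assume "f \<in> laurent" "g \<in> laurent"
  then obtain p n p' n' where "f = poly_ratfun p / qq ^ n" "g = poly_ratfun p' / qq ^ n'"
    unfolding laurent_iff by blast
  then have "f * g = poly_ratfun (p * p') / qq ^ (n + n')"
    by (simp add: poly_ratfun_simps power_add)
  then show ?thesis by (auto simp: laurent_iff)
qed

lemma laurent_0 [simp]: "0 \<in> laurent" and laurent_1 [simp]: "1 \<in> laurent"
  using laurent_poly[of 0] laurent_poly[of 1] by (simp_all add: poly_ratfun_simps)

lemma laurent_uminus [simp]: "f \<in> laurent \<Longrightarrow> - f \<in> laurent"
  by (auto simp: laurent_iff) (metis minus_divide_left poly_ratfun_simps(3))

lemma laurent_diff [simp]: "f \<in> laurent \<Longrightarrow> g \<in> laurent \<Longrightarrow> f - g \<in> laurent"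
  using laurent_add[of f "- g"] by simp

lemma laurent_power [simp]: "f \<in> laurent \<Longrightarrow> f ^ n \<in> laurent"
  by (induction n) simp_all

lemma laurent_qq_powi [simp]: "qq powi n \<in> laurent"
  by (simp add: power_int_def)

lemma const_simps: "const (a + b) = const a + const b" "const (a * b) = const a * const b"
  "const 1 = 1" "const 0 = 0" "const (- a) = - const a"
  by (simp_all add: const_def One_fract_def Zero_fract_def one_pCons mult.commute)

lemma const_of_nat: "const (of_nat n) = of_nat n"
  by (induction n) (simp_all add: const_simps)

lemma const_of_int: "const (of_int n) = of_int n"
  by (cases n rule: int_cases2) (simp_all add: const_simps const_of_nat)

lemma const_eq_0_iff: "const a = 0 \<longleftrightarrow> a = 0"
  by (simp add: const_def Zero_fract_def eq_fract)

lemma const_inverse: "const (inverse a) = inverse (const a)"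
proof (cases "a = 0")
  case False
  then have "const (inverse a) * const a = 1" by (simp add: const_simps flip: const_simps(2))
  then show ?thesis by (metis inverse_unique mult.commute)
qed (simp add: const_simps)

lemma laurent_of_nat [simp]: "of_nat n \<in> laurent" and laurent_of_int [simp]: "of_int k \<in> laurent"
  by (metis const_of_nat laurent_const, metis const_of_int laurent_const)

lemma laurent_inverse_of_int [simp]: "inverse (of_int k) \<in> laurent"
  by (metis const_inverse const_of_int laurent_const)

lemma heis_coeff_laurent [simp]: "heis_coeff m \<in> laurent"
  unfolding heis_coeff_def divide_inverse by simp

text \<open>A Laurent polynomial has many representations p / q^n. Cross-multiplying two of them
  gives an identity of polynomials, so evaluating at a nonzero point gives the same value for
  both.\<close>

lemma laurent_eval_eq:
  assumes "\<epsilon> \<noteq> 0"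
  shows "laurent_eval \<epsilon> (poly_ratfun p / qq ^ n) = poly p \<epsilon> / \<epsilon> ^ n"
proof -
  have F: "Fract p (monom 1 n) = poly_ratfun p / qq ^ n" for p n
    by (simp add: poly_ratfun_def flip: poly_ratfun_monom)
  have "poly p' \<epsilon> / \<epsilon> ^ n' = poly p \<epsilon> / \<epsilon> ^ n"
    if "poly_ratfun p / qq ^ n = poly_ratfun p' / qq ^ n'" for p' n'
  proof -
    have "poly_ratfun (p * monom 1 n') = poly_ratfun (p' * monom 1 n)"
      using that by (simp add: poly_ratfun_simps poly_ratfun_monom field_simps)
    then have "p * monom 1 n' = p' * monom 1 n" by (simp only: poly_ratfun_eq_iff)
    then have "poly (p * monom 1 n') \<epsilon> = poly (p' * monom 1 n) \<epsilon>" by simp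
    then show ?thesis using assms by (simp add: poly_monom field_simps)
  qed
  then have "{poly p' \<epsilon> / \<epsilon> ^ n' |p' n'. poly_ratfun p / qq ^ n = poly_ratfun p' / qq ^ n'} = {poly p \<epsilon> / \<epsilon> ^ n}"
    by blast
  then show ?thesis unfolding laurent_eval_def F by simp
qed

lemma laurent_eval_add:
  assumes "\<epsilon> \<noteq> 0" "f \<in> laurent" "g \<in> laurent"
  shows "laurent_eval \<epsilon> (f + g) = laurent_eval \<epsilon> f + laurent_eval \<epsilon> g"
proof -
  obtain p n p' n' where fg: "f = poly_ratfun p / qq ^ n" "g = poly_ratfun p' / qq ^ n'"
    using assms unfolding laurent_iff by blast
  then have eq: "f + g = poly_ratfun (p * monom 1 n' + p' * monom 1 n) / qq ^ (n + n')"
    by (simp add: poly_ratfun_simps poly_ratfun_monom power_add add_frac_eq)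
  show ?thesis
    unfolding eq unfolding fg laurent_eval_eq[OF assms(1)]
    using assms(1) by (simp add: poly_monom power_add add_frac_eq)
qed

lemma laurent_eval_mult:
  assumes "\<epsilon> \<noteq> 0" "f \<in> laurent" "g \<in> laurent"
  shows "laurent_eval \<epsilon> (f * g) = laurent_eval \<epsilon> f * laurent_eval \<epsilon> g"
proof -
  obtain p n p' n' where fg: "f = poly_ratfun p / qq ^ n" "g = poly_ratfun p' / qq ^ n'"
    using assms unfolding laurent_iff by blast
  then have eq: "f * g = poly_ratfun (p * p') / qq ^ (n + n')"
    by (simp add: poly_ratfun_simps power_add)
  show ?thesis
    unfolding eq unfolding fg laurent_eval_eq[OF assms(1)] by (simp add: power_add)
qed

lemma laurent_eval_poly: "\<epsilon> \<noteq> 0 \<Longrightarrow> laurent_eval \<epsilon> (poly_ratfun p) = poly p \<epsilon>"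
  using laurent_eval_eq[of \<epsilon> p 0] by simp

lemma laurent_eval_const [simp]: "\<epsilon> \<noteq> 0 \<Longrightarrow> laurent_eval \<epsilon> (const c) = c"
  by (simp add: laurent_eval_poly flip: poly_ratfun_const)

lemma laurent_eval_0_1 [simp]: "\<epsilon> \<noteq> 0 \<Longrightarrow> laurent_eval \<epsilon> 0 = 0" "\<epsilon> \<noteq> 0 \<Longrightarrow> laurent_eval \<epsilon> 1 = 1"
  using laurent_eval_const[of \<epsilon> 0] laurent_eval_const[of \<epsilon> 1] by (simp_all add: const_simps)

lemma laurent_eval_qq [simp]: "\<epsilon> \<noteq> 0 \<Longrightarrow> laurent_eval \<epsilon> qq = \<epsilon>"
  using laurent_eval_poly[of \<epsilon> "monom 1 1"] unfolding poly_ratfun_monom by (simp add: poly_monom)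

lemma laurent_eval_uminus: "\<epsilon> \<noteq> 0 \<Longrightarrow> f \<in> laurent \<Longrightarrow> laurent_eval \<epsilon> (- f) = - laurent_eval \<epsilon> f"
  using laurent_eval_add[of \<epsilon> f "- f"] by (simp add: eq_neg_iff_add_eq_0 add.commute)

lemma laurent_eval_diff: "\<epsilon> \<noteq> 0 \<Longrightarrow> f \<in> laurent \<Longrightarrow> g \<in> laurent \<Longrightarrow>
    laurent_eval \<epsilon> (f - g) = laurent_eval \<epsilon> f - laurent_eval \<epsilon> g"
  using laurent_eval_add[of \<epsilon> f "- g"] by (simp add: laurent_eval_uminus)

lemma laurent_eval_power: "\<epsilon> \<noteq> 0 \<Longrightarrow> f \<in> laurent \<Longrightarrow> laurent_eval \<epsilon> (f ^ n) = laurent_eval \<epsilon> f ^ n"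
  by (induction n) (simp_all add: laurent_eval_mult)

lemma laurent_eval_inverse_qq: "\<epsilon> \<noteq> 0 \<Longrightarrow> laurent_eval \<epsilon> (inverse qq) = inverse \<epsilon>"
  using laurent_eval_mult[of \<epsilon> "inverse qq" qq] by (simp add: inverse_unique mult.commute)

lemma laurent_eval_qq_powi: "\<epsilon> \<noteq> 0 \<Longrightarrow> laurent_eval \<epsilon> (qq powi n) = \<epsilon> powi n"
  by (simp add: power_int_def laurent_eval_power laurent_eval_inverse_qq)

lemma laurent_eval_inverse_of_int: "\<epsilon> \<noteq> 0 \<Longrightarrow> laurent_eval \<epsilon> (inverse (of_int k)) = inverse (of_int k)"
  by (metis const_inverse const_of_int laurent_eval_const)

lemma laurent_eval_heis_coeff: "\<epsilon> \<noteq> 0 \<Longrightarrow> laurent_eval \<epsilon> (heis_coeff m) = (\<epsilon> powi m - \<epsilon> powi (- m)) / of_int m"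
  unfolding heis_coeff_def divide_inverse
  by (simp add: laurent_eval_mult laurent_eval_diff laurent_eval_qq_powi laurent_eval_inverse_of_int)

text \<open>A zero at \<epsilon> is a zero of the numerator, as q is invertible there, so the linear
  factor splits off. Reducing scalars modulo \<open>qq - const \<epsilon>\<close> is thereby the
  same as evaluating them.\<close>

lemma laurent_eval_0_dvd:
  assumes "\<epsilon> \<noteq> 0" "f \<in> laurent" "laurent_eval \<epsilon> f = 0"
  shows "\<exists>g\<in>laurent. f = (qq - const \<epsilon>) * g"
proof -
  obtain p n where f: "f = poly_ratfun p / qq ^ n" using assms unfolding laurent_iff by blast
  then have "poly p \<epsilon> = 0" using assms by (simp add: laurent_eval_eq)
  then obtain g where "p = [:- \<epsilon>, 1:] * g" unfolding poly_eq_0_iff_dvd by (auto elim: dvdE)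
  then have "f = (qq - const \<epsilon>) * (poly_ratfun g / qq ^ n)"
    unfolding f by (simp only: poly_ratfun_simps poly_ratfun_linear) simp
  then show ?thesis using laurentI by blast
qed


text \<open>With two sets of scalars this covers the integral form, generated over
  \<open>laurent\<close> in an algebra over the rational functions, as well as the central
  subalgebra of a specialization, generated over the complex numbers.\<close>

locale generated_subalgebra = scalar_algebra M A
  for M :: "('k::comm_ring_1, 'b, 'm) module_scheme" (structure) and A +
  fixes B :: "'k set" and H :: "'b set" and R :: "('k, 'r) ring_scheme"
  assumes BA: "B \<subseteq> A" and HM: "H \<subseteq> carrier M" and R: "carrier R = B"
    and B1: "1 \<in> B" and B_add: "\<And>r s. r \<in> B \<Longrightarrow> s \<in> B \<Longrightarrow> r + s \<in> B"
    and B_uminus: "\<And>r. r \<in> B \<Longrightarrow> - r \<in> B"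
    and B_mult: "\<And>r s. r \<in> B \<Longrightarrow> s \<in> B \<Longrightarrow> r * s \<in> B"
begin

abbreviation "S \<equiv> gen_subalgebra R M H"

lemma H': "H \<union> {r \<odot> \<one> |r. r \<in> carrier R} \<subseteq> carrier M"
  using BA HM R by auto

lemma S_subset: "S \<subseteq> carrier M"
  unfolding gen_subalgebra_def by (rule generate_ring_incl[OF H'])

lemma S_smult:
  assumes "r \<in> B" "x \<in> S"
  shows "r \<odot> x \<in> S"
proof -
  have "r \<odot> \<one> \<in> S" unfolding gen_subalgebra_def by (rule generate_ring.incl) (use assms R in auto)
  then have "(r \<odot> \<one>) \<otimes> x \<in> S"
    using assms(2) unfolding gen_subalgebra_def by (rule generate_ring.eng_mult)
  moreover have "r \<odot> x = (r \<odot> \<one>) \<otimes> x"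
    using assms BA S_subset by (intro smult_eq_mult) auto
  ultimately show ?thesis by simp
qed

lemma S_closed:
  "\<one> \<in> S" "x \<in> S \<Longrightarrow> y \<in> S \<Longrightarrow> x \<oplus> y \<in> S" "x \<in> S \<Longrightarrow> y \<in> S \<Longrightarrow> x \<otimes> y \<in> S" "x \<in> S \<Longrightarrow> \<ominus> x \<in> S"
  "h \<in> H \<Longrightarrow> h \<in> S"
  unfolding gen_subalgebra_def by (auto intro: generate_ring.intros)

lemma scalar_algebra_S: "scalar_algebra (M\<lparr>carrier := S\<rparr>) B"
proof -
  have "ring (M\<lparr>carrier := S\<rparr>)"
    unfolding gen_subalgebra_def by (rule generate_ring_is_ring[OF H'])
  moreover have "x \<in> carrier M" if "x \<in> S" for x using S_subset that by auto
  moreover have "r \<in> A" if "r \<in> B" for r using BA that by auto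
  ultimately show ?thesis
    by (intro scalar_algebra.intro scalar_algebra_axioms.intro)
      (simp_all add: B1 B_add B_uminus B_mult S_smult smult_l_distr smult_r_distr smult_assoc1
        smult_mult_left smult_mult_right)
qed

lemma S_a_inv:
  assumes "x \<in> S"
  shows "\<ominus>\<^bsub>M\<lparr>carrier := S\<rparr>\<^esub> x = \<ominus> x"
proof -
  interpret T: scalar_algebra "M\<lparr>carrier := S\<rparr>" B by (rule scalar_algebra_S)
  have "x \<in> carrier M" using assms S_subset by auto
  then show ?thesis
    using T.minus_equality[of "\<ominus> x" x] assms S_closed(4)[OF assms] by (simp add: l_neg)
qed

text \<open>The generated ring also has a rule for negation and contains the scalar multiples of one
  as generators. Both are absorbed by the rule for scalar multiplication, so inductions over
  subalgebras have only the cases natural for linear multiplicative maps.\<close>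

lemma S_induct [consumes 1, case_names one gen add mult smult]:
  assumes "x \<in> S" and "P \<one>" and "\<And>h. h \<in> H \<Longrightarrow> P h"
    and "\<And>x y. x \<in> S \<Longrightarrow> y \<in> S \<Longrightarrow> P x \<Longrightarrow> P y \<Longrightarrow> P (x \<oplus> y)"
    and "\<And>x y. x \<in> S \<Longrightarrow> y \<in> S \<Longrightarrow> P x \<Longrightarrow> P y \<Longrightarrow> P (x \<otimes> y)"
    and smult: "\<And>r x. r \<in> B \<Longrightarrow> x \<in> S \<Longrightarrow> P x \<Longrightarrow> P (r \<odot> x)"
  shows "P x"
proof -
  from assms(1) have "x \<in> generate_ring M (H \<union> {r \<odot> \<one> |r. r \<in> carrier R})"
    unfolding gen_subalgebra_def .
  then have "x \<in> S \<and> P x"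
  proof (induction rule: generate_ring.induct)
    case one
    then show ?case using assms(2) S_closed by simp
  next
    case (incl h)
    then show ?case using assms(2,3) S_closed smult R S_smult by auto
  next
    case (a_inv h)
    then have "\<ominus> h = (- 1) \<odot> h" using S_subset by (auto simp: smult_uminus_left)
    moreover have "\<ominus> h \<in> S" using a_inv S_closed(4) by blast
    moreover have "P ((- 1) \<odot> h)" by (rule smult) (use a_inv B_uminus[OF B1] in simp_all)
    ultimately show ?case by simp
  next
    case (eng_add x y)
    then show ?case using assms(4) S_closed by simp
  next
    case (eng_mult x y)
    then show ?case using assms(5) S_closed by simp
  qed
  then show ?thesis by simp
qed

end

lemma scalar_algebra_Uq: "scalar_algebra Uq UNIV"
  by (rule scalar_algebra_transfer[OF scalar_algebra_Uq_alg]) simp_all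

section \<open>The integral form, its spanning monomials and its Hopf structure\<close>

definition int_gens :: "uq set" where
  "int_gens = {hh m | m. m \<noteq> 0} \<union> ugen ` {GenLam, GenLam', GenGam, GenGam', GenK, GenK'}"

interpretation IG: generated_subalgebra Uq UNIV laurent int_gens ring_L
proof (intro generated_subalgebra.intro scalar_algebra_Uq generated_subalgebra_axioms.intro)
  show "int_gens \<subseteq> carrier Uq" by (auto simp: int_gens_def)
qed simp_all

abbreviation "SA \<equiv> gen_subalgebra ring_L Uq int_gens"
abbreviation "AI \<equiv> Uq\<lparr>carrier := SA\<rparr>"

interpretation AI: scalar_algebra AI laurent
  by (rule IG.scalar_algebra_S)

lemma int_form_eq: "int_form = restrict_hopf ring_L ring_Cq Uq SA"
  by (simp only: int_form_def int_gens_def)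

lemma int_form_simps [simp]:
  "carrier int_form = SA" "monoid.mult int_form = monoid.mult Uq_alg" "one int_form = one Uq_alg"
  "ring.zero int_form = ring.zero Uq_alg" "add int_form = add Uq_alg" "module.smult int_form = module.smult Uq_alg"
  "counit int_form = uq_ext Cq_alg counit_gen" "antipode int_form = uq_ext Uq_op antipode_gen"
  by (simp_all add: int_form_eq restrict_hopf_def)

lemma comult_int_form: "comult int_form x = (THE t. t \<in> carrier (tensor ring_L AI AI) \<and>
    tensor_map ring_Cq Uq_alg Uq_alg (\<lambda>y. y) (\<lambda>y. y) t = comult Uq x)"
  by (simp add: int_form_eq restrict_hopf_def)

lemma SA_subset: "x \<in> SA \<Longrightarrow> x \<in> carrier Uq_alg"
  using IG.S_subset by auto

lemma SA_closed [simp]: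
  "\<one>\<^bsub>Uq_alg\<^esub> \<in> SA" "\<zero>\<^bsub>Uq_alg\<^esub> \<in> SA" "x \<in> SA \<Longrightarrow> y \<in> SA \<Longrightarrow> x \<oplus>\<^bsub>Uq_alg\<^esub> y \<in> SA"
  "x \<in> SA \<Longrightarrow> y \<in> SA \<Longrightarrow> x \<otimes>\<^bsub>Uq_alg\<^esub> y \<in> SA" "x \<in> SA \<Longrightarrow> \<ominus>\<^bsub>Uq_alg\<^esub> x \<in> SA"
  "r \<in> laurent \<Longrightarrow> x \<in> SA \<Longrightarrow> r \<odot>\<^bsub>Uq_alg\<^esub> x \<in> SA"
  using IG.S_closed IG.S_smult AI.zero_closed by simp_all

lemma SA_minus [simp]: "x \<in> SA \<Longrightarrow> y \<in> SA \<Longrightarrow> x \<ominus>\<^bsub>Uq_alg\<^esub> y \<in> SA"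
  by (simp add: a_minus_def)

lemma hh_SA [simp]: "m \<noteq> 0 \<Longrightarrow> hh m \<in> SA"
  by (rule IG.S_closed(5)) (auto simp: int_gens_def)

lemma ugen_SA [simp]: "ugen GenLam \<in> SA" "ugen GenLam' \<in> SA" "ugen GenGam \<in> SA" "ugen GenGam' \<in> SA"
  "ugen GenK \<in> SA" "ugen GenK' \<in> SA"
  by (rule IG.S_closed(5), simp add: int_gens_def)+

lemma SA_induct [consumes 1, case_names one hh ugen add mult smult]:
  assumes "x \<in> SA" and "P \<one>\<^bsub>Uq_alg\<^esub>" and "\<And>m. m \<noteq> 0 \<Longrightarrow> P (hh m)"
    and "\<And>x. x \<in> {GenLam, GenLam', GenGam, GenGam', GenK, GenK'} \<Longrightarrow> P (ugen x)"
    and "\<And>x y. x \<in> SA \<Longrightarrow> y \<in> SA \<Longrightarrow> P x \<Longrightarrow> P y \<Longrightarrow> P (x \<oplus>\<^bsub>Uq_alg\<^esub> y)"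
    and "\<And>x y. x \<in> SA \<Longrightarrow> y \<in> SA \<Longrightarrow> P x \<Longrightarrow> P y \<Longrightarrow> P (x \<otimes>\<^bsub>Uq_alg\<^esub> y)"
    and "\<And>r x. r \<in> laurent \<Longrightarrow> x \<in> SA \<Longrightarrow> P x \<Longrightarrow> P (r \<odot>\<^bsub>Uq_alg\<^esub> x)"
  shows "P x"
  using assms(1)
proof (induction rule: IG.S_induct)
  case (gen h)
  then show ?case using assms(3,4) unfolding int_gens_def by blast
qed (use assms in simp_all)

lemma gam_SA [simp]: "gam n \<in> SA"
proof (induction n rule: int_induct[where k = 0])
  case (step1 i)
  then show ?case unfolding gam_Suc by simp
next
  case (step2 i)
  then show ?case unfolding gam_pred by simp
qed simp

lemma lamp_SA [simp]: "lamp n \<in> SA"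
proof (induction n rule: int_induct[where k = 0])
  case (step1 i)
  then show ?case unfolding lamp_Suc by simp
next
  case (step2 i)
  then show ?case unfolding lamp_pred by simp
qed simp

lemma kp_SA [simp]: "kp n \<in> SA"
proof (induction n rule: int_induct[where k = 0])
  case (step1 i)
  then show ?case unfolding kp_Suc by simp
next
  case (step2 i)
  then show ?case unfolding kp_pred by simp
qed simp

lemma hprod_SA: "0 \<notin> set xs \<Longrightarrow> hprod xs \<in> SA"
  by (induction xs) auto

lemma pbw_SA: "i \<in> pbw_index \<Longrightarrow> pbw i \<in> SA"
  by (auto simp: pbw_index_def intro!: SA_closed hprod_SA)

abbreviation "pbw_span \<equiv> span_of AI laurent pbw pbw_index"

lemma pbw_image_AI: "pbw ` pbw_index \<subseteq> carrier AI"
  using pbw_SA by auto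

lemma pbw_span_closed:
  "\<zero>\<^bsub>Uq_alg\<^esub> \<in> pbw_span"
  "x \<in> pbw_span \<Longrightarrow> y \<in> pbw_span \<Longrightarrow> x \<oplus>\<^bsub>Uq_alg\<^esub> y \<in> pbw_span"
  "r \<in> laurent \<Longrightarrow> x \<in> pbw_span \<Longrightarrow> r \<odot>\<^bsub>Uq_alg\<^esub> x \<in> pbw_span"
  "x \<in> pbw_span \<Longrightarrow> x \<in> SA"
  "i \<in> pbw_index \<Longrightarrow> pbw i \<in> pbw_span"
  using span_of.zero[of AI laurent pbw pbw_index] AI.span_of_add[OF _ _ pbw_image_AI, of x y]
    AI.span_of_smult[OF _ _ pbw_image_AI, of x r] AI.span_of_closed[OF _ pbw_image_AI, of x]
    AI.span_of_base[OF _ pbw_image_AI, of i]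
  by simp_all

lemma pbw_span_minus: "x \<in> pbw_span \<Longrightarrow> y \<in> pbw_span \<Longrightarrow> x \<ominus>\<^bsub>Uq_alg\<^esub> y \<in> pbw_span"
  using pbw_span_closed(2)[of x "\<ominus>\<^bsub>Uq_alg\<^esub> y"] pbw_span_closed(3)[of "- 1" y] pbw_span_closed(4)[of y]
  by (simp add: a_minus_def UU.smult_uminus_left SA_subset)

lemma pbw_span_mult:
  assumes x: "x \<in> carrier Uq_alg" and xe: "\<And>i. i \<in> pbw_index \<Longrightarrow> x \<otimes>\<^bsub>Uq_alg\<^esub> pbw i \<in> pbw_span"
    and y: "y \<in> pbw_span"
  shows "x \<otimes>\<^bsub>Uq_alg\<^esub> y \<in> pbw_span"
  using y
proof (induction rule: span_of.induct)
  case zero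
  then show ?case using x pbw_span_closed(1) by simp
next
  case (step r i y)
  have "pbw i \<in> carrier Uq_alg" using pbw_image step(2) by auto
  moreover have "y \<in> carrier Uq_alg" using pbw_span_closed(4)[OF step(3)] by (rule SA_subset)
  ultimately have "x \<otimes>\<^bsub>Uq_alg\<^esub> (r \<odot>\<^bsub>Uq_alg\<^esub> pbw i \<oplus>\<^bsub>Uq_alg\<^esub> y) = r \<odot>\<^bsub>Uq_alg\<^esub> (x \<otimes>\<^bsub>Uq_alg\<^esub> pbw i) \<oplus>\<^bsub>Uq_alg\<^esub> x \<otimes>\<^bsub>Uq_alg\<^esub> y"
    using x by (simp add: UU.r_distr UU.smult_mult_right)
  then show ?case
    using pbw_span_closed(2)[OF pbw_span_closed(3)[OF step(1) xe[OF step(2)]] step.IH] by simp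
qed

text \<open>Only left multiplication of a monomial by a generator has been computed. The statement
  is therefore proved by induction on the left factor for arbitrary \<open>y\<close> in the span;
  since 1 is a monomial, it follows that the monomials span the integral form.\<close>

lemma SA_mult_span: "x \<in> SA \<Longrightarrow> y \<in> pbw_span \<Longrightarrow> x \<otimes>\<^bsub>Uq_alg\<^esub> y \<in> pbw_span"
proof (induction arbitrary: y rule: SA_induct)
  case one
  then show ?case using SA_subset pbw_span_closed(4) by simp
next
  case (hh m)
  have "hh m \<otimes>\<^bsub>Uq_alg\<^esub> pbw i \<in> pbw_span" if i': "i \<in> pbw_index" for i
  proof -
    obtain a b c N where i: "i = (a, b, c, N)" "0 \<notin># N" using i' by (auto simp: pbw_index_def)
    have "0 \<notin># N - {#- m#}" using i by (meson in_diffD)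
    then have mem: "(a, b, c, add_mset m N) \<in> pbw_index" "(a, b', c, N - {#- m#}) \<in> pbw_index" for b'
      using i hh by (auto simp: pbw_index_def)
    show ?thesis
      unfolding i(1) hh_pbw[OF i(2) hh(1)]
      using mem
      by (intro pbw_span_closed(2,3) laurent_qq_powi)
        (auto simp del: pbw.simps intro!: pbw_span_closed pbw_span_minus laurent_mult)
  qed
  from pbw_span_mult[OF _ this hh(2)] show ?case using hh(1) by simp
next
  case (ugen x)
  have "ugen x \<otimes>\<^bsub>Uq_alg\<^esub> pbw i \<in> pbw_span" if i': "i \<in> pbw_index" for i
  proof -
    obtain a b c N where i: "i = (a, b, c, N)" "0 \<notin># N" using i' by (auto simp: pbw_index_def)
    have "(a, b, c, N) \<in> pbw_index" for a b c using i by (simp add: pbw_index_def)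
    then show ?thesis
      using ugen(1) ugen_pbw[OF i(2)] unfolding i(1)
      by (auto simp del: pbw.simps intro!: pbw_span_closed(5))
  qed
  from pbw_span_mult[OF _ this ugen(2)] show ?case using ugen(1) by auto
next
  case (add x z)
  then show ?case
    using pbw_span_closed(2)[OF add.IH(1)[OF add.prems] add.IH(2)[OF add.prems]] pbw_span_closed(4)[OF add.prems]
    by (simp add: UU.l_distr SA_subset)
next
  case (mult x z)
  then show ?case
    using mult.IH(1)[OF mult.IH(2)[OF mult.prems]] pbw_span_closed(4)[OF mult.prems]
    by (simp add: UU.m_assoc SA_subset)
next
  case (smult r x)
  then show ?case
    using pbw_span_closed(3)[OF smult(1) smult.IH[OF smult.prems]] pbw_span_closed(4)[OF smult.prems]
    by (simp add: UU.smult_mult_left SA_subset)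
qed

lemma SA_span: "x \<in> SA \<Longrightarrow> x \<in> pbw_span"
proof -
  assume x: "x \<in> SA"
  have "pbw (0, 0, 0, {#}) \<in> pbw_span" by (rule pbw_span_closed(5)) (simp add: pbw_index_def)
  from SA_mult_span[OF x this] show ?thesis unfolding pbw_one using x SA_subset by simp
qed

interpretation IH: algebra_pair_hom AI AI laurent ring_L Uq_alg Uq_alg UNIV ring_Cq "\<lambda>y. y" "\<lambda>y. y" "\<lambda>r. r"
proof (intro algebra_pair_hom.intro algebra_pair.intro algebra_pair_hom_axioms.intro
    algebra_pair_axioms.intro AI.scalar_algebra_axioms scalar_algebra_Uq_alg)
  show "(\<lambda>y. y) \<in> ring_hom AI Uq_alg" by (rule ring_hom_memI) (simp_all add: SA_subset)
  then show "(\<lambda>y. y) \<in> ring_hom AI Uq_alg" .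
qed simp_all

abbreviation "TL \<equiv> tensor ring_L AI AI"
abbreviation "\<iota>L \<equiv> tensor_map ring_Cq Uq_alg Uq_alg (\<lambda>y. y) (\<lambda>y. y)"

interpretation TLS: scalar_algebra TL laurent
  by (rule IH.P.scalar_algebra_T)

lemma ring_hom_uminus:
  assumes "h \<in> ring_hom R S" "ring R" "ring S" "x \<in> carrier R"
  shows "h (\<ominus>\<^bsub>R\<^esub> x) = \<ominus>\<^bsub>S\<^esub> h x"
proof -
  interpret ring_hom_ring R S h by (rule ring_hom_ringI2) (use assms in auto)
  show ?thesis using assms(4) by simp
qed

lemma ring_hom_minus:
  assumes "h \<in> ring_hom R S" "ring R" "ring S" "x \<in> carrier R" "y \<in> carrier R"
  shows "h (x \<ominus>\<^bsub>R\<^esub> y) = h x \<ominus>\<^bsub>S\<^esub> h y"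
proof -
  interpret R: ring R by fact
  show ?thesis
    using assms ring_hom_add[OF assms(1), of x "\<ominus>\<^bsub>R\<^esub> y"] ring_hom_uminus[OF assms(1-3)]
    by (simp add: a_minus_def)
qed

theorem tensor_inclusion_inj:
  fixes H :: "('k::comm_ring_1, 'b, 'm) module_scheme" and R :: "('k, 'r) ring_scheme"
    and K :: "('k, 'r1) ring_scheme" and c :: "'b \<Rightarrow> 'i \<Rightarrow> 'k" and S :: "'b set"
  defines "HS \<equiv> H\<lparr>carrier := S\<rparr>"
  assumes H: "scalar_algebra H UNIV" and HS: "scalar_algebra HS A"
    and R: "carrier R = A" and K: "carrier K = UNIV" and S: "S \<subseteq> carrier H"
    and c: "\<And>x y i. x \<in> carrier H \<Longrightarrow> y \<in> carrier H \<Longrightarrow> c (x \<oplus>\<^bsub>H\<^esub> y) i = c x i + c y i"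
      "\<And>r x i. x \<in> carrier H \<Longrightarrow> c (r \<odot>\<^bsub>H\<^esub> x) i = r * c x i"
      "\<And>i j. i \<in> E \<Longrightarrow> c (e i) j = (if i = j then 1 else 0)"
    and e: "e ` E \<subseteq> S" and span: "\<And>x. x \<in> S \<Longrightarrow> x \<in> span_of HS A e E"
  shows "inj_on (tensor_map K H H (\<lambda>y. y) (\<lambda>y. y)) (carrier (tensor R HS HS))"
proof (rule inj_onI)
  interpret h: algebra_pair_hom HS HS A R H H UNIV K "\<lambda>y. y" "\<lambda>y. y" "\<lambda>r. r"
    by (intro algebra_pair_hom.intro algebra_pair.intro algebra_pair_hom_axioms.intro
        algebra_pair_axioms.intro H HS)
      (use S in \<open>auto simp: HS_def R K intro!: ring_hom_memI\<close>)
  fix t t' assume t: "t \<in> carrier h.P.T" "t' \<in> carrier h.P.T" and eq: "h.tmap t = h.tmap t'"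
  have "h.tmap (t \<ominus>\<^bsub>h.P.T\<^esub> t') = h.tmap t \<ominus>\<^bsub>h.P'.T\<^esub> h.tmap t'"
    by (rule ring_hom_minus[OF h.tmap_hom h.P.T.ring_axioms h.P'.T.ring_axioms t])
  also have "\<dots> = \<zero>\<^bsub>h.P'.T\<^esub>"
    using eq ring_hom_closed[OF h.tmap_hom t(2)] by (simp add: a_minus_def h.P'.T.r_neg)
  finally have "h.tmap (t \<ominus>\<^bsub>h.P.T\<^esub> t') = \<zero>\<^bsub>h.P'.T\<^esub>" .
  moreover have "t \<ominus>\<^bsub>h.P.T\<^esub> t' \<in> carrier h.P.T" by (rule h.P.T.minus_closed[OF t])
  ultimately have "t \<ominus>\<^bsub>h.P.T\<^esub> t' = \<zero>\<^bsub>h.P.T\<^esub>"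
    using tensor_inclusion_kernel_trivial[of H S A R K c E e "t \<ominus>\<^bsub>h.P.T\<^esub> t'"] H HS R K S c e span t
    by (simp add: HS_def)
  then show "t = t'" using t by simp
qed

text \<open>This is the uniqueness which the \<open>THE\<close> in \<open>restrict_hopf\<close>
  demands. The ordered monomials span the integral form over \<open>laurent\<close>, and their
  coordinates are defined over all rational functions, so the general criterion applies.\<close>

lemma iotaL_inj: "inj_on \<iota>L (carrier TL)"
proof -
  have "inj_on (tensor_map ring_Cq Uq Uq (\<lambda>y. y) (\<lambda>y. y)) (carrier TL)"
  proof (rule tensor_inclusion_inj[where c = pbw_coord and e = pbw and E = pbw_index, OF scalar_algebra_Uq AI.scalar_algebra_axioms])
    show "SA \<subseteq> carrier Uq" using SA_subset by auto
    show "pbw ` pbw_index \<subseteq> SA" using pbw_SA by auto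
  qed (simp_all add: pbw_coord_add pbw_coord_smult pbw_coord_pbw SA_span)
  then show ?thesis by simp
qed

text \<open>Existence of the restricted coproduct. The lifts are visible on generators, and liftable
  elements are closed under the algebra operations because \<open>\<iota>L\<close> is a homomorphism
  compatible with scalars.\<close>

lemma comult_lift:
  assumes "x \<in> SA"
  shows "\<exists>t\<in>carrier TL. \<iota>L t = comult Uq x"
  using assms
proof (induction rule: SA_induct)
  case one
  show ?case
    using ring_hom_one[OF IH.tmap_hom] ring_hom_one[OF comult_hom(1)] by (intro bexI[of _ "\<one>\<^bsub>TL\<^esub>"]) simp_all
next
  case (hh m)
  have "\<iota>L (IH.P.pure (hh m) (gam (- \<bar>m\<bar>)) \<oplus>\<^bsub>TL\<^esub> IH.P.pure (gam \<bar>m\<bar>) (hh m)) =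
      uq_pure (hh m) (gam (- \<bar>m\<bar>)) \<oplus>\<^bsub>Uq_tensor\<^esub> uq_pure (gam \<bar>m\<bar>) (hh m)"
    using hh by (simp add: ring_hom_add[OF IH.tmap_hom] IH.tmap_pure IH.P.pure_closed)
  also have "\<dots> = comult Uq (hh m)"
    using hh by (simp add: hh_eq comult_hom(2,3) TTS.smult_r_distr TT.pure_smult_right flip: TT.pure_smult)
  finally show ?case using hh by (intro bexI) (auto intro!: IH.P.pure_closed)
next
  case (ugen x)
  then have x: "x \<in> gens" "ugen x \<in> SA" by auto
  have "\<iota>L (IH.P.pure (ugen x) (ugen x)) = comult Uq (ugen x)"
    using ugen x by (auto simp: IH.tmap_pure comult_hom(3))
  then show ?case using x by (intro bexI) (auto intro!: IH.P.pure_closed)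
next
  case (add x y)
  then obtain s t where "s \<in> carrier TL" "t \<in> carrier TL" "\<iota>L s = comult Uq x" "\<iota>L t = comult Uq y" by blast
  then show ?case
    using add ring_hom_add[OF IH.tmap_hom] ring_hom_add[OF comult_hom(1)]
    by (intro bexI[of _ "s \<oplus>\<^bsub>TL\<^esub> t"]) (simp_all add: SA_subset)
next
  case (mult x y)
  then obtain s t where "s \<in> carrier TL" "t \<in> carrier TL" "\<iota>L s = comult Uq x" "\<iota>L t = comult Uq y" by blast
  then show ?case
    using mult ring_hom_mult[OF IH.tmap_hom] ring_hom_mult[OF comult_hom(1)]
    by (intro bexI[of _ "s \<otimes>\<^bsub>TL\<^esub> t"]) (simp_all add: SA_subset)
next
  case (smult r x)
  then obtain s where "s \<in> carrier TL" "\<iota>L s = comult Uq x" by blast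
  then show ?case
    using smult IH.tmap_smult[of r s] comult_hom(2)
    by (intro bexI[of _ "r \<odot>\<^bsub>TL\<^esub> s"]) (simp_all add: SA_subset)
qed

lemma comult_int_form_spec:
  assumes "x \<in> SA"
  shows "comult int_form x \<in> carrier TL" "\<iota>L (comult int_form x) = comult Uq x"
proof -
  have "\<exists>!t. t \<in> carrier TL \<and> \<iota>L t = comult Uq x"
    using comult_lift[OF assms] inj_onD[OF iotaL_inj] by metis
  from theI'[OF this] show "comult int_form x \<in> carrier TL" "\<iota>L (comult int_form x) = comult Uq x"
    unfolding comult_int_form by simp_all
qed

text \<open>Laws of the coproduct on the integral form are verified after applying the injective map
  \<open>\<iota>L\<close>, where they become laws of the original coproduct.\<close>

lemma comult_int_form_eqI:
  assumes "x \<in> SA" "t \<in> carrier TL" "\<iota>L t = comult Uq x"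
  shows "comult int_form x = t"
  using inj_onD[OF iotaL_inj _ comult_int_form_spec(1)[OF assms(1)] assms(2)] comult_int_form_spec(2)[OF assms(1)] assms(3)
  by simp

lemma comult_int_form_hom: "comult int_form \<in> ring_hom AI TL"
proof (rule ring_hom_memI)
  fix x y assume "x \<in> carrier AI" "y \<in> carrier AI"
  then have xy: "x \<in> SA" "y \<in> SA" by simp_all
  note c = comult_int_form_spec[OF xy(1)] comult_int_form_spec[OF xy(2)]
  show "comult int_form x \<in> carrier TL" by (rule c)
  show "comult int_form (x \<otimes>\<^bsub>AI\<^esub> y) = comult int_form x \<otimes>\<^bsub>TL\<^esub> comult int_form y"
    using xy c ring_hom_mult[OF IH.tmap_hom] ring_hom_mult[OF comult_hom(1)]
    by (intro comult_int_form_eqI) (simp_all add: SA_subset)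
  show "comult int_form (x \<oplus>\<^bsub>AI\<^esub> y) = comult int_form x \<oplus>\<^bsub>TL\<^esub> comult int_form y"
    using xy c ring_hom_add[OF IH.tmap_hom] ring_hom_add[OF comult_hom(1)]
    by (intro comult_int_form_eqI) (simp_all add: SA_subset)
next
  show "comult int_form \<one>\<^bsub>AI\<^esub> = \<one>\<^bsub>TL\<^esub>"
    using ring_hom_one[OF IH.tmap_hom] ring_hom_one[OF comult_hom(1)]
    by (intro comult_int_form_eqI) simp_all
qed

lemma comult_int_form_smult:
  "r \<in> laurent \<Longrightarrow> x \<in> SA \<Longrightarrow> comult int_form (r \<odot>\<^bsub>Uq_alg\<^esub> x) = r \<odot>\<^bsub>TL\<^esub> comult int_form x"
  using comult_int_form_spec[of x] IH.tmap_smult[of r "comult int_form x"] comult_hom(2)[of x r]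
  by (intro comult_int_form_eqI) (simp_all add: SA_subset)

lemma comult_int_form_hh:
  assumes m: "m \<noteq> 0"
  shows "comult int_form (hh m) = IH.P.pure (hh m) (gam (- \<bar>m\<bar>)) \<oplus>\<^bsub>TL\<^esub> IH.P.pure (gam \<bar>m\<bar>) (hh m)"
proof (rule comult_int_form_eqI)
  have "\<iota>L (IH.P.pure (hh m) (gam (- \<bar>m\<bar>)) \<oplus>\<^bsub>TL\<^esub> IH.P.pure (gam \<bar>m\<bar>) (hh m)) =
      uq_pure (hh m) (gam (- \<bar>m\<bar>)) \<oplus>\<^bsub>Uq_tensor\<^esub> uq_pure (gam \<bar>m\<bar>) (hh m)"
    using m by (simp add: ring_hom_add[OF IH.tmap_hom] IH.tmap_pure IH.P.pure_closed)
  also have "\<dots> = comult Uq (hh m)"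
    using m by (simp add: hh_eq comult_hom(2,3) TTS.smult_r_distr TT.pure_smult_right flip: TT.pure_smult)
  finally show "\<iota>L (IH.P.pure (hh m) (gam (- \<bar>m\<bar>)) \<oplus>\<^bsub>TL\<^esub> IH.P.pure (gam \<bar>m\<bar>) (hh m)) = comult Uq (hh m)" .
qed (use m in \<open>auto intro!: IH.P.pure_closed\<close>)

lemma comult_int_form_ugen:
  assumes "x \<in> {GenLam, GenLam', GenGam, GenGam', GenK, GenK'}"
  shows "comult int_form (ugen x) = IH.P.pure (ugen x) (ugen x)"
proof -
  have x: "x \<in> gens" "ugen x \<in> SA" using assms by auto
  have "\<iota>L (IH.P.pure (ugen x) (ugen x)) = comult Uq (ugen x)"
    using assms x by (auto simp: IH.tmap_pure comult_hom(3))
  then show ?thesis using x by (intro comult_int_form_eqI) (auto intro!: IH.P.pure_closed)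
qed

abbreviation "eps_U \<equiv> uq_ext Cq_alg counit_gen"
abbreviation "S_U \<equiv> uq_ext Uq_op antipode_gen"

lemma eps_U_laurent: "x \<in> SA \<Longrightarrow> eps_U x \<in> laurent"
proof (induction rule: SA_induct)
  case one
  then show ?case using ring_hom_one[OF counit_hom(1)] by simp
next
  case (hh m)
  then show ?case by (simp add: hh_eq counit_hom(2,3))
next
  case (ugen x)
  then show ?case by (auto simp: counit_hom(3))
next
  case (add x y)
  then show ?case using ring_hom_add[OF counit_hom(1)] by (simp add: SA_subset)
next
  case (mult x y)
  then show ?case using ring_hom_mult[OF counit_hom(1)] by (simp add: SA_subset)
next
  case (smult r x)
  then show ?case using counit_hom(2) by (simp add: SA_subset)
qed

lemma S_U_simps:
  "S_U \<one>\<^bsub>Uq_alg\<^esub> = \<one>\<^bsub>Uq_alg\<^esub>"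
  "x \<in> carrier Uq_alg \<Longrightarrow> S_U x \<in> carrier Uq_alg"
  "x \<in> carrier Uq_alg \<Longrightarrow> y \<in> carrier Uq_alg \<Longrightarrow> S_U (x \<oplus>\<^bsub>Uq_alg\<^esub> y) = S_U x \<oplus>\<^bsub>Uq_alg\<^esub> S_U y"
  "x \<in> carrier Uq_alg \<Longrightarrow> y \<in> carrier Uq_alg \<Longrightarrow> S_U (x \<otimes>\<^bsub>Uq_alg\<^esub> y) = S_U y \<otimes>\<^bsub>Uq_alg\<^esub> S_U x"
  "x \<in> carrier Uq_alg \<Longrightarrow> S_U (r \<odot>\<^bsub>Uq_alg\<^esub> x) = r \<odot>\<^bsub>Uq_alg\<^esub> S_U x"
  "g \<in> gens \<Longrightarrow> S_U (ugen g) = antipode_gen g"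
  "m \<noteq> 0 \<Longrightarrow> S_U (hh m) = \<ominus>\<^bsub>Uq_alg\<^esub> hh m"
  using ring_hom_one[OF antipode_hom(1)] ring_hom_closed[OF antipode_hom(1)] ring_hom_add[OF antipode_hom(1), of x y]
    ring_hom_mult[OF antipode_hom(1), of x y] antipode_hom(2)[of x r] antipode_hom(3)[of g]
    antipode_hom(2)[of "ugen (GenH m)" kap] antipode_hom(3)[of "GenH m"]
  by (simp_all add: hh_eq UU.smult_uminus_right)

lemma S_U_SA: "x \<in> SA \<Longrightarrow> S_U x \<in> SA"
proof (induction rule: SA_induct)
  case (ugen x)
  then show ?case by (auto simp: S_U_simps)
qed (simp_all add: S_U_simps SA_subset)

section \<open>Specialization\<close>

lemma ring_int_form: "ring int_form"
  by (rule ring_transfer[OF AI.ring_axioms]) simp_all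

lemma AI_inv: "x \<in> SA \<Longrightarrow> \<ominus>\<^bsub>int_form\<^esub> x = \<ominus>\<^bsub>Uq_alg\<^esub> x"
  using IG.S_a_inv[of x] a_inv_transfer(1)[of int_form AI] by simp

lemma AI_minus: "x \<in> SA \<Longrightarrow> y \<in> SA \<Longrightarrow> x \<ominus>\<^bsub>int_form\<^esub> y = x \<ominus>\<^bsub>Uq_alg\<^esub> y"
  by (simp add: a_minus_def AI_inv)

text \<open>Coordinates of integral elements must be Laurent polynomials before they can be
  evaluated at \<epsilon>.\<close>

lemma pbw_coord_laurent: "x \<in> SA \<Longrightarrow> pbw_coord x j \<in> laurent"
proof -
  assume "x \<in> SA"
  then have "x \<in> pbw_span" by (rule SA_span)
  then show ?thesis
  proof (induction rule: span_of.induct)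
    case zero
    have "pbw_coord (0 \<odot>\<^bsub>Uq_alg\<^esub> \<one>\<^bsub>Uq_alg\<^esub>) j = 0 * pbw_coord \<one>\<^bsub>Uq_alg\<^esub> j" by (rule pbw_coord_smult) simp
    then show ?case by simp
  next
    case (step r i x)
    then show ?case
      using pbw_SA[OF step(2)] pbw_span_closed(4)[OF step(3)]
      by (simp add: pbw_coord_add pbw_coord_smult pbw_coord_pbw SA_subset)
  qed
qed

lemma eps_U_hh: "m \<noteq> 0 \<Longrightarrow> eps_U (hh m) = 0"
  by (simp add: hh_eq counit_hom(2,3))

text \<open>Evaluating Laurent polynomials only requires \<epsilon> to be nonzero, so the
  specialization at 1 and the one at a root of unity are treated together.\<close>

locale specialization =
  fixes \<epsilon> :: complex
  assumes eps_nonzero: "\<epsilon> \<noteq> 0"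
begin

abbreviation "ev \<equiv> laurent_eval \<epsilon>"
abbreviation "cls \<equiv> spec_class \<epsilon>"
abbreviation "Ue \<equiv> U_spec_alg \<epsilon>"

lemma spec_ideal_eq: "spec_ideal \<epsilon> = {(qq - const \<epsilon>) \<odot>\<^bsub>Uq_alg\<^esub> a | a. a \<in> SA}"
  by (simp add: spec_ideal_def)

lemma spec_ideal: "ideal (spec_ideal \<epsilon>) int_form"
proof (rule idealI)
  interpret R: ring int_form by (rule ring_int_form)
  show "ring int_form" by (rule ring_int_form)
  have t: "qq - const \<epsilon> \<in> laurent" by simp
  show "subgroup (spec_ideal \<epsilon>) (add_monoid int_form)"
  proof (rule R.add.subgroupI)
    show "spec_ideal \<epsilon> \<subseteq> carrier int_form" using t by (auto simp: spec_ideal_eq simp del: laurent_diff)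
    have "(qq - const \<epsilon>) \<odot>\<^bsub>Uq_alg\<^esub> \<one>\<^bsub>Uq_alg\<^esub> \<in> spec_ideal \<epsilon>" unfolding spec_ideal_eq using SA_closed(1) by blast
    then show "spec_ideal \<epsilon> \<noteq> {}" by blast
    fix x assume "x \<in> spec_ideal \<epsilon>"
    then obtain a where a: "a \<in> SA" "x = (qq - const \<epsilon>) \<odot>\<^bsub>Uq_alg\<^esub> a" unfolding spec_ideal_eq by blast
    have "\<ominus>\<^bsub>int_form\<^esub> x = (qq - const \<epsilon>) \<odot>\<^bsub>Uq_alg\<^esub> (\<ominus>\<^bsub>Uq_alg\<^esub> a)"
      using a t by (simp add: AI_inv UU.smult_uminus_right SA_subset)
    then show "\<ominus>\<^bsub>int_form\<^esub> x \<in> spec_ideal \<epsilon>" unfolding spec_ideal_eq using a SA_closed(5) by blast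
    fix y assume "y \<in> spec_ideal \<epsilon>"
    then obtain b where b: "b \<in> SA" "y = (qq - const \<epsilon>) \<odot>\<^bsub>Uq_alg\<^esub> b" unfolding spec_ideal_eq by blast
    have "x \<oplus>\<^bsub>int_form\<^esub> y = (qq - const \<epsilon>) \<odot>\<^bsub>Uq_alg\<^esub> (a \<oplus>\<^bsub>Uq_alg\<^esub> b)"
      using a b by (simp add: UU.smult_r_distr SA_subset)
    then show "x \<oplus>\<^bsub>int_form\<^esub> y \<in> spec_ideal \<epsilon>" unfolding spec_ideal_eq using SA_closed(3)[OF a(1) b(1)] by blast
  qed
  fix x y assume "x \<in> spec_ideal \<epsilon>" and y: "y \<in> carrier int_form"
  then obtain a where a: "a \<in> SA" "x = (qq - const \<epsilon>) \<odot>\<^bsub>Uq_alg\<^esub> a" unfolding spec_ideal_eq by blast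
  have "y \<otimes>\<^bsub>int_form\<^esub> x = (qq - const \<epsilon>) \<odot>\<^bsub>Uq_alg\<^esub> (y \<otimes>\<^bsub>Uq_alg\<^esub> a)"
    "x \<otimes>\<^bsub>int_form\<^esub> y = (qq - const \<epsilon>) \<odot>\<^bsub>Uq_alg\<^esub> (a \<otimes>\<^bsub>Uq_alg\<^esub> y)"
    using a y by (simp_all add: UU.smult_mult_left UU.smult_mult_right SA_subset)
  moreover have "y \<otimes>\<^bsub>Uq_alg\<^esub> a \<in> SA" "a \<otimes>\<^bsub>Uq_alg\<^esub> y \<in> SA" using a y by simp_all
  ultimately show "y \<otimes>\<^bsub>int_form\<^esub> x \<in> spec_ideal \<epsilon>" "x \<otimes>\<^bsub>int_form\<^esub> y \<in> spec_ideal \<epsilon>"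
    unfolding spec_ideal_eq by blast+
qed

lemma cls_eq_iff: "a \<in> SA \<Longrightarrow> b \<in> SA \<Longrightarrow> cls a = cls b \<longleftrightarrow> (\<exists>d\<in>SA. a \<ominus>\<^bsub>Uq_alg\<^esub> b = (qq - const \<epsilon>) \<odot>\<^bsub>Uq_alg\<^esub> d)"
  using ring.quotient_eq_iff_same_a_r_cos[OF ring_int_form spec_ideal, of a b]
  by (simp add: spec_class_def AI_minus) (auto simp: spec_ideal_eq)

lemma Ue_carrier: "carrier Ue = cls ` SA"
  by (auto simp: U_spec_alg_def Let_def FactRing_def A_RCOSETS_def' spec_class_def)

lemma cls_closed [simp]: "a \<in> SA \<Longrightarrow> cls a \<in> carrier Ue"
  by (simp add: Ue_carrier)

lemma Ue_add: "a \<in> SA \<Longrightarrow> b \<in> SA \<Longrightarrow> cls a \<oplus>\<^bsub>Ue\<^esub> cls b = cls (a \<oplus>\<^bsub>Uq_alg\<^esub> b)"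
  using ideal.a_rcos_sum[OF spec_ideal, of a b]
  by (simp add: U_spec_alg_def Let_def FactRing_def spec_class_def)

lemma Ue_mult: "a \<in> SA \<Longrightarrow> b \<in> SA \<Longrightarrow> cls a \<otimes>\<^bsub>Ue\<^esub> cls b = cls (a \<otimes>\<^bsub>Uq_alg\<^esub> b)"
  using ideal.rcoset_mult_add[OF spec_ideal, of a b]
  by (simp add: U_spec_alg_def Let_def FactRing_def spec_class_def)

lemma Ue_one: "\<one>\<^bsub>Ue\<^esub> = cls \<one>\<^bsub>Uq_alg\<^esub>"
  by (simp add: U_spec_alg_def Let_def FactRing_def spec_class_def)

lemma Ue_zero: "\<zero>\<^bsub>Ue\<^esub> = cls \<zero>\<^bsub>Uq_alg\<^esub>"
  using ring.a_rcos_zero[OF ring_int_form spec_ideal additive_subgroup.zero_closed[OF ideal.axioms(1)[OF spec_ideal]]]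
  by (simp add: U_spec_alg_def Let_def FactRing_def spec_class_def)

text \<open>The difference between a Laurent polynomial and its value at \<epsilon> is a multiple of
  \<open>qq - const \<epsilon>\<close>. Hence scalars act on classes through their values.\<close>

lemma cls_smult:
  assumes "r \<in> laurent" "a \<in> SA"
  shows "cls (r \<odot>\<^bsub>Uq_alg\<^esub> a) = cls (const (ev r) \<odot>\<^bsub>Uq_alg\<^esub> a)"
proof -
  have "ev (r - const (ev r)) = 0"
    using assms eps_nonzero by (simp add: laurent_eval_diff)
  then obtain g where g: "g \<in> laurent" "r - const (ev r) = (qq - const \<epsilon>) * g"
    using laurent_eval_0_dvd[OF eps_nonzero, of "r - const (ev r)"] assms by auto
  have "r \<odot>\<^bsub>Uq_alg\<^esub> a \<ominus>\<^bsub>Uq_alg\<^esub> const (ev r) \<odot>\<^bsub>Uq_alg\<^esub> a = (qq - const \<epsilon>) \<odot>\<^bsub>Uq_alg\<^esub> (g \<odot>\<^bsub>Uq_alg\<^esub> a)"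
    using assms by (simp add: SA_subset g(2) flip: UU.smult_minus_left UU.smult_assoc1)
  then show ?thesis using assms g by (subst cls_eq_iff) auto
qed

lemma Ue_smult: "a \<in> SA \<Longrightarrow> c \<odot>\<^bsub>Ue\<^esub> cls a = cls (const c \<odot>\<^bsub>Uq_alg\<^esub> a)"
proof -
  assume a: "a \<in> SA"
  have "c \<odot>\<^bsub>Ue\<^esub> cls a = cls (const c \<odot>\<^bsub>Uq_alg\<^esub> \<one>\<^bsub>Uq_alg\<^esub>) \<otimes>\<^bsub>Ue\<^esub> cls a"
    by (simp add: U_spec_alg_def Let_def)
  then show ?thesis using a by (simp add: Ue_mult UU.smult_mult_left SA_subset)
qed

lemma cls_smult_laurent: "r \<in> laurent \<Longrightarrow> a \<in> SA \<Longrightarrow> cls (r \<odot>\<^bsub>Uq_alg\<^esub> a) = ev r \<odot>\<^bsub>Ue\<^esub> cls a"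
  by (simp only: Ue_smult) (rule cls_smult)

lemma ring_Ue: "ring Ue"
  by (rule ring_transfer[OF ideal.quotient_is_ring[OF spec_ideal]]) (simp_all add: U_spec_alg_def Let_def)

lemma scalar_algebra_Ue: "scalar_algebra Ue UNIV"
proof -
  interpret R: ring Ue by (rule ring_Ue)
  show ?thesis
  proof unfold_locales
    fix c d x y assume "x \<in> carrier Ue" "y \<in> carrier Ue"
    then obtain a b where ab: "x = cls a" "y = cls b" "a \<in> SA" "b \<in> SA" unfolding Ue_carrier by blast
    note s = ab Ue_smult Ue_add Ue_mult SA_subset const_simps UU.smult_l_distr UU.smult_r_distr UU.smult_assoc1
      UU.smult_mult_left UU.smult_mult_right
    show "c \<odot>\<^bsub>Ue\<^esub> x \<in> carrier Ue" "(c + d) \<odot>\<^bsub>Ue\<^esub> x = c \<odot>\<^bsub>Ue\<^esub> x \<oplus>\<^bsub>Ue\<^esub> d \<odot>\<^bsub>Ue\<^esub> x"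
      "c \<odot>\<^bsub>Ue\<^esub> (x \<oplus>\<^bsub>Ue\<^esub> y) = c \<odot>\<^bsub>Ue\<^esub> x \<oplus>\<^bsub>Ue\<^esub> c \<odot>\<^bsub>Ue\<^esub> y"
      "(c * d) \<odot>\<^bsub>Ue\<^esub> x = c \<odot>\<^bsub>Ue\<^esub> (d \<odot>\<^bsub>Ue\<^esub> x)" "1 \<odot>\<^bsub>Ue\<^esub> x = x"
      "c \<odot>\<^bsub>Ue\<^esub> x \<otimes>\<^bsub>Ue\<^esub> y = c \<odot>\<^bsub>Ue\<^esub> (x \<otimes>\<^bsub>Ue\<^esub> y)" "x \<otimes>\<^bsub>Ue\<^esub> (c \<odot>\<^bsub>Ue\<^esub> y) = c \<odot>\<^bsub>Ue\<^esub> (x \<otimes>\<^bsub>Ue\<^esub> y)"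
      by (simp_all add: s)
  qed simp_all
qed

sublocale Ue: scalar_algebra Ue UNIV
  by (rule scalar_algebra_Ue)

lemma cls_hom: "cls \<in> ring_hom AI Ue"
  by (rule ring_hom_memI) (simp_all add: Ue_mult Ue_add Ue_one)

lemma cls_minus: "a \<in> SA \<Longrightarrow> b \<in> SA \<Longrightarrow> cls (a \<ominus>\<^bsub>Uq_alg\<^esub> b) = cls a \<ominus>\<^bsub>Ue\<^esub> cls b"
  using ring_hom_minus[OF cls_hom AI.ring_axioms ring_Ue, of a b] AI_minus[of a b] a_inv_transfer(2)[of int_form AI]
  by simp

lemma cls_uminus: "a \<in> SA \<Longrightarrow> cls (\<ominus>\<^bsub>Uq_alg\<^esub> a) = \<ominus>\<^bsub>Ue\<^esub> cls a"
  using ring_hom_uminus[OF cls_hom AI.ring_axioms ring_Ue, of a] AI_inv[of a] a_inv_transfer(1)[of int_form AI]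
  by simp

lemma Ue_induct [consumes 1, case_names one hh ugen add mult smult]:
  assumes "x \<in> carrier Ue" and "P \<one>\<^bsub>Ue\<^esub>" and "\<And>m. m \<noteq> 0 \<Longrightarrow> P (cls (hh m))"
    and "\<And>x. x \<in> {GenLam, GenLam', GenGam, GenGam', GenK, GenK'} \<Longrightarrow> P (cls (ugen x))"
    and "\<And>x y. x \<in> carrier Ue \<Longrightarrow> y \<in> carrier Ue \<Longrightarrow> P x \<Longrightarrow> P y \<Longrightarrow> P (x \<oplus>\<^bsub>Ue\<^esub> y)"
    and "\<And>x y. x \<in> carrier Ue \<Longrightarrow> y \<in> carrier Ue \<Longrightarrow> P x \<Longrightarrow> P y \<Longrightarrow> P (x \<otimes>\<^bsub>Ue\<^esub> y)"
    and "\<And>c x. x \<in> carrier Ue \<Longrightarrow> P x \<Longrightarrow> P (c \<odot>\<^bsub>Ue\<^esub> x)"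
  shows "P x"
proof -
  obtain a where a: "x = cls a" "a \<in> SA" using assms(1) unfolding Ue_carrier by blast
  have "P (cls a)" using a(2)
  proof (induction rule: SA_induct)
    case one
    then show ?case using assms(2) by (simp add: Ue_one)
  next
    case (add x y)
    then show ?case using assms(5)[of "cls x" "cls y"] by (simp add: Ue_add)
  next
    case (mult x y)
    then show ?case using assms(6)[of "cls x" "cls y"] by (simp add: Ue_mult)
  next
    case (smult r x)
    then show ?case using assms(7)[of "cls x" "ev r"] by (simp add: cls_smult_laurent)
  next
    case (hh m)
    then show ?case by (rule assms(3))
  next
    case (ugen x)
    then show ?case by (rule assms(4))
  qed
  then show ?thesis using a by simp
qed

lemma the_elem_cls:
  fixes h :: "uq \<Rightarrow> 'z"
  assumes "a \<in> SA" "\<And>d. d \<in> SA \<Longrightarrow> h ((qq - const \<epsilon>) \<odot>\<^bsub>Uq_alg\<^esub> d \<oplus>\<^bsub>Uq_alg\<^esub> a) = h a"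
  shows "the_elem (h ` cls a) = h a"
  unfolding spec_class_def
  by (rule ideal.the_elem_coset[OF spec_ideal]) (use assms in \<open>auto simp: spec_ideal_eq\<close>)

lemma ev_linear: "ev (qq - const \<epsilon>) = 0"
  using eps_nonzero by (simp add: laurent_eval_diff)

text \<open>Coordinates modulo q - \<epsilon>: those of
  \<open>(qq - const \<epsilon>) \<odot> d\<close> evaluate to zero, so evaluated coordinates depend
  only on the class. They are dual to the classes of the monomials, which therefore remain
  independent after specialization.\<close>

definition "spec_coord U j = the_elem ((\<lambda>a. ev (pbw_coord a j)) ` U)"

lemma spec_coord_cls: "a \<in> SA \<Longrightarrow> spec_coord (cls a) j = ev (pbw_coord a j)"
  unfolding spec_coord_def
  by (rule the_elem_cls)
    (simp_all add: pbw_coord_add pbw_coord_smult SA_subset laurent_eval_add laurent_eval_mult eps_nonzero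
      pbw_coord_laurent ev_linear)

lemma spec_coord_add: "x \<in> carrier Ue \<Longrightarrow> y \<in> carrier Ue \<Longrightarrow> spec_coord (x \<oplus>\<^bsub>Ue\<^esub> y) j = spec_coord x j + spec_coord y j"
  unfolding Ue_carrier
  by (auto simp: Ue_add spec_coord_cls pbw_coord_add SA_subset laurent_eval_add eps_nonzero pbw_coord_laurent)

lemma spec_coord_smult: "x \<in> carrier Ue \<Longrightarrow> spec_coord (c \<odot>\<^bsub>Ue\<^esub> x) j = c * spec_coord x j"
  unfolding Ue_carrier
  by (auto simp: Ue_smult spec_coord_cls pbw_coord_smult SA_subset laurent_eval_mult eps_nonzero pbw_coord_laurent)

lemma spec_coord_pbw: "i \<in> pbw_index \<Longrightarrow> spec_coord (cls (pbw i)) j = (if i = j then 1 else 0)"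
  by (simp add: spec_coord_cls pbw_SA pbw_coord_pbw eps_nonzero)

lemma cls_pbw_image: "(\<lambda>i. cls (pbw i)) ` pbw_index \<subseteq> carrier Ue"
  using pbw_SA by auto

lemma Ue_span: "x \<in> carrier Ue \<Longrightarrow> x \<in> span_of Ue UNIV (\<lambda>i. cls (pbw i)) pbw_index"
proof -
  assume "x \<in> carrier Ue"
  then obtain a where a: "x = cls a" "a \<in> SA" unfolding Ue_carrier by blast
  from SA_span[OF a(2)] have "cls a \<in> span_of Ue UNIV (\<lambda>i. cls (pbw i)) pbw_index"
  proof (induction rule: span_of.induct)
    case zero
    show ?case using span_of.zero[of Ue] by (simp add: Ue_zero)
  next
    case (step r i y)
    have "cls (r \<odot>\<^bsub>AI\<^esub> pbw i \<oplus>\<^bsub>AI\<^esub> y) = ev r \<odot>\<^bsub>Ue\<^esub> cls (pbw i) \<oplus>\<^bsub>Ue\<^esub> cls y"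
      using step pbw_SA[OF step(2)] pbw_span_closed(4)[OF step(3)] by (simp add: cls_smult_laurent flip: Ue_add)
    then show ?case using span_of.step[OF _ step(2) step.IH, of "ev r"] by simp
  qed
  then show ?thesis using a by simp
qed

lemma U_spec_simps [simp]:
  "carrier (U_spec \<epsilon>) = carrier Ue" "monoid.mult (U_spec \<epsilon>) = monoid.mult Ue" "one (U_spec \<epsilon>) = one Ue"
  "ring.zero (U_spec \<epsilon>) = ring.zero Ue" "add (U_spec \<epsilon>) = add Ue" "module.smult (U_spec \<epsilon>) = module.smult Ue"
  by (simp_all add: U_spec_def add_hopf_def)

sublocale ST: algebra_pair_hom AI AI laurent ring_L Ue Ue UNIV ring_C cls cls ev
proof (intro algebra_pair_hom.intro algebra_pair.intro algebra_pair_hom_axioms.intro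
    algebra_pair_axioms.intro AI.scalar_algebra_axioms scalar_algebra_Ue cls_hom)
qed (simp_all add: cls_smult_laurent)

abbreviation "TU \<equiv> tensor ring_C Ue Ue"

sublocale TUS: scalar_algebra TU UNIV
  by (rule ST.P'.scalar_algebra_T)

text \<open>The coproduct of a multiple of \<open>qq - const \<epsilon>\<close> is again such a
  multiple in the tensor square over \<open>laurent\<close>, and passing to the specialized tensor
  square evaluates this scalar to zero. The choice of a lift is thus immaterial.\<close>

lemma comult_cls:
  assumes a: "a \<in> SA"
  shows "comult (U_spec \<epsilon>) (cls a) = ST.tmap (comult int_form a)"
proof -
  have "comult (U_spec \<epsilon>) (cls a) = the_elem ((\<lambda>a. ST.tmap (comult int_form a)) ` cls a)"
    by (simp add: U_spec_def add_hopf_def)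
  also have "\<dots> = ST.tmap (comult int_form a)"
  proof (rule the_elem_cls[OF a])
    fix d assume d: "d \<in> SA"
    note c = comult_int_form_spec(1)[OF d] comult_int_form_spec(1)[OF a]
    have "comult int_form ((qq - const \<epsilon>) \<odot>\<^bsub>Uq_alg\<^esub> d \<oplus>\<^bsub>Uq_alg\<^esub> a) =
        (qq - const \<epsilon>) \<odot>\<^bsub>TL\<^esub> comult int_form d \<oplus>\<^bsub>TL\<^esub> comult int_form a"
      using ring_hom_add[OF comult_int_form_hom, of "(qq - const \<epsilon>) \<odot>\<^bsub>Uq_alg\<^esub> d" a] d a
      by (simp add: comult_int_form_smult)
    then show "ST.tmap (comult int_form ((qq - const \<epsilon>) \<odot>\<^bsub>Uq_alg\<^esub> d \<oplus>\<^bsub>Uq_alg\<^esub> a)) = ST.tmap (comult int_form a)"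
      using c by (simp add: ring_hom_add[OF ST.tmap_hom] ST.tmap_smult ev_linear ring_hom_closed[OF ST.tmap_hom])
  qed
  finally show ?thesis .
qed

lemma comult_spec_hom: "comult (U_spec \<epsilon>) \<in> ring_hom Ue TU"
proof (rule ring_hom_memI)
  fix x y assume "x \<in> carrier Ue" "y \<in> carrier Ue"
  then obtain a b where ab: "x = cls a" "y = cls b" "a \<in> SA" "b \<in> SA" unfolding Ue_carrier by blast
  note c = comult_int_form_spec(1)[OF ab(3)] comult_int_form_spec(1)[OF ab(4)]
  show "comult (U_spec \<epsilon>) x \<in> carrier TU"
    using ab c ring_hom_closed[OF ST.tmap_hom] by (simp add: comult_cls)
  show "comult (U_spec \<epsilon>) (x \<otimes>\<^bsub>Ue\<^esub> y) = comult (U_spec \<epsilon>) x \<otimes>\<^bsub>TU\<^esub> comult (U_spec \<epsilon>) y"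
    using ab c ring_hom_mult[OF comult_int_form_hom, of a b]
    by (simp add: comult_cls Ue_mult ring_hom_mult[OF ST.tmap_hom])
  show "comult (U_spec \<epsilon>) (x \<oplus>\<^bsub>Ue\<^esub> y) = comult (U_spec \<epsilon>) x \<oplus>\<^bsub>TU\<^esub> comult (U_spec \<epsilon>) y"
    using ab c ring_hom_add[OF comult_int_form_hom, of a b]
    by (simp add: comult_cls Ue_add ring_hom_add[OF ST.tmap_hom])
next
  show "comult (U_spec \<epsilon>) \<one>\<^bsub>Ue\<^esub> = \<one>\<^bsub>TU\<^esub>"
    using ring_hom_one[OF comult_int_form_hom] ring_hom_one[OF ST.tmap_hom]
    by (simp add: Ue_one comult_cls)
qed

lemma comult_spec_smult: "x \<in> carrier Ue \<Longrightarrow> comult (U_spec \<epsilon>) (c \<odot>\<^bsub>Ue\<^esub> x) = c \<odot>\<^bsub>TU\<^esub> comult (U_spec \<epsilon>) x"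
  unfolding Ue_carrier
  by (auto simp: Ue_smult comult_cls comult_int_form_smult ST.tmap_smult comult_int_form_spec(1) eps_nonzero)

lemma comult_spec_hh: "m \<noteq> 0 \<Longrightarrow> comult (U_spec \<epsilon>) (cls (hh m)) =
    ST.P'.pure (cls (hh m)) (cls (gam (- \<bar>m\<bar>))) \<oplus>\<^bsub>TU\<^esub> ST.P'.pure (cls (gam \<bar>m\<bar>)) (cls (hh m))"
  by (simp add: comult_cls comult_int_form_hh ring_hom_add[OF ST.tmap_hom] ST.tmap_pure IH.P.pure_closed)

lemma comult_spec_ugen: "x \<in> {GenLam, GenLam', GenGam, GenGam', GenK, GenK'} \<Longrightarrow>
    comult (U_spec \<epsilon>) (cls (ugen x)) = ST.P'.pure (cls (ugen x)) (cls (ugen x))"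
  by (subst comult_cls; auto simp: comult_int_form_ugen ST.tmap_pure)

lemma counit_cls:
  assumes a: "a \<in> SA"
  shows "counit (U_spec \<epsilon>) (cls a) = ev (eps_U a)"
proof -
  have "counit (U_spec \<epsilon>) (cls a) = the_elem ((\<lambda>a. ev (eps_U a)) ` cls a)"
    by (simp add: U_spec_def add_hopf_def)
  also have "\<dots> = ev (eps_U a)"
    using ring_hom_add[OF counit_hom(1)] counit_hom(2)
    by (intro the_elem_cls[OF a])
      (simp add: a SA_subset laurent_eval_add laurent_eval_mult eps_nonzero eps_U_laurent ev_linear)
  finally show ?thesis .
qed

lemma counit_spec:
  "x \<in> carrier Ue \<Longrightarrow> y \<in> carrier Ue \<Longrightarrow> counit (U_spec \<epsilon>) (x \<oplus>\<^bsub>Ue\<^esub> y) = counit (U_spec \<epsilon>) x + counit (U_spec \<epsilon>) y"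
  "x \<in> carrier Ue \<Longrightarrow> y \<in> carrier Ue \<Longrightarrow> counit (U_spec \<epsilon>) (x \<otimes>\<^bsub>Ue\<^esub> y) = counit (U_spec \<epsilon>) x * counit (U_spec \<epsilon>) y"
  "x \<in> carrier Ue \<Longrightarrow> counit (U_spec \<epsilon>) (c \<odot>\<^bsub>Ue\<^esub> x) = c * counit (U_spec \<epsilon>) x"
  "counit (U_spec \<epsilon>) \<one>\<^bsub>Ue\<^esub> = 1"
  "m \<noteq> 0 \<Longrightarrow> counit (U_spec \<epsilon>) (cls (hh m)) = 0"
  "g \<in> {GenLam, GenLam', GenGam, GenGam', GenK, GenK'} \<Longrightarrow> counit (U_spec \<epsilon>) (cls (ugen g)) = 1"
  using ring_hom_add[OF counit_hom(1)] ring_hom_mult[OF counit_hom(1)] counit_hom(2) ring_hom_one[OF counit_hom(1)]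
    counit_hom(3)[of g]
  unfolding Ue_carrier
  by (auto simp: Ue_add Ue_mult Ue_smult Ue_one counit_cls SA_subset laurent_eval_add laurent_eval_mult eps_nonzero eps_U_laurent
      eps_U_hh)

lemma antipode_cls:
  assumes a: "a \<in> SA"
  shows "antipode (U_spec \<epsilon>) (cls a) = cls (S_U a)"
proof -
  have "antipode (U_spec \<epsilon>) (cls a) = the_elem ((\<lambda>a. cls (S_U a)) ` cls a)"
    by (simp add: U_spec_def add_hopf_def)
  also have "\<dots> = cls (S_U a)"
    by (intro the_elem_cls[OF a])
      (simp add: a SA_subset S_U_simps S_U_SA cls_smult_laurent ev_linear flip: Ue_add)
  finally show ?thesis .
qed

lemma antipode_spec:
  "x \<in> carrier Ue \<Longrightarrow> antipode (U_spec \<epsilon>) x \<in> carrier Ue"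
  "x \<in> carrier Ue \<Longrightarrow> y \<in> carrier Ue \<Longrightarrow> antipode (U_spec \<epsilon>) (x \<oplus>\<^bsub>Ue\<^esub> y) = antipode (U_spec \<epsilon>) x \<oplus>\<^bsub>Ue\<^esub> antipode (U_spec \<epsilon>) y"
  "x \<in> carrier Ue \<Longrightarrow> y \<in> carrier Ue \<Longrightarrow> antipode (U_spec \<epsilon>) (x \<otimes>\<^bsub>Ue\<^esub> y) = antipode (U_spec \<epsilon>) y \<otimes>\<^bsub>Ue\<^esub> antipode (U_spec \<epsilon>) x"
  "x \<in> carrier Ue \<Longrightarrow> antipode (U_spec \<epsilon>) (c \<odot>\<^bsub>Ue\<^esub> x) = c \<odot>\<^bsub>Ue\<^esub> antipode (U_spec \<epsilon>) x"
  "antipode (U_spec \<epsilon>) \<one>\<^bsub>Ue\<^esub> = \<one>\<^bsub>Ue\<^esub>"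
  "m \<noteq> 0 \<Longrightarrow> antipode (U_spec \<epsilon>) (cls (hh m)) = \<ominus>\<^bsub>Ue\<^esub> cls (hh m)"
  "g \<in> {GenLam, GenLam', GenGam, GenGam', GenK, GenK'} \<Longrightarrow> antipode (U_spec \<epsilon>) (cls (ugen g)) = cls (antipode_gen g)"
  unfolding Ue_carrier
  by (auto simp: Ue_add Ue_mult Ue_smult Ue_one antipode_cls SA_subset S_U_simps S_U_SA cls_uminus)

end

section \<open>Central elements and the Poisson bracket\<close>

lemma inverse_cancel:
  fixes a b :: "'a::field"
  shows "b \<noteq> 0 \<Longrightarrow> inverse a * inverse b * b = inverse a" "a \<noteq> 0 \<Longrightarrow> inverse a * inverse b * a = inverse b"
  by (simp_all add: field_simps)

text \<open>The pair (1, 1) satisfies the assumptions too. All results on the bracket are thereby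
  available both for \<open>Z_root\<close> and for \<open>Z_one\<close>.\<close>

locale poisson_specialization = specialization +
  fixes l :: nat
  assumes l_pos: "l > 0" and eps_power: "\<epsilon> ^ l = 1"
begin

definition "den = of_nat l * (qq powi int l - qq powi (- int l))"

text \<open>The zero of the denominator at \<epsilon> is simple: after clearing negative powers, its
  derivative at \<epsilon> is a nonzero multiple of a power of \<epsilon>, and by the product rule
  this derivative equals the value of the cofactor \<open>p\<close>.\<close>

lemma den_factor: "\<exists>p. poly p \<epsilon> \<noteq> 0 \<and> den * qq ^ l = (qq - const \<epsilon>) * poly_ratfun p"
proof -
  \<comment> \<open>\<open>P\<close> is \<open>den * qq ^ l\<close> written as a polynomial.\<close>
  define P :: "complex poly" where "P = smult (of_nat l) (monom 1 (2 * l) - 1)"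
  have "poly P \<epsilon> = 0"
    using eps_power by (simp add: P_def poly_monom power_mult mult.commute[of 2])
  then obtain p where p: "P = [:- \<epsilon>, 1:] * p" unfolding poly_eq_0_iff_dvd by (auto elim: dvdE)
  have "poly (pderiv P) \<epsilon> = of_nat l * (of_nat (2 * l) * \<epsilon> ^ (2 * l - 1))"
    by (simp add: P_def pderiv_smult pderiv_diff pderiv_monom poly_monom)
  moreover have "poly (pderiv P) \<epsilon> = poly p \<epsilon>"
    unfolding p pderiv_mult by (simp add: pderiv_pCons)
  ultimately have "poly p \<epsilon> \<noteq> 0" using l_pos eps_nonzero by auto
  moreover have "den * qq ^ l = (qq - const \<epsilon>) * poly_ratfun p"
  proof -
    have "den * qq ^ l = of_nat l * (qq ^ l * qq ^ l - 1)"
      by (simp add: den_def power_int_minus algebra_simps)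
    also have "\<dots> = of_nat l * (qq ^ (2 * l) - 1)"
      by (simp add: mult_2 power_add)
    also have "\<dots> = poly_ratfun P"
    proof -
      have "P = [:of_nat l:] * (monom 1 (2 * l) - 1)" by (simp add: P_def)
      then show ?thesis
        by (simp only: poly_ratfun_simps poly_ratfun_diff poly_ratfun_monom poly_ratfun_const const_of_nat)
    qed
    finally show ?thesis unfolding p by (simp only: poly_ratfun_simps poly_ratfun_linear)
  qed
  ultimately show ?thesis by blast
qed

lemma den_nonzero [simp]: "den \<noteq> 0"
proof
  assume "den = 0"
  obtain p where p: "poly p \<epsilon> \<noteq> 0" "den * qq ^ l = (qq - const \<epsilon>) * poly_ratfun p"
    using den_factor by blast
  then have "poly_ratfun ([:- \<epsilon>, 1:] * p) = poly_ratfun 0"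
    using \<open>den = 0\<close> by (simp only: poly_ratfun_simps poly_ratfun_linear) simp
  then have "[:- \<epsilon>, 1:] * p = 0" by (simp only: poly_ratfun_eq_iff)
  then have "p = 0" by (metis mult_eq_0_iff one_neq_zero pCons_eq_0_iff)
  then show False using p by simp
qed

abbreviation "red \<equiv> reduces_to \<epsilon>"

lemma red_iff: "red b W \<longleftrightarrow> (\<exists>p. poly p \<epsilon> \<noteq> 0 \<and> poly_ratfun p \<odot>\<^bsub>Uq_alg\<^esub> b \<in> SA \<and>
    W = inverse (poly p \<epsilon>) \<odot>\<^bsub>Ue\<^esub> cls (poly_ratfun p \<odot>\<^bsub>Uq_alg\<^esub> b))"
  by (simp add: reduces_to_def poly_ratfun_def)

lemma ev_poly: "ev (poly_ratfun p) = poly p \<epsilon>"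
  using eps_nonzero by (rule laurent_eval_poly)

lemma red_closed: "red b W \<Longrightarrow> W \<in> carrier Ue"
  unfolding red_iff by auto

text \<open>Two clearing polynomials are compared on the product of both with \<open>b\<close>. Its
  class is p'(\<epsilon>) times the one class and p(\<epsilon>) times the other, and both values may
  be divided by.\<close>

lemma red_unique:
  assumes b: "b \<in> carrier Uq_alg" and "red b W" "red b W'"
  shows "W = W'"
proof -
  obtain p p' where p: "poly p \<epsilon> \<noteq> 0" "poly_ratfun p \<odot>\<^bsub>Uq_alg\<^esub> b \<in> SA" "W = inverse (poly p \<epsilon>) \<odot>\<^bsub>Ue\<^esub> cls (poly_ratfun p \<odot>\<^bsub>Uq_alg\<^esub> b)"
    and p': "poly p' \<epsilon> \<noteq> 0" "poly_ratfun p' \<odot>\<^bsub>Uq_alg\<^esub> b \<in> SA" "W' = inverse (poly p' \<epsilon>) \<odot>\<^bsub>Ue\<^esub> cls (poly_ratfun p' \<odot>\<^bsub>Uq_alg\<^esub> b)"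
    using assms(2,3) unfolding red_iff by blast
  define C C' where "C = cls (poly_ratfun p \<odot>\<^bsub>Uq_alg\<^esub> b)" and "C' = cls (poly_ratfun p' \<odot>\<^bsub>Uq_alg\<^esub> b)"
  have c: "C \<in> carrier Ue" "C' \<in> carrier Ue" using p p' by (simp_all add: C_def C'_def)
  have "poly p' \<epsilon> \<odot>\<^bsub>Ue\<^esub> C = cls (poly_ratfun p' \<odot>\<^bsub>Uq_alg\<^esub> (poly_ratfun p \<odot>\<^bsub>Uq_alg\<^esub> b))"
    using p by (simp add: cls_smult_laurent ev_poly C_def)
  also have "\<dots> = cls (poly_ratfun p \<odot>\<^bsub>Uq_alg\<^esub> (poly_ratfun p' \<odot>\<^bsub>Uq_alg\<^esub> b))"
    using b by (simp add: UU.smult_commute)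
  also have "\<dots> = poly p \<epsilon> \<odot>\<^bsub>Ue\<^esub> C'"
    using p' by (simp add: cls_smult_laurent ev_poly C'_def)
  finally have "(inverse (poly p \<epsilon>) * inverse (poly p' \<epsilon>)) \<odot>\<^bsub>Ue\<^esub> (poly p' \<epsilon> \<odot>\<^bsub>Ue\<^esub> C) =
      (inverse (poly p \<epsilon>) * inverse (poly p' \<epsilon>)) \<odot>\<^bsub>Ue\<^esub> (poly p \<epsilon> \<odot>\<^bsub>Ue\<^esub> C')" by simp
  then have "inverse (poly p \<epsilon>) \<odot>\<^bsub>Ue\<^esub> C = inverse (poly p' \<epsilon>) \<odot>\<^bsub>Ue\<^esub> C'"
    using c p(1) p'(1) by (simp add: inverse_cancel flip: Ue.smult_assoc1)
  then show ?thesis by (simp add: p(3) p'(3) C_def C'_def)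
qed

lemma red_add:
  assumes b: "b \<in> carrier Uq_alg" "b' \<in> carrier Uq_alg" and "red b W" "red b' W'"
  shows "red (b \<oplus>\<^bsub>Uq_alg\<^esub> b') (W \<oplus>\<^bsub>Ue\<^esub> W')"
proof -
  obtain p p' where p: "poly p \<epsilon> \<noteq> 0" "poly_ratfun p \<odot>\<^bsub>Uq_alg\<^esub> b \<in> SA" "W = inverse (poly p \<epsilon>) \<odot>\<^bsub>Ue\<^esub> cls (poly_ratfun p \<odot>\<^bsub>Uq_alg\<^esub> b)"
    and p': "poly p' \<epsilon> \<noteq> 0" "poly_ratfun p' \<odot>\<^bsub>Uq_alg\<^esub> b' \<in> SA" "W' = inverse (poly p' \<epsilon>) \<odot>\<^bsub>Ue\<^esub> cls (poly_ratfun p' \<odot>\<^bsub>Uq_alg\<^esub> b')"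
    using assms(3,4) unfolding red_iff by blast
  have eq: "poly_ratfun (p * p') \<odot>\<^bsub>Uq_alg\<^esub> (b \<oplus>\<^bsub>Uq_alg\<^esub> b') =
      poly_ratfun p' \<odot>\<^bsub>Uq_alg\<^esub> (poly_ratfun p \<odot>\<^bsub>Uq_alg\<^esub> b) \<oplus>\<^bsub>Uq_alg\<^esub> poly_ratfun p \<odot>\<^bsub>Uq_alg\<^esub> (poly_ratfun p' \<odot>\<^bsub>Uq_alg\<^esub> b')"
    using b by (simp add: UU.smult_r_distr poly_ratfun_simps UU.smult_assoc1 UU.smult_commute[of "poly_ratfun p" "poly_ratfun p'"])
  have "inverse (poly (p * p') \<epsilon>) \<odot>\<^bsub>Ue\<^esub> cls (poly_ratfun (p * p') \<odot>\<^bsub>Uq_alg\<^esub> (b \<oplus>\<^bsub>Uq_alg\<^esub> b')) = W \<oplus>\<^bsub>Ue\<^esub> W'"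
    unfolding eq using p p' by (simp add: cls_smult_laurent ev_poly Ue.smult_r_distr inverse_cancel flip: Ue_add Ue.smult_assoc1)
  moreover have "poly_ratfun (p * p') \<odot>\<^bsub>Uq_alg\<^esub> (b \<oplus>\<^bsub>Uq_alg\<^esub> b') \<in> SA" unfolding eq using p p' by simp
  ultimately show ?thesis unfolding red_iff using p(1) p'(1) by (intro exI[of _ "p * p'"]) simp
qed

lemma red_smult:
  assumes b: "b \<in> carrier Uq_alg" and "red b W" and r: "r \<in> laurent"
  shows "red (r \<odot>\<^bsub>Uq_alg\<^esub> b) (ev r \<odot>\<^bsub>Ue\<^esub> W)"
proof -
  obtain p where p: "poly p \<epsilon> \<noteq> 0" "poly_ratfun p \<odot>\<^bsub>Uq_alg\<^esub> b \<in> SA" "W = inverse (poly p \<epsilon>) \<odot>\<^bsub>Ue\<^esub> cls (poly_ratfun p \<odot>\<^bsub>Uq_alg\<^esub> b)"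
    using assms(2) unfolding red_iff by blast
  have eq: "poly_ratfun p \<odot>\<^bsub>Uq_alg\<^esub> (r \<odot>\<^bsub>Uq_alg\<^esub> b) = r \<odot>\<^bsub>Uq_alg\<^esub> (poly_ratfun p \<odot>\<^bsub>Uq_alg\<^esub> b)"
    using b by (simp add: UU.smult_commute)
  show ?thesis
    unfolding red_iff
    by (intro exI[of _ p]) (use p r in \<open>simp add: eq cls_smult_laurent Ue.smult_commute[of "ev r"]\<close>)
qed

lemma red_mult:
  assumes b: "b \<in> carrier Uq_alg" and "red b W" and a: "a \<in> SA"
  shows "red (a \<otimes>\<^bsub>Uq_alg\<^esub> b) (cls a \<otimes>\<^bsub>Ue\<^esub> W)" "red (b \<otimes>\<^bsub>Uq_alg\<^esub> a) (W \<otimes>\<^bsub>Ue\<^esub> cls a)"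
proof -
  obtain p where p: "poly p \<epsilon> \<noteq> 0" "poly_ratfun p \<odot>\<^bsub>Uq_alg\<^esub> b \<in> SA" "W = inverse (poly p \<epsilon>) \<odot>\<^bsub>Ue\<^esub> cls (poly_ratfun p \<odot>\<^bsub>Uq_alg\<^esub> b)"
    using assms(2) unfolding red_iff by blast
  have eq: "poly_ratfun p \<odot>\<^bsub>Uq_alg\<^esub> (a \<otimes>\<^bsub>Uq_alg\<^esub> b) = a \<otimes>\<^bsub>Uq_alg\<^esub> (poly_ratfun p \<odot>\<^bsub>Uq_alg\<^esub> b)"
    "poly_ratfun p \<odot>\<^bsub>Uq_alg\<^esub> (b \<otimes>\<^bsub>Uq_alg\<^esub> a) = (poly_ratfun p \<odot>\<^bsub>Uq_alg\<^esub> b) \<otimes>\<^bsub>Uq_alg\<^esub> a"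
    using a b by (simp_all add: SA_subset UU.smult_mult_left UU.smult_mult_right)
  show "red (a \<otimes>\<^bsub>Uq_alg\<^esub> b) (cls a \<otimes>\<^bsub>Ue\<^esub> W)" "red (b \<otimes>\<^bsub>Uq_alg\<^esub> a) (W \<otimes>\<^bsub>Ue\<^esub> cls a)"
    unfolding red_iff
    by (intro exI[of _ p]; use p a in \<open>simp add: eq Ue.smult_mult_left Ue.smult_mult_right flip: Ue_mult\<close>)+
qed

lemma red_int: "a \<in> SA \<Longrightarrow> red a (cls a)"
  unfolding red_iff by (intro exI[of _ 1]) (simp add: poly_ratfun_simps SA_subset)

text \<open>The quotient of \<open>qq - const \<epsilon>\<close> by \<open>den\<close> has no pole
  at \<epsilon>: multiplied by the cofactor \<open>p\<close> of \<open>den_factor\<close> it becomes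
  \<open>qq ^ l\<close>. So \<open>p\<close> serves as the clearing polynomial.\<close>

lemma red_quotient: "a \<in> SA \<Longrightarrow> \<exists>W. red (((qq - const \<epsilon>) / den) \<odot>\<^bsub>Uq_alg\<^esub> a) W"
proof -
  assume a: "a \<in> SA"
  obtain p where p: "poly p \<epsilon> \<noteq> 0" "den * qq ^ l = (qq - const \<epsilon>) * poly_ratfun p"
    using den_factor by blast
  have "poly_ratfun p * ((qq - const \<epsilon>) / den) = qq ^ l"
    using p(2) by (simp add: divide_eq_eq mult.commute)
  then have "poly_ratfun p \<odot>\<^bsub>Uq_alg\<^esub> (((qq - const \<epsilon>) / den) \<odot>\<^bsub>Uq_alg\<^esub> a) = (qq ^ l) \<odot>\<^bsub>Uq_alg\<^esub> a"
    using a by (simp add: SA_subset flip: UU.smult_assoc1)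
  then have "poly_ratfun p \<odot>\<^bsub>Uq_alg\<^esub> (((qq - const \<epsilon>) / den) \<odot>\<^bsub>Uq_alg\<^esub> a) \<in> SA" using a by simp
  then show ?thesis unfolding red_iff using p(1) by blast
qed

definition "com x y = x \<otimes>\<^bsub>Uq_alg\<^esub> y \<ominus>\<^bsub>Uq_alg\<^esub> y \<otimes>\<^bsub>Uq_alg\<^esub> x"

definition "center = {u \<in> carrier Ue. \<forall>v\<in>carrier Ue. u \<otimes>\<^bsub>Ue\<^esub> v = v \<otimes>\<^bsub>Ue\<^esub> u}"

lemma center_closed: "u \<in> center \<Longrightarrow> u \<in> carrier Ue"
  and center_commute: "u \<in> center \<Longrightarrow> v \<in> carrier Ue \<Longrightarrow> u \<otimes>\<^bsub>Ue\<^esub> v = v \<otimes>\<^bsub>Ue\<^esub> u"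
  by (simp_all add: center_def)

lemma com_closed [simp]: "x \<in> carrier Uq_alg \<Longrightarrow> y \<in> carrier Uq_alg \<Longrightarrow> com x y \<in> carrier Uq_alg"
  by (simp add: com_def)

lemma com_anti: "x \<in> carrier Uq_alg \<Longrightarrow> y \<in> carrier Uq_alg \<Longrightarrow> com y x = \<ominus>\<^bsub>Uq_alg\<^esub> com x y"
  by (simp add: com_def a_minus_def UU.minus_add UU.a_comm)

lemma com_add: "x \<in> carrier Uq_alg \<Longrightarrow> y \<in> carrier Uq_alg \<Longrightarrow> z \<in> carrier Uq_alg \<Longrightarrow>
    com (x \<oplus>\<^bsub>Uq_alg\<^esub> y) z = com x z \<oplus>\<^bsub>Uq_alg\<^esub> com y z"
  by (simp add: com_def a_minus_def UU.minus_add UU.l_distr UU.r_distr UU.a_ac)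

lemma com_smult: "x \<in> carrier Uq_alg \<Longrightarrow> z \<in> carrier Uq_alg \<Longrightarrow> com (r \<odot>\<^bsub>Uq_alg\<^esub> x) z = r \<odot>\<^bsub>Uq_alg\<^esub> com x z"
  by (simp add: com_def UU.smult_mult_left UU.smult_mult_right UU.smult_minus_right)

lemma com_mult: "x \<in> carrier Uq_alg \<Longrightarrow> y \<in> carrier Uq_alg \<Longrightarrow> z \<in> carrier Uq_alg \<Longrightarrow>
    com (x \<otimes>\<^bsub>Uq_alg\<^esub> y) z = x \<otimes>\<^bsub>Uq_alg\<^esub> com y z \<oplus>\<^bsub>Uq_alg\<^esub> com x z \<otimes>\<^bsub>Uq_alg\<^esub> y"
  by (simp add: com_def a_minus_def UU.l_distr UU.r_distr UU.l_minus UU.r_minus UU.m_assoc UU.a_assoc UU.r_neg1 UU.r_neg2)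

lemma com_divisible:
  assumes "x \<in> SA" "y \<in> SA" "cls x \<otimes>\<^bsub>Ue\<^esub> cls y = cls y \<otimes>\<^bsub>Ue\<^esub> cls x"
  obtains d where "d \<in> SA" "com x y = (qq - const \<epsilon>) \<odot>\<^bsub>Uq_alg\<^esub> d"
  using assms cls_eq_iff[of "x \<otimes>\<^bsub>Uq_alg\<^esub> y" "y \<otimes>\<^bsub>Uq_alg\<^esub> x"] by (auto simp: Ue_mult com_def)

definition "quo x y = inverse den \<odot>\<^bsub>Uq_alg\<^esub> com x y"

lemma quo_closed [simp]: "x \<in> carrier Uq_alg \<Longrightarrow> y \<in> carrier Uq_alg \<Longrightarrow> quo x y \<in> carrier Uq_alg"
  by (simp add: quo_def)

lemma quo_add: "x \<in> carrier Uq_alg \<Longrightarrow> y \<in> carrier Uq_alg \<Longrightarrow> z \<in> carrier Uq_alg \<Longrightarrow>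
    quo (x \<oplus>\<^bsub>Uq_alg\<^esub> y) z = quo x z \<oplus>\<^bsub>Uq_alg\<^esub> quo y z"
  by (simp add: quo_def com_add UU.smult_r_distr)

lemma quo_anti: "x \<in> carrier Uq_alg \<Longrightarrow> y \<in> carrier Uq_alg \<Longrightarrow> quo y x = (- 1) \<odot>\<^bsub>Uq_alg\<^esub> quo x y"
  by (simp add: quo_def com_anti[of x y] UU.smult_uminus_right UU.smult_uminus_left)

lemma quo_smult: "x \<in> carrier Uq_alg \<Longrightarrow> z \<in> carrier Uq_alg \<Longrightarrow> quo (r \<odot>\<^bsub>Uq_alg\<^esub> x) z = r \<odot>\<^bsub>Uq_alg\<^esub> quo x z"
  by (simp add: quo_def com_smult UU.smult_commute)

lemma quo_mult: "x \<in> carrier Uq_alg \<Longrightarrow> y \<in> carrier Uq_alg \<Longrightarrow> z \<in> carrier Uq_alg \<Longrightarrow>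
    quo (x \<otimes>\<^bsub>Uq_alg\<^esub> y) z = x \<otimes>\<^bsub>Uq_alg\<^esub> quo y z \<oplus>\<^bsub>Uq_alg\<^esub> quo x z \<otimes>\<^bsub>Uq_alg\<^esub> y"
  by (simp add: quo_def com_mult UU.smult_r_distr UU.smult_mult_left UU.smult_mult_right)

lemma quo_exists:
  assumes "x \<in> SA" "y \<in> SA" "cls x \<in> center"
  shows "\<exists>W. red (quo x y) W"
proof -
  obtain d where d: "d \<in> SA" "com x y = (qq - const \<epsilon>) \<odot>\<^bsub>Uq_alg\<^esub> d"
    using com_divisible[of x y] assms center_commute[OF assms(3), of "cls y"] by auto
  then have "quo x y = ((qq - const \<epsilon>) / den) \<odot>\<^bsub>Uq_alg\<^esub> d"
    by (simp add: quo_def divide_inverse mult.commute SA_subset flip: UU.smult_assoc1)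
  then show ?thesis using red_quotient[OF d(1)] by simp
qed

text \<open>Changing a lift of a central element by a multiple of \<open>q - \<epsilon>\<close> changes the commutator by a
  multiple of the square of \<open>q - \<epsilon>\<close>, while the denominator has only a simple zero.\<close>

lemma red_quo_cong:
  assumes "x \<in> SA" "x' \<in> SA" "y \<in> SA" and eq: "cls x' = cls x" and y: "cls y \<in> center"
    and W: "red (quo x y) W"
  shows "red (quo x' y) W"
proof -
  obtain d where d: "d \<in> SA" "x' \<ominus>\<^bsub>Uq_alg\<^esub> x = (qq - const \<epsilon>) \<odot>\<^bsub>Uq_alg\<^esub> d"
    using eq assms(1,2) by (auto simp: cls_eq_iff)
  have x': "x' = x \<oplus>\<^bsub>Uq_alg\<^esub> (qq - const \<epsilon>) \<odot>\<^bsub>Uq_alg\<^esub> d"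
    unfolding d(2)[symmetric] using assms(1,2) by (simp add: a_minus_def SA_subset UU.a_lcomm[of x x'] UU.r_neg)
  obtain e where e: "e \<in> SA" "com d y = (qq - const \<epsilon>) \<odot>\<^bsub>Uq_alg\<^esub> e"
    using com_divisible[of d y] d(1) assms(3) center_commute[OF y, of "cls d"] by auto
  have "quo ((qq - const \<epsilon>) \<odot>\<^bsub>Uq_alg\<^esub> d) y = (qq - const \<epsilon>) \<odot>\<^bsub>Uq_alg\<^esub> (((qq - const \<epsilon>) / den) \<odot>\<^bsub>Uq_alg\<^esub> e)"
    using d e assms(3)
    by (simp add: quo_smult SA_subset, simp add: quo_def e(2) divide_inverse mult.commute SA_subset flip: UU.smult_assoc1)
  moreover obtain V where V: "red (((qq - const \<epsilon>) / den) \<odot>\<^bsub>Uq_alg\<^esub> e) V"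
    using red_quotient[OF e(1)] by blast
  \<comment> \<open>One factor q - \<epsilon> has been used up against the denominator. The other
    one is evaluated at \<epsilon> and annihilates the contribution.\<close>
  ultimately have "red (quo ((qq - const \<epsilon>) \<odot>\<^bsub>Uq_alg\<^esub> d) y) (ev (qq - const \<epsilon>) \<odot>\<^bsub>Ue\<^esub> V)"
    using red_smult[OF _ V, of "qq - const \<epsilon>"] e(1) by (simp add: SA_subset)
  then have "red (quo ((qq - const \<epsilon>) \<odot>\<^bsub>Uq_alg\<^esub> d) y) \<zero>\<^bsub>Ue\<^esub>"
    using red_closed[OF V] by (simp add: ev_linear)
  from red_add[OF _ _ W this] show ?thesis
    using assms d red_closed[OF W] by (simp add: x' quo_add SA_subset)
qed

lemma red_quo_swap:
  assumes "x \<in> SA" "y \<in> SA" "red (quo x y) W"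
  shows "red (quo y x) (\<ominus>\<^bsub>Ue\<^esub> W)"
proof -
  have "red ((- 1) \<odot>\<^bsub>Uq_alg\<^esub> quo x y) (ev (- 1) \<odot>\<^bsub>Ue\<^esub> W)"
    by (rule red_smult) (use assms in \<open>simp_all add: SA_subset\<close>)
  then show ?thesis
    using assms red_closed[OF assms(3)] eps_nonzero quo_anti[of x y]
    by (simp add: SA_subset laurent_eval_uminus Ue.smult_uminus_left)
qed

lemma cls_memD: "x' \<in> cls x \<Longrightarrow> x \<in> SA \<Longrightarrow> x' \<in> SA \<and> cls x' = cls x"
proof -
  assume x: "x \<in> SA" and "x' \<in> cls x"
  then obtain i where i: "i \<in> spec_ideal \<epsilon>" "x' = i \<oplus>\<^bsub>Uq_alg\<^esub> x"
    unfolding spec_class_def a_r_coset_def' by auto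
  then obtain d where d: "d \<in> SA" "i = (qq - const \<epsilon>) \<odot>\<^bsub>Uq_alg\<^esub> d" unfolding spec_ideal_eq by blast
  have "cls x' = cls i \<oplus>\<^bsub>Ue\<^esub> cls x" using d x by (simp add: i(2) Ue_add)
  also have "cls i = \<zero>\<^bsub>Ue\<^esub>" using d by (simp add: cls_smult_laurent ev_linear)
  finally show ?thesis using x d by (simp add: i(2))
qed

lemma cls_self: "x \<in> SA \<Longrightarrow> x \<in> cls x"
proof -
  assume x: "x \<in> SA"
  have "\<zero>\<^bsub>Uq_alg\<^esub> = (qq - const \<epsilon>) \<odot>\<^bsub>Uq_alg\<^esub> \<zero>\<^bsub>Uq_alg\<^esub>" by simp
  then have "\<zero>\<^bsub>Uq_alg\<^esub> \<in> spec_ideal \<epsilon>" unfolding spec_ideal_eq using SA_closed(2) by blast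
  moreover have "x = \<zero>\<^bsub>Uq_alg\<^esub> \<oplus>\<^bsub>Uq_alg\<^esub> x" using x by (simp add: SA_subset)
  ultimately show ?thesis unfolding spec_class_def a_r_coset_def' by auto
qed

abbreviation "br \<equiv> spec_bracket \<epsilon> l"

text \<open>The bracket quantifies over all lifts of both arguments. The first lift is exchanged
  directly and the second after swapping the arguments, with two sign changes that cancel;
  \<open>red_unique\<close> then identifies the reductions.\<close>

lemma br_eqI:
  assumes x: "x \<in> SA" "cls x \<in> center" and y: "y \<in> SA" "cls y \<in> center" and W: "red (quo x y) W"
  shows "br (cls x) (cls y) = W"
proof -
  have eq: "br (cls x) (cls y) = (THE W. \<exists>x'\<in>cls x. \<exists>y'\<in>cls y. red (quo x' y') W)"
    by (simp add: spec_bracket_def quo_def com_def den_def)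
  show ?thesis unfolding eq
  proof (rule the_equality)
    show "\<exists>x'\<in>cls x. \<exists>y'\<in>cls y. red (quo x' y') W"
      using cls_self x(1) y(1) W by blast
    fix W' assume "\<exists>x'\<in>cls x. \<exists>y'\<in>cls y. red (quo x' y') W'"
    then obtain x' y' where xy: "x' \<in> cls x" "y' \<in> cls y" "red (quo x' y') W'" by blast
    note x' = cls_memD[OF xy(1) x(1)] and y' = cls_memD[OF xy(2) y(1)]
    have 1: "red (quo x' y) W" using red_quo_cong[of x x' y W] x x' y W by simp
    have 2: "red (quo y' x') (\<ominus>\<^bsub>Ue\<^esub> W)"
      by (rule red_quo_cong[OF y(1) _ _ _ _ red_quo_swap[OF _ y(1) 1]]) (use x x' y' in simp_all)
    have "red (quo x' y') (\<ominus>\<^bsub>Ue\<^esub> (\<ominus>\<^bsub>Ue\<^esub> W))"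
      using red_quo_swap[OF _ _ 2] x' y' by simp
    then have "red (quo x' y') W" using red_closed[OF W] by simp
    then show "W' = W" using red_unique[OF _ xy(3)] x' y' by (simp add: SA_subset)
  qed
qed

lemma lift_center:
  assumes "u \<in> center"
  obtains x where "x \<in> SA" "u = cls x" "cls x \<in> center"
  using assms center_closed[OF assms] unfolding Ue_carrier by auto

lemma br_red:
  assumes "x \<in> SA" "cls x \<in> center" "y \<in> SA" "cls y \<in> center"
  shows "red (quo x y) (br (cls x) (cls y))"
  using quo_exists[OF assms(1,3,2)] br_eqI[OF assms] by auto

lemma center_subalgebra:
  "\<one>\<^bsub>Ue\<^esub> \<in> center" "u \<in> center \<Longrightarrow> v \<in> center \<Longrightarrow> u \<oplus>\<^bsub>Ue\<^esub> v \<in> center"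
  "u \<in> center \<Longrightarrow> v \<in> center \<Longrightarrow> u \<otimes>\<^bsub>Ue\<^esub> v \<in> center" "u \<in> center \<Longrightarrow> c \<odot>\<^bsub>Ue\<^esub> u \<in> center"
proof -
  show "\<one>\<^bsub>Ue\<^esub> \<in> center" by (simp add: center_def)
  show "u \<oplus>\<^bsub>Ue\<^esub> v \<in> center" if "u \<in> center" "v \<in> center"
    using that by (simp add: center_def Ue.l_distr Ue.r_distr)
  show "c \<odot>\<^bsub>Ue\<^esub> u \<in> center" if "u \<in> center"
    using that by (simp add: center_def Ue.smult_mult_left Ue.smult_mult_right)
  show "u \<otimes>\<^bsub>Ue\<^esub> v \<in> center" if "u \<in> center" "v \<in> center"
  proof -
    have c: "u \<in> carrier Ue" "v \<in> carrier Ue" using that by (auto simp: center_closed)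
    have "u \<otimes>\<^bsub>Ue\<^esub> v \<otimes>\<^bsub>Ue\<^esub> w = w \<otimes>\<^bsub>Ue\<^esub> (u \<otimes>\<^bsub>Ue\<^esub> v)" if w: "w \<in> carrier Ue" for w
    proof -
      have "u \<otimes>\<^bsub>Ue\<^esub> v \<otimes>\<^bsub>Ue\<^esub> w = u \<otimes>\<^bsub>Ue\<^esub> (w \<otimes>\<^bsub>Ue\<^esub> v)"
        using c w center_commute[OF \<open>v \<in> center\<close> w] by (simp add: Ue.m_assoc)
      also have "\<dots> = w \<otimes>\<^bsub>Ue\<^esub> u \<otimes>\<^bsub>Ue\<^esub> v"
        using c w center_commute[OF \<open>u \<in> center\<close> w] by (simp flip: Ue.m_assoc)
      finally show ?thesis using c w by (simp add: Ue.m_assoc)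
    qed
    then show ?thesis using c by (simp add: center_def)
  qed
qed

lemma br_closed: "u \<in> center \<Longrightarrow> v \<in> center \<Longrightarrow> br u v \<in> carrier Ue"
  by (metis br_red lift_center red_closed)

lemma br_anti:
  assumes "u \<in> center" "v \<in> center"
  shows "br v u = \<ominus>\<^bsub>Ue\<^esub> br u v"
proof -
  obtain x where x: "x \<in> SA" "u = cls x" "cls x \<in> center" using lift_center assms(1) by blast
  obtain y where y: "y \<in> SA" "v = cls y" "cls y \<in> center" using lift_center assms(2) by blast
  show ?thesis
    unfolding x(2) y(2) by (rule br_eqI[OF y(1,3) x(1,3) red_quo_swap[OF x(1) y(1) br_red[OF x(1,3) y(1,3)]]])
qed

lemma br_add:
  assumes "u \<in> center" "v \<in> center" "w \<in> center"
  shows "br (u \<oplus>\<^bsub>Ue\<^esub> v) w = br u w \<oplus>\<^bsub>Ue\<^esub> br v w"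
proof -
  obtain x where x: "x \<in> SA" "u = cls x" "cls x \<in> center" using lift_center assms(1) by blast
  obtain y where y: "y \<in> SA" "v = cls y" "cls y \<in> center" using lift_center assms(2) by blast
  obtain z where z: "z \<in> SA" "w = cls z" "cls z \<in> center" using lift_center assms(3) by blast
  have "br (cls (x \<oplus>\<^bsub>Uq_alg\<^esub> y)) (cls z) = br (cls x) (cls z) \<oplus>\<^bsub>Ue\<^esub> br (cls y) (cls z)"
    using br_red[OF x(1,3) z(1,3)] br_red[OF y(1,3) z(1,3)] x y z center_subalgebra(2)[OF x(3) y(3)]
    by (intro br_eqI) (simp_all add: Ue_add quo_add SA_subset red_add)
  then show ?thesis using x y z by (simp add: Ue_add)
qed

lemma br_smult:
  assumes "u \<in> center" "w \<in> center"
  shows "br (c \<odot>\<^bsub>Ue\<^esub> u) w = c \<odot>\<^bsub>Ue\<^esub> br u w"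
proof -
  obtain x where x: "x \<in> SA" "u = cls x" "cls x \<in> center" using lift_center assms(1) by blast
  obtain z where z: "z \<in> SA" "w = cls z" "cls z \<in> center" using lift_center assms(2) by blast
  have "red (const c \<odot>\<^bsub>Uq_alg\<^esub> quo x z) (ev (const c) \<odot>\<^bsub>Ue\<^esub> br (cls x) (cls z))"
    by (rule red_smult) (use br_red[OF x(1,3) z(1,3)] x z in \<open>simp_all add: SA_subset\<close>)
  then have "br (cls (const c \<odot>\<^bsub>Uq_alg\<^esub> x)) (cls z) = c \<odot>\<^bsub>Ue\<^esub> br (cls x) (cls z)"
    using x z center_subalgebra(4)[OF x(3)] eps_nonzero
    by (intro br_eqI) (simp_all add: Ue_smult[symmetric] quo_smult SA_subset)
  then show ?thesis using x z by (simp add: Ue_smult)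
qed

lemma br_mult:
  assumes "u \<in> center" "v \<in> center" "w \<in> center"
  shows "br (u \<otimes>\<^bsub>Ue\<^esub> v) w = u \<otimes>\<^bsub>Ue\<^esub> br v w \<oplus>\<^bsub>Ue\<^esub> br u w \<otimes>\<^bsub>Ue\<^esub> v"
proof -
  obtain x where x: "x \<in> SA" "u = cls x" "cls x \<in> center" using lift_center assms(1) by blast
  obtain y where y: "y \<in> SA" "v = cls y" "cls y \<in> center" using lift_center assms(2) by blast
  obtain z where z: "z \<in> SA" "w = cls z" "cls z \<in> center" using lift_center assms(3) by blast
  have "br (cls (x \<otimes>\<^bsub>Uq_alg\<^esub> y)) (cls z) = cls x \<otimes>\<^bsub>Ue\<^esub> br (cls y) (cls z) \<oplus>\<^bsub>Ue\<^esub> br (cls x) (cls z) \<otimes>\<^bsub>Ue\<^esub> cls y"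
    using br_red[OF x(1,3) z(1,3)] br_red[OF y(1,3) z(1,3)] x y z center_subalgebra(3)[OF x(3) y(3)]
    by (intro br_eqI) (simp_all add: Ue_mult quo_mult SA_subset red_add red_mult)
  then show ?thesis using x y z by (simp add: Ue_mult)
qed

lemma br_exact:
  assumes "x \<in> SA" "cls x \<in> center" "y \<in> SA" "cls y \<in> center" "a \<in> SA" "com x y = den \<odot>\<^bsub>Uq_alg\<^esub> a"
  shows "br (cls x) (cls y) = cls a"
proof -
  have "quo x y = a" using assms(5,6) by (simp add: quo_def SA_subset flip: UU.smult_assoc1)
  then show ?thesis using br_eqI[OF assms(1-4)] red_int[OF assms(5)] by simp
qed

lemma br_one: "w \<in> center \<Longrightarrow> br \<one>\<^bsub>Ue\<^esub> w = \<zero>\<^bsub>Ue\<^esub>"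
proof -
  assume "w \<in> center"
  then obtain z where z: "z \<in> SA" "w = cls z" "cls z \<in> center" using lift_center by blast
  have "com \<one>\<^bsub>Uq_alg\<^esub> z = \<zero>\<^bsub>Uq_alg\<^esub>"
    using z by (simp add: com_def SA_subset a_minus_def UU.r_neg)
  then have "br (cls \<one>\<^bsub>Uq_alg\<^esub>) (cls z) = cls \<zero>\<^bsub>Uq_alg\<^esub>"
    using z center_subalgebra(1) by (intro br_exact) (simp_all flip: Ue_one)
  then show ?thesis by (simp add: Ue_one Ue_zero z)
qed

end

lemma ratfun_of_nat_eq_0 [simp]: "of_nat n = (0 :: ratfun) \<longleftrightarrow> n = 0"
  by (metis const_eq_0_iff const_of_nat of_nat_eq_0_iff)

lemma ratfun_of_int_eq_0 [simp]: "of_int k = (0 :: ratfun) \<longleftrightarrow> k = 0"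
  by (metis const_eq_0_iff const_of_int of_int_eq_0_iff)

section \<open>Central elements at a root of unity and the brackets of the generators\<close>

context poisson_specialization
begin

lemma ev_qq_powi: "ev (qq powi n) = \<epsilon> powi n"
  by (rule laurent_eval_qq_powi[OF eps_nonzero])

lemma eps_powi_l [simp]: "\<epsilon> powi (int l * n) = 1"
  by (simp add: power_int_mult eps_power)

lemma eps_powi_l' [simp]: "\<epsilon> powi (n * int l) = 1"
  using eps_powi_l[of n] by (simp only: mult.commute)

text \<open>Both q^(ml) and its inverse become 1 at \<epsilon>. This is why the letters h_ml become
  central.\<close>

lemma ev_heis_coeff_l [simp]: "ev (heis_coeff (m * int l)) = 0"
proof -
  have "\<epsilon> powi (- (m * int l)) = 1" using eps_powi_l'[of "- m"] by (simp del: eps_powi_l')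
  then show ?thesis using laurent_eval_heis_coeff[OF eps_nonzero, of "m * int l"] by simp
qed

declare l_pos [simp]

lemma l_nonzero [simp]: "l \<noteq> 0"
  using l_pos by (rule less_imp_neq[symmetric])

text \<open>Every correction term of the straightening rule carries the coefficient
  \<open>heis_coeff (m * int l)\<close>, which vanishes at \<epsilon>. Multiplication by h_ml hence
  just adds a letter to a monomial, up to the factor from \<Lambda>.\<close>

lemma cls_hh_pbw:
  assumes m: "m \<noteq> 0" and N: "0 \<notin># N"
  shows "cls (hh (m * int l)) \<otimes>\<^bsub>Ue\<^esub> cls (pbw (a, b, c, N)) =
    (\<epsilon> powi (2 * (m * int l) * a)) \<odot>\<^bsub>Ue\<^esub> cls (pbw (a, b, c, add_mset (m * int l) N))"
proof -
  let ?m = "m * int l"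
  have m': "?m \<noteq> 0" using m by simp
  define Q where "Q = pbw (a, b + 2 * ?m, c, N - {#- ?m#}) \<ominus>\<^bsub>Uq_alg\<^esub> pbw (a, b - 2 * ?m, c, N - {#- ?m#})"
  define P where "P = pbw (a, b, c, add_mset ?m N)"
  define T where "T = (if ?m > 0 then (of_nat (count N (- ?m)) * heis_coeff ?m) \<odot>\<^bsub>Uq_alg\<^esub> Q else \<zero>\<^bsub>Uq_alg\<^esub>)"
  have "0 \<notin># N - {#- ?m#}" using N by (meson in_diffD)
  then have Q: "Q \<in> SA" unfolding Q_def by (intro SA_minus pbw_SA) (simp_all add: pbw_index_def)
  have P: "P \<in> SA" unfolding P_def using N m by (intro pbw_SA) (simp add: pbw_index_def)
  have T: "T \<in> SA" using Q by (simp add: T_def)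
  have T0: "cls T = \<zero>\<^bsub>Ue\<^esub>"
    using Q by (auto simp: T_def cls_smult_laurent laurent_eval_mult eps_nonzero Ue_zero[symmetric])
  have "hh ?m \<otimes>\<^bsub>Uq_alg\<^esub> pbw (a, b, c, N) = (qq powi (2 * ?m * a)) \<odot>\<^bsub>Uq_alg\<^esub> (P \<oplus>\<^bsub>Uq_alg\<^esub> T)"
    unfolding hh_pbw[OF N m'] P_def T_def Q_def ..
  moreover have "pbw (a, b, c, N) \<in> SA" using N by (intro pbw_SA) (simp add: pbw_index_def)
  ultimately have "cls (hh ?m) \<otimes>\<^bsub>Ue\<^esub> cls (pbw (a, b, c, N)) = cls ((qq powi (2 * ?m * a)) \<odot>\<^bsub>Uq_alg\<^esub> (P \<oplus>\<^bsub>Uq_alg\<^esub> T))"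
    using m' by (simp add: Ue_mult del: pbw.simps)
  also have "\<dots> = (\<epsilon> powi (2 * ?m * a)) \<odot>\<^bsub>Ue\<^esub> cls P"
    using P T T0 by (simp add: cls_smult_laurent ev_qq_powi flip: Ue_add)
  finally show ?thesis by (simp only: P_def)
qed

lemma centerI:
  assumes u: "u \<in> carrier Ue"
    and hh: "\<And>m. m \<noteq> 0 \<Longrightarrow> u \<otimes>\<^bsub>Ue\<^esub> cls (hh m) = cls (hh m) \<otimes>\<^bsub>Ue\<^esub> u"
    and ug: "\<And>g. g \<in> {GenLam, GenLam', GenGam, GenGam', GenK, GenK'} \<Longrightarrow>
      u \<otimes>\<^bsub>Ue\<^esub> cls (ugen g) = cls (ugen g) \<otimes>\<^bsub>Ue\<^esub> u"
  shows "u \<in> center"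
proof -
  have "u \<otimes>\<^bsub>Ue\<^esub> v = v \<otimes>\<^bsub>Ue\<^esub> u" if "v \<in> carrier Ue" for v
    using that
  proof (induction rule: Ue_induct)
    case (mult x y)
    have "u \<otimes>\<^bsub>Ue\<^esub> (x \<otimes>\<^bsub>Ue\<^esub> y) = x \<otimes>\<^bsub>Ue\<^esub> u \<otimes>\<^bsub>Ue\<^esub> y"
      using mult u by (simp flip: Ue.m_assoc)
    then show ?case using mult u by (simp add: Ue.m_assoc)
  qed (use u hh ug in \<open>simp_all add: Ue.l_distr Ue.r_distr Ue.smult_mult_left Ue.smult_mult_right\<close>)
  then show ?thesis using u by (simp add: center_def)
qed

lemma cls_commute: "x \<in> SA \<Longrightarrow> y \<in> SA \<Longrightarrow> x \<otimes>\<^bsub>Uq_alg\<^esub> y = y \<otimes>\<^bsub>Uq_alg\<^esub> x \<Longrightarrow> cls x \<otimes>\<^bsub>Ue\<^esub> cls y = cls y \<otimes>\<^bsub>Ue\<^esub> cls x"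
  by (simp add: Ue_mult)

lemma ugen_gens: "g \<in> {GenLam, GenLam', GenGam, GenGam', GenK, GenK'} \<Longrightarrow> g \<in> gens \<and> ugen g \<in> SA"
  by auto

lemma center_gam: "cls (gam n) \<in> center"
proof (rule centerI)
  fix g assume "g \<in> {GenLam, GenLam', GenGam, GenGam', GenK, GenK'}"
  then have "g \<in> gens \<and> ugen g \<in> SA" by (rule ugen_gens)
  then show "cls (gam n) \<otimes>\<^bsub>Ue\<^esub> cls (ugen g) = cls (ugen g) \<otimes>\<^bsub>Ue\<^esub> cls (gam n)"
    by (intro cls_commute gam_commute) simp_all
qed (simp_all add: cls_commute hh_gam)

lemma center_kp: "cls (kp n) \<in> center"
proof (rule centerI)
  fix g assume "g \<in> {GenLam, GenLam', GenGam, GenGam', GenK, GenK'}"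
  then have "g \<in> gens \<and> ugen g \<in> SA" by (rule ugen_gens)
  then show "cls (kp n) \<otimes>\<^bsub>Ue\<^esub> cls (ugen g) = cls (ugen g) \<otimes>\<^bsub>Ue\<^esub> cls (kp n)"
    by (intro cls_commute kp_commute[symmetric]) simp_all
qed (simp_all add: cls_commute hh_kp)

lemma ugen_lamp:
  assumes "g \<in> {GenLam, GenLam', GenGam, GenGam', GenK, GenK'}"
  shows "ugen g \<otimes>\<^bsub>Uq_alg\<^esub> lamp a = lamp a \<otimes>\<^bsub>Uq_alg\<^esub> ugen g"
proof -
  consider "g = GenLam" | "g = GenLam'" | "g \<in> {GenGam, GenGam', GenK, GenK'}" using assms by blast
  then show ?thesis
  proof cases
    case 1
    show ?thesis unfolding 1 by (rule UU.ipow_commute) simp_all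
  next
    case 2
    show ?thesis unfolding 2 by (rule UU.ipow_commute) simp_all
  qed (rule central_lamp)
qed

lemma cls_hh_lamp: "m \<noteq> 0 \<Longrightarrow> cls (hh m) \<otimes>\<^bsub>Ue\<^esub> cls (lamp a) = (\<epsilon> powi (2 * m * a)) \<odot>\<^bsub>Ue\<^esub> (cls (lamp a) \<otimes>\<^bsub>Ue\<^esub> cls (hh m))"
  by (simp add: Ue_mult hh_lamp cls_smult_laurent ev_qq_powi)

lemma center_lamp: "cls (lamp (s * int l)) \<in> center"
proof (rule centerI)
  fix m :: int assume m: "m \<noteq> 0"
  have "\<epsilon> powi (2 * m * (s * int l)) = 1"
    using eps_powi_l'[of "2 * m * s"] by (simp only: mult.assoc)
  then show "cls (lamp (s * int l)) \<otimes>\<^bsub>Ue\<^esub> cls (hh m) = cls (hh m) \<otimes>\<^bsub>Ue\<^esub> cls (lamp (s * int l))"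
    using cls_hh_lamp[OF m, of "s * int l"] m by simp
qed (simp_all add: ugen_gens cls_commute ugen_lamp)

lemma cls_hh_ugen_lam:
  assumes m: "m \<noteq> 0"
  shows "cls (hh m) \<otimes>\<^bsub>Ue\<^esub> cls (ugen GenLam) = (\<epsilon> powi (2 * m)) \<odot>\<^bsub>Ue\<^esub> (cls (ugen GenLam) \<otimes>\<^bsub>Ue\<^esub> cls (hh m))"
    "cls (hh m) \<otimes>\<^bsub>Ue\<^esub> cls (ugen GenLam') = (\<epsilon> powi (- (2 * m))) \<odot>\<^bsub>Ue\<^esub> (cls (ugen GenLam') \<otimes>\<^bsub>Ue\<^esub> cls (hh m))"
  using m by (simp_all add: Ue_mult hh_Lam hh_Lam' cls_smult_laurent ev_qq_powi del: power_int_minus)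

text \<open>The commutator with h_n can be nonzero only for n = -ml, where its coefficient vanishes
  at \<epsilon>. The exchange with \<Lambda> costs \<epsilon>^(2ml) = 1.\<close>

lemma center_hh: "m \<noteq> 0 \<Longrightarrow> cls (hh (m * int l)) \<in> center"
proof (rule centerI)
  assume m: "m \<noteq> 0"
  let ?m = "m * int l"
  show "cls (hh ?m) \<in> carrier Ue" using m by simp
  fix n :: int assume n: "n \<noteq> 0"
  define D where "D = (if n = - ?m then heis_coeff ?m \<odot>\<^bsub>Uq_alg\<^esub> (gam (2 * ?m) \<ominus>\<^bsub>Uq_alg\<^esub> gam (- (2 * ?m))) else \<zero>\<^bsub>Uq_alg\<^esub>)"
  have D: "D \<in> SA" by (simp add: D_def)
  have "hh ?m \<otimes>\<^bsub>Uq_alg\<^esub> hh n = hh n \<otimes>\<^bsub>Uq_alg\<^esub> hh ?m \<oplus>\<^bsub>Uq_alg\<^esub> D"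
    unfolding D_def by (rule hh_heis) (use m n in simp_all)
  moreover have "cls D = \<zero>\<^bsub>Ue\<^esub>"
    by (auto simp: D_def cls_smult_laurent Ue_zero[symmetric])
  ultimately show "cls (hh ?m) \<otimes>\<^bsub>Ue\<^esub> cls (hh n) = cls (hh n) \<otimes>\<^bsub>Ue\<^esub> cls (hh ?m)"
    using m n D by (simp add: Ue_mult) (simp flip: Ue_add)
next
  fix g assume m: "m \<noteq> 0" and g: "g \<in> {GenLam, GenLam', GenGam, GenGam', GenK, GenK'}"
  let ?m = "m * int l"
  have 1: "\<epsilon> powi (2 * ?m) = 1" "\<epsilon> powi (- (2 * ?m)) = 1"
    using eps_powi_l'[of "2 * m"] eps_powi_l'[of "- (2 * m)"] by (simp_all add: mult.assoc del: eps_powi_l')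
  have m': "?m \<noteq> 0" using m by simp
  consider "g = GenLam" | "g = GenLam'" | "g \<in> {GenGam, GenGam', GenK, GenK'}" using g by blast
  then show "cls (hh ?m) \<otimes>\<^bsub>Ue\<^esub> cls (ugen g) = cls (ugen g) \<otimes>\<^bsub>Ue\<^esub> cls (hh ?m)"
  proof cases
    case 1
    then show ?thesis using cls_hh_ugen_lam(1)[OF m'] m' \<open>\<epsilon> powi (2 * ?m) = 1\<close> by simp
  next
    case 2
    then show ?thesis using cls_hh_ugen_lam(2)[OF m'] m' \<open>\<epsilon> powi (- (2 * ?m)) = 1\<close> by simp
  next
    case 3
    have "hh ?m \<otimes>\<^bsub>Uq_alg\<^esub> ugen g = ugen g \<otimes>\<^bsub>Uq_alg\<^esub> hh ?m"
      using central_commute[OF 3, of "GenH ?m"] m' ugen_gens[OF g]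
      by (simp add: hh_eq UU.smult_mult_left UU.smult_mult_right)
    then show ?thesis using m' ugen_gens[OF g] by (intro cls_commute) simp_all
  qed
qed

text \<open>The quotient \<open>s\<close> is the quantum integer [n] in the variable t = q^l. As t
  becomes 1 at \<epsilon>, it evaluates to the ordinary integer n.\<close>

lemma qnum_laurent:
  "\<exists>s\<in>laurent. qq powi (int l * n) - qq powi (- (int l * n)) = (qq powi int l - qq powi (- int l)) * s \<and> ev s = of_int n"
proof -
  define t where "t = qq powi int l"
  have t: "t \<noteq> 0" "t \<in> laurent" "ev t = 1" "inverse t \<in> laurent" "ev (inverse t) = 1"
    using eps_powi_l[of 1] eps_powi_l[of "- 1"] laurent_qq_powi[of "- int l"] ev_qq_powi[of "- int l"] ev_qq_powi[of "int l"]
    by (simp_all add: t_def ev_qq_powi power_int_minus del: eps_powi_l eps_powi_l')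
  have tp: "t powi k \<in> laurent" "ev (t powi k) = 1" for k
    using t by (simp_all add: power_int_def laurent_eval_power eps_nonzero)
  have nat: "\<exists>s\<in>laurent. t powi int n - t powi (- int n) = (t - inverse t) * s \<and> ev s = of_nat n" for n
  proof (induction n)
    case 0
    show ?case using eps_nonzero by (intro bexI[of _ 0]) simp_all
  next
    case (Suc n)
    then obtain s where s: "s \<in> laurent" "t powi int n - t powi (- int n) = (t - inverse t) * s" "ev s = of_nat n" by blast
    have a: "t powi int (Suc n) = t * t powi int n" by (simp add: power_int_add t)
    have b: "t powi (- int (Suc n)) = inverse t * t powi (- int n)" by (simp only: power_int_minus power_int_of_nat) simp
    \<comment> \<open>The recursion [n + 1] = t [n] + t^-n of quantum integers, before division by t
      - t^-1. At t = 1 it adds one.\<close>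
    have "t powi int (Suc n) - t powi (- int (Suc n)) = t * (t powi int n - t powi (- int n)) + (t - inverse t) * t powi (- int n)"
      unfolding a b by (simp add: algebra_simps)
    also have "\<dots> = (t - inverse t) * (t * s + t powi (- int n))"
      unfolding s(2) by (simp add: algebra_simps)
    finally have "t powi int (Suc n) - t powi (- int (Suc n)) = (t - inverse t) * (t * s + t powi (- int n))" .
    moreover have "t * s + t powi (- int n) \<in> laurent" using t s tp by simp
    moreover have "ev (t * s + t powi (- int n)) = of_nat (Suc n)"
      using t s tp[of "- int n"] by (simp add: laurent_eval_add laurent_eval_mult eps_nonzero add.commute del: power_int_minus)
    ultimately show ?case by blast
  qed
  have main: "\<exists>s\<in>laurent. t powi n - t powi (- n) = (t - inverse t) * s \<and> ev s = of_int n"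
  proof (cases n rule: int_cases2)
    case (nonneg k)
    then show ?thesis using nat[of k] by simp
  next
    case (nonpos k)
    obtain s where s: "s \<in> laurent" "t powi int k - t powi (- int k) = (t - inverse t) * s" "ev s = of_nat k"
      using nat by blast
    have "t powi n - t powi (- n) = (t - inverse t) * (- s)"
      using s(2) nonpos by (simp add: algebra_simps)
    moreover have "ev (- s) = of_int n" using s nonpos by (simp add: laurent_eval_uminus eps_nonzero)
    ultimately show ?thesis using s(1) by (intro bexI[of _ "- s"]) simp_all
  qed
  have "qq powi (- (int l * n)) = t powi (- n)"
    using power_int_mult[of qq "int l" "- n"] by (simp add: t_def)
  moreover have "qq powi (int l * n) = t powi n" by (simp add: t_def power_int_mult)
  moreover have "qq powi (- int l) = inverse t" by (simp add: t_def power_int_minus)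
  ultimately show ?thesis using main by (simp only: t_def[symmetric])
qed

lemma br_commuting:
  assumes "x \<in> SA" "cls x \<in> center" "y \<in> SA" "cls y \<in> center" "x \<otimes>\<^bsub>Uq_alg\<^esub> y = y \<otimes>\<^bsub>Uq_alg\<^esub> x"
  shows "br (cls x) (cls y) = \<zero>\<^bsub>Ue\<^esub>"
proof -
  have "com x y = den \<odot>\<^bsub>Uq_alg\<^esub> \<zero>\<^bsub>Uq_alg\<^esub>"
    using assms(1,3,5) by (simp add: com_def SA_subset a_minus_def UU.r_neg)
  from br_exact[OF assms(1-4) _ this] show ?thesis by (simp add: Ue_zero)
qed

text \<open>The coefficient (q^(lm) - q^(-lm)) / (ml) is the quantum integer [m] in q^l times (q^l -
  q^-l) / (ml). Dividing by the denominator l(q^l - q^-l) and evaluating gives m / (m l^2), whence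
  the constant 1 / l^2.\<close>

lemma br_hh_hh:
  assumes m: "m \<noteq> 0" and n: "n \<noteq> 0"
  shows "br (cls (hh (m * int l))) (cls (hh (n * int l))) =
    (if n = - m then (1 / (of_nat l * of_nat l)) \<odot>\<^bsub>Ue\<^esub> (cls (gam (2 * (m * int l))) \<ominus>\<^bsub>Ue\<^esub> cls (gam (- (2 * (m * int l))))) else \<zero>\<^bsub>Ue\<^esub>)"
proof -
  let ?m = "m * int l" and ?n = "n * int l"
  have nz: "?m \<noteq> 0" "?n \<noteq> 0" using m n by simp_all
  have c: "hh ?m \<in> SA" "hh ?n \<in> SA" using nz by simp_all
  have eq: "?n = - ?m \<longleftrightarrow> n = - m" using l_pos by (simp flip: mult_minus_left)
  show ?thesis
  proof (cases "n = - m")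
    case True
    define G where "G = gam (2 * ?m) \<ominus>\<^bsub>Uq_alg\<^esub> gam (- (2 * ?m))"
    have G: "G \<in> SA" by (simp add: G_def)
    obtain s where s: "s \<in> laurent" "qq powi (int l * m) - qq powi (- (int l * m)) = (qq powi int l - qq powi (- int l)) * s" "ev s = of_int m"
      using qnum_laurent by blast
    define r where "r = s * (inverse (of_int (int l)) * inverse (of_int ?m))"
    have r: "r \<in> laurent" using s by (simp add: r_def del: of_int_of_nat_eq of_int_mult)
    have h: "heis_coeff ?m = den * r"
    proof -
      have "heis_coeff ?m = (qq powi (int l * m) - qq powi (- (int l * m))) / of_int ?m"
        by (simp only: heis_coeff_def mult.commute)
      also have "\<dots> = den * r"
        unfolding s(2) den_def r_def using l_pos by (simp add: divide_inverse)
      finally show ?thesis .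
    qed
    have "ev r = of_int m * (inverse (of_int (int l)) * inverse (of_int ?m))"
      using s by (simp add: r_def laurent_eval_mult laurent_eval_inverse_of_int eps_nonzero del: of_int_of_nat_eq of_int_mult)
    also have "\<dots> = 1 / (of_nat l * of_nat l)" using m by (simp add: field_simps)
    finally have er: "ev r = 1 / (of_nat l * of_nat l)" .
    have "hh ?m \<otimes>\<^bsub>Uq_alg\<^esub> hh ?n = hh ?n \<otimes>\<^bsub>Uq_alg\<^esub> hh ?m \<oplus>\<^bsub>Uq_alg\<^esub> heis_coeff ?m \<odot>\<^bsub>Uq_alg\<^esub> G"
      using hh_heis[OF nz] True eq by (simp add: G_def)
    then have "com (hh ?m) (hh ?n) = heis_coeff ?m \<odot>\<^bsub>Uq_alg\<^esub> G"
      using c G by (simp add: com_def SA_subset a_minus_def UU.a_ac UU.r_neg1 UU.r_neg2 UU.r_neg)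
    then have "com (hh ?m) (hh ?n) = den \<odot>\<^bsub>Uq_alg\<^esub> (r \<odot>\<^bsub>Uq_alg\<^esub> G)"
      using G h by (simp add: SA_subset UU.smult_assoc1)
    then have "br (cls (hh ?m)) (cls (hh ?n)) = cls (r \<odot>\<^bsub>Uq_alg\<^esub> G)"
      by (intro br_exact) (use c center_hh m n G r in simp_all)
    also have "\<dots> = (1 / (of_nat l * of_nat l)) \<odot>\<^bsub>Ue\<^esub> cls G"
      using r G er by (simp add: cls_smult_laurent)
    finally show ?thesis using True by (simp add: G_def cls_minus)
  next
    case False
    have "hh ?m \<otimes>\<^bsub>Uq_alg\<^esub> hh ?n = hh ?n \<otimes>\<^bsub>Uq_alg\<^esub> hh ?m"
      using hh_heis[OF nz] False eq c by (simp add: SA_subset)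
    then show ?thesis using False br_commuting[OF c(1) center_hh[OF m] c(2) center_hh[OF n]] by simp
  qed
qed

text \<open>Exchanging h_ml and \<Lambda>^(sl) costs q^(2lk) with k = msl. Since q^(2lk) - 1 is
  q^(lk) times q^(lk) - q^(-lk), the quotient by the denominator evaluates to k / l = ms, the same
  integer as for the specialization at 1.\<close>

lemma br_hh_lamp:
  assumes m: "m \<noteq> 0"
  shows "br (cls (hh (m * int l))) (cls (lamp (s * int l))) =
    of_int (m * s) \<odot>\<^bsub>Ue\<^esub> (cls (lamp (s * int l)) \<otimes>\<^bsub>Ue\<^esub> cls (hh (m * int l)))"
proof -
  let ?m = "m * int l" and ?s = "s * int l"
  have nz: "?m \<noteq> 0" using m by simp
  define k where "k = m * s * int l"
  define Y where "Y = lamp ?s \<otimes>\<^bsub>Uq_alg\<^esub> hh ?m"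
  have Y: "Y \<in> SA" using nz by (simp add: Y_def)
  obtain u where u: "u \<in> laurent" "qq powi (int l * k) - qq powi (- (int l * k)) = (qq powi int l - qq powi (- int l)) * u" "ev u = of_int k"
    using qnum_laurent by blast
  define r where "r = qq powi (int l * k) * u * inverse (of_int (int l))"
  have r: "r \<in> laurent" using u by (simp add: r_def del: of_int_of_nat_eq)
  have er: "ev r = of_int (m * s)"
    using u l_pos
    by (simp add: r_def laurent_eval_mult laurent_eval_inverse_of_int eps_nonzero ev_qq_powi del: of_int_of_nat_eq)
      (simp add: k_def)
  have "qq powi (2 * ?m * ?s) - 1 = qq powi (int l * k) * (qq powi (int l * k) - qq powi (- (int l * k)))"
  proof -
    have "qq powi (int l * k) * qq powi (- (int l * k)) = 1" by (simp add: power_int_minus)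
    moreover have "qq powi (2 * ?m * ?s) = qq powi (int l * k) * qq powi (int l * k)"
    proof -
      have "2 * ?m * ?s = int l * k + int l * k" by (simp add: k_def)
      then show ?thesis by (simp only: power_int_add[OF disjI1[OF qq_nonzero]])
    qed
    ultimately show ?thesis by (simp add: right_diff_distrib)
  qed
  also have "\<dots> = den * r"
    unfolding u(2) den_def r_def using l_pos by simp
  finally have q: "qq powi (2 * ?m * ?s) - 1 = den * r" .
  have "com (hh ?m) (lamp ?s) = (qq powi (2 * ?m * ?s)) \<odot>\<^bsub>Uq_alg\<^esub> Y \<ominus>\<^bsub>Uq_alg\<^esub> Y"
    using nz by (simp add: com_def hh_lamp Y_def)
  also have "\<dots> = (qq powi (2 * ?m * ?s) - 1) \<odot>\<^bsub>Uq_alg\<^esub> Y"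
    using Y by (simp add: UU.smult_minus_left SA_subset)
  finally have "com (hh ?m) (lamp ?s) = den \<odot>\<^bsub>Uq_alg\<^esub> (r \<odot>\<^bsub>Uq_alg\<^esub> Y)"
    unfolding q using Y by (simp add: UU.smult_assoc1 SA_subset)
  then have "br (cls (hh ?m)) (cls (lamp ?s)) = cls (r \<odot>\<^bsub>Uq_alg\<^esub> Y)"
    by (intro br_exact) (use nz center_hh m center_lamp Y r in simp_all)
  also have "\<dots> = of_int (m * s) \<odot>\<^bsub>Ue\<^esub> cls Y"
    using r Y er by (simp add: cls_smult_laurent)
  finally show ?thesis using nz by (simp add: Y_def Ue_mult)
qed

end

section \<open>The Frobenius map\<close>

lemma (in scalar_algebra) coord_lin:
  fixes c :: "'b \<Rightarrow> 'i \<Rightarrow> 'k"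
  assumes v: "v \<in> scalars_in E" and e: "e ` E \<subseteq> carrier M" and i: "i \<in> E"
    and c: "\<And>x y. x \<in> carrier M \<Longrightarrow> y \<in> carrier M \<Longrightarrow> c (x \<oplus> y) i = c x i + c y i"
      "\<And>r x. r \<in> A \<Longrightarrow> x \<in> carrier M \<Longrightarrow> c (r \<odot> x) i = r * c x i"
      "\<And>j. j \<in> E \<Longrightarrow> c (e j) i = (if j = i then 1 else 0)"
  shows "c (lin e v) i = Poly_Mapping.lookup v i"
  using v
proof (induction v rule: scalars_in_induct)
  case zero
  have "c (0 \<odot> \<one>) i = 0 * c \<one> i" by (rule c(2)) simp_all
  then show ?case by (simp add: lin_zero)
next
  case (single a r)
  then have "e a \<in> carrier M" using e by auto
  then show ?case using single by (simp add: lin_single c(2,3) lookup_single when_def)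
next
  case (add f g)
  then show ?case
    using lin_closed[OF add(1) e] lin_closed[OF add(2) e] by (simp add: lin_add[OF add(1,2) e] c(1) lookup_add)
qed

lemma (in scalar_algebra) coord_eq_zero:
  fixes c :: "'b \<Rightarrow> 'i \<Rightarrow> 'k"
  assumes "x \<in> span_of M A e E" "e ` E \<subseteq> carrier M"
    and "\<And>x y i. x \<in> carrier M \<Longrightarrow> y \<in> carrier M \<Longrightarrow> c (x \<oplus> y) i = c x i + c y i"
      "\<And>r x i. r \<in> A \<Longrightarrow> x \<in> carrier M \<Longrightarrow> c (r \<odot> x) i = r * c x i"
      "\<And>j i. j \<in> E \<Longrightarrow> c (e j) i = (if j = i then 1 else 0)"
    and "\<And>i. i \<in> E \<Longrightarrow> c x i = 0"
  shows "x = \<zero>"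
proof -
  obtain v where v: "v \<in> scalars_in E" "x = lin e v" using span_of_lin[OF assms(1,2)] by blast
  have "Poly_Mapping.lookup v i = 0" if "i \<in> E" for i
    using coord_lin[where c = c, OF v(1) assms(2) that assms(3,4,5)] assms(6)[OF that] v(2) by simp
  moreover have "Poly_Mapping.lookup v i = 0" if "i \<notin> E" for i
    using v(1) that by (auto simp: scalars_in_def in_keys_iff)
  ultimately have "v = 0" by (intro poly_mapping_eqI) (metis lookup_zero)
  then show ?thesis using v(2) lin_zero by simp
qed

text \<open>A spanning family with dual coordinate functions is a basis, so a linear map may be
  prescribed on it. Multiplicativity is not part of this and has to be proved afterwards for the map
  so obtained.\<close>

lemma linear_map_exists:
  fixes M :: "('k::comm_ring_1, 'b, 'm) module_scheme" and M' :: "('k, 'd, 'n) module_scheme"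
    and c :: "'b \<Rightarrow> 'i \<Rightarrow> 'k"
  assumes M: "scalar_algebra M UNIV" and M': "scalar_algebra M' UNIV"
    and e: "e ` E \<subseteq> carrier M" and f: "f ` E \<subseteq> carrier M'"
    and span: "\<And>x. x \<in> carrier M \<Longrightarrow> x \<in> span_of M UNIV e E"
    and c: "\<And>x y i. x \<in> carrier M \<Longrightarrow> y \<in> carrier M \<Longrightarrow> c (x \<oplus>\<^bsub>M\<^esub> y) i = c x i + c y i"
      "\<And>r x i. x \<in> carrier M \<Longrightarrow> c (r \<odot>\<^bsub>M\<^esub> x) i = r * c x i"
      "\<And>j i. j \<in> E \<Longrightarrow> c (e j) i = (if j = i then 1 else 0)"
  shows "\<exists>F. (\<forall>x\<in>carrier M. F x \<in> carrier M') \<and>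
    (\<forall>x\<in>carrier M. \<forall>y\<in>carrier M. F (x \<oplus>\<^bsub>M\<^esub> y) = F x \<oplus>\<^bsub>M'\<^esub> F y) \<and>
    (\<forall>r. \<forall>x\<in>carrier M. F (r \<odot>\<^bsub>M\<^esub> x) = r \<odot>\<^bsub>M'\<^esub> F x) \<and> (\<forall>i\<in>E. F (e i) = f i)"
proof -
  interpret M: scalar_algebra M UNIV by fact
  interpret M': scalar_algebra M' UNIV by fact
  define V where "V x = (SOME v. v \<in> M.scalars_in E \<and> x = M.lin e v)" for x
  have V: "V x \<in> M.scalars_in E \<and> x = M.lin e (V x)" if "x \<in> carrier M" for x
    unfolding V_def by (rule someI_ex) (use M.span_of_lin[OF span[OF that] e] in blast)
  have lookup: "Poly_Mapping.lookup v i = c (M.lin e v) i" if "v \<in> M.scalars_in E" "i \<in> E" for v i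
    using M.coord_lin[where c = c, OF that(1) e that(2) c] by simp
  \<comment> \<open>The coefficients are chosen by \<open>SOME\<close>; since the coordinate
    functions determine them, the choice is unique and therefore additive.\<close>
  have uniq: "V (M.lin e v) = v" if v: "v \<in> M.scalars_in E" for v
  proof (rule poly_mapping_eqI)
    fix i
    have x: "M.lin e v \<in> carrier M" by (rule M.lin_closed[OF v e])
    show "Poly_Mapping.lookup (V (M.lin e v)) i = Poly_Mapping.lookup v i"
    proof (cases "i \<in> E")
      case True
      then show ?thesis using lookup[of "V (M.lin e v)" i] lookup[OF v True] V[OF x] by simp
    next
      case False
      have "Poly_Mapping.lookup w i = 0" if "w \<in> M.scalars_in E" for w
        using that False by (auto simp: M.scalars_in_def in_keys_iff)
      then show ?thesis using V[OF x] v by simp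
    qed
  qed
  define F where "F x = M'.lin f (V x)" for x
  have closed: "F x \<in> carrier M'" if "x \<in> carrier M" for x
    unfolding F_def using V[OF that] f by (intro M'.lin_closed) auto
  have add: "F (x \<oplus>\<^bsub>M\<^esub> y) = F x \<oplus>\<^bsub>M'\<^esub> F y" if xy: "x \<in> carrier M" "y \<in> carrier M" for x y
  proof -
    note vx = conjunct1[OF V[OF xy(1)]] and ex = conjunct2[OF V[OF xy(1)]]
      and vy = conjunct1[OF V[OF xy(2)]] and ey = conjunct2[OF V[OF xy(2)]]
    have "M.lin e (V x + V y) = M.lin e (V x) \<oplus>\<^bsub>M\<^esub> M.lin e (V y)"
      by (rule M.lin_add[OF vx vy e])
    also have "\<dots> = x \<oplus>\<^bsub>M\<^esub> y" by (simp only: ex[symmetric] ey[symmetric])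
    finally have "V (x \<oplus>\<^bsub>M\<^esub> y) = V x + V y"
      using uniq[OF M.scalars_in_add[OF vx vy]] by simp
    then show ?thesis
      unfolding F_def using M'.lin_add[OF vx vy f] by simp
  qed
  have base: "F (r \<odot>\<^bsub>M\<^esub> e i) = r \<odot>\<^bsub>M'\<^esub> f i" if i: "i \<in> E" for r i
  proof -
    have ei: "e i \<in> carrier M" "f i \<in> carrier M'" using i e f by auto
    have "V (r \<odot>\<^bsub>M\<^esub> e i) = Poly_Mapping.single i r"
      using uniq[OF M.scalars_in_single[OF i, of r]] ei by (simp add: M.lin_single)
    then show ?thesis unfolding F_def using ei by (simp add: M'.lin_single)
  qed
  have zero: "F \<zero>\<^bsub>M\<^esub> = \<zero>\<^bsub>M'\<^esub>"
    using add[of "\<zero>\<^bsub>M\<^esub>" "\<zero>\<^bsub>M\<^esub>"] closed[of "\<zero>\<^bsub>M\<^esub>"] by simp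
  have smult: "F (r \<odot>\<^bsub>M\<^esub> x) = r \<odot>\<^bsub>M'\<^esub> F x" if x: "x \<in> carrier M" for r x
    using span[OF x]
  proof (induction rule: span_of.induct)
    case zero
    then show ?case using \<open>F \<zero>\<^bsub>M\<^esub> = \<zero>\<^bsub>M'\<^esub>\<close> by simp
  next
    case (step t i y)
    have ei: "e i \<in> carrier M" "f i \<in> carrier M'" using step(2) e f by auto
    have y: "y \<in> carrier M" using M.span_of_closed[OF step(3) e] .
    show ?case
      using ei y step.IH closed[OF y]
      by (simp add: add M.smult_r_distr base[OF step(2)] M'.smult_r_distr M'.smult_assoc1 flip: M.smult_assoc1)
  qed
  have "F (e i) = f i" if "i \<in> E" for i
    using base[OF that, of 1] e f that by (auto simp: image_subset_iff)
  then show ?thesis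
    by (intro exI[of _ F] conjI ballI allI) (simp_all add: closed add smult)
qed

lemma pow_transfer: "monoid.mult S = monoid.mult R \<Longrightarrow> one S = one R \<Longrightarrow> x [^]\<^bsub>S\<^esub> (n::nat) = x [^]\<^bsub>R\<^esub> n"
  by (simp add: nat_pow_def)

text \<open>\<Lambda>, \<Gamma> and k share the behaviour of group-like elements. Pairing each with
  its inverse allows the Hopf operations on their integer powers to be treated at once.\<close>

definition inverse_letters :: "(gen \<times> gen) set" where
  "inverse_letters = {(GenLam, GenLam'), (GenGam, GenGam'), (GenK, GenK')}"

abbreviation lpow :: "gen \<Rightarrow> gen \<Rightarrow> int \<Rightarrow> uq" where
  "lpow x y \<equiv> ipow Uq_alg (ugen x) (ugen y)"

lemma gam_lpow: "gam n = lpow GenGam GenGam' n"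
proof (induction n rule: int_induct[where k = 0])
  case (step1 i)
  then show ?case unfolding gam_Suc by (simp add: UU.ipow_Suc)
next
  case (step2 i)
  then show ?case unfolding gam_pred by (simp add: UU.ipow_pred)
qed (simp add: ipow_def)

lemma lpow_facts:
  assumes "(x, y) \<in> inverse_letters"
  shows "lpow x y n \<in> SA" "lpow x y 0 = \<one>\<^bsub>Uq_alg\<^esub>"
    "lpow x y (n + 1) = ugen x \<otimes>\<^bsub>Uq_alg\<^esub> lpow x y n" "lpow x y (n - 1) = ugen y \<otimes>\<^bsub>Uq_alg\<^esub> lpow x y n"
    "ugen x \<otimes>\<^bsub>Uq_alg\<^esub> lpow x y n = lpow x y n \<otimes>\<^bsub>Uq_alg\<^esub> ugen x"
    "ugen y \<otimes>\<^bsub>Uq_alg\<^esub> lpow x y n = lpow x y n \<otimes>\<^bsub>Uq_alg\<^esub> ugen y"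
    "ugen x \<in> SA" "ugen y \<in> SA" "S_U (ugen x) = ugen y" "S_U (ugen y) = ugen x"
    "x \<in> {GenLam, GenLam', GenGam, GenGam', GenK, GenK'}" "y \<in> {GenLam, GenLam', GenGam, GenGam', GenK, GenK'}"
proof -
  have gam: "lpow GenGam GenGam' n \<in> SA" using gam_SA[of n] by (simp only: gam_lpow)
  show "lpow x y n \<in> SA" using assms gam by (auto simp: inverse_letters_def)
  show "lpow x y 0 = \<one>\<^bsub>Uq_alg\<^esub>" by (simp add: ipow_def)
  have g: "ugen x \<in> carrier Uq_alg" "ugen y \<in> carrier Uq_alg"
    "ugen x \<otimes>\<^bsub>Uq_alg\<^esub> ugen y = \<one>\<^bsub>Uq_alg\<^esub>" "ugen y \<otimes>\<^bsub>Uq_alg\<^esub> ugen x = \<one>\<^bsub>Uq_alg\<^esub>"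
    using assms by (auto simp: inverse_letters_def)
  show "lpow x y (n + 1) = ugen x \<otimes>\<^bsub>Uq_alg\<^esub> lpow x y n" "lpow x y (n - 1) = ugen y \<otimes>\<^bsub>Uq_alg\<^esub> lpow x y n"
    using g by (simp_all add: UU.ipow_Suc UU.ipow_pred)
  show "ugen x \<otimes>\<^bsub>Uq_alg\<^esub> lpow x y n = lpow x y n \<otimes>\<^bsub>Uq_alg\<^esub> ugen x"
    "ugen y \<otimes>\<^bsub>Uq_alg\<^esub> lpow x y n = lpow x y n \<otimes>\<^bsub>Uq_alg\<^esub> ugen y"
    by (rule UU.ipow_commute; use g in simp)+
  show "ugen x \<in> SA" "ugen y \<in> SA" "S_U (ugen x) = ugen y" "S_U (ugen y) = ugen x"
    "x \<in> {GenLam, GenLam', GenGam, GenGam', GenK, GenK'}" "y \<in> {GenLam, GenLam', GenGam, GenGam', GenK, GenK'}"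
    using assms by (auto simp: inverse_letters_def S_U_simps)
qed

lemma lpow_pbw:
  assumes N: "0 \<notin># N"
  shows "lpow GenLam GenLam' n \<otimes>\<^bsub>Uq_alg\<^esub> pbw (a, b, c, N) = pbw (a + n, b, c, N)"
    "lpow GenGam GenGam' n \<otimes>\<^bsub>Uq_alg\<^esub> pbw (a, b, c, N) = pbw (a, b + n, c, N)"
    "lpow GenK GenK' n \<otimes>\<^bsub>Uq_alg\<^esub> pbw (a, b, c, N) = pbw (a, b, c + n, N)"
proof -
  have c: "pbw (a, b, c, N) \<in> carrier Uq_alg" for a b c using N by (rule pbw_closed)
  have gen: "lpow x y n \<otimes>\<^bsub>Uq_alg\<^esub> pbw (a, b, c, N) = P n"
    if xy: "(x, y) \<in> inverse_letters" and P: "\<And>n. P n \<in> carrier Uq_alg" "P 0 = pbw (a, b, c, N)"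
      "\<And>n. ugen x \<otimes>\<^bsub>Uq_alg\<^esub> P n = P (n + 1)" "\<And>n. ugen y \<otimes>\<^bsub>Uq_alg\<^esub> P n = P (n - 1)" for x y P n
  proof (induction n rule: int_induct[where k = 0])
    case base
    then show ?case unfolding lpow_facts(2)[OF xy] P(2) using c by (rule UU.l_one)
  next
    case (step1 i)
    have "lpow x y (i + 1) \<otimes>\<^bsub>Uq_alg\<^esub> pbw (a, b, c, N) = ugen x \<otimes>\<^bsub>Uq_alg\<^esub> (lpow x y i \<otimes>\<^bsub>Uq_alg\<^esub> pbw (a, b, c, N))"
      unfolding lpow_facts(3)[OF xy] by (intro UU.m_assoc SA_subset lpow_facts[OF xy] c)
    then show ?case by (simp only: step1 P)
  next
    case (step2 i)
    have "lpow x y (i - 1) \<otimes>\<^bsub>Uq_alg\<^esub> pbw (a, b, c, N) = ugen y \<otimes>\<^bsub>Uq_alg\<^esub> (lpow x y i \<otimes>\<^bsub>Uq_alg\<^esub> pbw (a, b, c, N))"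
      unfolding lpow_facts(4)[OF xy] by (intro UU.m_assoc SA_subset lpow_facts[OF xy] c)
    then show ?case by (simp only: step2 P)
  qed
  show "lpow GenLam GenLam' n \<otimes>\<^bsub>Uq_alg\<^esub> pbw (a, b, c, N) = pbw (a + n, b, c, N)"
    by (rule gen) (use N in \<open>simp_all add: inverse_letters_def ugen_pbw algebra_simps del: pbw.simps add: c\<close>)
  show "lpow GenGam GenGam' n \<otimes>\<^bsub>Uq_alg\<^esub> pbw (a, b, c, N) = pbw (a, b + n, c, N)"
    by (rule gen) (use N in \<open>simp_all add: inverse_letters_def ugen_pbw algebra_simps del: pbw.simps add: c\<close>)
  show "lpow GenK GenK' n \<otimes>\<^bsub>Uq_alg\<^esub> pbw (a, b, c, N) = pbw (a, b, c + n, N)"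
    by (rule gen) (use N in \<open>simp_all add: inverse_letters_def ugen_pbw algebra_simps del: pbw.simps add: c\<close>)
qed

text \<open>The generators and the powers of the invertible ones are themselves basis monomials, so
  a linear map prescribed on the basis can be read off on them.\<close>

lemma lpow_eq_pbw: "lpow GenLam GenLam' n = pbw (n, 0, 0, {#})" "lpow GenGam GenGam' n = pbw (0, n, 0, {#})"
  "lpow GenK GenK' n = pbw (0, 0, n, {#})" "m \<noteq> 0 \<Longrightarrow> hh m = pbw (0, 0, 0, {#m#})"
  by (simp_all flip: gam_lpow)

context specialization
begin

lemma cls_lpow_Suc:
  assumes "(x, y) \<in> inverse_letters"
  shows "cls (lpow x y (n + 1)) = cls (ugen x) \<otimes>\<^bsub>Ue\<^esub> cls (lpow x y n)"
    "cls (lpow x y (n - 1)) = cls (ugen y) \<otimes>\<^bsub>Ue\<^esub> cls (lpow x y n)"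
  using lpow_facts[OF assms] by (simp_all add: Ue_mult)

lemma cls_lpow_power:
  assumes "(x, y) \<in> inverse_letters"
  shows "cls (lpow x y (int n)) = cls (ugen x) [^]\<^bsub>Ue\<^esub> n" "cls (lpow x y (- int n)) = cls (ugen y) [^]\<^bsub>Ue\<^esub> n"
proof -
  note f = lpow_facts[OF assms]
  show "cls (lpow x y (int n)) = cls (ugen x) [^]\<^bsub>Ue\<^esub> n"
  proof (induction n)
    case (Suc n)
    have "cls (lpow x y (int (Suc n))) = cls (ugen x) \<otimes>\<^bsub>Ue\<^esub> cls (lpow x y (int n))"
      using cls_lpow_Suc(1)[OF assms, of "int n"] by (simp add: add.commute)
    then show ?case using Suc f(7) Ue.nat_pow_Suc2[of "cls (ugen x)" n] by simp
  qed (simp add: f(2) Ue_one)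
  show "cls (lpow x y (- int n)) = cls (ugen y) [^]\<^bsub>Ue\<^esub> n"
  proof (induction n)
    case (Suc n)
    have "- int (Suc n) = - int n - 1" by simp
    then have "cls (lpow x y (- int (Suc n))) = cls (ugen y) \<otimes>\<^bsub>Ue\<^esub> cls (lpow x y (- int n))"
      using cls_lpow_Suc(2)[OF assms, of "- int n"] by (simp only:)
    then show ?case using Suc f(8) Ue.nat_pow_Suc2[of "cls (ugen y)" n] by simp
  qed (simp add: f(2) Ue_one)
qed

lemma comult_lpow:
  assumes "(x, y) \<in> inverse_letters"
  shows "comult (U_spec \<epsilon>) (cls (lpow x y n)) = ST.P'.pure (cls (lpow x y n)) (cls (lpow x y n))"
proof (induction n rule: int_induct[where k = 0])
  case base
  then show ?case using ring_hom_one[OF comult_spec_hom] by (simp add: lpow_facts(2)[OF assms] Ue_one[symmetric] ST.P'.T_one)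
next
  case (step1 i)
  note f = lpow_facts[OF assms]
  show ?case
    unfolding cls_lpow_Suc[OF assms]
    using step1 f(1)[of i] f(7) by (simp add: ring_hom_mult[OF comult_spec_hom] comult_spec_ugen[OF f(11)] ST.P'.pure_mult)
next
  case (step2 i)
  note f = lpow_facts[OF assms]
  show ?case
    unfolding cls_lpow_Suc[OF assms]
    using step2 f(1)[of i] f(8) by (simp add: ring_hom_mult[OF comult_spec_hom] comult_spec_ugen[OF f(12)] ST.P'.pure_mult)
qed

lemma counit_lpow:
  assumes "(x, y) \<in> inverse_letters"
  shows "counit (U_spec \<epsilon>) (cls (lpow x y n)) = 1"
proof (induction n rule: int_induct[where k = 0])
  case base
  then show ?case by (simp add: lpow_facts(2)[OF assms] Ue_one[symmetric] counit_spec)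
next
  case (step1 i)
  note f = lpow_facts[OF assms]
  show ?case unfolding cls_lpow_Suc[OF assms] using step1 f(1)[of i] f(7) by (simp add: counit_spec(2) counit_spec(6)[OF f(11)])
next
  case (step2 i)
  note f = lpow_facts[OF assms]
  show ?case unfolding cls_lpow_Suc[OF assms] using step2 f(1)[of i] f(8) by (simp add: counit_spec(2) counit_spec(6)[OF f(12)])
qed

lemma antipode_lpow:
  assumes "(x, y) \<in> inverse_letters"
  shows "antipode (U_spec \<epsilon>) (cls (lpow x y n)) = cls (lpow x y (- n))"
proof -
  note f = lpow_facts[OF assms]
  have "S_U (lpow x y n) = lpow x y (- n)"
  proof (induction n rule: int_induct[where k = 0])
    case base
    then show ?case by (simp add: f(2) S_U_simps)
  next
    case (step1 i)
    have "lpow x y (- (i + 1)) = ugen y \<otimes>\<^bsub>Uq_alg\<^esub> lpow x y (- i)"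
    proof -
      have "- (i + 1) = - i - 1" by simp
      then show ?thesis using f(4)[of "- i"] by (simp only:)
    qed
    then show ?case
      unfolding f(3) using step1 f(1)[of i] f(7) f(6)[of "- i"] by (simp add: S_U_simps SA_subset f(9))
  next
    case (step2 i)
    have "lpow x y (- (i - 1)) = ugen x \<otimes>\<^bsub>Uq_alg\<^esub> lpow x y (- i)"
    proof -
      have "- (i - 1) = - i + 1" by simp
      then show ?thesis using f(3)[of "- i"] by (simp only:)
    qed
    then show ?case
      unfolding f(4) using step2 f(1)[of i] f(8) f(5)[of "- i"] by (simp add: S_U_simps SA_subset f(10))
  qed
  then show ?thesis using f(1)[of n] by (simp add: antipode_cls)
qed

end

lemma lpow_unit:
  assumes "(x, y) \<in> inverse_letters"
  shows "lpow x y 1 = ugen x" "lpow x y (- 1) = ugen y"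
  using lpow_facts(3)[OF assms, of 0] lpow_facts(4)[OF assms, of 0] lpow_facts(2,7,8)[OF assms]
  by (simp_all add: SA_subset)

lemma ugen_lpow:
  assumes "g \<in> {GenLam, GenLam', GenGam, GenGam', GenK, GenK'}"
  obtains x y n where "(x, y) \<in> inverse_letters" "ugen g = lpow x y n"
proof -
  from assms show thesis
  proof (elim insertE emptyE)
    assume "g = GenLam"
    then show thesis using that[of GenLam GenLam' "1"] lpow_unit(1)[of GenLam GenLam'] by (simp add: inverse_letters_def)
  next
    assume "g = GenLam'"
    then show thesis using that[of GenLam GenLam' "- 1"] lpow_unit(2)[of GenLam GenLam'] by (simp add: inverse_letters_def)
  next
    assume "g = GenGam"
    then show thesis using that[of GenGam GenGam' "1"] lpow_unit(1)[of GenGam GenGam'] by (simp add: inverse_letters_def)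
  next
    assume "g = GenGam'"
    then show thesis using that[of GenGam GenGam' "- 1"] lpow_unit(2)[of GenGam GenGam'] by (simp add: inverse_letters_def)
  next
    assume "g = GenK"
    then show thesis using that[of GenK GenK' "1"] lpow_unit(1)[of GenK GenK'] by (simp add: inverse_letters_def)
  next
    assume "g = GenK'"
    then show thesis using that[of GenK GenK' "- 1"] lpow_unit(2)[of GenK GenK'] by (simp add: inverse_letters_def)
  qed
qed

interpretation O1: poisson_specialization 1 1
  by unfold_locales simp_all

context poisson_specialization
begin

abbreviation "U1 \<equiv> U_spec_alg 1"
abbreviation "cls1 \<equiv> spec_class 1"

text \<open>The exponent of k is not multiplied, in accordance with k being its own image under the
  Frobenius map.\<close>

fun sc :: "int \<times> int \<times> int \<times> int multiset \<Rightarrow> int \<times> int \<times> int \<times> int multiset" where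
  "sc (a, b, c, N) = (a * int l, b * int l, c, image_mset (\<lambda>m. m * int l) N)"

fun wt :: "int \<times> int \<times> int \<times> int multiset \<Rightarrow> complex" where
  "wt (a, b, c, N) = of_nat l ^ size N"

lemma wt_nonzero: "wt i \<noteq> 0"
  by (cases i) simp

lemma sc_index: "i \<in> pbw_index \<Longrightarrow> sc i \<in> pbw_index"
  by (cases i) (auto simp: pbw_index_def)

lemma sc_inj: "sc i = sc j \<longleftrightarrow> i = j"
proof -
  have "inj (image_mset (\<lambda>m. m * int l))" by (intro multiset.inj_map injI) simp
  then show ?thesis by (cases i; cases j) (auto dest: injD)
qed

text \<open>The letter \<open>h\<^sub>m\<close> contributes a factor \<open>l\<close>, hence the weights.\<close>

definition "is_Fr F \<longleftrightarrow> (\<forall>x\<in>carrier U1. F x \<in> carrier Ue) \<and>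
    (\<forall>x\<in>carrier U1. \<forall>y\<in>carrier U1. F (x \<oplus>\<^bsub>U1\<^esub> y) = F x \<oplus>\<^bsub>Ue\<^esub> F y) \<and>
    (\<forall>r. \<forall>x\<in>carrier U1. F (r \<odot>\<^bsub>U1\<^esub> x) = r \<odot>\<^bsub>Ue\<^esub> F x) \<and>
    (\<forall>i\<in>pbw_index. F (cls1 (pbw i)) = wt i \<odot>\<^bsub>Ue\<^esub> cls (pbw (sc i)))"

definition "Fr = (SOME F. is_Fr F)"

lemma is_Fr: "is_Fr Fr"
proof -
  have "\<exists>F. is_Fr F"
    unfolding is_Fr_def
    by (rule linear_map_exists[OF O1.scalar_algebra_Ue scalar_algebra_Ue O1.cls_pbw_image _ O1.Ue_span
          O1.spec_coord_add O1.spec_coord_smult O1.spec_coord_pbw])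
      (auto intro!: Ue.smult_closed cls_closed pbw_SA sc_index)
  then show ?thesis unfolding Fr_def by (rule someI_ex)
qed

lemma Fr_closed: "x \<in> carrier U1 \<Longrightarrow> Fr x \<in> carrier Ue"
  and Fr_add: "x \<in> carrier U1 \<Longrightarrow> y \<in> carrier U1 \<Longrightarrow> Fr (x \<oplus>\<^bsub>U1\<^esub> y) = Fr x \<oplus>\<^bsub>Ue\<^esub> Fr y"
  and Fr_smult: "x \<in> carrier U1 \<Longrightarrow> Fr (r \<odot>\<^bsub>U1\<^esub> x) = r \<odot>\<^bsub>Ue\<^esub> Fr x"
  and Fr_pbw: "i \<in> pbw_index \<Longrightarrow> Fr (cls1 (pbw i)) = wt i \<odot>\<^bsub>Ue\<^esub> cls (pbw (sc i))"
  using is_Fr by (simp_all add: is_Fr_def)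

lemma Fr_zero: "Fr \<zero>\<^bsub>U1\<^esub> = \<zero>\<^bsub>Ue\<^esub>"
  using Fr_add[of "\<zero>\<^bsub>U1\<^esub>" "\<zero>\<^bsub>U1\<^esub>"] Fr_closed[of "\<zero>\<^bsub>U1\<^esub>"] by simp

lemma Fr_hh: "m \<noteq> 0 \<Longrightarrow> Fr (cls1 (hh m)) = of_nat l \<odot>\<^bsub>Ue\<^esub> cls (hh (m * int l))"
  using Fr_pbw[of "(0, 0, 0, {#m#})"] by (simp add: lpow_eq_pbw(4) pbw_index_def del: pbw.simps)

lemma Fr_lpow:
  "Fr (cls1 (lpow GenLam GenLam' n)) = cls (lpow GenLam GenLam' (n * int l))"
  "Fr (cls1 (lpow GenGam GenGam' n)) = cls (lpow GenGam GenGam' (n * int l))"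
  "Fr (cls1 (lpow GenK GenK' n)) = cls (lpow GenK GenK' n)"
  using Fr_pbw[of "(n, 0, 0, {#})"] Fr_pbw[of "(0, n, 0, {#})"] Fr_pbw[of "(0, 0, n, {#})"]
  by (simp_all add: lpow_eq_pbw pbw_index_def pbw_SA del: pbw.simps)

lemma Fr_one: "Fr \<one>\<^bsub>U1\<^esub> = \<one>\<^bsub>Ue\<^esub>"
  using Fr_lpow(1)[of 0] by (simp add: ipow_def Ue_one O1.Ue_one)

lemma Fr_mult_basis:
  assumes x: "x \<in> carrier U1" and basis: "\<And>i. i \<in> pbw_index \<Longrightarrow> Fr (x \<otimes>\<^bsub>U1\<^esub> cls1 (pbw i)) = Fr x \<otimes>\<^bsub>Ue\<^esub> Fr (cls1 (pbw i))"
    and y: "y \<in> carrier U1"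
  shows "Fr (x \<otimes>\<^bsub>U1\<^esub> y) = Fr x \<otimes>\<^bsub>Ue\<^esub> Fr y"
  using O1.Ue_span[OF y]
proof (induction rule: span_of.induct)
  case zero
  then show ?case using x by (simp add: Fr_zero Fr_closed)
next
  case (step r i z)
  have z: "z \<in> carrier U1" using O1.Ue.span_of_closed[OF step(3) O1.cls_pbw_image] .
  have i: "cls1 (pbw i) \<in> carrier U1" using step(2) by (simp add: pbw_SA)
  show ?case
    using x z i step.IH basis[OF step(2)]
    by (simp add: O1.Ue.r_distr O1.Ue.smult_mult_right Fr_add Fr_smult Fr_closed Ue.r_distr Ue.smult_mult_right)
qed

text \<open>Induction on the left factor reduces the claim to a generator times a basis monomial. At
  1 and, for the image of the generator, also at \<epsilon>, the product is a multiple of a single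
  monomial, since corrections vanish. The scaling of indices respects this, and each added letter h
  accounts for one factor l of the weight.\<close>

lemma Fr_mult:
  assumes "x \<in> carrier U1" "y \<in> carrier U1"
  shows "Fr (x \<otimes>\<^bsub>U1\<^esub> y) = Fr x \<otimes>\<^bsub>Ue\<^esub> Fr y"
  using assms
proof (induction arbitrary: y rule: O1.Ue_induct)
  case one
  then show ?case by (simp add: Fr_one Fr_closed)
next
  case (hh m)
  show ?case
  proof (rule Fr_mult_basis)
    fix i assume i: "i \<in> pbw_index"
    obtain a b c N where abc: "i = (a, b, c, N)" "0 \<notin># N" using i by (auto simp: pbw_index_def)
    have "0 \<notin># image_mset (\<lambda>m. m * int l) N" using abc(2) by auto
    note E = cls_hh_pbw[OF hh(1) this, of "a * int l" "b * int l" c]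
    have O: "cls1 (hh m) \<otimes>\<^bsub>U1\<^esub> cls1 (pbw i) = cls1 (pbw (a, b, c, add_mset m N))"
      using O1.cls_hh_pbw[OF hh(1) abc(2), of a b c] hh(1) abc(2) pbw_SA[of "(a, b, c, add_mset m N)"]
      by (simp add: abc(1) pbw_index_def del: pbw.simps)
    have j: "(a, b, c, add_mset m N) \<in> pbw_index" using abc(2) hh(1) by (simp add: pbw_index_def)
    \<comment> \<open>Moving h_ml past \<Lambda>^(al) costs nothing, as the exponent is a multiple
      of l.\<close>
    have e: "\<epsilon> powi (2 * (m * int l) * (a * int l)) = 1"
      using eps_powi_l'[of "2 * (m * int l) * a"] by (simp only: mult.assoc)
    have c: "cls (hh (m * int l)) \<in> carrier Ue" "cls (pbw (sc i)) \<in> carrier Ue"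
      "cls (pbw (sc (a, b, c, add_mset m N))) \<in> carrier Ue"
      using hh(1) pbw_SA[OF sc_index[OF i]] pbw_SA[OF sc_index[OF j]] by (simp_all del: pbw.simps sc.simps)
    have "cls (hh (m * int l)) \<otimes>\<^bsub>Ue\<^esub> cls (pbw (sc i)) = cls (pbw (sc (a, b, c, add_mset m N)))"
      using E c(3) by (simp add: abc(1) e del: pbw.simps)
    then show "Fr (cls1 (hh m) \<otimes>\<^bsub>U1\<^esub> cls1 (pbw i)) = Fr (cls1 (hh m)) \<otimes>\<^bsub>Ue\<^esub> Fr (cls1 (pbw i))"
      unfolding O Fr_pbw[OF j] Fr_pbw[OF i] Fr_hh[OF hh(1)]
      using c abc(1)
      by (simp add: Ue.smult_mult_left Ue.smult_mult_right Ue.smult_assoc1 Ue.smult_commute[of "of_nat l"] del: pbw.simps sc.simps)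
  qed (use hh in simp_all)
next
  case (ugen g)
  obtain x z n where g: "(x, z) \<in> inverse_letters" "ugen g = lpow x z n"
    by (rule ugen_lpow[OF ugen(1)])
  show ?case
  proof (rule Fr_mult_basis)
    fix i assume i: "i \<in> pbw_index"
    obtain a b c N where abc: "i = (a, b, c, N)" "0 \<notin># N" using i by (auto simp: pbw_index_def)
    have N: "0 \<notin># image_mset (\<lambda>m. m * int l) N" using abc(2) by auto
    have idx: "(a, b, c, N) \<in> pbw_index" for a b c using abc(2) by (simp add: pbw_index_def)
    have s: "pbw (a, b, c, image_mset (\<lambda>m. m * int l) N) \<in> SA" for a b c
      using N by (intro pbw_SA) (simp add: pbw_index_def)
    consider "x = GenLam" "z = GenLam'" | "x = GenGam" "z = GenGam'" | "x = GenK" "z = GenK'"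
      using g(1) by (auto simp: inverse_letters_def)
    then show "Fr (cls1 (ugen g) \<otimes>\<^bsub>U1\<^esub> cls1 (pbw i)) = Fr (cls1 (ugen g)) \<otimes>\<^bsub>Ue\<^esub> Fr (cls1 (pbw i))"
    proof cases
      case 1
      have "cls1 (ugen g) \<otimes>\<^bsub>U1\<^esub> cls1 (pbw i) = cls1 (pbw (a + n, b, c, N))"
        using lpow_facts(1)[OF g(1), of n] pbw_SA[OF i] lpow_pbw(1)[OF abc(2)]
        by (simp add: g(2) O1.Ue_mult abc(1) 1 del: pbw.simps)
      moreover have "cls (lpow x z (n * int l)) \<otimes>\<^bsub>Ue\<^esub> cls (pbw (sc i)) = cls (pbw (sc (a + n, b, c, N)))"
        using lpow_facts(1)[OF g(1), of "n * int l"] s lpow_pbw(1)[OF N]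
        by (simp add: Ue_mult abc(1) 1 ring_distribs del: pbw.simps)
      ultimately show ?thesis
        using lpow_facts(1)[OF g(1), of "n * int l"] s
        by (simp add: Fr_pbw idx abc(1) g(2) 1 Fr_lpow Ue.smult_mult_right del: pbw.simps)
    next
      case 2
      have "cls1 (ugen g) \<otimes>\<^bsub>U1\<^esub> cls1 (pbw i) = cls1 (pbw (a, b + n, c, N))"
        using lpow_facts(1)[OF g(1), of n] pbw_SA[OF i] lpow_pbw(2)[OF abc(2)]
        by (simp add: g(2) O1.Ue_mult abc(1) 2 del: pbw.simps)
      moreover have "cls (lpow x z (n * int l)) \<otimes>\<^bsub>Ue\<^esub> cls (pbw (sc i)) = cls (pbw (sc (a, b + n, c, N)))"
        using lpow_facts(1)[OF g(1), of "n * int l"] s lpow_pbw(2)[OF N]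
        by (simp add: Ue_mult abc(1) 2 ring_distribs del: pbw.simps)
      ultimately show ?thesis
        using lpow_facts(1)[OF g(1), of "n * int l"] s
        by (simp add: Fr_pbw idx abc(1) g(2) 2 Fr_lpow Ue.smult_mult_right del: pbw.simps)
    next
      case 3
      have "cls1 (ugen g) \<otimes>\<^bsub>U1\<^esub> cls1 (pbw i) = cls1 (pbw (a, b, c + n, N))"
        using lpow_facts(1)[OF g(1), of n] pbw_SA[OF i] lpow_pbw(3)[OF abc(2)]
        by (simp add: g(2) O1.Ue_mult abc(1) 3 del: pbw.simps)
      moreover have "cls (lpow x z n) \<otimes>\<^bsub>Ue\<^esub> cls (pbw (sc i)) = cls (pbw (sc (a, b, c + n, N)))"
        using lpow_facts(1)[OF g(1), of n] s lpow_pbw(3)[OF N]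
        by (simp add: Ue_mult abc(1) 3 ring_distribs del: pbw.simps)
      ultimately show ?thesis
        using lpow_facts(1)[OF g(1), of n] s
        by (simp add: Fr_pbw idx abc(1) g(2) 3 Fr_lpow Ue.smult_mult_right del: pbw.simps)
    qed
  qed (use ugen ugen_gens in simp_all)
next
  case (add x z)
  then show ?case by (simp add: O1.Ue.l_distr Fr_add Fr_closed Ue.l_distr)
next
  case (mult x z)
  then show ?case by (simp add: O1.Ue.m_assoc Fr_closed Ue.m_assoc)
next
  case (smult c x)
  then show ?case by (simp add: O1.Ue.smult_mult_left Fr_smult Fr_closed Ue.smult_mult_left)
qed

lemma Fr_hom: "Fr \<in> ring_hom U1 Ue"
  by (rule ring_hom_memI) (simp_all add: Fr_closed Fr_mult Fr_add Fr_one)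

text \<open>As \<open>sc\<close> is injective on indices, distinct monomials do not mix, and a
  coordinate is only multiplied by a nonzero weight. Injectivity of the Frobenius map follows by
  comparing coordinates.\<close>

lemma spec_coord_Fr:
  assumes x: "x \<in> carrier U1" and i: "i \<in> pbw_index"
  shows "spec_coord (Fr x) (sc i) = wt i * O1.spec_coord x i"
  using O1.Ue_span[OF x]
proof (induction rule: span_of.induct)
  case zero
  have "spec_coord (0 \<odot>\<^bsub>Ue\<^esub> \<zero>\<^bsub>Ue\<^esub>) (sc i) = 0 * spec_coord \<zero>\<^bsub>Ue\<^esub> (sc i)" by (rule spec_coord_smult) simp
  moreover have "O1.spec_coord (0 \<odot>\<^bsub>U1\<^esub> \<zero>\<^bsub>U1\<^esub>) i = 0 * O1.spec_coord \<zero>\<^bsub>U1\<^esub> i" by (rule O1.spec_coord_smult) simp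
  ultimately show ?case by (simp add: Fr_zero)
next
  case (step r j z)
  have z: "z \<in> carrier U1" using O1.Ue.span_of_closed[OF step(3) O1.cls_pbw_image] .
  have j: "cls1 (pbw j) \<in> carrier U1" "cls (pbw (sc j)) \<in> carrier Ue"
    using step(2) pbw_SA sc_index by simp_all
  show ?case
    using z j step.IH step(2)
    by (simp add: Fr_add Fr_smult Fr_closed spec_coord_add spec_coord_smult O1.spec_coord_add O1.spec_coord_smult
        Fr_pbw spec_coord_pbw O1.spec_coord_pbw sc_index sc_inj ring_distribs)
qed

lemma Fr_inj: "inj_on Fr (carrier U1)"
proof (rule inj_onI)
  fix x y assume xy: "x \<in> carrier U1" "y \<in> carrier U1" "Fr x = Fr y"
  have c: "x \<ominus>\<^bsub>U1\<^esub> y \<in> carrier U1" using xy by simp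
  have "Fr (x \<ominus>\<^bsub>U1\<^esub> y) = \<zero>\<^bsub>Ue\<^esub>"
    using ring_hom_minus[OF Fr_hom O1.ring_Ue ring_Ue xy(1,2)] xy Fr_closed by (simp add: a_minus_def Ue.r_neg)
  moreover have "spec_coord \<zero>\<^bsub>Ue\<^esub> j = 0" for j
    using spec_coord_smult[of "\<zero>\<^bsub>Ue\<^esub>" 0 j] by simp
  ultimately have "O1.spec_coord (x \<ominus>\<^bsub>U1\<^esub> y) i = 0" if "i \<in> pbw_index" for i
    using spec_coord_Fr[OF c that] wt_nonzero[of i] by simp
  then have "x \<ominus>\<^bsub>U1\<^esub> y = \<zero>\<^bsub>U1\<^esub>"
    using O1.Ue.coord_eq_zero[where c = O1.spec_coord, OF O1.Ue_span[OF c] O1.cls_pbw_image]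
      O1.spec_coord_add O1.spec_coord_smult O1.spec_coord_pbw by blast
  then show "x = y" using xy by simp
qed

end

text \<open>Keeps the parameter 1 of \<open>spec_bracket 1 1\<close> from being rewritten to
  \<open>Suc 0\<close>, so that it continues to match the facts of the instance
  \<open>O1\<close>.\<close>

declare One_nat_def [simp del]

lemma Z_one_simps [simp]:
  "carrier Z_one = carrier (U_spec_alg 1)" "monoid.mult Z_one = monoid.mult (U_spec_alg 1)"
  "one Z_one = one (U_spec_alg 1)" "ring.zero Z_one = ring.zero (U_spec_alg 1)"
  "add Z_one = add (U_spec_alg 1)" "module.smult Z_one = module.smult (U_spec_alg 1)"
  "comult Z_one = comult (U_spec 1)" "counit Z_one = counit (U_spec 1)"
  "antipode Z_one = antipode (U_spec 1)" "pbracket Z_one = spec_bracket 1 1"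
  by (simp_all add: Z_one_def add_poisson_def)

lemma lpow_commute_ugen:
  assumes "(x, y) \<in> inverse_letters" "g \<in> {GenLam, GenLam', GenGam, GenGam', GenK, GenK'}"
  shows "ugen g \<otimes>\<^bsub>Uq_alg\<^esub> lpow x y n = lpow x y n \<otimes>\<^bsub>Uq_alg\<^esub> ugen g"
proof -
  consider "x = GenLam" "y = GenLam'" | "x = GenGam" "y = GenGam'" | "x = GenK" "y = GenK'"
    using assms(1) by (auto simp: inverse_letters_def)
  then show ?thesis
  proof cases
    case 2
    have "g \<in> gens" using assms(2) by auto
    then show ?thesis using gam_commute[of g n] unfolding 2 gam_lpow by simp
  next
    case 3
    have "g \<in> gens" using assms(2) by auto
    then show ?thesis unfolding 3 by (rule kp_commute)
  next
    case 1
    show ?thesis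
    proof (cases "g \<in> {GenGam, GenGam', GenK, GenK'}")
      case True
      then show ?thesis unfolding 1 by (rule central_lamp)
    next
      case False
      then consider "g = x" | "g = y" using assms(2) 1 by auto
      then show ?thesis using lpow_facts(5,6)[OF assms(1)] by cases simp_all
    qed
  qed
qed

lemma lpow_commute_lpow:
  assumes "(x, y) \<in> inverse_letters" "(x', y') \<in> inverse_letters"
  shows "lpow x y n \<otimes>\<^bsub>Uq_alg\<^esub> lpow x' y' n' = lpow x' y' n' \<otimes>\<^bsub>Uq_alg\<^esub> lpow x y n"
proof (rule UU.ipow_commute)
  note f = lpow_facts[OF assms(1)] and f' = lpow_facts[OF assms(2)]
  show "ugen x' \<in> carrier Uq_alg" "ugen y' \<in> carrier Uq_alg" "lpow x y n \<in> carrier Uq_alg"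
    using f f' by (simp_all add: SA_subset)
  show "ugen x' \<otimes>\<^bsub>Uq_alg\<^esub> ugen y' = \<one>\<^bsub>Uq_alg\<^esub>" "ugen y' \<otimes>\<^bsub>Uq_alg\<^esub> ugen x' = \<one>\<^bsub>Uq_alg\<^esub>"
    using assms(2) by (auto simp: inverse_letters_def)
  show "lpow x y n \<otimes>\<^bsub>Uq_alg\<^esub> ugen x' = ugen x' \<otimes>\<^bsub>Uq_alg\<^esub> lpow x y n"
    "lpow x y n \<otimes>\<^bsub>Uq_alg\<^esub> ugen y' = ugen y' \<otimes>\<^bsub>Uq_alg\<^esub> lpow x y n"
    by (rule lpow_commute_ugen[OF assms(1), symmetric], rule f')+
qed

lemma hh_commute_lpow:
  assumes "m \<noteq> 0" "(x, y) \<in> inverse_letters" "x \<noteq> GenLam"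
  shows "hh m \<otimes>\<^bsub>Uq_alg\<^esub> lpow x y n = lpow x y n \<otimes>\<^bsub>Uq_alg\<^esub> hh m"
proof -
  consider "x = GenGam" "y = GenGam'" | "x = GenK" "y = GenK'"
    using assms(2,3) by (auto simp: inverse_letters_def)
  then show ?thesis
  proof cases
    case 1
    show ?thesis using hh_gam[OF assms(1), of n] unfolding 1 gam_lpow .
  next
    case 2
    show ?thesis unfolding 2 by (rule hh_kp[OF assms(1)])
  qed
qed

section \<open>Compatibility with the Poisson bracket, the counit and the antipode\<close>

context poisson_specialization
begin

definition "frob_letter x n = (if x = GenK then n else n * int l)"

lemma Fr_lpow': "(x, y) \<in> inverse_letters \<Longrightarrow> Fr (cls1 (lpow x y n)) = cls (lpow x y (frob_letter x n))"
  by (auto simp: inverse_letters_def Fr_lpow frob_letter_def)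

lemma center_lpow: "(x, y) \<in> inverse_letters \<Longrightarrow> cls (lpow x y (frob_letter x n)) \<in> center"
  using center_lamp[of n] center_gam[of "n * int l"] center_kp[of n]
  by (auto simp: inverse_letters_def frob_letter_def gam_lpow)

lemma U1_induct [consumes 1, case_names one hh lpow add mult smult]:
  assumes "u \<in> carrier U1" and "P \<one>\<^bsub>U1\<^esub>" and "\<And>m. m \<noteq> 0 \<Longrightarrow> P (cls1 (hh m))"
    and "\<And>x y n. (x, y) \<in> inverse_letters \<Longrightarrow> P (cls1 (lpow x y n))"
    and "\<And>x y. x \<in> carrier U1 \<Longrightarrow> y \<in> carrier U1 \<Longrightarrow> P x \<Longrightarrow> P y \<Longrightarrow> P (x \<oplus>\<^bsub>U1\<^esub> y)"
    and "\<And>x y. x \<in> carrier U1 \<Longrightarrow> y \<in> carrier U1 \<Longrightarrow> P x \<Longrightarrow> P y \<Longrightarrow> P (x \<otimes>\<^bsub>U1\<^esub> y)"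
    and "\<And>c x. x \<in> carrier U1 \<Longrightarrow> P x \<Longrightarrow> P (c \<odot>\<^bsub>U1\<^esub> x)"
  shows "P u"
  using assms(1)
proof (induction rule: O1.Ue_induct)
  case (ugen g)
  obtain x z n where g: "(x, z) \<in> inverse_letters" "ugen g = lpow x z n"
    by (rule ugen_lpow[OF ugen(1)])
  show ?case unfolding g(2) by (rule assms(4)[OF g(1)])
qed (fact assms)+

lemma cls1_lpow_closed [simp]: "(x, y) \<in> inverse_letters \<Longrightarrow> cls1 (lpow x y n) \<in> carrier U1"
  and cls_lpow_closed [simp]: "(x, y) \<in> inverse_letters \<Longrightarrow> cls (lpow x y n) \<in> carrier Ue"
  using lpow_facts(1)[of x y n] by simp_all

text \<open>For l = 1 the central elements found at a root of unity include all generators, so the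
  specialization at 1 is commutative. The laws of the bracket, stated for central elements, thus
  hold on all of it.\<close>

lemma U1_center: "u \<in> carrier U1 \<Longrightarrow> u \<in> O1.center"
proof (induction rule: U1_induct)
  case (hh m)
  then show ?case using O1.center_hh[OF hh] by simp
next
  case (lpow x y n)
  then show ?case
    using O1.center_lamp[of n] O1.center_gam[of n] O1.center_kp[of n]
    by (auto simp: inverse_letters_def gam_lpow)
qed (simp_all add: O1.center_subalgebra)

lemma Fr_center: "u \<in> carrier U1 \<Longrightarrow> Fr u \<in> center"
proof (induction rule: U1_induct)
  case (hh m)
  then show ?case by (simp add: Fr_hh center_subalgebra(4) center_hh)
next
  case (lpow x y n)
  then show ?case by (simp add: Fr_lpow' center_lpow)
qed (simp_all add: Fr_one Fr_add Fr_mult Fr_smult center_subalgebra)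

definition "bracket_compat u v \<longleftrightarrow> Fr (O1.br u v) = br (Fr u) (Fr v)"

lemma bracket_compat_sym:
  assumes "u \<in> carrier U1" "v \<in> carrier U1" "bracket_compat u v"
  shows "bracket_compat v u"
proof -
  note c = U1_center[OF assms(1)] U1_center[OF assms(2)]
  have "Fr (O1.br v u) = \<ominus>\<^bsub>Ue\<^esub> Fr (O1.br u v)"
    unfolding O1.br_anti[OF c] by (rule ring_hom_uminus[OF Fr_hom O1.ring_Ue ring_Ue O1.br_closed[OF c]])
  also have "\<dots> = br (Fr v) (Fr u)"
    using assms(3) br_anti[OF Fr_center[OF assms(1)] Fr_center[OF assms(2)]] by (simp add: bracket_compat_def)
  finally show ?thesis by (simp add: bracket_compat_def)
qed

text \<open>Both brackets are linear and satisfy the Leibniz rule in the first argument, and the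
  Frobenius map is an algebra homomorphism. For fixed second argument compatibility thus passes from
  generators to everything.\<close>

lemma bracket_compat_induct:
  assumes v: "v \<in> carrier U1" and u: "u \<in> carrier U1"
    and hh: "\<And>m. m \<noteq> 0 \<Longrightarrow> bracket_compat (cls1 (hh m)) v"
    and lp: "\<And>x y n. (x, y) \<in> inverse_letters \<Longrightarrow> bracket_compat (cls1 (lpow x y n)) v"
  shows "bracket_compat u v"
  using u
proof (induction rule: U1_induct)
  case one
  show ?case
    using U1_center[OF v] Fr_center[OF v] by (simp add: bracket_compat_def O1.br_one Fr_one br_one Fr_zero)
next
  case (hh m)
  then show ?case by (rule assms(3))
next
  case (lpow x y n)
  then show ?case by (rule assms(4))
next
  case (add x y)
  note c = U1_center[OF add(1)] U1_center[OF add(2)] U1_center[OF v]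
  show ?case
    using add c v Fr_center O1.br_closed[OF c(1,3)] O1.br_closed[OF c(2,3)]
    by (simp add: bracket_compat_def O1.br_add Fr_add br_add)
next
  case (mult x y)
  note c = U1_center[OF mult(1)] U1_center[OF mult(2)] U1_center[OF v]
  show ?case
    using mult c v Fr_center O1.br_closed[OF c(1,3)] O1.br_closed[OF c(2,3)]
    by (simp add: bracket_compat_def O1.br_mult Fr_add Fr_mult br_mult)
next
  case (smult r x)
  note c = U1_center[OF smult(1)] U1_center[OF v]
  show ?case
    using smult c v Fr_center O1.br_closed[OF c]
    by (simp add: bracket_compat_def O1.br_smult Fr_smult br_smult)
qed

lemma br_smult_right:
  assumes "u \<in> center" "w \<in> center"
  shows "br w (c \<odot>\<^bsub>Ue\<^esub> u) = c \<odot>\<^bsub>Ue\<^esub> br w u"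
  using br_anti[OF center_subalgebra(4)[OF assms(1)] assms(2), of c] br_anti[OF assms] br_smult[OF assms, of c] br_closed[OF assms]
  by (simp add: Ue.smult_uminus_right)

text \<open>The images of the two letters contribute a factor l each, which cancels the constant 1 /
  l^2 of the bracket at \<epsilon>. The remaining powers \<Gamma>^(2ml) and \<Gamma>^(-2ml) are the
  images of those occurring at 1.\<close>

lemma bracket_compat_hh_hh:
  assumes m: "m \<noteq> 0" and n: "n \<noteq> 0"
  shows "bracket_compat (cls1 (hh m)) (cls1 (hh n))"
proof -
  let ?g = "lpow GenGam GenGam'"
  have i: "(GenGam, GenGam') \<in> inverse_letters" by (simp add: inverse_letters_def)
  have 1: "O1.br (cls1 (hh m)) (cls1 (hh n)) =
    (if n = - m then cls1 (?g (2 * m)) \<ominus>\<^bsub>U1\<^esub> cls1 (?g (- (2 * m))) else \<zero>\<^bsub>U1\<^esub>)"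
    using O1.br_hh_hh[OF m n] i by (simp add: gam_lpow)
  have "br (Fr (cls1 (hh m))) (Fr (cls1 (hh n))) = (of_nat l * of_nat l) \<odot>\<^bsub>Ue\<^esub> br (cls (hh (m * int l))) (cls (hh (n * int l)))"
    using m n center_hh br_closed[OF center_hh[OF m] center_hh[OF n]]
    by (simp add: Fr_hh br_smult br_smult_right center_subalgebra(4) Ue.smult_assoc1)
  also have "\<dots> = (if n = - m then cls (?g (2 * m * int l)) \<ominus>\<^bsub>Ue\<^esub> cls (?g (- (2 * m) * int l)) else \<zero>\<^bsub>Ue\<^esub>)"
    unfolding br_hh_hh[OF m n] using i
    by (simp add: gam_lpow mult.assoc flip: Ue.smult_assoc1)
  also have "\<dots> = Fr (O1.br (cls1 (hh m)) (cls1 (hh n)))"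
    unfolding 1 using i ring_hom_minus[OF Fr_hom O1.ring_Ue ring_Ue, of "cls1 (?g (2 * m))" "cls1 (?g (- (2 * m)))"]
    by (simp add: Fr_lpow Fr_zero)
  finally show ?thesis by (simp add: bracket_compat_def)
qed

text \<open>For \<Lambda> both sides are linear in the letter h and carry one factor l, while the
  integer coefficient is the same at 1 and at \<epsilon>. Powers of \<Gamma> and k commute with the
  lifts already before specialization, and their brackets vanish.\<close>

lemma bracket_compat_hh_lpow:
  assumes m: "m \<noteq> 0" and xy: "(x, y) \<in> inverse_letters"
  shows "bracket_compat (cls1 (hh m)) (cls1 (lpow x y n))"
proof (cases "x = GenLam")
  case True
  then have y: "y = GenLam'" using xy by (auto simp: inverse_letters_def)
  have i: "(GenLam, GenLam') \<in> inverse_letters" using xy True y by simp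
  have c: "cls (hh (m * int l)) \<in> carrier Ue" "cls1 (hh m) \<in> carrier U1" using m by simp_all
  have "Fr (O1.br (cls1 (hh m)) (cls1 (lamp n))) =
      of_int (m * n) \<odot>\<^bsub>Ue\<^esub> (cls (lamp (n * int l)) \<otimes>\<^bsub>Ue\<^esub> (of_nat l \<odot>\<^bsub>Ue\<^esub> cls (hh (m * int l))))"
    using O1.br_hh_lamp[OF m, of n] c i m by (simp add: Fr_smult Fr_mult Fr_lpow Fr_hh)
  also have "\<dots> = of_nat l \<odot>\<^bsub>Ue\<^esub> br (cls (hh (m * int l))) (cls (lamp (n * int l)))"
    unfolding br_hh_lamp[OF m] using c i by (simp add: Ue.smult_mult_right Ue.smult_commute[of "of_nat l"] del: of_int_mult)
  also have "\<dots> = br (Fr (cls1 (hh m))) (Fr (cls1 (lamp n)))"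
    using m center_hh center_lamp by (simp add: Fr_hh Fr_lpow br_smult)
  finally show ?thesis unfolding True y by (simp add: bracket_compat_def)
next
  case False
  have ml: "m * int l \<noteq> 0" using m by simp
  have "O1.br (cls1 (hh m)) (cls1 (lpow x y n)) = \<zero>\<^bsub>U1\<^esub>"
    using lpow_facts(1)[OF xy] m U1_center hh_commute_lpow[OF m xy False] by (intro O1.br_commuting) (simp_all add: xy)
  moreover have "br (cls (hh (m * int l))) (cls (lpow x y (frob_letter x n))) = \<zero>\<^bsub>Ue\<^esub>"
    using lpow_facts(1)[OF xy] ml m center_hh center_lpow[OF xy] hh_commute_lpow[OF ml xy False] by (intro br_commuting) simp_all
  ultimately show ?thesis
    using m center_hh center_lpow[OF xy] by (simp add: bracket_compat_def Fr_zero Fr_hh Fr_lpow'[OF xy] br_smult)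
qed

lemma bracket_compat_lpow_lpow:
  assumes xy: "(x, y) \<in> inverse_letters" and xy': "(x', y') \<in> inverse_letters"
  shows "bracket_compat (cls1 (lpow x y n)) (cls1 (lpow x' y' n'))"
proof -
  have "O1.br (cls1 (lpow x y n)) (cls1 (lpow x' y' n')) = \<zero>\<^bsub>U1\<^esub>"
    using lpow_facts(1)[OF xy] lpow_facts(1)[OF xy'] U1_center lpow_commute_lpow[OF xy xy'] by (intro O1.br_commuting) simp_all
  moreover have "br (cls (lpow x y (frob_letter x n))) (cls (lpow x' y' (frob_letter x' n'))) = \<zero>\<^bsub>Ue\<^esub>"
    using lpow_facts(1)[OF xy] lpow_facts(1)[OF xy'] center_lpow[OF xy] center_lpow[OF xy'] lpow_commute_lpow[OF xy xy']
    by (intro br_commuting) simp_all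
  ultimately show ?thesis
    by (simp add: bracket_compat_def Fr_zero Fr_lpow'[OF xy] Fr_lpow'[OF xy'])
qed

text \<open>The induction principle only runs over the first argument. It is applied once with a
  generator as second argument; then antisymmetry exchanges the roles, and a second application
  makes the remaining argument arbitrary.\<close>

lemma Fr_bracket:
  assumes u: "u \<in> carrier U1" and v: "v \<in> carrier U1"
  shows "Fr (O1.br u v) = br (Fr u) (Fr v)"
proof -
  have hh: "bracket_compat w (cls1 (hh m))" if m: "m \<noteq> 0" and w: "w \<in> carrier U1" for m w
  proof (rule bracket_compat_induct[OF _ w])
    show "bracket_compat (cls1 (lpow x y n)) (cls1 (hh m))" if "(x, y) \<in> inverse_letters" for x y n
      by (rule bracket_compat_sym[OF _ _ bracket_compat_hh_lpow[OF m that]]) (use m that in simp_all)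
  qed (use m bracket_compat_hh_hh in simp_all)
  have lp: "bracket_compat w (cls1 (lpow x y n))" if xy: "(x, y) \<in> inverse_letters" and w: "w \<in> carrier U1" for x y n w
    by (rule bracket_compat_induct[OF _ w]) (use xy bracket_compat_hh_lpow bracket_compat_lpow_lpow in simp_all)
  have "bracket_compat u v"
  proof (rule bracket_compat_induct[OF v u])
    show "bracket_compat (cls1 (hh m)) v" if "m \<noteq> 0" for m
      by (rule bracket_compat_sym[OF v _ hh[OF that v]]) (use that in simp)
    show "bracket_compat (cls1 (lpow x y n)) v" if "(x, y) \<in> inverse_letters" for x y n
      by (rule bracket_compat_sym[OF v _ lp[OF that v]]) (use that in simp)
  qed
  then show ?thesis by (simp add: bracket_compat_def)
qed

lemma Fr_counit: "u \<in> carrier U1 \<Longrightarrow> counit (U_spec \<epsilon>) (Fr u) = counit (U_spec 1) u"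
proof (induction rule: U1_induct)
  case (hh m)
  then show ?case by (simp add: Fr_hh counit_spec O1.counit_spec)
next
  case (lpow x y n)
  then show ?case by (simp add: Fr_lpow' counit_lpow O1.counit_lpow)
qed (simp_all add: Fr_one Fr_add Fr_mult Fr_smult Fr_closed counit_spec O1.counit_spec)

lemma Fr_antipode: "u \<in> carrier U1 \<Longrightarrow> antipode (U_spec \<epsilon>) (Fr u) = Fr (antipode (U_spec 1) u)"
proof (induction rule: U1_induct)
  case (hh m)
  have "Fr (\<ominus>\<^bsub>U1\<^esub> cls1 (hh m)) = \<ominus>\<^bsub>Ue\<^esub> Fr (cls1 (hh m))"
    by (rule ring_hom_uminus[OF Fr_hom O1.ring_Ue ring_Ue]) (use hh in simp)
  then show ?case using hh by (simp add: Fr_hh antipode_spec O1.antipode_spec Ue.smult_uminus_right)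
next
  case (lpow x y n)
  have "- frob_letter x n = frob_letter x (- n)" by (simp add: frob_letter_def)
  then show ?case using lpow by (simp add: Fr_lpow' antipode_lpow O1.antipode_lpow)
qed (simp_all add: Fr_one Fr_add Fr_mult Fr_smult Fr_closed antipode_spec O1.antipode_spec)

end

section \<open>The image of the Frobenius map\<close>

context poisson_specialization
begin

definition "frob_gens = {spec_class \<epsilon> (hh (r * int l)) | r. r \<noteq> 0} \<union>
  {spec_class \<epsilon> (ugen x) | x. x \<in> {GenK, GenK'}} \<union>
  {spec_class \<epsilon> (ugen x) [^]\<^bsub>U_spec \<epsilon>\<^esub> l | x. x \<in> {GenGam, GenGam', GenLam, GenLam'}}"

abbreviation "Zset \<equiv> gen_subalgebra ring_C (U_spec \<epsilon>) frob_gens"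
abbreviation "Z \<equiv> Z_root \<epsilon> l"

lemma U_spec_pow: "x [^]\<^bsub>U_spec \<epsilon>\<^esub> (n::nat) = x [^]\<^bsub>Ue\<^esub> n"
  by (rule pow_transfer) simp_all

lemma Z_root_eq: "Z = add_poisson (restrict_hopf ring_C ring_C (U_spec \<epsilon>) Zset) br"
  by (simp add: Z_root_def frob_gens_def)

lemma Z_simps [simp]:
  "carrier Z = Zset" "monoid.mult Z = monoid.mult Ue" "one Z = one Ue" "ring.zero Z = ring.zero Ue"
  "add Z = add Ue" "module.smult Z = module.smult Ue"
  "counit Z = counit (U_spec \<epsilon>)" "antipode Z = antipode (U_spec \<epsilon>)" "pbracket Z = br"
  by (simp_all add: Z_root_eq add_poisson_def restrict_hopf_def)

lemma Z_pow: "x [^]\<^bsub>Z\<^esub> (n::nat) = x [^]\<^bsub>Ue\<^esub> n"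
  by (rule pow_transfer) simp_all

lemma scalar_algebra_U_spec: "scalar_algebra (U_spec \<epsilon>) UNIV"
  by (rule scalar_algebra_transfer[OF scalar_algebra_Ue]) simp_all

lemma frob_gens_closed: "frob_gens \<subseteq> carrier Ue"
  by (auto simp: frob_gens_def U_spec_pow)

lemma generated_Z: "generated_subalgebra (U_spec \<epsilon>) UNIV UNIV frob_gens ring_C"
  using frob_gens_closed
  by (intro generated_subalgebra.intro generated_subalgebra_axioms.intro scalar_algebra_U_spec) simp_all

lemma Zset_closed:
  "Zset \<subseteq> carrier Ue" "\<one>\<^bsub>Ue\<^esub> \<in> Zset" "x \<in> Zset \<Longrightarrow> y \<in> Zset \<Longrightarrow> x \<oplus>\<^bsub>Ue\<^esub> y \<in> Zset"
  "x \<in> Zset \<Longrightarrow> y \<in> Zset \<Longrightarrow> x \<otimes>\<^bsub>Ue\<^esub> y \<in> Zset" "x \<in> Zset \<Longrightarrow> c \<odot>\<^bsub>Ue\<^esub> x \<in> Zset" "h \<in> frob_gens \<Longrightarrow> h \<in> Zset"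
proof -
  interpret G: generated_subalgebra "U_spec \<epsilon>" UNIV UNIV frob_gens ring_C by (rule generated_Z)
  show "Zset \<subseteq> carrier Ue" "\<one>\<^bsub>Ue\<^esub> \<in> Zset" "x \<in> Zset \<Longrightarrow> y \<in> Zset \<Longrightarrow> x \<oplus>\<^bsub>Ue\<^esub> y \<in> Zset"
    "x \<in> Zset \<Longrightarrow> y \<in> Zset \<Longrightarrow> x \<otimes>\<^bsub>Ue\<^esub> y \<in> Zset" "x \<in> Zset \<Longrightarrow> c \<odot>\<^bsub>Ue\<^esub> x \<in> Zset" "h \<in> frob_gens \<Longrightarrow> h \<in> Zset"
    using G.S_subset G.S_closed G.S_smult by simp_all
qed

lemma Zset_induct [consumes 1, case_names one gen add mult smult]:
  assumes "x \<in> Zset" and "P \<one>\<^bsub>Ue\<^esub>" and "\<And>h. h \<in> frob_gens \<Longrightarrow> P h"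
    and "\<And>x y. x \<in> Zset \<Longrightarrow> y \<in> Zset \<Longrightarrow> P x \<Longrightarrow> P y \<Longrightarrow> P (x \<oplus>\<^bsub>Ue\<^esub> y)"
    and "\<And>x y. x \<in> Zset \<Longrightarrow> y \<in> Zset \<Longrightarrow> P x \<Longrightarrow> P y \<Longrightarrow> P (x \<otimes>\<^bsub>Ue\<^esub> y)"
    and "\<And>r x. x \<in> Zset \<Longrightarrow> P x \<Longrightarrow> P (r \<odot>\<^bsub>Ue\<^esub> x)"
  shows "P x"
proof -
  interpret G: generated_subalgebra "U_spec \<epsilon>" UNIV UNIV frob_gens ring_C by (rule generated_Z)
  show ?thesis using assms(1) by (rule G.S_induct) (simp_all add: assms)
qed

lemma scalar_algebra_HS: "scalar_algebra (U_spec \<epsilon>\<lparr>carrier := Zset\<rparr>) UNIV"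
proof -
  interpret G: generated_subalgebra "U_spec \<epsilon>" UNIV UNIV frob_gens ring_C by (rule generated_Z)
  show ?thesis by (rule G.scalar_algebra_S)
qed

lemma Fr_ugen:
  assumes "(x, y) \<in> inverse_letters"
  shows "x \<noteq> GenK \<Longrightarrow> Fr (cls1 (ugen x)) = cls (ugen x) [^]\<^bsub>Ue\<^esub> l"
    "x \<noteq> GenK \<Longrightarrow> Fr (cls1 (ugen y)) = cls (ugen y) [^]\<^bsub>Ue\<^esub> l"
    "x = GenK \<Longrightarrow> Fr (cls1 (ugen x)) = cls (ugen x)" "x = GenK \<Longrightarrow> Fr (cls1 (ugen y)) = cls (ugen y)"
  using Fr_lpow'[OF assms, of 1] Fr_lpow'[OF assms, of "- 1"] cls_lpow_power[OF assms, of l] lpow_unit[OF assms]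
  by (simp_all add: frob_letter_def)

lemma Fr_gens:
  "Fr (cls1 (ugen GenLam)) = cls (ugen GenLam) [^]\<^bsub>Ue\<^esub> l" "Fr (cls1 (ugen GenLam')) = cls (ugen GenLam') [^]\<^bsub>Ue\<^esub> l"
  "Fr (cls1 (ugen GenGam)) = cls (ugen GenGam) [^]\<^bsub>Ue\<^esub> l" "Fr (cls1 (ugen GenGam')) = cls (ugen GenGam') [^]\<^bsub>Ue\<^esub> l"
  "Fr (cls1 (ugen GenK)) = cls (ugen GenK)" "Fr (cls1 (ugen GenK')) = cls (ugen GenK')"
  using Fr_ugen[of GenLam GenLam'] Fr_ugen[of GenGam GenGam'] Fr_ugen[of GenK GenK']
  by (simp_all add: inverse_letters_def)

lemma Fr_in_Zset: "u \<in> carrier U1 \<Longrightarrow> Fr u \<in> Zset"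
proof (induction rule: O1.Ue_induct)
  case (hh m)
  then have "cls (hh (m * int l)) \<in> frob_gens" unfolding frob_gens_def by blast
  then show ?case using hh by (simp add: Fr_hh Zset_closed(5,6))
next
  case (ugen x)
  have "Fr (cls1 (ugen x)) \<in> frob_gens"
    using ugen unfolding frob_gens_def U_spec_pow by (auto simp: Fr_gens)
  then show ?case by (rule Zset_closed(6))
qed (simp_all add: Fr_one Fr_add Fr_mult Fr_smult Zset_closed(2-5))

text \<open>Identifying the generated subalgebra with the image yields surjectivity and also
  provides its elements with preimages, from which its spanning monomials are found.\<close>

lemma Zset_eq: "Zset = Fr ` carrier U1"
proof
  show "Fr ` carrier U1 \<subseteq> Zset" using Fr_in_Zset by blast
  show "Zset \<subseteq> Fr ` carrier U1"
  proof
    fix z assume "z \<in> Zset"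
    then show "z \<in> Fr ` carrier U1"
    proof (induction rule: Zset_induct)
      case one
      then show ?case using Fr_one by (intro image_eqI[of _ _ "\<one>\<^bsub>U1\<^esub>"]) simp_all
    next
      case (gen h)
      have powers: "cls (ugen x) [^]\<^bsub>Ue\<^esub> l \<in> Fr ` carrier U1" if "x \<in> {GenGam, GenGam', GenLam, GenLam'}" for x
        using that by (intro image_eqI[of _ _ "cls1 (ugen x)"]) (auto simp: Fr_gens)
      have k: "cls (ugen x) \<in> Fr ` carrier U1" if "x \<in> {GenK, GenK'}" for x
        using that by (intro image_eqI[of _ _ "cls1 (ugen x)"]) (auto simp: Fr_gens)
      \<comment> \<open>The Frobenius map hits l times this generator; the factor is a nonzero
        complex number and can be divided out in the preimage.\<close>
      have hs: "cls (hh (r * int l)) \<in> Fr ` carrier U1" if "r \<noteq> 0" for r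
        using that l_pos
        by (intro image_eqI[of _ _ "inverse (of_nat l) \<odot>\<^bsub>U1\<^esub> cls1 (hh r)"]) (simp_all add: Fr_smult Fr_hh flip: Ue.smult_assoc1)
      show ?case using gen powers k hs unfolding frob_gens_def U_spec_pow by blast
    next
      case (add x y)
      then obtain a b where ab: "x = Fr a" "y = Fr b" "a \<in> carrier U1" "b \<in> carrier U1" by blast
      show ?case unfolding ab(1,2) Fr_add[OF ab(3,4), symmetric] using ab(3,4) by simp
    next
      case (mult x y)
      then obtain a b where ab: "x = Fr a" "y = Fr b" "a \<in> carrier U1" "b \<in> carrier U1" by blast
      show ?case unfolding ab(1,2) Fr_mult[OF ab(3,4), symmetric] using ab(3,4) by simp
    next
      case (smult r x)
      then obtain a where a: "x = Fr a" "a \<in> carrier U1" by blast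
      show ?case unfolding a(1) Fr_smult[OF a(2), symmetric] using a(2) by simp
    qed
  qed
qed

end

section \<open>Compatibility with the coproduct\<close>

context poisson_specialization
begin

abbreviation "HS \<equiv> U_spec \<epsilon>\<lparr>carrier := Zset\<rparr>"
abbreviation "Fr_tensor \<equiv> tensor_map ring_C Ue Ue Fr Fr"

lemma Fr_pair_hom: "algebra_pair_hom U1 U1 UNIV ring_C Ue Ue UNIV ring_C Fr Fr (\<lambda>r. r)"
  by (intro algebra_pair_hom.intro algebra_pair.intro algebra_pair_hom_axioms.intro
      algebra_pair_axioms.intro O1.scalar_algebra_Ue scalar_algebra_Ue Fr_hom) (simp_all add: Fr_smult)

lemma Fr_hom_HS: "Fr \<in> ring_hom U1 HS"
  by (rule ring_hom_memI) (simp_all add: Fr_in_Zset Fr_add Fr_mult Fr_one)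

lemma Fr_pair_hom_HS: "algebra_pair_hom U1 U1 UNIV ring_C HS HS UNIV ring_C Fr Fr (\<lambda>r. r)"
  by (intro algebra_pair_hom.intro algebra_pair.intro algebra_pair_hom_axioms.intro
      algebra_pair_axioms.intro O1.scalar_algebra_Ue scalar_algebra_HS Fr_hom_HS) (simp_all add: Fr_smult)

lemma inclusion_pair_hom: "algebra_pair_hom HS HS UNIV ring_C Ue Ue UNIV ring_C (\<lambda>y. y) (\<lambda>y. y) (\<lambda>r. r)"
proof -
  have "x \<in> carrier Ue" if "x \<in> Zset" for x using that Zset_closed(1) by blast
  then have "(\<lambda>y. y) \<in> ring_hom HS Ue"
    by (intro ring_hom_memI) simp_all
  then show ?thesis
    by (intro algebra_pair_hom.intro algebra_pair.intro algebra_pair_hom_axioms.intro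
        algebra_pair_axioms.intro scalar_algebra_Ue scalar_algebra_HS) simp_all
qed

text \<open>The comparison is first made in the tensor square of the whole specialization, where the
  coproduct is a known homomorphism. For h_m it rests on |ml| = |m| l: the powers of \<Gamma> in the
  coproduct of h_ml are the images of those in the coproduct of h_m.\<close>

lemma Fr_comult_Ue:
  assumes "u \<in> carrier U1"
  shows "Fr_tensor (comult (U_spec 1) u) = comult (U_spec \<epsilon>) (Fr u)"
proof -
  interpret FU: algebra_pair_hom U1 U1 UNIV ring_C Ue Ue UNIV ring_C Fr Fr "\<lambda>r. r"
    by (rule Fr_pair_hom)
  note closed = ring_hom_closed[OF O1.comult_spec_hom]
  from assms show ?thesis
  proof (induction rule: U1_induct)
    case one
    show ?case
      by (simp add: Fr_one ring_hom_one[OF comult_spec_hom] ring_hom_one[OF O1.comult_spec_hom] ring_hom_one[OF FU.tmap_hom])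
  next
    case (hh m)
    have ml: "m * int l \<noteq> 0" "\<bar>m * int l\<bar> = \<bar>m\<bar> * int l" using hh by (simp_all add: abs_mult)
    have g: "Fr (cls1 (gam n)) = cls (gam (n * int l))" for n unfolding gam_lpow by (rule Fr_lpow)
    have c: "cls1 (gam n) \<in> carrier U1" "cls (gam n) \<in> carrier Ue" for n by simp_all
    have "Fr_tensor (comult (U_spec 1) (cls1 (hh m))) =
        ST.P'.pure (Fr (cls1 (hh m))) (Fr (cls1 (gam (- \<bar>m\<bar>)))) \<oplus>\<^bsub>TU\<^esub> ST.P'.pure (Fr (cls1 (gam \<bar>m\<bar>))) (Fr (cls1 (hh m)))"
      unfolding O1.comult_spec_hh[OF hh] using hh
      by (simp add: ring_hom_add[OF FU.tmap_hom] FU.tmap_pure O1.ST.P'.pure_closed)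
    also have "\<dots> = of_nat l \<odot>\<^bsub>TU\<^esub> comult (U_spec \<epsilon>) (cls (hh (m * int l)))"
      unfolding comult_spec_hh[OF ml(1)] Fr_hh[OF hh] g ml(2) using hh
      by (simp add: TUS.smult_r_distr ST.P'.pure_smult_right ST.P'.pure_smult ST.P'.pure_closed)
    also have "\<dots> = comult (U_spec \<epsilon>) (Fr (cls1 (hh m)))"
      using hh by (simp add: Fr_hh comult_spec_smult)
    finally show ?case .
  next
    case (lpow x y n)
    then show ?case by (simp add: O1.comult_lpow comult_lpow Fr_lpow' FU.tmap_pure)
  next
    case (add x y)
    then show ?case
      by (simp add: Fr_add Fr_closed closed ring_hom_add[OF comult_spec_hom] ring_hom_add[OF O1.comult_spec_hom] ring_hom_add[OF FU.tmap_hom])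
  next
    case (mult x y)
    then show ?case
      by (simp add: Fr_mult Fr_closed closed ring_hom_mult[OF comult_spec_hom] ring_hom_mult[OF O1.comult_spec_hom] ring_hom_mult[OF FU.tmap_hom])
  next
    case (smult r x)
    then show ?case
      by (simp add: Fr_smult Fr_closed closed comult_spec_smult O1.comult_spec_smult FU.tmap_smult)
  qed
qed

lemma Zset_span:
  assumes "z \<in> Zset"
  shows "z \<in> span_of HS UNIV (\<lambda>i. cls (pbw i)) (sc ` pbw_index)"
proof -
  obtain u where u: "u \<in> carrier U1" "z = Fr u" using assms unfolding Zset_eq by blast
  from O1.Ue_span[OF u(1)] have "Fr u \<in> span_of HS UNIV (\<lambda>i. cls (pbw i)) (sc ` pbw_index)"
  proof (induction rule: span_of.induct)
    case zero
    have "\<zero>\<^bsub>HS\<^esub> \<in> span_of HS UNIV (\<lambda>i. cls (pbw i)) (sc ` pbw_index)" by (rule span_of.zero)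
    then show ?case by (simp add: Fr_zero)
  next
    case (step r i x)
    have x: "x \<in> carrier U1" by (rule O1.Ue.span_of_closed[OF step(3) O1.cls_pbw_image])
    have i: "cls1 (pbw i) \<in> carrier U1" "cls (pbw (sc i)) \<in> carrier Ue"
      using pbw_SA[OF step(2)] pbw_SA[OF sc_index[OF step(2)]] by simp_all
    have "(r * wt i) \<odot>\<^bsub>HS\<^esub> cls (pbw (sc i)) \<oplus>\<^bsub>HS\<^esub> Fr x \<in> span_of HS UNIV (\<lambda>i. cls (pbw i)) (sc ` pbw_index)"
      by (rule span_of.step) (use step in simp_all)
    then show ?case using i x by (simp add: Fr_add Fr_smult Fr_pbw[OF step(2)] Ue.smult_assoc1)
  qed
  then show ?thesis using u by simp
qed

text \<open>A scaled monomial is the image of the unscaled one divided by its weight, which is a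
  power of l and hence invertible.\<close>

lemma pbw_sc_Zset:
  assumes "i \<in> pbw_index"
  shows "cls (pbw (sc i)) \<in> Zset"
proof -
  have c: "cls1 (pbw i) \<in> carrier U1" "cls (pbw (sc i)) \<in> carrier Ue"
    using pbw_SA[OF assms] pbw_SA[OF sc_index[OF assms]] by simp_all
  have "inverse (wt i) \<odot>\<^bsub>Ue\<^esub> Fr (cls1 (pbw i)) \<in> Zset"
    using c by (intro Zset_closed(5) Fr_in_Zset)
  also have "inverse (wt i) \<odot>\<^bsub>Ue\<^esub> Fr (cls1 (pbw i)) = cls (pbw (sc i))"
    using c wt_nonzero[of i] by (simp add: Fr_pbw[OF assms] flip: Ue.smult_assoc1)
  finally show ?thesis .
qed

lemma U_spec_tensor: "tensor_map ring_C (U_spec \<epsilon>) (U_spec \<epsilon>) = tensor_map ring_C Ue Ue"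
  by (rule tensor_transfer) simp_all

text \<open>The coordinate functions of the whole specialization restrict to the scaled monomials
  spanning the subalgebra, so the injectivity criterion applies once more. It provides the
  uniqueness required by the \<open>THE\<close> in the restricted coproduct.\<close>

lemma inclusion_inj: "inj_on (tensor_map ring_C Ue Ue (\<lambda>y. y) (\<lambda>y. y)) (carrier (tensor ring_C HS HS))"
  unfolding U_spec_tensor[symmetric]
proof (rule tensor_inclusion_inj[where c = spec_coord and e = "\<lambda>i. cls (pbw i)" and E = "sc ` pbw_index",
      OF scalar_algebra_U_spec scalar_algebra_HS])
  show "(\<lambda>i. cls (pbw i)) ` sc ` pbw_index \<subseteq> Zset" using pbw_sc_Zset by blast
  show "x \<in> span_of HS UNIV (\<lambda>i. cls (pbw i)) (sc ` pbw_index)" if "x \<in> Zset" for x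
    by (rule Zset_span[OF that])
  show "spec_coord (cls (pbw i)) j = (if i = j then 1 else 0)" if "i \<in> sc ` pbw_index" for i j
    using that spec_coord_pbw sc_index by blast
qed (use Zset_closed(1) in \<open>simp_all add: spec_coord_add spec_coord_smult\<close>)

lemma comult_Z:
  "comult Z x = (THE t. t \<in> carrier (tensor ring_C HS HS) \<and> tensor_map ring_C Ue Ue (\<lambda>y. y) (\<lambda>y. y) t = comult (U_spec \<epsilon>) x)"
  by (simp add: Z_root_eq add_poisson_def restrict_hopf_def U_spec_tensor)

text \<open>The tensor square of the Frobenius map into the subalgebra, followed by the inclusion,
  is its tensor square into the whole specialization, as is seen on pure tensors. There the
  coproducts agree, and uniqueness of the lift carries the agreement to the subalgebra.\<close>

lemma Fr_comult:
  assumes u: "u \<in> carrier U1"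
  shows "comult Z (Fr u) = tensor_map ring_C Z Z Fr Fr (comult (U_spec 1) u)"
proof -
  interpret FZ: algebra_pair_hom U1 U1 UNIV ring_C HS HS UNIV ring_C Fr Fr "\<lambda>r. r"
    by (rule Fr_pair_hom_HS)
  interpret FU: algebra_pair_hom U1 U1 UNIV ring_C Ue Ue UNIV ring_C Fr Fr "\<lambda>r. r"
    by (rule Fr_pair_hom)
  interpret IZ: algebra_pair_hom HS HS UNIV ring_C Ue Ue UNIV ring_C "\<lambda>y. y" "\<lambda>y. y" "\<lambda>r. r"
    by (rule inclusion_pair_hom)
  have "IZ.tmap (FZ.tmap t) = FU.tmap t" if "t \<in> carrier (tensor ring_C U1 U1)" for t
    using that
  proof (induction rule: O1.ST.P'.tensor_induct)
    case (pure x y)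
    then show ?case by (simp add: FZ.tmap_pure FU.tmap_pure IZ.tmap_pure Fr_in_Zset)
  next
    case (add s t)
    then show ?case
      by (simp add: ring_hom_add[OF FZ.tmap_hom] ring_hom_add[OF FU.tmap_hom] ring_hom_add[OF IZ.tmap_hom]
          ring_hom_closed[OF FZ.tmap_hom])
  qed
  note this[OF ring_hom_closed[OF O1.comult_spec_hom u]]
  then have eq: "IZ.tmap (FZ.tmap (comult (U_spec 1) u)) = comult (U_spec \<epsilon>) (Fr u)"
    using Fr_comult_Ue[OF u] by simp
  have c: "FZ.tmap (comult (U_spec 1) u) \<in> carrier (tensor ring_C HS HS)"
    using ring_hom_closed[OF FZ.tmap_hom ring_hom_closed[OF O1.comult_spec_hom u]] .
  have "comult Z (Fr u) = FZ.tmap (comult (U_spec 1) u)"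
    unfolding comult_Z
  proof (rule the_equality)
    fix t assume "t \<in> carrier (tensor ring_C HS HS) \<and> IZ.tmap t = comult (U_spec \<epsilon>) (Fr u)"
    then show "t = FZ.tmap (comult (U_spec 1) u)"
      using inj_onD[OF inclusion_inj, of t] c eq by simp
  qed (use c eq in simp)
  also have "tensor_map ring_C HS HS = tensor_map ring_C Z Z"
    by (rule tensor_transfer) simp_all
  finally show ?thesis .
qed

theorem Fr_iso: "Fr \<in> hopf_poisson_iso ring_C Z_one Z"
proof -
  have "Fr \<in> ring_hom Z_one Z"
    by (rule ring_hom_memI) (simp_all add: Fr_in_Zset Fr_add Fr_mult Fr_one)
  moreover have "bij_betw Fr (carrier Z_one) (carrier Z)"
    using Fr_inj by (simp add: bij_betw_def Zset_eq)
  ultimately show ?thesis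
    by (simp add: hopf_poisson_iso_def ring_iso_def Fr_smult Fr_comult Fr_counit Fr_antipode Fr_bracket)
qed

end

theorem proposition3p3:
  fixes \<epsilon> :: complex and l :: nat
  assumes "l \<ge> 3" and "odd l" and "primitive_root_of_unity l \<epsilon>"
  shows "\<exists>Fr. Fr \<in> hopf_poisson_iso ring_C Z_one (Z_root \<epsilon> l) \<and>
    (\<forall>m. m \<noteq> 0 \<longrightarrow> Fr (spec_class 1 (hh m)) =
       of_nat l \<odot>\<^bsub>Z_root \<epsilon> l\<^esub> spec_class \<epsilon> (hh (m * int l))) \<and>
    Fr (spec_class 1 (ugen GenGam)) = spec_class \<epsilon> (ugen GenGam) [^]\<^bsub>Z_root \<epsilon> l\<^esub> l \<and>
    Fr (spec_class 1 (ugen GenLam)) = spec_class \<epsilon> (ugen GenLam) [^]\<^bsub>Z_root \<epsilon> l\<^esub> l \<and>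
    Fr (spec_class 1 (ugen GenK)) = spec_class \<epsilon> (ugen GenK)"
proof -
  have "\<epsilon> ^ l = 1" "l > 0" using assms(3) by (simp_all add: primitive_root_of_unity_def)
  moreover from this have "\<epsilon> \<noteq> 0" by (auto simp: zero_power)
  ultimately interpret poisson_specialization \<epsilon> l
    by unfold_locales
  show ?thesis
    by (intro exI[of _ Fr] conjI allI impI) (simp_all only: Fr_iso Fr_gens Z_pow Z_simps Fr_hh simp_thms)
qed

end
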